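(* Let $\sigma,\tau:\mathbb R_+\to\mathbb R$ satisfy $\sup_{x>0}\int_x^{x+1}\sigma(t)^2\,dt<\infty$ and $\sup_{x>0}\int_x^{x+1}|\tau(t)|\,dt<\infty$, and fix arbitrary $\alpha\in[0,\pi)$. Let $F\subset\mathbb R$ be a measurable set and suppose there exist sequences $\{x_j\}_{j=1}^\infty\subset\mathbb R_+$, $\{y_j\}_{j=1}^\infty\subset\mathbb R_+$ such that for Lebesgue almost every $E\in F$, $$\lim_{j\to\infty}\|T(E;x_j,y_j)\|=\infty.$$ Then $\mu^\alpha_{\mathrm{ac}}(F)=0$.
   Context: $\mathbb R_+=(0,\infty)$. For $u\in AC_{\mathrm{loc}}(\mathbb R_+)$ put $u^{[1]}:=u'-\sigma u$, let $\mathfrak D:=\{u\in AC_{\mathrm{loc}}(\mathbb R_+): u^{[1]}\in AC_{\mathrm{loc}}(\mathbb R_+)\}$ and, for $u\in\mathfrak D$, $\ell u:=-(u^{[1]})'-\sigma u^{[1]}+(\tau-\sigma^2)u$. The endpoint $0$ is regular, so $u(0),u^{[1]}(0)$ exist as limits whenever $u\in L^2(\mathbb R_+)\cap\mathfrak D$, $\ell u\in L^2(\mathbb R_+)$, or $\ell u=zu$; the endpoint $\infty$ is limit point. $H^\alpha$ is the self-adjoint operator in $L^2(\mathbb R_+)$ given by $H^\alpha u=\ell u$ on $\mathrm{dom}(H^\alpha)=\{u\in L^2(\mathbb R_+): u\in\mathfrak D,\ \ell u\in L^2(\mathbb R_+),\ u(0)\cos\alpha+u^{[1]}(0)\sin\alpha=0\}$.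 For $x,y\ge0$ the transfer matrix $T(z;x,y)$ is the $2\times2$ matrix with $T(z;x,y)\,(u^{[1]}(y),u(y))^\top=(u^{[1]}(x),u(x))^\top$ for every $u\in\mathfrak D$ with $\ell u=zu$. For $z\in\mathbb C\setminus\mathbb R$ there is, up to multiples, a unique nontrivial solution $\psi_z\in L^2(\mathbb R_+)$ of $\ell\psi_z=z\psi_z$; set $$m_\alpha(z)=\frac{\cos(\alpha)\psi_z^{[1]}(0)-\sin(\alpha)\psi_z(0)}{\sin(\alpha)\psi_z^{[1]}(0)+\cos(\alpha)\psi_z(0)},$$ a Herglotz function. The spectral measure $\mu^\alpha$ is the Borel measure on $\mathbb R$ with $\mu^\alpha((\lambda_1,\lambda_2])=\lim_{\delta\downarrow0}\lim_{\varepsilon\downarrow0}\frac1\pi\int_{\lambda_1+\delta}^{\lambda_2+\delta}\mathrm{Im}\,m_\alpha(\lambda+i\varepsilon)\,d\lambda$ for $\lambda_1<\lambda_2$; $H^\alpha$ is unitarily equivalent to multiplication by the independent variable in $L^2(\mathbb R,\mu^\alpha)$. $\mu^\alpha_{\mathrm{ac}}$ is the absolutely continuous part of $\mu^\alpha$ with respect to Lebesgue measure. *)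

theory Defs
  imports "HOL-Analysis.Analysis"
begin

text \<open>
  The half-line is the interval \<open>(0, \<infinity>)\<close>. Functions on it are represented by functions on all
  of \<open>real\<close> whose values outside the half-line are irrelevant; values at the regular endpoint 0
  always mean right-hand limits there (see \<open>bdry_val\<close>).
\<close>

definition abs_cont_on :: "real \<Rightarrow> real \<Rightarrow> (real \<Rightarrow> complex) \<Rightarrow> bool" where
  "abs_cont_on a b u \<longleftrightarrow>
     (\<forall>\<epsilon>>0. \<exists>\<delta>>0. \<forall>I. finite I \<longrightarrow>
        (\<forall>(s, t)\<in>I. a \<le> s \<and> s \<le> t \<and> t \<le> b) \<longrightarrow>
        (\<forall>p\<in>I. \<forall>q\<in>I. p \<noteq> q \<longrightarrow> {fst p<..<snd p} \<inter> {fst q<..<snd q} = {}) \<longrightarrow>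
        (\<Sum>(s, t)\<in>I. t - s) < \<delta> \<longrightarrow>
        (\<Sum>(s, t)\<in>I. norm (u t - u s)) < \<epsilon>)"

definition AC_loc :: "(real \<Rightarrow> complex) set" where
  "AC_loc = {u. \<forall>a b. 0 < a \<longrightarrow> a \<le> b \<longrightarrow> abs_cont_on a b u}"

text \<open>
  The expression \<open>u' - \<sigma> u\<close> is determined only almost everywhere. Saying that it is locally
  absolutely continuous means that it has a representative \<open>v\<close> in \<open>AC_loc\<close>; that representative
  is unique on the half-line, by continuity, and is what \<open>quasi_deriv\<close> selects.
\<close>

definition is_quasi_deriv :: "(real \<Rightarrow> real) \<Rightarrow> (real \<Rightarrow> complex) \<Rightarrow> (real \<Rightarrow> complex) \<Rightarrow> bool" where
  "is_quasi_deriv \<sigma> u v \<longleftrightarrow>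
     v \<in> AC_loc \<and>
     (AE x in lebesgue. 0 < x \<longrightarrow> v x = vector_derivative u (at x) - of_real (\<sigma> x) * u x)"

definition quasi_deriv :: "(real \<Rightarrow> real) \<Rightarrow> (real \<Rightarrow> complex) \<Rightarrow> real \<Rightarrow> complex" where
  "quasi_deriv \<sigma> u = (SOME v. is_quasi_deriv \<sigma> u v)"

definition DD :: "(real \<Rightarrow> real) \<Rightarrow> (real \<Rightarrow> complex) set" where
  "DD \<sigma> = {u \<in> AC_loc. \<exists>v. is_quasi_deriv \<sigma> u v}"

definition ell :: "(real \<Rightarrow> real) \<Rightarrow> (real \<Rightarrow> real) \<Rightarrow> (real \<Rightarrow> complex) \<Rightarrow> real \<Rightarrow> complex" where
  "ell \<sigma> \<tau> u x =
     - vector_derivative (quasi_deriv \<sigma> u) (at x) - of_real (\<sigma> x) * quasi_deriv \<sigma> u x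
     + of_real (\<tau> x - (\<sigma> x)\<^sup>2) * u x"

definition is_solution ::
    "(real \<Rightarrow> real) \<Rightarrow> (real \<Rightarrow> real) \<Rightarrow> complex \<Rightarrow> (real \<Rightarrow> complex) \<Rightarrow> bool" where
  "is_solution \<sigma> \<tau> z u \<longleftrightarrow>
     u \<in> DD \<sigma> \<and> (AE x in lebesgue. 0 < x \<longrightarrow> ell \<sigma> \<tau> u x = z * u x)"

definition bdry_val :: "(real \<Rightarrow> complex) \<Rightarrow> real \<Rightarrow> complex" where
  "bdry_val f x = (if 0 < x then f x else Lim (at_right 0) f)"

definition transfer_matrix ::
    "(real \<Rightarrow> real) \<Rightarrow> (real \<Rightarrow> real) \<Rightarrow> complex \<Rightarrow> real \<Rightarrow> real \<Rightarrow> complex^2^2" where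
  "transfer_matrix \<sigma> \<tau> z x y =
     (THE T. \<forall>u. is_solution \<sigma> \<tau> z u \<longrightarrow>
        T *v vector [bdry_val (quasi_deriv \<sigma> u) y, bdry_val u y] =
        vector [bdry_val (quasi_deriv \<sigma> u) x, bdry_val u x])"

definition L2_half_line :: "(real \<Rightarrow> complex) \<Rightarrow> bool" where
  "L2_half_line u \<longleftrightarrow>
     u \<in> borel_measurable (lebesgue_on {0<..}) \<and>
     integrable (lebesgue_on {0<..}) (\<lambda>x. (norm (u x))\<^sup>2)"

text \<open>
  For nonreal \<open>z\<close> the solution below is unique up to a nonzero scalar factor, which cancels in
  \<open>m_fun\<close>, so the choice is immaterial.
\<close>

definition weyl_solution :: "(real \<Rightarrow> real) \<Rightarrow> (real \<Rightarrow> real) \<Rightarrow> complex \<Rightarrow> real \<Rightarrow> complex" where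
  "weyl_solution \<sigma> \<tau> z =
     (SOME \<psi>. is_solution \<sigma> \<tau> z \<psi> \<and> L2_half_line \<psi> \<and> (\<exists>x>0. \<psi> x \<noteq> 0))"

definition m_fun :: "(real \<Rightarrow> real) \<Rightarrow> (real \<Rightarrow> real) \<Rightarrow> real \<Rightarrow> complex \<Rightarrow> complex" where
  "m_fun \<sigma> \<tau> \<alpha> z =
     (let \<psi> = weyl_solution \<sigma> \<tau> z;
          \<psi>0 = bdry_val \<psi> 0;
          \<psi>1 = bdry_val (quasi_deriv \<sigma> \<psi>) 0
      in (of_real (cos \<alpha>) * \<psi>1 - of_real (sin \<alpha>) * \<psi>0) /
         (of_real (sin \<alpha>) * \<psi>1 + of_real (cos \<alpha>) * \<psi>0))"

text \<open>
  In the Stieltjes inversion formula, \<open>J \<delta>\<close> is the inner limit as \<open>\<epsilon>\<close> decreases to 0.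
\<close>

definition spectral_measure :: "(real \<Rightarrow> real) \<Rightarrow> (real \<Rightarrow> real) \<Rightarrow> real \<Rightarrow> real measure" where
  "spectral_measure \<sigma> \<tau> \<alpha> =
     (THE \<mu>. sets \<mu> = sets borel \<and>
        (\<forall>a b. a < b \<longrightarrow>
           emeasure \<mu> {a<..b} < \<infinity> \<and>
           (\<exists>J. (\<forall>\<delta>>0. ((\<lambda>\<epsilon>. (1 / pi) *
                     (LBINT t:{a + \<delta>..b + \<delta>}. Im (m_fun \<sigma> \<tau> \<alpha> (Complex t \<epsilon>))))
                   \<longlongrightarrow> J \<delta>) (at_right 0)) \<and>
                (J \<longlongrightarrow> measure \<mu> {a<..b}) (at_right 0))))"

text \<open>
  The absolutely continuous summand \<open>\<nu>\<close> of the Lebesgue decomposition \<open>\<mu> = \<nu> + \<rho>\<close> of a Borel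
  measure on the line; \<open>\<rho>\<close> is concentrated on a Lebesgue null set \<open>N\<close>.
\<close>

definition ac_part :: "real measure \<Rightarrow> real measure" where
  "ac_part \<mu> =
     (THE \<nu>. sets \<nu> = sets borel \<and> absolutely_continuous lborel \<nu> \<and>
        (\<exists>\<rho>. sets \<rho> = sets borel \<and>
           (\<exists>N\<in>null_sets lborel. emeasure \<rho> (- N) = 0) \<and>
           (\<forall>A\<in>sets borel. emeasure \<mu> A = emeasure \<nu> A + emeasure \<rho> A)))"

end

theory Submission
  imports Defs "HOL-Complex_Analysis.Complex_Analysis"
begin

text \<open>
  Let \<open>a\<close>, \<open>b\<close> be the real solutions with boundary parameters \<open>\<alpha>\<close> and \<open>\<alpha> + \<pi>/2\<close> at 0, and
  \<open>\<psi> = b + m a\<close> the Weyl solution. The functions \<open>a \<psi>\<close>, \<open>a\<^sup>[\<^sup>1\<^sup>] \<psi>\<^sup>[\<^sup>1\<^sup>]\<close>, \<open>- b \<psi> / m\<close> and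
  \<open>- b\<^sup>[\<^sup>1\<^sup>] \<psi>\<^sup>[\<^sup>1\<^sup>] / m\<close> at a point \<open>x\<close> are Herglotz functions of \<open>z\<close>. The uniform local bounds on
  \<open>\<sigma>\<close> and \<open>\<tau>\<close> give \<open>\<integral> |u|\<^sup>2 \<ge> c (|u x|\<^sup>2 + |u\<^sup>[\<^sup>1\<^sup>] x|\<^sup>2)\<close> over \<open>[x, x + 1]\<close> for every solution \<open>u\<close>, and
  this bounds the four functions at \<open>z = \<i>\<close> independently of \<open>x\<close>; by Poisson's formula the
  integrals of their imaginary parts over \<open>[-R, R] + \<i> \<epsilon>\<close> are then bounded uniformly in \<open>x\<close> and \<open>\<epsilon>\<close>.

  If \<open>\<mu>\<^sub>a\<^sub>c F > 0\<close>, there is a set \<open>A \<subseteq> F\<close> of positive measure on which the density of \<open>\<mu>\<^sub>a\<^sub>c\<close> is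
  bounded below, and off a small part of \<open>A\<close> both \<open>|m (t + \<i> \<epsilon>)|\<close> and \<open>1 / Im m (t + \<i> \<epsilon>)\<close> are
  bounded. There \<open>Im (a \<psi>)\<close> controls \<open>|a (t, x)|\<^sup>2\<close> as \<open>\<epsilon> \<rightarrow> 0\<close>, and likewise for the other three
  functions. So the fundamental matrix \<open>\<Phi> x\<close> is bounded outside a subset of \<open>A\<close> of small measure,
  uniformly in \<open>x\<close>, and \<open>T (x, y) = \<Phi> x (\<Phi> y)\<^sup>-\<^sup>1\<close> cannot tend to infinity almost everywhere on \<open>A\<close>.
\<close>

section \<open>Absolutely continuous functions\<close>

text \<open>The sequences are arbitrary, so no limit of \<open>\<Phi> (x j)\<close> is available and
  boundedness of \<open>\<Phi>\<close> can only be had in measure: the exceptional part of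
  \<open>A\<close> depends on \<open>x\<close>, the bound on its size does not. Two exceptional
  parts of relative size 1/4, for \<open>x j\<close> and \<open>y j\<close>, leave half of
  \<open>A\<close>, where the transfer matrix stays below a fixed constant; this contradicts
  divergence at every point of \<open>A\<close>. Boundary values of \<open>m\<close> are never
  taken. Heights \<open>1 / (n + 2)\<close> are used instead, with \<open>n\<close> chosen after
  \<open>x\<close>. The four products enter because the entries of \<open>\<Phi>\<close> are real at
  a real energy, so that \<open>Im (a \<psi>)\<close> reduces to \<open>a^2 Im m\<close> there. The
  definitions select their objects by \<open>THE\<close> and \<open>SOME\<close>; hence much of the
  text proves existence and uniqueness: absolutely continuous functions in the \<epsilon>-\<delta>
  sense are integrals of their derivatives, the endpoint \<infinity> is limit point, and the limits
  in the inversion formula exist at all endpoints, atoms included.\<close>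

definition disjoint_ivls :: "real \<Rightarrow> real \<Rightarrow> (real \<times> real) set \<Rightarrow> bool" where
  "disjoint_ivls a b I \<longleftrightarrow> finite I \<and> (\<forall>(s, t)\<in>I. a \<le> s \<and> s \<le> t \<and> t \<le> b) \<and>
     (\<forall>p\<in>I. \<forall>q\<in>I. p \<noteq> q \<longrightarrow> {fst p<..<snd p} \<inter> {fst q<..<snd q} = {})"

lemma abs_cont_onI:
  assumes "\<And>\<epsilon>. \<epsilon> > 0 \<Longrightarrow> \<exists>\<delta>>0. \<forall>I. disjoint_ivls a b I \<longrightarrow> (\<Sum>(s, t)\<in>I. t - s) < \<delta> \<longrightarrow>
     (\<Sum>(s, t)\<in>I. norm (u t - u s)) < \<epsilon>"
  shows "abs_cont_on a b u"
  using assms unfolding abs_cont_on_def disjoint_ivls_def by simp meson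

lemma abs_cont_onD:
  assumes "abs_cont_on a b u" "\<epsilon> > 0"
  obtains \<delta> where "\<delta> > 0" "\<And>I. \<lbrakk>disjoint_ivls a b I; (\<Sum>(s, t)\<in>I. t - s) < \<delta>\<rbrakk> \<Longrightarrow>
     (\<Sum>(s, t)\<in>I. norm (u t - u s)) < \<epsilon>"
  using assms unfolding abs_cont_on_def disjoint_ivls_def by meson

lemma abs_cont_on_continuous:
  assumes "abs_cont_on a b u" shows "continuous_on {a..b} u"
  unfolding continuous_on_iff
proof (intro ballI allI impI)
  fix x \<epsilon> :: real assume x: "x \<in> {a..b}" and "\<epsilon> > 0"
  from abs_cont_onD[OF assms this(2)] obtain \<delta> where "\<delta> > 0" and
    d: "\<And>I. \<lbrakk>disjoint_ivls a b I; (\<Sum>(s, t)\<in>I. t - s) < \<delta>\<rbrakk> \<Longrightarrow> (\<Sum>(s, t)\<in>I. norm (u t - u s)) < \<epsilon>" by metis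
  have "dist (u y) (u x) < \<epsilon>" if y: "y \<in> {a..b}" "dist y x < \<delta>" for y
  proof (cases "x \<le> y")
    case True
    then show ?thesis using d[of "{(x, y)}"] x y by (auto simp: disjoint_ivls_def dist_norm)
  next
    case False
    then show ?thesis using d[of "{(y, x)}"] x y by (auto simp: disjoint_ivls_def dist_norm norm_minus_commute)
  qed
  then show "\<exists>d>0. \<forall>x'\<in>{a..b}. dist x' x < d \<longrightarrow> dist (u x') (u x) < \<epsilon>" using \<open>\<delta> > 0\<close> by blast
qed

lemma abs_cont_on_bounded:
  assumes "abs_cont_on a b u"
  obtains B where "B > 0" "\<And>x. x \<in> {a..b} \<Longrightarrow> norm (u x) \<le> B"
proof -
  have "bounded (u ` {a..b})"
    using compact_continuous_image[OF abs_cont_on_continuous[OF assms] compact_Icc] by (rule compact_imp_bounded)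
  then show thesis using that unfolding bounded_pos by blast
qed

text \<open>Products, exponentials and the real functions \<open>V + L (u x)\<close> used for the
  fundamental theorem all obey such an increment bound, so one \<epsilon>-\<delta> argument serves
  them all.\<close>

lemma abs_cont_on_dominated:
  assumes u: "abs_cont_on a b u" and v: "abs_cont_on a b v" and C: "C \<ge> 0"
    and le: "\<And>s t. \<lbrakk>a \<le> s; s \<le> t; t \<le> b\<rbrakk> \<Longrightarrow> norm (w t - w s) \<le> C * (norm (u t - u s) + norm (v t - v s))"
  shows "abs_cont_on a b w"
proof (rule abs_cont_onI)
  fix \<epsilon> :: real assume "\<epsilon> > 0"
  then have "\<epsilon> / (2 * (C + 1)) > 0" using C by simp
  obtain \<delta>1 where "\<delta>1 > 0" and
    d1: "\<And>I. \<lbrakk>disjoint_ivls a b I; (\<Sum>(s, t)\<in>I. t - s) < \<delta>1\<rbrakk> \<Longrightarrow> (\<Sum>(s, t)\<in>I. norm (u t - u s)) < \<epsilon> / (2 * (C + 1))"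
    using abs_cont_onD[OF u \<open>\<epsilon> / (2 * (C + 1)) > 0\<close>] by metis
  obtain \<delta>2 where "\<delta>2 > 0" and
    d2: "\<And>I. \<lbrakk>disjoint_ivls a b I; (\<Sum>(s, t)\<in>I. t - s) < \<delta>2\<rbrakk> \<Longrightarrow> (\<Sum>(s, t)\<in>I. norm (v t - v s)) < \<epsilon> / (2 * (C + 1))"
    using abs_cont_onD[OF v \<open>\<epsilon> / (2 * (C + 1)) > 0\<close>] by metis
  have "(\<Sum>(s, t)\<in>I. norm (w t - w s)) < \<epsilon>"
    if I: "disjoint_ivls a b I" "(\<Sum>(s, t)\<in>I. t - s) < min \<delta>1 \<delta>2" for I
  proof -
    have "(\<Sum>(s, t)\<in>I. norm (w t - w s)) \<le> (\<Sum>(s, t)\<in>I. C * (norm (u t - u s) + norm (v t - v s)))"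
      using I(1) le unfolding disjoint_ivls_def by (intro sum_mono) auto
    also have "\<dots> = C * ((\<Sum>(s, t)\<in>I. norm (u t - u s)) + (\<Sum>(s, t)\<in>I. norm (v t - v s)))"
      by (simp add: sum_distrib_left sum.distrib case_prod_unfold algebra_simps)
    also have "\<dots> \<le> C * (\<epsilon> / (2 * (C + 1)) + \<epsilon> / (2 * (C + 1)))"
      using d1[OF I(1)] d2[OF I(1)] I(2) C by (intro mult_left_mono add_mono) auto
    also have "\<dots> = (C / (C + 1)) * \<epsilon>" using C by (simp add: divide_simps)
    also have "\<dots> < 1 * \<epsilon>" using C \<open>\<epsilon> > 0\<close> by (intro mult_strict_right_mono) auto
    finally show ?thesis by simp
  qed
  then show "\<exists>\<delta>>0. \<forall>I. disjoint_ivls a b I \<longrightarrow> (\<Sum>(s, t)\<in>I. t - s) < \<delta> \<longrightarrow>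
     (\<Sum>(s, t)\<in>I. norm (w t - w s)) < \<epsilon>" using \<open>\<delta>1 > 0\<close> \<open>\<delta>2 > 0\<close> by (intro exI[of _ "min \<delta>1 \<delta>2"]) auto
qed

lemma abs_cont_on_mult:
  assumes u: "abs_cont_on a b u" and v: "abs_cont_on a b v"
  shows "abs_cont_on a b (\<lambda>x. u x * v x)"
proof -
  obtain B where B: "B > 0" "\<And>x. x \<in> {a..b} \<Longrightarrow> norm (u x) \<le> B"
    by (rule abs_cont_on_bounded[OF u]) blast
  obtain D where D: "D > 0" "\<And>x. x \<in> {a..b} \<Longrightarrow> norm (v x) \<le> D"
    by (rule abs_cont_on_bounded[OF v]) blast
  show ?thesis
  proof (rule abs_cont_on_dominated[OF u v, of "B + D"])
    fix s t assume st: "a \<le> s" "s \<le> t" "t \<le> b"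
    have "u t * v t - u s * v s = (u t - u s) * v t + u s * (v t - v s)" by (simp add: algebra_simps)
    then have "norm (u t * v t - u s * v s) \<le> norm (u t - u s) * norm (v t) + norm (u s) * norm (v t - v s)"
      by (metis norm_mult norm_triangle_ineq)
    also have "\<dots> \<le> norm (u t - u s) * (B + D) + (B + D) * norm (v t - v s)"
      using B(2)[of s] D(2)[of t] B(1) D(1) st by (intro add_mono mult_mono) auto
    finally show "norm (u t * v t - u s * v s) \<le> (B + D) * (norm (u t - u s) + norm (v t - v s))"
      by (simp add: algebra_simps)
  qed (use B D in auto)
qed

lemma abs_cont_on_exp:
  assumes u: "abs_cont_on a b u"
  shows "abs_cont_on a b (\<lambda>x. exp (u x))"
proof -
  obtain B where B: "B > 0" "\<And>x. x \<in> {a..b} \<Longrightarrow> norm (u x) \<le> B"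
    by (rule abs_cont_on_bounded[OF u]) blast
  show ?thesis
  proof (rule abs_cont_on_dominated[OF u u, of "exp B"])
    fix s t assume st: "a \<le> s" "s \<le> t" "t \<le> b"
    have "norm (exp (u t) - exp (u s)) \<le> exp B * norm (u t - u s)"
    proof (rule field_differentiable_bound[of "cball 0 B" exp exp])
      show "norm (exp z) \<le> exp B" if "z \<in> cball 0 B" for z :: complex
        using that norm_exp[of z] by (auto intro: order_trans)
    qed (use B(2)[of s] B(2)[of t] st in \<open>auto intro: DERIV_exp has_field_derivative_at_within\<close>)
    also have "\<dots> \<le> exp B * (norm (u t - u s) + norm (u t - u s))"
      by (intro mult_left_mono) auto
    finally show "norm (exp (u t) - exp (u s)) \<le> exp B * (norm (u t - u s) + norm (u t - u s))" .
  qed auto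
qed

section \<open>Indefinite integrals and their almost everywhere derivatives\<close>

lemma sum_integral_disjoint_le:
  fixes k :: "real \<Rightarrow> real"
  assumes k: "k integrable_on {a..b}" "\<And>x. x \<in> {a..b} \<Longrightarrow> 0 \<le> k x" and I: "disjoint_ivls a b I"
  shows "(\<Sum>(s, t)\<in>I. integral {s..t} k) \<le> integral {a..b} k"
proof -
  have fin: "finite I" and st: "\<And>p. p \<in> I \<Longrightarrow> a \<le> fst p \<and> fst p \<le> snd p \<and> snd p \<le> b"
    using I unfolding disjoint_ivls_def by auto
  let ?h = "\<lambda>p x. if x \<in> {fst p<..<snd p} then k x else 0"
  have h: "(?h p has_integral integral {fst p..snd p} k) {a..b}" if "p \<in> I" for p
  proof -
    have "k integrable_on {fst p..snd p}" using integrable_on_subinterval[OF k(1)] st[OF that] by auto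
    then have "(k has_integral integral {fst p..snd p} k) {fst p<..<snd p}"
      by (simp add: has_integral_Icc_iff_Ioo[symmetric] integrable_integral)
    then show ?thesis using st[OF that] by (subst has_integral_restrict) auto
  qed
  have "(\<Sum>(s, t)\<in>I. integral {s..t} k) = integral {a..b} (\<lambda>x. \<Sum>p\<in>I. ?h p x)"
    using integral_unique[OF has_integral_sum[OF fin, of ?h, OF h]] by (simp add: case_prod_unfold)
  also have "\<dots> \<le> integral {a..b} k"
  proof (rule integral_le)
    show "(\<lambda>x. \<Sum>p\<in>I. ?h p x) integrable_on {a..b}" using has_integral_sum[OF fin, of ?h, OF h] by blast
    fix x assume x: "x \<in> {a..b}"
    show "(\<Sum>p\<in>I. ?h p x) \<le> k x"
    proof (cases "\<exists>p\<in>I. x \<in> {fst p<..<snd p}")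
      case True
      then obtain p where p: "p \<in> I" "x \<in> {fst p<..<snd p}" by blast
      have "?h q x = 0" if "q \<in> I - {p}" for q
      proof -
        have "{fst p<..<snd p} \<inter> {fst q<..<snd q} = {}"
          using I that p(1) unfolding disjoint_ivls_def by blast
        then show ?thesis using p(2) by auto
      qed
      then have "(\<Sum>q\<in>I. ?h q x) = ?h p x"
        using sum.remove[OF fin p(1), of "\<lambda>p. ?h p x"] by simp
      then show ?thesis using p by simp
    next
      case False then have "(\<Sum>p\<in>I. ?h p x) = 0" by (intro sum.neutral) auto
      then show ?thesis using k(2)[OF x] by simp
    qed
  qed (rule k(1))
  finally show ?thesis .
qed

text \<open>The working form of absolute continuity: the density is carried along explicitly, so
  that rules of calculus can state it instead of going through \<open>vector_derivative\<close>. For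
  \<open>b < a\<close> the interval is empty and the predicate holds trivially.\<close>

definition AC_with :: "real \<Rightarrow> real \<Rightarrow> (real \<Rightarrow> complex) \<Rightarrow> (real \<Rightarrow> complex) \<Rightarrow> bool" where
  "AC_with a b u g \<longleftrightarrow> g absolutely_integrable_on {a..b} \<and> (\<forall>x\<in>{a..b}. u x = u a + integral {a..x} g)"

lemma AC_with_diff:
  assumes "AC_with a b u g" "a \<le> s" "s \<le> t" "t \<le> b"
  shows "u t - u s = integral {s..t} g" "g absolutely_integrable_on {s..t}"
proof -
  have g: "g absolutely_integrable_on {a..b}" using assms(1) by (simp add: AC_with_def)
  then have "g integrable_on {a..b}" using absolutely_integrable_on_def by blast
  then have "g integrable_on {a..t}" using assms(4) by (rule_tac integrable_on_subinterval) auto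
  then have "integral {a..s} g + integral {s..t} g = integral {a..t} g"
    using assms by (intro Henstock_Kurzweil_Integration.integral_combine) auto
  moreover have "u t = u a + integral {a..t} g" "u s = u a + integral {a..s} g"
    by (rule assms(1)[unfolded AC_with_def, THEN conjunct2, rule_format]; use assms in simp)+
  ultimately show "u t - u s = integral {s..t} g" by (metis add_diff_cancel_left add_diff_cancel_left')
  show "g absolutely_integrable_on {s..t}"
    using absolutely_integrable_on_subinterval[OF g] assms by auto
qed

lemma AC_with_subset:
  assumes "AC_with a b u g" "a \<le> c" "d \<le> b" shows "AC_with c d u g"
proof (cases "c \<le> d")
  case True
  have "u x = u c + integral {c..x} g" if "x \<in> {c..d}" for x
    using AC_with_diff(1)[OF assms(1,2), of x] that assms(3) by (simp add: algebra_simps)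
  moreover have "g absolutely_integrable_on {c..d}"
    using AC_with_diff(2)[OF assms(1,2), of d] assms(3) True by auto
  ultimately show ?thesis unfolding AC_with_def by blast
qed (auto simp: AC_with_def set_integrable_def)

text \<open>Absolute continuity of the integral: truncating \<open>h\<close>, the norm of
  \<open>g\<close>, at height \<open>n\<close> leaves a remainder \<open>k\<close> of small total
  integral, and the bounded part contributes at most \<open>n\<close> times the length of the
  intervals.\<close>

lemma AC_with_abs_cont:
  assumes u: "AC_with a b u g" shows "abs_cont_on a b u"
proof (rule abs_cont_onI)
  fix \<epsilon> :: real assume e: "\<epsilon> > 0"
  define h where "h x = norm (g x)" for x
  have h: "h integrable_on {a..b}"
    using u unfolding AC_with_def absolutely_integrable_on_def h_def by auto
  have ha: "h absolutely_integrable_on {a..b}"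
    using h by (intro nonnegative_absolutely_integrable_1) (auto simp: h_def)
  have m: "(\<lambda>x. min (h x) (real n)) integrable_on {a..b}" for n
  proof -
    have "(\<lambda>x. min (h x) (real n)) absolutely_integrable_on {a..b}"
      by (intro absolutely_integrable_min_1 ha absolutely_integrable_continuous_real continuous_intros)
    then show ?thesis using absolutely_integrable_on_def by blast
  qed
  have "(\<lambda>n. integral {a..b} (\<lambda>x. min (h x) (real n))) \<longlonglongrightarrow> integral {a..b} h"
  proof (rule dominated_convergence(2)[where h = h])
    show "(\<lambda>n. min (h x) (real n)) \<longlonglongrightarrow> h x" for x
    proof (rule tendsto_eventually)
      obtain N :: nat where "h x \<le> N" using real_arch_simple by blast
      then show "\<forall>\<^sub>F n in sequentially. min (h x) (real n) = h x"
        by (auto simp: eventually_sequentially min_def intro!: exI[of _ N])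
    qed
  qed (use m h in \<open>auto simp: h_def\<close>)
  then have "\<forall>\<^sub>F n in sequentially. integral {a..b} (\<lambda>x. min (h x) (real n)) > integral {a..b} h - \<epsilon> / 2"
    using e by (intro order_tendstoD(1)) auto
  then obtain n where n: "integral {a..b} (\<lambda>x. min (h x) (real n)) > integral {a..b} h - \<epsilon> / 2"
    by (auto simp: eventually_sequentially)
  define k where "k x = h x - min (h x) (real n)" for x
  have k: "k integrable_on {a..b}" unfolding k_def by (intro integrable_diff h m)
  have kI: "integral {a..b} k < \<epsilon> / 2" unfolding k_def using n h m by (subst integral_diff) auto
  show "\<exists>\<delta>>0. \<forall>I. disjoint_ivls a b I \<longrightarrow> (\<Sum>(s, t)\<in>I. t - s) < \<delta> \<longrightarrow>
     (\<Sum>(s, t)\<in>I. norm (u t - u s)) < \<epsilon>"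
  proof (intro exI[of _ "\<epsilon> / (2 * (real n + 1))"] conjI allI impI)
    fix I assume I: "disjoint_ivls a b I" "(\<Sum>(s, t)\<in>I. t - s) < \<epsilon> / (2 * (real n + 1))"
    have le: "norm (u (snd p) - u (fst p)) \<le> integral {fst p..snd p} k + real n * (snd p - fst p)" if p: "p \<in> I" for p
    proof -
      have st: "a \<le> fst p" "fst p \<le> snd p" "snd p \<le> b" using I(1) p unfolding disjoint_ivls_def by auto
      have sub: "f integrable_on {a..b} \<Longrightarrow> f integrable_on {fst p..snd p}" for f :: "real \<Rightarrow> real"
        using st by (rule_tac integrable_on_subinterval) auto
      have "norm (u (snd p) - u (fst p)) = norm (integral {fst p..snd p} g)"
        using AC_with_diff[OF u st] by simp
      also have "\<dots> \<le> integral {fst p..snd p} h" unfolding h_def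
        using AC_with_diff(2)[OF u st] by (intro integral_norm_bound_integral) (auto simp: absolutely_integrable_on_def)
      also have "\<dots> \<le> integral {fst p..snd p} (\<lambda>x. k x + real n)"
      proof (rule integral_le[OF sub[OF h]])
        show "(\<lambda>x. k x + real n) integrable_on {fst p..snd p}"
          by (intro integrable_add sub k integrable_const_ivl)
      qed (simp add: k_def)
      also have "\<dots> = integral {fst p..snd p} k + real n * (snd p - fst p)"
        using sub[OF k] st by (subst integral_add) auto
      finally show ?thesis .
    qed
    have "(\<Sum>(s, t)\<in>I. norm (u t - u s)) \<le> (\<Sum>(s, t)\<in>I. integral {s..t} k + real n * (t - s))"
      using le by (intro sum_mono) auto
    also have "\<dots> = (\<Sum>(s, t)\<in>I. integral {s..t} k) + real n * (\<Sum>(s, t)\<in>I. t - s)"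
      by (simp add: case_prod_unfold sum.distrib sum_distrib_left)
    also have "\<dots> < \<epsilon> / 2 + \<epsilon> / 2"
    proof (rule add_less_le_mono)
      show "(\<Sum>(s, t)\<in>I. integral {s..t} k) < \<epsilon> / 2"
        using sum_integral_disjoint_le[OF k _ I(1)] kI by (force simp: k_def)
      have "real n * (\<Sum>(s, t)\<in>I. t - s) \<le> real n * (\<epsilon> / (2 * (real n + 1)))"
        using I(2) by (intro mult_left_mono) auto
      also have "\<dots> \<le> \<epsilon> / 2" using e by (simp add: field_simps)
      finally show "real n * (\<Sum>(s, t)\<in>I. t - s) \<le> \<epsilon> / 2" .
    qed
    finally show "(\<Sum>(s, t)\<in>I. norm (u t - u s)) < \<epsilon>" by simp
  qed (use e in simp)
qed

text \<open>\<open>integrable_ccontinuous_explicit\<close> treats averages over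
  \<open>[x, x + h]\<close> with \<open>h > 0\<close>, which give the right-hand quotients; the
  left-hand ones come from the reflected function \<open>\<lambda>x. f0 (- x)\<close>.\<close>

lemma indefinite_integral_has_vector_derivative_AE:
  fixes f :: "real \<Rightarrow> complex"
  assumes f: "f integrable_on {a..b}"
  shows "AE x in lebesgue. x \<in> {a<..<b} \<longrightarrow> ((\<lambda>t. integral {a..t} f) has_vector_derivative f x) (at x)"
proof -
  define f0 where "f0 x = (if x \<in> {a..b} then f x else 0)" for x
  have "f0 integrable_on UNIV" unfolding f0_def using f by (subst integrable_restrict_UNIV)
  then have f0: "f0 integrable_on cbox c d" for c d using integrable_on_subcbox by blast
  have f1: "(\<lambda>x. f0 (-x)) integrable_on cbox c d" for c d :: real
    using f0[of "-d" "-c"] integrable_reflect[of f0 "-c" "-d"] by simp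
  obtain N1 where N1: "negligible N1" and N1': "\<And>x e. \<lbrakk>x \<notin> N1; 0 < e\<rbrakk> \<Longrightarrow> \<exists>d>0. \<forall>h. 0 < h \<and> h < d \<longrightarrow>
      norm (integral (cbox x (x + h *\<^sub>R One)) f0 /\<^sub>R h ^ DIM(real) - f0 x) < e"
    by (rule integrable_ccontinuous_explicit[of f0, OF f0]) blast
  obtain N2 where N2: "negligible N2" and N2': "\<And>x e. \<lbrakk>x \<notin> N2; 0 < e\<rbrakk> \<Longrightarrow> \<exists>d>0. \<forall>h. 0 < h \<and> h < d \<longrightarrow>
      norm (integral (cbox x (x + h *\<^sub>R One)) (\<lambda>x. f0 (-x)) /\<^sub>R h ^ DIM(real) - f0 (-x)) < e"
    by (rule integrable_ccontinuous_explicit[of "\<lambda>x. f0 (-x)", OF f1]) blast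
  have "negligible (uminus ` N2)"
    using N2 by (intro negligible_differentiable_image_negligible) (auto intro!: derivative_intros differentiable_on_minus differentiable_on_ident)
  then have "negligible (N1 \<union> uminus ` N2)" using N1 by (intro negligible_Un)
  moreover have "((\<lambda>t. integral {a..t} f) has_vector_derivative f x) (at x)"
    if x: "x \<notin> N1 \<union> uminus ` N2" "x \<in> {a<..<b}" for x
    unfolding has_vector_derivative_def has_derivative_at_alt
  proof (intro conjI allI impI)
    show "bounded_linear (\<lambda>xa. xa *\<^sub>R f x)" by (rule bounded_linear_scaleR_left)
    fix e :: real assume e: "e > 0"
    obtain d1 where d1: "d1 > 0" "\<And>h. \<lbrakk>0 < h; h < d1\<rbrakk> \<Longrightarrow> norm (integral {x..x+h} f0 /\<^sub>R h - f0 x) < e"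
      using N1'[of x e] x e by auto
    have "-x \<notin> N2" using x by force
    then obtain d2 where d2: "d2 > 0" "\<And>h. \<lbrakk>0 < h; h < d2\<rbrakk> \<Longrightarrow> norm (integral {-x..-x+h} (\<lambda>x. f0 (-x)) /\<^sub>R h - f0 x) < e"
      using N2'[of "-x" e] e by auto
    define d where "d = Min {d1, d2, x - a, b - x}"
    have d: "d > 0" "d \<le> d1" "d \<le> d2" "d \<le> x - a" "d \<le> b - x" using d1 d2 x by (auto simp: d_def)
    have fx: "f0 x = f x" using x by (auto simp: f0_def)
    have sub: "f integrable_on {a..t}" if "t \<le> b" for t
      using f that by (rule_tac integrable_on_subinterval) auto
    have key: "norm (I - h *\<^sub>R f x) \<le> e * h" if "norm (I /\<^sub>R h - f x) < e" "h > 0" for h I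
    proof -
      have "I - h *\<^sub>R f x = h *\<^sub>R (I /\<^sub>R h - f x)" using that by (simp add: algebra_simps)
      then have "norm (I - h *\<^sub>R f x) = h * norm (I /\<^sub>R h - f x)" using that by simp
      then show ?thesis using that by (simp add: mult.commute)
    qed
    have "norm (integral {a..y} f - integral {a..x} f - (y - x) *\<^sub>R f x) \<le> e * norm (y - x)"
      if y: "norm (y - x) < d" for y
    proof (cases "y > x")
      case True
      have "integral {a..x} f + integral {x..y} f = integral {a..y} f"
        using True y d x by (intro Henstock_Kurzweil_Integration.integral_combine sub) auto
      moreover have "integral {x..y} f0 = integral {x..y} f"
        using y d x True by (intro integral_cong) (auto simp: f0_def)
      ultimately have "integral {a..y} f - integral {a..x} f = integral {x..x+(y-x)} f0" by (simp add: algebra_simps)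
      then show ?thesis using key[OF d1(2)[of "y - x", unfolded fx]] True y d by auto
    next
      case False
      show ?thesis
      proof (cases "y = x")
        case False
        with \<open>\<not> y > x\<close> have yx: "y < x" by simp
        have "integral {a..y} f + integral {y..x} f = integral {a..x} f"
          using yx y d x by (intro Henstock_Kurzweil_Integration.integral_combine sub) auto
        moreover have "integral {y..x} f0 = integral {y..x} f"
          using y d x yx by (intro integral_cong) (auto simp: f0_def)
        moreover have "integral {-x..-x+(x-y)} (\<lambda>x. f0 (-x)) = integral {y..x} f0"
          using integral_reflect_real[of x y f0] by simp
        ultimately have "integral {a..x} f - integral {a..y} f = integral {-x..-x+(x-y)} (\<lambda>x. f0 (-x))"
          by (simp add: algebra_simps)
        then have "norm (integral {a..x} f - integral {a..y} f - (x - y) *\<^sub>R f x) \<le> e * (x - y)"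
          using key[OF d2(2)[of "x - y", unfolded fx]] yx y d by auto
        moreover have "integral {a..y} f - integral {a..x} f - (y - x) *\<^sub>R f x =
            - (integral {a..x} f - integral {a..y} f - (x - y) *\<^sub>R f x)" by (simp add: algebra_simps)
        ultimately have "norm (integral {a..y} f - integral {a..x} f - (y - x) *\<^sub>R f x) \<le> e * (x - y)"
          by (simp only: norm_minus_cancel)
        then show ?thesis using yx by simp
      qed simp
    qed
    then show "\<exists>d>0. \<forall>y. norm (y - x) < d \<longrightarrow>
        norm (integral {a..y} f - integral {a..x} f - (y - x) *\<^sub>R f x) \<le> e * norm (y - x)"
      using d(1) by blast
  qed
  moreover from calculation(1) have "AE x in lebesgue. x \<notin> N1 \<union> uminus ` N2"
    unfolding negligible_iff_null_sets by (rule AE_not_in)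
  from this show ?thesis
    by (rule eventually_mono) (use calculation(2) in blast)
qed

lemma AC_with_derivative_AE:
  assumes u: "AC_with a b u g"
  shows "AE x in lebesgue. x \<in> {a<..<b} \<longrightarrow> (u has_vector_derivative g x) (at x)"
proof -
  have "g integrable_on {a..b}" using u unfolding AC_with_def absolutely_integrable_on_def by auto
  from indefinite_integral_has_vector_derivative_AE[OF this] show ?thesis
  proof eventually_elim
    case (elim x)
    show ?case
    proof
      assume x: "x \<in> {a<..<b}"
      from elim x have "((\<lambda>t. u a + integral {a..t} g) has_vector_derivative g x) (at x)"
        by (auto intro!: derivative_eq_intros)
      then show "(u has_vector_derivative g x) (at x)"
        by (rule has_vector_derivative_transform_within_open[of _ _ _ "{a<..<b}"])
           (use x in \<open>auto intro!: u[unfolded AC_with_def, THEN conjunct2, rule_format, symmetric]\<close>)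
    qed
  qed
qed

section \<open>Total variation and the fundamental theorem of calculus\<close>

lemma disjoint_ivls_length_le:
  assumes "disjoint_ivls a b I" "a \<le> b"
  shows "(\<Sum>(s, t)\<in>I. t - s) \<le> b - a"
proof -
  have "(\<Sum>(s, t)\<in>I. t - s) = (\<Sum>(s, t)\<in>I. integral {s..t} (\<lambda>_. 1 :: real))"
    using assms(1) unfolding disjoint_ivls_def by (intro sum.cong) auto
  also have "\<dots> \<le> integral {a..b} (\<lambda>_. 1 :: real)"
    by (rule sum_integral_disjoint_le[OF _ _ assms(1)]) auto
  finally show ?thesis using assms(2) by simp
qed

lemma disjoint_ivls_Un:
  assumes "disjoint_ivls a c I" "disjoint_ivls c b J" "a \<le> c" "c \<le> b"
  shows "disjoint_ivls a b (I \<union> J)"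
    and "(\<Sum>(s, t)\<in>I \<union> J. norm (u t - u s)) = (\<Sum>(s, t)\<in>I. norm (u t - u s)) + (\<Sum>(s, t)\<in>J. norm (u t - u s))"
proof -
  have I: "finite I" "\<And>p. p \<in> I \<Longrightarrow> a \<le> fst p \<and> fst p \<le> snd p \<and> snd p \<le> c"
    "\<And>p q. \<lbrakk>p \<in> I; q \<in> I; p \<noteq> q\<rbrakk> \<Longrightarrow> {fst p<..<snd p} \<inter> {fst q<..<snd q} = {}"
    using assms(1) unfolding disjoint_ivls_def by auto
  have J: "finite J" "\<And>p. p \<in> J \<Longrightarrow> c \<le> fst p \<and> fst p \<le> snd p \<and> snd p \<le> b"
    "\<And>p q. \<lbrakk>p \<in> J; q \<in> J; p \<noteq> q\<rbrakk> \<Longrightarrow> {fst p<..<snd p} \<inter> {fst q<..<snd q} = {}"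
    using assms(2) unfolding disjoint_ivls_def by auto
  have IJ: "{fst p<..<snd p} \<inter> {fst q<..<snd q} = {}" if "p \<in> I" "q \<in> J" for p q
    using I(2)[OF that(1)] J(2)[OF that(2)] by auto
  show "disjoint_ivls a b (I \<union> J)" unfolding disjoint_ivls_def
  proof (intro conjI ballI impI)
    show "finite (I \<union> J)" using I J by simp
    show "case p of (s, t) \<Rightarrow> a \<le> s \<and> s \<le> t \<and> t \<le> b" if "p \<in> I \<union> J" for p
      using that I(2)[of p] J(2)[of p] assms(3,4) by (cases p) auto
    show "{fst p<..<snd p} \<inter> {fst q<..<snd q} = {}" if "p \<in> I \<union> J" "q \<in> I \<union> J" "p \<noteq> q" for p q
      using that I(3)[of p q] J(3)[of p q] IJ[of p q] IJ[of q p] by (metis Un_iff inf_commute)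
  qed
  \<comment> \<open>A pair that belongs to both families is degenerate and sits at \<open>c\<close>,
    so counting it once or twice makes no difference.\<close>
  have "p \<in> I \<Longrightarrow> p \<in> J \<Longrightarrow> fst p = snd p" for p using I(2)[of p] J(2)[of p] by auto
  then have "(\<Sum>(s, t)\<in>I \<inter> J. norm (u t - u s)) = 0" by (intro sum.neutral) fastforce
  then show "(\<Sum>(s, t)\<in>I \<union> J. norm (u t - u s)) = (\<Sum>(s, t)\<in>I. norm (u t - u s)) + (\<Sum>(s, t)\<in>J. norm (u t - u s))"
    using sum.union_inter[OF I(1) J(1), of "\<lambda>(s, t). norm (u t - u s)"] by simp
qed

text \<open>Members that straddle \<open>c\<close> are split there, and by the triangle inequality
  splitting can only increase the sum. This gives one half of the additivity of
  \<open>tot_var\<close>.\<close>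

lemma disjoint_ivls_cut:
  fixes u :: "real \<Rightarrow> complex"
  assumes I: "disjoint_ivls a b I" and c: "a \<le> c" "c \<le> b"
  obtains I1 I2 where "disjoint_ivls a c I1" "disjoint_ivls c b I2"
    "(\<Sum>(s, t)\<in>I. norm (u t - u s)) \<le> (\<Sum>(s, t)\<in>I1. norm (u t - u s)) + (\<Sum>(s, t)\<in>I2. norm (u t - u s))"
proof -
  \<comment> \<open>Degenerate pairs are dropped: injectivity of the truncations \<open>f1\<close>
    and \<open>f2\<close> rests on a common interior point of two intervals with the same image,
    which a degenerate pair would not supply.\<close>
  define K where "K = {p \<in> I. fst p < snd p}"
  have K: "finite K" "\<And>p. p \<in> K \<Longrightarrow> a \<le> fst p \<and> fst p < snd p \<and> snd p \<le> b"
    using I unfolding disjoint_ivls_def K_def by auto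
  have Kd: "{fst p<..<snd p} \<inter> {fst q<..<snd q} = {}" if "p \<in> K" "q \<in> K" "p \<noteq> q" for p q
    using I that unfolding disjoint_ivls_def K_def by blast
  have same: "p = q" if "p \<in> K" "q \<in> K" "x \<in> {fst p<..<snd p}" "x \<in> {fst q<..<snd q}" for p q x
    using Kd[of p q] that by blast
  define K1 where "K1 = {p \<in> K. fst p < c}"
  define K2 where "K2 = {p \<in> K. c < snd p}"
  define f1 where "f1 p = (fst p, min (snd p) c)" for p :: "real \<times> real"
  define f2 where "f2 p = (max (fst p) c, snd p)" for p :: "real \<times> real"
  have inj1: "inj_on f1 K1"
  proof (rule inj_onI)
    fix p q assume pq: "p \<in> K1" "q \<in> K1" "f1 p = f1 q"
    obtain x where "fst p < x" "x < min (snd p) (snd q)"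
      using pq K(2)[of p] K(2)[of q] dense[of "fst p" "min (snd p) (snd q)"] unfolding K1_def f1_def by auto
    then show "p = q" using same[of p q x] pq unfolding K1_def f1_def by auto
  qed
  have inj2: "inj_on f2 K2"
  proof (rule inj_onI)
    fix p q assume pq: "p \<in> K2" "q \<in> K2" "f2 p = f2 q"
    obtain x where "max (fst p) (fst q) < x" "x < snd p"
      using pq K(2)[of p] K(2)[of q] dense[of "max (fst p) (fst q)" "snd p"] unfolding K2_def f2_def by auto
    then show "p = q" using same[of p q x] pq unfolding K2_def f2_def by auto
  qed
  let ?v = "\<lambda>(s, t). norm (u t - u s)"
  show thesis
  proof (rule that[of "f1 ` K1" "f2 ` K2"])
    show "disjoint_ivls a c (f1 ` K1)" unfolding disjoint_ivls_def
    proof (intro conjI ballI impI)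
      show "finite (f1 ` K1)" using K(1) by (simp add: K1_def)
      show "case p of (s, t) \<Rightarrow> a \<le> s \<and> s \<le> t \<and> t \<le> c" if "p \<in> f1 ` K1" for p
        using that K(2) c unfolding K1_def f1_def by force
      show "{fst p<..<snd p} \<inter> {fst q<..<snd q} = {}" if pq: "p \<in> f1 ` K1" "q \<in> f1 ` K1" "p \<noteq> q" for p q
      proof -
        obtain p' q' where "p' \<in> K1" "q' \<in> K1" "p = f1 p'" "q = f1 q'" using pq by blast
        then have "{fst p'<..<snd p'} \<inter> {fst q'<..<snd q'} = {}" using Kd[of p' q'] pq(3) unfolding K1_def by blast
        moreover have "{fst p<..<snd p} \<subseteq> {fst p'<..<snd p'}" "{fst q<..<snd q} \<subseteq> {fst q'<..<snd q'}"
          using \<open>p = f1 p'\<close> \<open>q = f1 q'\<close> by (auto simp: f1_def)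
        ultimately show ?thesis by blast
      qed
    qed
    show "disjoint_ivls c b (f2 ` K2)" unfolding disjoint_ivls_def
    proof (intro conjI ballI impI)
      show "finite (f2 ` K2)" using K(1) by (simp add: K2_def)
      show "case p of (s, t) \<Rightarrow> c \<le> s \<and> s \<le> t \<and> t \<le> b" if "p \<in> f2 ` K2" for p
        using that K(2) c unfolding K2_def f2_def by force
      show "{fst p<..<snd p} \<inter> {fst q<..<snd q} = {}" if pq: "p \<in> f2 ` K2" "q \<in> f2 ` K2" "p \<noteq> q" for p q
      proof -
        obtain p' q' where "p' \<in> K2" "q' \<in> K2" "p = f2 p'" "q = f2 q'" using pq by blast
        then have "{fst p'<..<snd p'} \<inter> {fst q'<..<snd q'} = {}" using Kd[of p' q'] pq(3) unfolding K2_def by blast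
        moreover have "{fst p<..<snd p} \<subseteq> {fst p'<..<snd p'}" "{fst q<..<snd q} \<subseteq> {fst q'<..<snd q'}"
          using \<open>p = f2 p'\<close> \<open>q = f2 q'\<close> by (auto simp: f2_def)
        ultimately show ?thesis by blast
      qed
    qed
    have "sum ?v I = sum ?v K"
      using I unfolding K_def disjoint_ivls_def by (intro sum.mono_neutral_right) force+
    also have "\<dots> \<le> (\<Sum>p\<in>K. (if fst p < c then ?v (f1 p) else 0) + (if c < snd p then ?v (f2 p) else 0))"
    proof (rule sum_mono)
      fix p assume "p \<in> K"
      have "norm (u (snd p) - u (fst p)) \<le> norm (u c - u (fst p)) + norm (u (snd p) - u c)"
        by (metis add.commute norm_triangle_ineq diff_add_cancel add_diff_eq)
      then show "?v p \<le> (if fst p < c then ?v (f1 p) else 0) + (if c < snd p then ?v (f2 p) else 0)"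
        using K(2)[OF \<open>p \<in> K\<close>] by (auto simp: f1_def f2_def case_prod_unfold min_def max_def)
    qed
    also have "\<dots> = (\<Sum>p\<in>K1. ?v (f1 p)) + (\<Sum>p\<in>K2. ?v (f2 p))"
      unfolding K1_def K2_def sum.distrib using K(1) by (simp add: sum.inter_filter)
    also have "\<dots> = sum ?v (f1 ` K1) + sum ?v (f2 ` K2)"
      by (simp add: sum.reindex[OF inj1] sum.reindex[OF inj2])
    finally show "sum ?v I \<le> sum ?v (f1 ` K1) + sum ?v (f2 ` K2)" .
  qed
qed

text \<open>Total variation over families of nonoverlapping intervals, gaps allowed, in place of
  partitions. These are the families of \<open>abs_cont_on_def\<close>, so the sums compare
  directly.\<close>

definition tot_var :: "(real \<Rightarrow> complex) \<Rightarrow> real \<Rightarrow> real \<Rightarrow> real" where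
  "tot_var u a b = (SUP I\<in>{I. disjoint_ivls a b I}. \<Sum>(s, t)\<in>I. norm (u t - u s))"

lemma disjoint_ivls_empty [simp]: "disjoint_ivls a b {}" by (simp add: disjoint_ivls_def)

text \<open>Each piece shorter than the \<delta> for \<open>\<epsilon> = 1\<close> contributes less
  than 1, and \<open>n\<close> pieces of length \<open>\<delta> / 2\<close> reach \<open>b\<close>.
  The bound also serves subintervals, because a family in \<open>[c, d]\<close> is one in
  \<open>[a, b]\<close>.\<close>

lemma abs_cont_on_variation_bounded:
  assumes u: "abs_cont_on a b u"
  obtains B where "\<And>c d I. \<lbrakk>a \<le> c; d \<le> b; disjoint_ivls c d I\<rbrakk> \<Longrightarrow> (\<Sum>(s, t)\<in>I. norm (u t - u s)) \<le> B"
proof -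
  obtain \<delta> where \<delta>: "\<delta> > 0" and d: "\<And>I. \<lbrakk>disjoint_ivls a b I; (\<Sum>(s, t)\<in>I. t - s) < \<delta>\<rbrakk> \<Longrightarrow>
     (\<Sum>(s, t)\<in>I. norm (u t - u s)) < 1" using abs_cont_onD[OF u zero_less_one] by metis
  have mono: "disjoint_ivls a b I" if "a \<le> c" "d \<le> b" "disjoint_ivls c d I" for c d I
    using that unfolding disjoint_ivls_def by fastforce
  have *: "(\<Sum>(s, t)\<in>I. norm (u t - u s)) \<le> real n"
    if "disjoint_ivls a c I" "a \<le> c" "c \<le> b" "c \<le> a + real n * (\<delta> / 2)" for n c I
    using that
  proof (induction n arbitrary: c I)
    case 0
    then have "fst p = snd p" if "p \<in> I" for p
      using that unfolding disjoint_ivls_def by (cases p) auto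
    then have "(\<Sum>(s, t)\<in>I. norm (u t - u s)) = 0"
      by (intro sum.neutral) (simp add: case_prod_unfold)
    then show ?case by simp
  next
    case (Suc n)
    define e where "e = max a (c - \<delta> / 2)"
    have e: "a \<le> e" "e \<le> c" "e \<le> a + real n * (\<delta> / 2)" "c - e < \<delta>"
    proof -
      have "real (Suc n) * (\<delta> / 2) = real n * (\<delta> / 2) + \<delta> / 2" by (simp add: field_simps)
      then have "c - \<delta> / 2 \<le> a + real n * (\<delta> / 2)" using Suc.prems(4) by linarith
      moreover have "0 \<le> real n * (\<delta> / 2)" using \<delta> by simp
      ultimately show "a \<le> e" "e \<le> c" "e \<le> a + real n * (\<delta> / 2)" "c - e < \<delta>"
        using Suc.prems(2) \<delta> unfolding e_def by linarith+
    qed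
    obtain I1 I2 where I12: "disjoint_ivls a e I1" "disjoint_ivls e c I2"
      "(\<Sum>(s, t)\<in>I. norm (u t - u s)) \<le> (\<Sum>(s, t)\<in>I1. norm (u t - u s)) + (\<Sum>(s, t)\<in>I2. norm (u t - u s))"
      using disjoint_ivls_cut[OF Suc.prems(1) e(1,2), of u] by metis
    have "(\<Sum>(s, t)\<in>I1. norm (u t - u s)) \<le> real n"
      using Suc.IH[OF I12(1) e(1) _ e(3)] e Suc.prems by linarith
    moreover have "(\<Sum>(s, t)\<in>I2. norm (u t - u s)) < 1"
      using disjoint_ivls_length_le[OF I12(2) e(2)] e(4) Suc.prems by (intro d mono[OF e(1) _ I12(2)]) auto
    ultimately show ?case using I12(3) by simp
  qed
  obtain n :: nat where n: "(b - a) / (\<delta> / 2) \<le> real n" using real_arch_simple by blast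
  then have n: "b \<le> a + real n * (\<delta> / 2)" using \<delta> by (simp add: field_simps)
  show thesis
  proof (rule that[of "real n"])
    fix c d I assume I: "a \<le> c" "d \<le> b" "disjoint_ivls c d I"
    show "(\<Sum>(s, t)\<in>I. norm (u t - u s)) \<le> real n"
    proof (cases "a \<le> b")
      case True then show ?thesis using *[OF mono[OF I] _ _ n] by simp
    next
      case False
      then have "I = {}" using I unfolding disjoint_ivls_def by fastforce
      then show ?thesis by simp
    qed
  qed
qed

context
  fixes a b :: real and u :: "real \<Rightarrow> complex"
  assumes u: "abs_cont_on a b u"
begin

lemma tot_var_bdd: "a \<le> c \<Longrightarrow> d \<le> b \<Longrightarrow>
  bdd_above ((\<lambda>I. \<Sum>(s, t)\<in>I. norm (u t - u s)) ` {I. disjoint_ivls c d I})"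
  using abs_cont_on_variation_bounded[OF u] unfolding bdd_above_def by (metis (no_types, lifting) imageE mem_Collect_eq)

lemma tot_var_upper:
  "a \<le> c \<Longrightarrow> d \<le> b \<Longrightarrow> disjoint_ivls c d I \<Longrightarrow> (\<Sum>(s, t)\<in>I. norm (u t - u s)) \<le> tot_var u c d"
  unfolding tot_var_def by (intro cSUP_upper tot_var_bdd) auto

lemma tot_var_approx:
  assumes "a \<le> c" "d \<le> b" "\<epsilon> > 0"
  obtains I where "disjoint_ivls c d I" "tot_var u c d < (\<Sum>(s, t)\<in>I. norm (u t - u s)) + \<epsilon>"
proof -
  have "tot_var u c d - \<epsilon> < tot_var u c d" using assms by simp
  then have "\<exists>I\<in>{I. disjoint_ivls c d I}. tot_var u c d - \<epsilon> < (\<Sum>(s, t)\<in>I. norm (u t - u s))"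
    unfolding tot_var_def by (subst (asm) less_cSUP_iff[OF _ tot_var_bdd[OF assms(1,2)]]) (auto intro: exI[of _ "{}"])
  then show thesis using that by (auto simp: algebra_simps)
qed

lemma tot_var_add:
  assumes "a \<le> c" "c \<le> d" "d \<le> e" "e \<le> b"
  shows "tot_var u c e = tot_var u c d + tot_var u d e"
proof (rule antisym)
  show "tot_var u c e \<le> tot_var u c d + tot_var u d e"
    unfolding tot_var_def[of u c e]
  proof (rule cSUP_least)
    fix I assume "I \<in> {I. disjoint_ivls c e I}"
    then have I: "disjoint_ivls c e I" by simp
    obtain I1 I2 where I12: "disjoint_ivls c d I1" "disjoint_ivls d e I2"
      "(\<Sum>(s, t)\<in>I. norm (u t - u s)) \<le> (\<Sum>(s, t)\<in>I1. norm (u t - u s)) + (\<Sum>(s, t)\<in>I2. norm (u t - u s))"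
      using disjoint_ivls_cut[OF I assms(2,3), of u] by metis
    then show "(\<Sum>(s, t)\<in>I. norm (u t - u s)) \<le> tot_var u c d + tot_var u d e"
      using tot_var_upper[OF _ _ I12(1)] tot_var_upper[OF _ _ I12(2)] assms by linarith
  qed (auto intro: exI[of _ "{}"])
  show "tot_var u c d + tot_var u d e \<le> tot_var u c e"
  proof (rule field_le_epsilon)
    fix \<epsilon> :: real assume "\<epsilon> > 0"
    obtain I where I: "disjoint_ivls c d I" "tot_var u c d < (\<Sum>(s, t)\<in>I. norm (u t - u s)) + \<epsilon> / 2"
      using tot_var_approx[of c d "\<epsilon> / 2"] assms \<open>\<epsilon> > 0\<close> by auto
    obtain J where J: "disjoint_ivls d e J" "tot_var u d e < (\<Sum>(s, t)\<in>J. norm (u t - u s)) + \<epsilon> / 2"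
      using tot_var_approx[of d e "\<epsilon> / 2"] assms \<open>\<epsilon> > 0\<close> by auto
    show "tot_var u c d + tot_var u d e \<le> tot_var u c e + \<epsilon>"
      using tot_var_upper[OF _ _ disjoint_ivls_Un(1)[OF I(1) J(1)]] disjoint_ivls_Un(2)[OF I(1) J(1), of u] assms I(2) J(2)
      by linarith
  qed
qed

lemma tot_var_ge: "a \<le> s \<Longrightarrow> s \<le> t \<Longrightarrow> t \<le> b \<Longrightarrow> norm (u t - u s) \<le> tot_var u s t"
  using tot_var_upper[of s t "{(s, t)}"] by (simp add: disjoint_ivls_def)

text \<open>Every interval of \<open>J\<close> is refined by a family that nearly attains its
  variation. The union of the refinements is still nonoverlapping and no longer than
  \<open>J\<close>, so the \<delta> for \<open>\<epsilon> / 2\<close> applies to it;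
  \<open>\<eta>\<close> spreads the other \<open>\<epsilon> / 2\<close> over the
  \<open>card J\<close> approximation errors.\<close>

lemma abs_cont_on_tot_var: "abs_cont_on a b (\<lambda>x. complex_of_real (tot_var u a x))"
proof (rule abs_cont_onI)
  fix \<epsilon> :: real assume e: "\<epsilon> > 0"
  then obtain \<delta> where "\<delta> > 0" and d: "\<And>I. \<lbrakk>disjoint_ivls a b I; (\<Sum>(s, t)\<in>I. t - s) < \<delta>\<rbrakk> \<Longrightarrow>
     (\<Sum>(s, t)\<in>I. norm (u t - u s)) < \<epsilon> / 2" using abs_cont_onD[OF u, of "\<epsilon> / 2"] by (metis half_gt_zero)
  have "(\<Sum>(s, t)\<in>J. norm (complex_of_real (tot_var u a t) - complex_of_real (tot_var u a s))) < \<epsilon>"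
    if J: "disjoint_ivls a b J" and len: "(\<Sum>(s, t)\<in>J. t - s) < \<delta>" for J
  proof -
    have fin: "finite J" and st: "\<And>p. p \<in> J \<Longrightarrow> a \<le> fst p \<and> fst p \<le> snd p \<and> snd p \<le> b"
      using J unfolding disjoint_ivls_def by auto
    define \<eta> where "\<eta> = \<epsilon> / (2 * (real (card J) + 1))"
    have \<eta>: "\<eta> > 0" using e by (simp add: \<eta>_def)
    have "\<exists>I. disjoint_ivls (fst p) (snd p) I \<and> tot_var u (fst p) (snd p) < (\<Sum>(s, t)\<in>I. norm (u t - u s)) + \<eta>"
      if "p \<in> J" for p using tot_var_approx[of "fst p" "snd p" \<eta>] st[OF that] \<eta> by metis
    then obtain I where I: "\<And>p. p \<in> J \<Longrightarrow> disjoint_ivls (fst p) (snd p) (I p)"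
      "\<And>p. p \<in> J \<Longrightarrow> tot_var u (fst p) (snd p) < (\<Sum>(s, t)\<in>I p. norm (u t - u s)) + \<eta>" by metis
    define K where "K p = {q \<in> I p. fst q < snd q}" for p
    have K: "disjoint_ivls (fst p) (snd p) (K p)" if "p \<in> J" for p
      using I(1)[OF that] unfolding disjoint_ivls_def K_def by auto
    have Kfin: "finite (K p)" if "p \<in> J" for p using K[OF that] unfolding disjoint_ivls_def by auto
    have Kin: "fst p \<le> fst q \<and> fst q < snd q \<and> snd q \<le> snd p" if "p \<in> J" "q \<in> K p" for p q
      using I(1)[OF that(1)] that(2) unfolding disjoint_ivls_def K_def by auto
    have Keq: "p = p'" if "p \<in> J" "q \<in> K p" "p' \<in> J" "q' \<in> K p'" "x \<in> {fst q<..<snd q}" "x \<in> {fst q'<..<snd q'}" for p q p' q' x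
    proof (rule ccontr)
      assume "p \<noteq> p'"
      then have "{fst p<..<snd p} \<inter> {fst p'<..<snd p'} = {}" using J that unfolding disjoint_ivls_def by blast
      moreover have "x \<in> {fst p<..<snd p} \<inter> {fst p'<..<snd p'}" using Kin[OF that(1,2)] Kin[OF that(3,4)] that(5,6) by auto
      ultimately show False by blast
    qed
    have disj: "K p \<inter> K p' = {}" if "p \<in> J" "p' \<in> J" "p \<noteq> p'" for p p'
    proof (rule ccontr)
      assume "K p \<inter> K p' \<noteq> {}"
      then obtain q where "q \<in> K p" "q \<in> K p'" by blast
      then show False using Keq[of p q p' q "(fst q + snd q) / 2"] Kin[of p q] that by auto
    qed
    have sumU: "sum f (\<Union>p\<in>J. K p) = (\<Sum>p\<in>J. sum f (K p))" for f :: "real \<times> real \<Rightarrow> real"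
      using fin Kfin disj by (intro sum.UNION_disjoint) auto
    have "disjoint_ivls a b (\<Union>p\<in>J. K p)" unfolding disjoint_ivls_def
    proof (intro conjI ballI impI)
      show "finite (\<Union>p\<in>J. K p)" using fin Kfin by auto
      show "case q of (s, t) \<Rightarrow> a \<le> s \<and> s \<le> t \<and> t \<le> b" if "q \<in> (\<Union>p\<in>J. K p)" for q
        using that Kin st by (cases q) fastforce
      fix q q' assume q: "q \<in> (\<Union>p\<in>J. K p)" "q' \<in> (\<Union>p\<in>J. K p)" "q \<noteq> q'"
      then obtain p p' where p: "p \<in> J" "q \<in> K p" "p' \<in> J" "q' \<in> K p'" by blast
      show "{fst q<..<snd q} \<inter> {fst q'<..<snd q'} = {}"
      proof (cases "p = p'")
        case True then show ?thesis using K[OF p(1)] p q(3) unfolding disjoint_ivls_def by blast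
      next
        case False then show ?thesis using Keq[OF p] by blast
      qed
    qed
    moreover have "(\<Sum>(s, t)\<in>(\<Union>p\<in>J. K p). t - s) < \<delta>"
    proof -
      have "(\<Sum>(s, t)\<in>(\<Union>p\<in>J. K p). t - s) \<le> (\<Sum>(s, t)\<in>J. t - s)"
        unfolding sumU using disjoint_ivls_length_le[OF K] st by (intro sum_mono) (auto simp: case_prod_unfold)
      with len show ?thesis by simp
    qed
    ultimately have "(\<Sum>(s, t)\<in>(\<Union>p\<in>J. K p). norm (u t - u s)) < \<epsilon> / 2" by (rule d)
    moreover have "(\<Sum>(s, t)\<in>K p. norm (u t - u s)) = (\<Sum>(s, t)\<in>I p. norm (u t - u s))" if "p \<in> J" for p
      using I(1)[OF that] unfolding K_def disjoint_ivls_def by (intro sum.mono_neutral_left) force+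
    ultimately have *: "(\<Sum>p\<in>J. \<Sum>(s, t)\<in>I p. norm (u t - u s)) < \<epsilon> / 2" unfolding sumU by simp
    have "(\<Sum>(s, t)\<in>J. norm (complex_of_real (tot_var u a t) - complex_of_real (tot_var u a s)))
       = (\<Sum>p\<in>J. tot_var u (fst p) (snd p))"
    proof (rule sum.cong)
      fix p assume p: "p \<in> J"
      have "tot_var u a (snd p) - tot_var u a (fst p) = tot_var u (fst p) (snd p)"
        using tot_var_add[of a "fst p" "snd p"] st[OF p] by simp
      moreover have "tot_var u (fst p) (snd p) \<ge> 0"
        using order_trans[OF norm_ge_zero tot_var_ge[of "fst p" "snd p"]] st[OF p] by simp
      ultimately show "(case p of (s, t) \<Rightarrow> norm (complex_of_real (tot_var u a t) - complex_of_real (tot_var u a s)))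
          = tot_var u (fst p) (snd p)"
        by (simp add: case_prod_unfold of_real_diff[symmetric] del: of_real_diff)
    qed simp
    also have "\<dots> \<le> (\<Sum>p\<in>J. (\<Sum>(s, t)\<in>I p. norm (u t - u s)) + \<eta>)"
      using I(2) by (intro sum_mono) (auto intro: less_imp_le)
    also have "\<dots> = (\<Sum>p\<in>J. \<Sum>(s, t)\<in>I p. norm (u t - u s)) + real (card J) * \<eta>"
      by (simp add: sum.distrib)
    also have "\<dots> < \<epsilon> / 2 + \<epsilon> / 2"
    proof (rule add_less_le_mono[OF *])
      show "real (card J) * \<eta> \<le> \<epsilon> / 2" using e by (simp add: \<eta>_def field_simps)
    qed
    finally show ?thesis by simp
  qed
  then show "\<exists>\<delta>>0. \<forall>I. disjoint_ivls a b I \<longrightarrow> (\<Sum>(s, t)\<in>I. t - s) < \<delta> \<longrightarrow>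
     (\<Sum>(s, t)\<in>I. norm (complex_of_real (tot_var u a t) - complex_of_real (tot_var u a s))) < \<epsilon>"
    using \<open>\<delta> > 0\<close> by blast
qed

end

text \<open>Radon-Nikodym for the Stieltjes measure \<open>M\<close> of \<open>G\<close>: absolute
  continuity of \<open>G\<close> makes \<open>M\<close> vanish on Lebesgue null sets, and its
  density is the wanted derivative.\<close>

lemma increasing_abs_cont_on_indefinite_integral:
  fixes G :: "real \<Rightarrow> real"
  assumes ab: "a < b" and mono: "\<And>s t. \<lbrakk>a \<le> s; s \<le> t; t \<le> b\<rbrakk> \<Longrightarrow> G s \<le> G t"
    and ac: "abs_cont_on a b (\<lambda>x. complex_of_real (G x))"
  obtains g :: "real \<Rightarrow> real" where "g absolutely_integrable_on {a..b}"
    "\<And>x. x \<in> {a..b} \<Longrightarrow> G x = G a + integral {a..x} g"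
proof -
  \<comment> \<open>\<open>G\<close> is frozen outside \<open>[a, b]\<close> to obtain a monotone
    continuous function on the line, whose measure has no mass outside the interval.\<close>
  define H where "H x = G (max a (min b x))" for x
  have contG: "continuous_on {a..b} G"
    using continuous_on_Re[OF abs_cont_on_continuous[OF ac]] by simp
  have "continuous_on UNIV H" unfolding H_def
    by (rule continuous_on_compose2[OF contG]) (use ab in \<open>auto intro!: continuous_intros\<close>)
  moreover have monoH: "H x \<le> H y" if "x \<le> y" for x y
    unfolding H_def using that ab by (intro mono) auto
  define M where "M = interval_measure H"
  have Icc: "emeasure M {s..t} = ennreal (H t - H s)" if "s \<le> t" for s t
    unfolding M_def using that monoH \<open>continuous_on UNIV H\<close> by (intro emeasure_interval_measure_Icc) auto
  have rc: "continuous (at_right x) H" for x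
    using \<open>continuous_on UNIV H\<close> by (simp add: continuous_on_eq_continuous_at continuous_at_imp_continuous_at_within)
  have Ioc: "emeasure M {s<..t} = ennreal (H t - H s)" if "s \<le> t" for s t
    unfolding M_def using that monoH rc by (intro emeasure_interval_measure_Ioc) auto
  have [measurable_cong, simp]: "sets M = sets borel" by (simp add: M_def)
  have inner: "emeasure M (N \<inter> {a..b}) \<le> ennreal \<epsilon>" if N: "N \<in> null_sets lborel" and e: "\<epsilon> > 0" for N \<epsilon>
  proof -
    obtain \<delta> where "\<delta> > 0" and d: "\<And>I. \<lbrakk>disjoint_ivls a b I; (\<Sum>(s, t)\<in>I. t - s) < \<delta>\<rbrakk> \<Longrightarrow>
       (\<Sum>(s, t)\<in>I. norm (complex_of_real (G t) - complex_of_real (G s))) < \<epsilon>" using abs_cont_onD[OF ac e] by metis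
    have "N \<in> sets borel" using N by auto
    then obtain U where U: "open U" "N \<subseteq> U" "emeasure lborel (U - N) < \<delta>"
      using outer_regular_lborel[of N \<delta>] \<open>\<delta> > 0\<close> by (metis ennreal_less_zero_iff)
    have Ulen: "emeasure lborel U < \<delta>"
    proof -
      have "U = (U - N) \<union> N" using U(2) by blast
      then have "emeasure lborel U = emeasure lborel (U - N)"
        using emeasure_Un_null_set[of "U - N" lborel N] N U(1) \<open>N \<in> sets borel\<close> by auto
      then show ?thesis using U(3) by simp
    qed
    \<comment> \<open>This gauge forces every member of the covering into \<open>U\<close>, because
      its tag lies in \<open>N\<close> and hence in \<open>U\<close>. The members do not overlap, so
      each finite subfamily can be fed to the \<epsilon>-\<delta> condition.\<close>
    define g where "g x = (if x \<in> U then U else ball x 1)" for x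
    have "gauge g" unfolding gauge_def g_def using U(1) by auto
    have "N \<inter> {a..b} \<subseteq> cbox a b" "box a b \<noteq> {}" using ab by auto
    from covering_lemma[OF this \<open>gauge g\<close>] obtain D where D: "countable D" "\<Union>D \<subseteq> cbox a b"
      "\<And>K. K \<in> D \<Longrightarrow> interior K \<noteq> {} \<and> (\<exists>c d. K = cbox c d)"
      "pairwise (\<lambda>A B. interior A \<inter> interior B = {}) D"
      "\<And>K. K \<in> D \<Longrightarrow> \<exists>x\<in>(N \<inter> {a..b}) \<inter> K. K \<subseteq> g x" "N \<inter> {a..b} \<subseteq> \<Union>D"
      by metis
    have DU: "K \<subseteq> U" if "K \<in> D" for K using D(5)[OF that] U(2) unfolding g_def by (auto split: if_splits)
    have Kform: "K = {Inf K..Sup K} \<and> Inf K < Sup K \<and> a \<le> Inf K \<and> Sup K \<le> b \<and> interior K = {Inf K<..<Sup K}" if "K \<in> D" for K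
    proof -
      have KD: "interior K \<noteq> {}" "\<exists>c d. K = cbox c d" using D(3)[OF that] by auto
      then obtain c d where K: "K = {c..d}" by auto
      then have "c < d" using KD(1) by auto
      moreover have "K \<subseteq> cbox a b" using D(2) that by blast
      then have "{c..d} \<subseteq> {a..b}" by (simp add: K)
      then have "a \<le> c" "d \<le> b" using \<open>c < d\<close> by auto
      ultimately show ?thesis using K by simp
    qed
    have fin: "emeasure M (\<Union>E) \<le> ennreal \<epsilon>" if E: "finite E" "E \<subseteq> D" for E
    proof -
      define I where "I = (\<lambda>K. (Inf K, Sup K)) ` E"
      have inj: "inj_on (\<lambda>K. (Inf K, Sup K)) E" using Kform E(2) by (intro inj_onI) (metis Pair_inject subsetD)
      have "disjoint_ivls a b I" unfolding disjoint_ivls_def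
      proof (intro conjI ballI impI)
        show "finite I" using E by (simp add: I_def)
        show "case p of (s, t) \<Rightarrow> a \<le> s \<and> s \<le> t \<and> t \<le> b" if "p \<in> I" for p
          using that Kform E(2) unfolding I_def by (auto simp: less_imp_le)
        fix p q assume "p \<in> I" "q \<in> I" "p \<noteq> q"
        then obtain K L where KL: "K \<in> D" "L \<in> D" "p = (Inf K, Sup K)" "q = (Inf L, Sup L)" "K \<noteq> L"
          unfolding I_def using E(2) by blast
        then have "interior K \<inter> interior L = {}" using D(4) unfolding pairwise_def by blast
        then show "{fst p<..<snd p} \<inter> {fst q<..<snd q} = {}" using Kform[OF KL(1)] Kform[OF KL(2)] KL(3,4) by simp
      qed
      moreover have "(\<Sum>(s, t)\<in>I. t - s) < \<delta>"
      proof -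
        have "ennreal (\<Sum>(s, t)\<in>I. t - s) = (\<Sum>K\<in>E. ennreal (Sup K - Inf K))"
          unfolding I_def using Kform E(2) by (subst sum.reindex[OF inj]) (auto simp: sum_ennreal less_imp_le subset_eq)
        also have "\<dots> = (\<Sum>K\<in>E. emeasure lborel (interior K))"
        proof (rule sum.cong)
          fix K assume "K \<in> E"
          then have "Inf K < Sup K" "interior K = {Inf K<..<Sup K}" using Kform E(2) by blast+
          then show "ennreal (Sup K - Inf K) = emeasure lborel (interior K)" by simp
        qed simp
        also have "\<dots> = emeasure lborel (\<Union>K\<in>E. interior K)"
          using E D(4) by (intro sum_emeasure) (auto simp: disjoint_family_on_def pairwise_def)
        also have "\<dots> \<le> emeasure lborel U"
          using DU E(2) U(1) interior_subset by (intro emeasure_mono) (auto, blast)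
        also have "\<dots> < \<delta>" by (rule Ulen)
        finally show ?thesis using \<open>\<delta> > 0\<close> by (simp add: ennreal_less_iff sum_nonneg)
            (metis ennreal_less_iff ennreal_neg less_le_trans linorder_not_le order_less_imp_le)
      qed
      ultimately have "(\<Sum>(s, t)\<in>I. norm (complex_of_real (G t) - complex_of_real (G s))) < \<epsilon>" by (rule d)
      then have "(\<Sum>K\<in>E. norm (complex_of_real (G (Sup K)) - complex_of_real (G (Inf K)))) < \<epsilon>"
        unfolding I_def by (subst (asm) sum.reindex[OF inj]) simp
      moreover have "emeasure M (\<Union>E) \<le> (\<Sum>K\<in>E. emeasure M K)"
      proof -
        have "\<And>K. K \<in> E \<Longrightarrow> K \<in> sets M" using D(3) E(2) by fastforce
        then show ?thesis using emeasure_subadditive_finite[OF E(1), of "\<lambda>K. K" M] by auto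
      qed
      moreover have "emeasure M K = ennreal (norm (complex_of_real (G (Sup K)) - complex_of_real (G (Inf K))))" if "K \<in> E" for K
      proof -
        have K: "K = {Inf K..Sup K}" "Inf K < Sup K" "a \<le> Inf K" "Sup K \<le> b" using Kform E(2) that by blast+
        then have "emeasure M K = ennreal (G (Sup K) - G (Inf K))"
          using Icc[of "Inf K" "Sup K"] by (simp add: H_def max_def min_def)
        then show ?thesis using mono[of "Inf K" "Sup K"] K by (simp add: of_real_diff[symmetric] del: of_real_diff)
      qed
      ultimately have "emeasure M (\<Union>E) \<le> ennreal (\<Sum>K\<in>E. norm (complex_of_real (G (Sup K)) - complex_of_real (G (Inf K))))"
        by (simp add: sum_ennreal)
      also have "\<dots> \<le> ennreal \<epsilon>"
        using \<open>(\<Sum>K\<in>E. norm (complex_of_real (G (Sup K)) - complex_of_real (G (Inf K)))) < \<epsilon>\<close> by (simp add: ennreal_leI)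
      finally show ?thesis .
    qed
    have "emeasure M (\<Union>D) \<le> ennreal \<epsilon>"
    proof (cases "D = {}")
      case False
      define E where "E n = from_nat_into D ` {..n}" for n :: nat
      have E: "finite (E n)" "E n \<subseteq> D" for n using from_nat_into[OF False] by (auto simp: E_def)
      have "D = (\<Union>n. E n)"
        unfolding E_def image_UN[symmetric] UN_atMost_UNIV using range_from_nat_into[OF False D(1)] by simp
      then have "\<Union>D = (\<Union>n. \<Union>(E n))" by blast
      moreover have "(SUP n. emeasure M (\<Union>(E n))) = emeasure M (\<Union>n. \<Union>(E n))"
      proof (rule SUP_emeasure_incseq)
        show "range (\<lambda>n. \<Union>(E n)) \<subseteq> sets M"
        proof safe
          fix n have "K \<in> sets borel" if "K \<in> E n" for K using that E(2)[of n] D(3) by fastforce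
          then show "\<Union>(E n) \<in> sets M" using E(1)[of n] by auto
        qed
        show "incseq (\<lambda>n. \<Union>(E n))" unfolding incseq_def E_def by (intro allI impI Union_mono image_mono) auto
      qed
      ultimately show ?thesis using fin[OF E] by (metis SUP_least)
    qed simp
    moreover have "\<Union>D \<in> sets M" using D(1,3) by (auto intro!: sets.countable_Union) fastforce
    ultimately show ?thesis using emeasure_mono[OF D(6), of M] by (metis order_trans)
  qed
  have "absolutely_continuous lborel M"
    unfolding absolutely_continuous_def
  proof
    fix N :: "real set" assume N: "N \<in> null_sets lborel"
    then have Nb: "N \<in> sets borel" by auto
    have "emeasure M (N \<inter> {a..b}) = 0"
      using inner[OF N] by (metis ennreal_le_epsilon add_0 le_zero_eq)
    moreover have "emeasure M (\<Union>n. {a - real n..a} \<union> {b..b + real n}) = 0"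
    proof (rule emeasure_UN_eq_0)
      fix n
      have "emeasure M {a - real n..a} = 0" "emeasure M {b..b + real n} = 0"
        using Icc[of "a - real n" a] Icc[of b "b + real n"] ab by (auto simp: H_def)
      then show "emeasure M ({a - real n..a} \<union> {b..b + real n}) = 0"
        using emeasure_subadditive[of "{a - real n..a}" M "{b..b + real n}"] by simp
    qed auto
    ultimately have "emeasure M ((N \<inter> {a..b}) \<union> (\<Union>n. {a - real n..a} \<union> {b..b + real n})) = 0"
      using Nb by (subst emeasure_Un_null_set) (auto intro!: null_setsI)
    moreover have "N \<subseteq> (N \<inter> {a..b}) \<union> (\<Union>n. {a - real n..a} \<union> {b..b + real n})"
    proof
      fix x assume "x \<in> N"
      obtain n :: nat where "\<bar>x\<bar> + \<bar>a\<bar> + \<bar>b\<bar> \<le> n" using real_arch_simple by blast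
      then show "x \<in> (N \<inter> {a..b}) \<union> (\<Union>n. {a - real n..a} \<union> {b..b + real n})"
        using \<open>x \<in> N\<close> by (cases "x < a"; cases "x > b") (auto intro!: exI[of _ n])
    qed
    then have "emeasure M N \<le> emeasure M ((N \<inter> {a..b}) \<union> (\<Union>n. {a - real n..a} \<union> {b..b + real n}))"
      by (rule emeasure_mono) (use Nb in auto)
    ultimately have "emeasure M N = 0" by simp
    then show "N \<in> null_sets M" using Nb by (auto intro: null_setsI)
  qed
  then obtain f where f: "f \<in> borel_measurable lborel" "density lborel f = M"
    using sigma_finite_measure.Radon_Nikodym[OF sigma_finite_lborel, of M] by auto
  have fint: "(\<integral>\<^sup>+ x. f x * indicator {a<..t} x \<partial>lborel) = ennreal (H t - H a)" if "a \<le> t" for t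
    using Ioc[OF that] emeasure_density[OF f(1), of "{a<..t}"] f(2) by simp
  define g where "g x = enn2real (f x)" for x
  have g0: "g x \<ge> 0" for x by (simp add: g_def)
  have gm[measurable]: "g \<in> borel_measurable borel" unfolding g_def using f(1) by measurable
  have "AE x in lborel. f x * indicator {a<..b} x \<noteq> \<infinity>"
    using fint[of b] f(1) ab by (intro nn_integral_noteq_infinite) auto
  then have ae: "AE x in lborel. x \<in> {a<..b} \<longrightarrow> f x = ennreal (g x)"
    by eventually_elim (auto simp: g_def less_top indicator_def)
  have hasint: "(g has_integral (G t - G a)) {a..t}" if t: "a \<le> t" "t \<le> b" for t
  proof -
    have "(\<integral>\<^sup>+ x. ennreal (g x * indicator {a<..t} x) \<partial>lborel) = (\<integral>\<^sup>+ x. f x * indicator {a<..t} x \<partial>lborel)"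
    proof (rule nn_integral_cong_AE)
      show "AE x in lborel. ennreal (g x * indicator {a<..t} x) = f x * indicator {a<..t} x"
        using ae by eventually_elim (use t in \<open>auto simp: indicator_def\<close>)
    qed
    also have "\<dots> = ennreal (G t - G a)" using fint[OF t(1)] t ab by (simp add: H_def max_def min_def)
    finally have "((\<lambda>x. g x * indicator {a<..t} x) has_integral (G t - G a)) UNIV"
      using mono[of a t] t by (intro nn_integral_has_integral) (auto simp: g0 nn_integral_completion)
    then have "((\<lambda>x. if x \<in> {a<..t} then g x else 0) has_integral (G t - G a)) UNIV"
      by (rule has_integral_eq[rotated]) (auto simp: indicator_def)
    then have "(g has_integral (G t - G a)) {a<..t}" by (subst (asm) has_integral_restrict_UNIV)
    then show ?thesis
      by (subst (asm) has_integral_spike_set_eq[where T = "{a..t}"]) (auto intro: negligible_subset[of "{a}"])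
  qed
  show thesis
  proof (rule that[of g])
    show "g absolutely_integrable_on {a..b}"
      using hasint[of b] ab g0 by (intro nonnegative_absolutely_integrable_1) auto
    show "G x = G a + integral {a..x} g" if "x \<in> {a..b}" for x
      using integral_unique[OF hasint[of x]] that by simp
  qed
qed


text \<open>With the variation function \<open>V\<close>, the functions \<open>V\<close>,
  \<open>V + Re u\<close> and \<open>V + Im u\<close> are increasing and absolutely continuous,
  hence indefinite integrals; differences of their densities give real and imaginary part of
  \<open>g\<close>. This is the converse of \<open>AC_with_abs_cont\<close>.\<close>

lemma abs_cont_on_AC_with:
  assumes ab: "a < b" and u: "abs_cont_on a b u"
  obtains g where "AC_with a b u g"
proof -
  define V where "V = tot_var u a"
  have V: "abs_cont_on a b (\<lambda>x. complex_of_real (V x))"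
    unfolding V_def by (rule abs_cont_on_tot_var[OF u])
  have Vdiff: "norm (u t - u s) \<le> V t - V s" if "a \<le> s" "s \<le> t" "t \<le> b" for s t
    using tot_var_ge[OF u that] tot_var_add[OF u, of a s t] that by (simp add: V_def)
  \<comment> \<open>The cases \<open>L = 0\<close>, \<open>Re\<close> and \<open>Im\<close> are
    treated at once: an increment of \<open>L u\<close> is at most the increment of
    \<open>V\<close>, so the sum is increasing.\<close>
  have *: "\<exists>g::real\<Rightarrow>real. g absolutely_integrable_on {a..b} \<and> (\<forall>x\<in>{a..b}. V x + L (u x) = V a + L (u a) + integral {a..x} g)"
    if L: "\<And>z w. L (z - w) = L z - L w" "\<And>z. \<bar>L z\<bar> \<le> norm z" for L :: "complex \<Rightarrow> real"
  proof -
    have ac: "abs_cont_on a b (\<lambda>x. complex_of_real (V x + L (u x)))"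
    proof (rule abs_cont_on_dominated[OF V u, of 1])
      fix s t
      have "norm (complex_of_real (V t + L (u t)) - complex_of_real (V s + L (u s))) = \<bar>(V t - V s) + L (u t - u s)\<bar>"
        by (simp only: of_real_diff[symmetric] norm_of_real L(1) add_diff_add)
      also have "\<dots> \<le> \<bar>V t - V s\<bar> + norm (u t - u s)" using L(2)[of "u t - u s"] by linarith
      finally show "norm (complex_of_real (V t + L (u t)) - complex_of_real (V s + L (u s))) \<le>
          1 * (norm (complex_of_real (V t) - complex_of_real (V s)) + norm (u t - u s))"
        by (simp only: of_real_diff[symmetric] norm_of_real mult_1)
    qed simp
    have mono: "V s + L (u s) \<le> V t + L (u t)" if "a \<le> s" "s \<le> t" "t \<le> b" for s t
      using Vdiff[OF that] L(2)[of "u t - u s"] L(1)[of "u t" "u s"] by linarith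
    show ?thesis
      by (rule increasing_abs_cont_on_indefinite_integral[OF ab mono ac]) blast+
  qed
  obtain g0 where g0: "g0 absolutely_integrable_on {a..b}" "\<And>x. x \<in> {a..b} \<Longrightarrow> V x = V a + integral {a..x} g0"
  proof -
    have "\<exists>g::real\<Rightarrow>real. g absolutely_integrable_on {a..b} \<and> (\<forall>x\<in>{a..b}. V x + 0 = V a + 0 + integral {a..x} g)"
      by (rule *[of "\<lambda>_. 0"]) simp_all
    then show ?thesis using that unfolding add_0_right by blast
  qed
  obtain g1 where g1: "g1 absolutely_integrable_on {a..b}" "\<And>x. x \<in> {a..b} \<Longrightarrow> V x + Re (u x) = V a + Re (u a) + integral {a..x} g1"
    using *[OF minus_complex.simps(1) abs_Re_le_cmod] by blast
  obtain g2 where g2: "g2 absolutely_integrable_on {a..b}" "\<And>x. x \<in> {a..b} \<Longrightarrow> V x + Im (u x) = V a + Im (u a) + integral {a..x} g2"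
    using *[OF minus_complex.simps(2) abs_Im_le_cmod] by blast
  define g where "g x = complex_of_real (g1 x - g0 x) + \<i> * complex_of_real (g2 x - g0 x)" for x
  have cr: "(\<lambda>x. complex_of_real (k x)) absolutely_integrable_on {a..b}" if "k absolutely_integrable_on {a..b}" for k
    using absolutely_integrable_linear[OF that bounded_linear_of_real] by (simp add: o_def)
  have "(\<lambda>x. \<i> * complex_of_real (g2 x - g0 x)) absolutely_integrable_on {a..b}"
    using absolutely_integrable_linear[OF cr[OF set_integral_diff(1)[OF g2(1) g0(1)]] bounded_linear_mult_right[of \<i>]]
    by (simp add: o_def)
  then have "g absolutely_integrable_on {a..b}"
    unfolding g_def by (intro set_integral_add cr set_integral_diff g0 g1)
  moreover have "u x = u a + integral {a..x} g" if x: "x \<in> {a..b}" for x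
  proof -
    have i: "k integrable_on {a..x}" if "k absolutely_integrable_on {a..b}" for k :: "real \<Rightarrow> real"
      using that x unfolding absolutely_integrable_on_def by (auto intro: integrable_on_subinterval)
    have d: "((\<lambda>t. complex_of_real (k t - g0 t)) has_integral complex_of_real (integral {a..x} k - integral {a..x} g0)) {a..x}"
      if "k absolutely_integrable_on {a..b}" for k
      using has_integral_linear[OF has_integral_diff[OF integrable_integral[OF i[OF that]] integrable_integral[OF i[OF g0(1)]]] bounded_linear_of_real]
      by (simp add: o_def)
    have "(g has_integral (complex_of_real (integral {a..x} g1 - integral {a..x} g0) +
        \<i> * complex_of_real (integral {a..x} g2 - integral {a..x} g0))) {a..x}"
      unfolding g_def by (intro has_integral_add has_integral_mult_right d g1 g2)
    then have "integral {a..x} g = complex_of_real (integral {a..x} g1 - integral {a..x} g0) +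
        \<i> * complex_of_real (integral {a..x} g2 - integral {a..x} g0)" by (rule integral_unique)
    moreover have "Re (u x) = Re (u a) + (integral {a..x} g1 - integral {a..x} g0)"
      "Im (u x) = Im (u a) + (integral {a..x} g2 - integral {a..x} g0)"
      using g0(2)[OF x] g1(2)[OF x] g2(2)[OF x] by linarith+
    ultimately show ?thesis by (simp add: complex_eq_iff)
  qed
  ultimately show thesis using that unfolding AC_with_def by blast
qed

text \<open>Some density \<open>h\<close> exists by the preceding lemma and is the derivative almost
  everywhere, so it agrees with \<open>g\<close> off a null set, which integrals do not see. Product
  and chain rules thereby reduce to pointwise differentiation.\<close>

lemma AC_withI:
  assumes u: "abs_cont_on a b u" and g: "AE x in lebesgue. x \<in> {a<..<b} \<longrightarrow> (u has_vector_derivative g x) (at x)"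
    and ab: "a \<le> b"
  shows "AC_with a b u g"
proof (cases "a = b")
  case False
  then obtain h where h: "AC_with a b u h" using abs_cont_on_AC_with[OF _ u] ab by auto
  have "AE x in lebesgue. x \<in> {a<..<b} \<longrightarrow> g x = h x"
    using g AC_with_derivative_AE[OF h] by eventually_elim (auto intro: vector_derivative_unique_at)
  then have "AE x in lebesgue. x \<notin> {x. x \<in> {a<..<b} \<and> g x \<noteq> h x}" by eventually_elim auto
  then have N: "negligible {x. x \<in> {a<..<b} \<and> g x \<noteq> h x}"
    unfolding negligible_iff_null_sets completion.null_sets_iff_AE by simp
  have "negligible ({x. x \<in> {a<..<b} \<and> g x \<noteq> h x} \<union> {a, b})" using N by (intro negligible_Un) auto
  moreover have "g x = h x" if "x \<in> {a..b} - ({x. x \<in> {a<..<b} \<and> g x \<noteq> h x} \<union> {a, b})" for x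
    using that by auto
  note spike = this
  have ha: "h absolutely_integrable_on {a..b}" using h unfolding AC_with_def by blast
  have eq: "g absolutely_integrable_on {a..b}"
    by (rule absolutely_integrable_spike[OF ha \<open>negligible ({x. x \<in> {a<..<b} \<and> g x \<noteq> h x} \<union> {a, b})\<close> spike])
  have eq2: "integral {a..x} g = integral {a..x} h" if "x \<in> {a..b}" for x
  proof (rule integral_spike[OF \<open>negligible ({x. x \<in> {a<..<b} \<and> g x \<noteq> h x} \<union> {a, b})\<close>])
    fix y assume y: "y \<in> {a..x} - ({x. x \<in> {a<..<b} \<and> g x \<noteq> h x} \<union> {a, b})"
    then have "y \<in> {a..b} - ({x. x \<in> {a<..<b} \<and> g x \<noteq> h x} \<union> {a, b})" using that by simp
    then show "h y = g y" using spike by metis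
  qed
  show ?thesis unfolding AC_with_def
  proof (intro conjI ballI)
    show "u x = u a + integral {a..x} g" if "x \<in> {a..b}" for x
      using h that eq2[OF that] unfolding AC_with_def by metis
  qed (rule eq)
next
  case True
  have "g absolutely_integrable_on cbox a b" by (rule absolutely_integrable_on_null) (simp add: True)
  then show ?thesis by (simp add: AC_with_def True)
qed

section \<open>The first-order system\<close>

lemma absolutely_integrable_mult_continuous:
  fixes u g :: "real \<Rightarrow> complex"
  assumes u: "continuous_on {a..b} u" and g: "g absolutely_integrable_on {a..b}"
  shows "(\<lambda>x. u x * g x) absolutely_integrable_on {a..b}"
proof (rule absolutely_integrable_bounded_measurable_product[where h = "(*)" and f = u and S = "{a..b}", OF _ _ _ _ g])
  show "bilinear ((*) :: complex \<Rightarrow> complex \<Rightarrow> complex)" by (rule bilinear_times)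
  show "u \<in> borel_measurable (lebesgue_on {a..b})" by (rule continuous_imp_measurable_on_sets_lebesgue[OF u]) simp
  show "{a..b} \<in> sets lebesgue" by simp
  show "bounded (u ` {a..b})" by (intro compact_imp_bounded compact_continuous_image u) simp
qed

section \<open>Rules of calculus for \<open>AC_with\<close>\<close>

lemma AC_with_cong:
  assumes "AC_with a b u g" "\<And>x. x \<in> {a..b} \<Longrightarrow> u x = v x" "\<And>x. x \<in> {a..b} \<Longrightarrow> g x = h x"
  shows "AC_with a b v h"
proof (cases "a \<le> b")
  case True
  have "h absolutely_integrable_on {a..b}"
    using assms(1,3) unfolding AC_with_def by (metis (no_types, lifting) set_integrable_cong)
  moreover have "v x = v a + integral {a..x} h" if x: "x \<in> {a..b}" for x
  proof -
    have "u x = u a + integral {a..x} g" using assms(1) x unfolding AC_with_def by blast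
    moreover have "integral {a..x} g = integral {a..x} h"
      using assms(3) x by (intro Henstock_Kurzweil_Integration.integral_cong) auto
    ultimately show ?thesis using assms(2)[OF x] assms(2)[of a] True by simp
  qed
  ultimately show ?thesis unfolding AC_with_def by blast
next
  case False
  then show ?thesis by (simp add: AC_with_def set_integrable_def)
qed

lemma AC_with_continuous: "AC_with a b u g \<Longrightarrow> continuous_on {a..b} u"
  by (intro abs_cont_on_continuous AC_with_abs_cont)

lemma AC_with_add:
  assumes u: "AC_with a b u g" and v: "AC_with a b v h" shows "AC_with a b (\<lambda>x. u x + v x) (\<lambda>x. g x + h x)"
  unfolding AC_with_def
proof (intro conjI ballI)
  have gh: "g absolutely_integrable_on {a..b}" "h absolutely_integrable_on {a..b}" using u v unfolding AC_with_def by blast+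
  then show "(\<lambda>x. g x + h x) absolutely_integrable_on {a..b}" by (intro set_integral_add)
  fix x assume x: "x \<in> {a..b}"
  have i: "g integrable_on {a..x}" "h integrable_on {a..x}"
    using gh x unfolding absolutely_integrable_on_def by (auto intro: integrable_on_subinterval)
  have "u x = u a + integral {a..x} g" "v x = v a + integral {a..x} h" using u v x unfolding AC_with_def by blast+
  then show "u x + v x = u a + v a + integral {a..x} (\<lambda>x. g x + h x)"
    unfolding integral_add[OF i] by (simp only: ac_simps)
qed

lemma AC_with_linear:
  fixes L :: "complex \<Rightarrow> complex"
  assumes u: "AC_with a b u g" and L: "bounded_linear L"
  shows "AC_with a b (\<lambda>x. L (u x)) (\<lambda>x. L (g x))"
  unfolding AC_with_def
proof (intro conjI ballI)
  have g: "g absolutely_integrable_on {a..b}" using u unfolding AC_with_def by blast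
  then show "(\<lambda>x. L (g x)) absolutely_integrable_on {a..b}"
    using absolutely_integrable_linear[OF g L] by (simp add: o_def)
  fix x assume x: "x \<in> {a..b}"
  have i: "g integrable_on {a..x}"
    using g x unfolding absolutely_integrable_on_def by (auto intro: integrable_on_subinterval)
  have "u x = u a + integral {a..x} g" using u x unfolding AC_with_def by blast
  then have "L (u x) = L (u a) + L (integral {a..x} g)" by (simp only: linear_add[OF bounded_linear.linear[OF L]])
  then show "L (u x) = L (u a) + integral {a..x} (\<lambda>x. L (g x))"
    using integral_linear[OF i L] by (simp add: o_def)
qed

lemma AC_with_cmult: "AC_with a b u g \<Longrightarrow> AC_with a b (\<lambda>x. c * u x) (\<lambda>x. c * g x)"
  by (rule AC_with_linear[OF _ bounded_linear_mult_right])

lemma AC_with_cnj: "AC_with a b u g \<Longrightarrow> AC_with a b (\<lambda>x. cnj (u x)) (\<lambda>x. cnj (g x))"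
  by (rule AC_with_linear[OF _ bounded_linear_cnj])

lemma AC_with_diff': "AC_with a b u g \<Longrightarrow> AC_with a b v h \<Longrightarrow> AC_with a b (\<lambda>x. u x - v x) (\<lambda>x. g x - h x)"
  using AC_with_add[of a b u g "\<lambda>x. - 1 * v x" "\<lambda>x. - 1 * h x"] AC_with_cmult[of a b v h "- 1"] by simp

lemma AC_with_mult:
  assumes u: "AC_with a b u g" and v: "AC_with a b v h" and ab: "a \<le> b"
  shows "AC_with a b (\<lambda>x. u x * v x) (\<lambda>x. u x * h x + g x * v x)"
proof (rule AC_withI[OF abs_cont_on_mult[OF AC_with_abs_cont[OF u] AC_with_abs_cont[OF v]] _ ab])
  show "AE x in lebesgue. x \<in> {a<..<b} \<longrightarrow> ((\<lambda>x. u x * v x) has_vector_derivative u x * h x + g x * v x) (at x)"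
    using AC_with_derivative_AE[OF u] AC_with_derivative_AE[OF v]
    by eventually_elim (auto intro: has_vector_derivative_mult)
qed

lemma AC_with_exp:
  assumes u: "AC_with a b u g" and ab: "a \<le> b"
  shows "AC_with a b (\<lambda>x. exp (u x)) (\<lambda>x. g x * exp (u x))"
proof (rule AC_withI[OF abs_cont_on_exp[OF AC_with_abs_cont[OF u]] _ ab])
  show "AE x in lebesgue. x \<in> {a<..<b} \<longrightarrow> ((\<lambda>x. exp (u x)) has_vector_derivative g x * exp (u x)) (at x)"
    using AC_with_derivative_AE[OF u]
  proof eventually_elim
    case (elim x)
    then show ?case using field_vector_diff_chain_at[OF _ DERIV_exp, of u "g x" x] by (auto simp: o_def)
  qed
qed

lemma AC_with_indefinite:
  "g absolutely_integrable_on {a..b} \<Longrightarrow> AC_with a b (\<lambda>x. c + integral {a..x} g) g"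
  unfolding AC_with_def by simp

lemma AC_with_zero_const:
  assumes "AC_with a b u g" "\<And>x. x \<in> {a..b} \<Longrightarrow> g x = 0" "x \<in> {a..b}" shows "u x = u a"
proof -
  have "u x = u a + integral {a..x} g" using assms(1,3) unfolding AC_with_def by blast
  moreover have "integral {a..x} g = integral {a..x} (\<lambda>_. 0)"
    using assms(2,3) by (intro Henstock_Kurzweil_Integration.integral_cong) auto
  ultimately show ?thesis by simp
qed

lemma AC_with_power:
  assumes u: "AC_with a b u g" and ab: "a \<le> b"
  shows "AC_with a b (\<lambda>x. u x ^ Suc n) (\<lambda>x. of_nat (Suc n) * u x ^ n * g x)"
proof (induction n)
  case 0 show ?case using u by simp
next
  case (Suc n)
  from AC_with_mult[OF u Suc ab] show ?case by (rule AC_with_cong) (auto simp: algebra_simps)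
qed

text \<open>The source of the factorials in the Picard estimate: \<open>k * S^n\<close> is the
  density of \<open>S^(n+1) / (n+1)\<close> for the indefinite integral \<open>S\<close> of
  \<open>k\<close>. The detour through complex values lets \<open>AC_with_power\<close> be
  reused.\<close>

lemma integral_indefinite_power:
  fixes k :: "real \<Rightarrow> real"
  assumes k: "k absolutely_integrable_on {a..b}" and ab: "a \<le> b" and x: "x \<in> {a..b}"
  shows "((\<lambda>t. k t * integral {a..t} k ^ n) has_integral (integral {a..x} k ^ Suc n / real (Suc n))) {a..x}"
proof -
  define S where "S t = complex_of_real (integral {a..t} k)" for t
  have kc: "(\<lambda>t. complex_of_real (k t)) absolutely_integrable_on {a..b}"
    using absolutely_integrable_linear[OF k bounded_linear_of_real] by (simp add: o_def)
  have "AC_with a b S (\<lambda>t. complex_of_real (k t))"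
  proof (rule AC_with_cong[OF AC_with_indefinite[OF kc, of 0]])
    fix t assume t: "t \<in> {a..b}"
    have "k integrable_on {a..t}" using k t unfolding absolutely_integrable_on_def by (auto intro: integrable_on_subinterval)
    from integral_linear[OF this bounded_linear_of_real]
    show "0 + integral {a..t} (\<lambda>t. complex_of_real (k t)) = S t" by (simp add: S_def o_def)
  qed simp
  note P = AC_with_power[OF this ab, of n]
  have i: "(\<lambda>t. of_nat (Suc n) * S t ^ n * complex_of_real (k t)) integrable_on {a..x}"
    using P x unfolding AC_with_def absolutely_integrable_on_def by (auto intro: integrable_on_subinterval)
  have "S x ^ Suc n = S a ^ Suc n + integral {a..x} (\<lambda>t. of_nat (Suc n) * S t ^ n * complex_of_real (k t))"
    using P x unfolding AC_with_def by blast
  then have "((\<lambda>t. of_nat (Suc n) * S t ^ n * complex_of_real (k t)) has_integral S x ^ Suc n) {a..x}"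
    using integrable_integral[OF i] by (simp add: S_def)
  moreover have "of_nat (Suc n) * S t ^ n * complex_of_real (k t) = complex_of_real (real (Suc n) * (k t * integral {a..t} k ^ n))" for t
    unfolding S_def by simp
  moreover have "S x ^ Suc n = complex_of_real (integral {a..x} k ^ Suc n)" unfolding S_def by simp
  ultimately have "((\<lambda>t. complex_of_real (real (Suc n) * (k t * integral {a..t} k ^ n))) has_integral
      complex_of_real (integral {a..x} k ^ Suc n)) {a..x}" by (simp only:)
  from has_integral_Re[OF this]
  have "((\<lambda>t. real (Suc n) * (k t * integral {a..t} k ^ n)) has_integral (integral {a..x} k ^ Suc n)) {a..x}"
    by (simp only: Re_complex_of_real)
  from has_integral_mult_right[OF this, of "1 / real (Suc n)"] show ?thesis by (simp del: of_nat_Suc power_Suc)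
qed

text \<open>The supremum runs over intervals that start at \<open>s > 0\<close>, and measurability
  is given on the open half-line only. Monotone convergence carries the bound to intervals starting
  at 0, which is what makes 0 a regular endpoint.\<close>

lemma nonneg_uniformly_locally_integrable:
  fixes f :: "real \<Rightarrow> real"
  assumes f: "f \<in> borel_measurable (lebesgue_on {0<..})" and nn: "\<And>x. f x \<ge> 0"
    and sup: "(SUP s\<in>{0<..}. \<integral>\<^sup>+t\<in>{s..s+1}. ennreal (f t) \<partial>lebesgue) < \<infinity>"
  obtains K where "K \<ge> 0" "\<And>x. x \<ge> 0 \<Longrightarrow> f absolutely_integrable_on {x..x+1} \<and> integral {x..x+1} f \<le> K"
proof -
  define C where "C = (SUP s\<in>{0<..}. \<integral>\<^sup>+t\<in>{s..s+1}. ennreal (f t) \<partial>lebesgue)"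
  define f0 where "f0 t = (if t \<in> {0<..} then f t else 0)" for t :: real
  have f0m: "f0 \<in> borel_measurable lebesgue" unfolding f0_def by (rule borel_measurable_if_I[OF f]) simp
  have le: "(\<integral>\<^sup>+t. ennreal (f0 t) * indicator {x..x+1} t \<partial>lebesgue) \<le> C" if x: "x \<ge> 0" for x
  proof -
    \<comment> \<open>The lower ends \<open>max x (1 / (n + 1))\<close> are positive, so each of
      these integrals falls under the supremum with \<open>s\<close> equal to the lower end.\<close>
    define h where "h n t = ennreal (f0 t) * indicator {max x (1 / (real n + 1))..x+1} t" for n t
    have hm: "h n \<in> borel_measurable lebesgue" for n unfolding h_def
      by (intro borel_measurable_times_ennreal measurable_compose[OF f0m measurable_ennreal] borel_measurable_indicator) simp
    have "incseq h"
      unfolding incseq_def le_fun_def h_def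
    proof (intro allI impI mult_left_mono)
      fix m n :: nat and t :: real assume "m \<le> n"
      then have "1 / (real n + 1) \<le> 1 / (real m + 1)" by (intro divide_left_mono) auto
      then show "(indicator {max x (1 / (real m + 1))..x+1} t :: ennreal) \<le> indicator {max x (1 / (real n + 1))..x+1} t"
        by (auto simp: indicator_def)
    qed simp
    have "(\<integral>\<^sup>+t. ennreal (f0 t) * indicator {x..x+1} t \<partial>lebesgue) = (\<integral>\<^sup>+t. (SUP n. h n t) \<partial>lebesgue)"
    proof (rule nn_integral_cong)
      fix t :: real
      show "ennreal (f0 t) * indicator {x..x+1} t = (SUP n. h n t)"
      proof (rule antisym)
        show "(SUP n. h n t) \<le> ennreal (f0 t) * indicator {x..x+1} t"
          unfolding h_def by (intro SUP_least mult_left_mono) (auto simp: indicator_def)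
        show "ennreal (f0 t) * indicator {x..x+1} t \<le> (SUP n. h n t)"
        proof (cases "t > 0 \<and> t \<in> {x..x+1}")
          case True
          obtain n where "inverse (of_nat (Suc n)) < t" using reals_Archimedean[of t] True by blast
          then have "h n t = ennreal (f0 t) * indicator {x..x+1} t"
            using True by (auto simp: h_def indicator_def inverse_eq_divide add.commute)
          then show ?thesis by (metis SUP_upper UNIV_I)
        next
          case False
          then show ?thesis by (auto simp: f0_def indicator_def)
        qed
      qed
    qed
    also have "\<dots> = (SUP n. \<integral>\<^sup>+t. h n t \<partial>lebesgue)"
      by (rule nn_integral_monotone_convergence_SUP[OF \<open>incseq h\<close> hm])
    also have "\<dots> \<le> C"
    proof (rule SUP_least)
      fix n :: nat
      define s where "s = max x (1 / (real n + 1))"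
      have "1 / (real n + 1) > 0" by simp
      then have s: "s > 0" "s \<ge> x" by (auto simp: s_def less_max_iff_disj)
      have "(\<integral>\<^sup>+t. h n t \<partial>lebesgue) \<le> (\<integral>\<^sup>+t\<in>{s..s+1}. ennreal (f t) \<partial>lebesgue)"
        using s by (intro nn_integral_mono) (auto simp: h_def indicator_def f0_def s_def[symmetric])
      also have "\<dots> \<le> C" unfolding C_def using s by (intro SUP_upper) simp
      finally show "(\<integral>\<^sup>+t. h n t \<partial>lebesgue) \<le> C" .
    qed
    finally show ?thesis .
  qed
  show thesis
  proof (rule that[of "enn2real C"])
    fix x :: real assume x: "x \<ge> 0"
    define r where "r = enn2real (\<integral>\<^sup>+t. ennreal (f0 t) * indicator {x..x+1} t \<partial>lebesgue)"
    have fin: "(\<integral>\<^sup>+t. ennreal (f0 t) * indicator {x..x+1} t \<partial>lebesgue) < \<infinity>"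
      using le[OF x] sup unfolding C_def by (rule le_less_trans)
    have "((\<lambda>t. f0 t * indicator {x..x+1} t) has_integral r) UNIV"
    proof (subst has_integral_iff_nn_integral_lebesgue)
      show "0 \<le> f0 t * indicator {x..x+1} t" for t using nn by (simp add: f0_def)
      have "(\<integral>\<^sup>+t. ennreal (f0 t * indicator {x..x+1} t) \<partial>lebesgue) = (\<integral>\<^sup>+t. ennreal (f0 t) * indicator {x..x+1} t \<partial>lebesgue)"
        by (intro nn_integral_cong) (auto simp: indicator_def)
      also have "\<dots> = ennreal r" unfolding r_def using fin by simp
      finally show "(\<lambda>t. f0 t * indicator {x..x+1} t) \<in> borel_measurable lebesgue \<and>
        (\<integral>\<^sup>+t. ennreal (f0 t * indicator {x..x+1} t) \<partial>lebesgue) = ennreal r \<and> 0 \<le> r"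
        by (auto simp: r_def intro!: borel_measurable_times f0m borel_measurable_indicator)
    qed
    then have "((\<lambda>t. if t \<in> {x..x+1} then f0 t else 0) has_integral r) UNIV"
      by (rule has_integral_eq[rotated]) (auto simp: indicator_def)
    then have "(f0 has_integral r) {x..x+1}" by (subst (asm) has_integral_restrict_UNIV)
    then have I: "(f has_integral r) {x..x+1}"
      by (rule has_integral_spike[of "{0}", rotated 2]) (use x in \<open>auto simp: f0_def\<close>)
    have "r \<le> enn2real C" unfolding r_def using le[OF x] sup unfolding C_def by (intro enn2real_mono) auto
    then show "f absolutely_integrable_on {x..x+1} \<and> integral {x..x+1} f \<le> enn2real C"
      using I nn integral_unique[OF I] by (auto intro!: nonnegative_absolutely_integrable_1)
  qed simp
qed

lemma absolutely_integrable_half_line: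
  fixes f :: "real \<Rightarrow> real"
  assumes "\<And>x. x \<ge> 0 \<Longrightarrow> f absolutely_integrable_on {x..x+1}" "0 \<le> x"
  shows "f absolutely_integrable_on {x..y}"
proof -
  have *: "f absolutely_integrable_on {0..real n}" for n
  proof (induction n)
    case 0
    have "f absolutely_integrable_on cbox 0 (real 0)" by (rule absolutely_integrable_on_null) simp
    then show ?case by simp
  next
    case (Suc n)
    have "f absolutely_integrable_on {real n..real (Suc n)}" using assms(1)[of "real n"] by (simp add: add.commute)
    from absolutely_integrable_on_combine[OF Suc this] show ?case by simp
  qed
  obtain n :: nat where "y \<le> real n" using real_arch_simple by blast
  then show ?thesis using absolutely_integrable_on_subinterval[OF *[of n], of x y] assms(2) by auto
qed

text \<open>The first-order system \<open>p' = -\<sigma> p + (\<tau> - \<sigma>\<^sup>2 - z) q\<close>, \<open>q' = p + \<sigma> q\<close> for \<open>p = u\<^sup>[\<^sup>1\<^sup>]\<close> and \<open>q = u\<close>.\<close>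

definition sys_on :: "(real \<Rightarrow> real) \<Rightarrow> (real \<Rightarrow> real) \<Rightarrow> complex \<Rightarrow> real \<Rightarrow> real \<Rightarrow> (real \<Rightarrow> complex) \<Rightarrow> (real \<Rightarrow> complex) \<Rightarrow> bool" where
  "sys_on \<sigma> \<tau> z a b p q \<longleftrightarrow>
     AC_with a b p (\<lambda>t. - of_real (\<sigma> t) * p t + (of_real (\<tau> t - (\<sigma> t)\<^sup>2) - z) * q t) \<and>
     AC_with a b q (\<lambda>t. p t + of_real (\<sigma> t) * q t)"

lemma sys_on_subset: "sys_on \<sigma> \<tau> z a b p q \<Longrightarrow> a \<le> c \<Longrightarrow> d \<le> b \<Longrightarrow> sys_on \<sigma> \<tau> z c d p q"
  unfolding sys_on_def by (auto intro: AC_with_subset)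

lemma sys_on_combination:
  assumes "sys_on \<sigma> \<tau> z a b p q" "sys_on \<sigma> \<tau> z a b p' q'"
  shows "sys_on \<sigma> \<tau> z a b (\<lambda>x. c * p x + d * p' x) (\<lambda>x. c * q x + d * q' x)"
proof -
  note A = assms[unfolded sys_on_def]
  have "AC_with a b (\<lambda>x. c * p x + d * p' x) (\<lambda>t. - of_real (\<sigma> t) * (c * p t + d * p' t)
      + (of_real (\<tau> t - (\<sigma> t)\<^sup>2) - z) * (c * q t + d * q' t))"
    by (rule AC_with_cong[OF AC_with_add[OF AC_with_cmult[OF conjunct1[OF A(1)], of c] AC_with_cmult[OF conjunct1[OF A(2)], of d]]])
       (simp_all add: algebra_simps)
  moreover have "AC_with a b (\<lambda>x. c * q x + d * q' x) (\<lambda>t. (c * p t + d * p' t) + of_real (\<sigma> t) * (c * q t + d * q' t))"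
    by (rule AC_with_cong[OF AC_with_add[OF AC_with_cmult[OF conjunct2[OF A(1)], of c] AC_with_cmult[OF conjunct2[OF A(2)], of d]]])
       (simp_all add: algebra_simps)
  ultimately show ?thesis unfolding sys_on_def by blast
qed

text \<open>The coefficient matrix has trace zero, so the density of the determinant vanishes
  identically.\<close>

lemma sys_on_wronskian:
  assumes s: "sys_on \<sigma> \<tau> z a b p q" "sys_on \<sigma> \<tau> z a b p' q'" and x: "x \<in> {a..b}"
  shows "p x * q' x - q x * p' x = p a * q' a - q a * p' a"
proof -
  have ab: "a \<le> b" using x by simp
  note A = s[unfolded sys_on_def]
  note W = AC_with_diff'[OF AC_with_mult[OF conjunct1[OF A(1)] conjunct2[OF A(2)] ab] AC_with_mult[OF conjunct2[OF A(1)] conjunct1[OF A(2)] ab]]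
  from AC_with_zero_const[OF W _ x] show ?thesis by (simp add: algebra_simps)
qed

text \<open>In the density \<open>g\<close> of \<open>p * cnj q\<close> the two terms with
  \<open>\<sigma> * p * cnj q\<close> cancel, and what remains is real except for
  \<open>- z * |q|^2\<close>. The quantity \<open>Im (p * cnj q)\<close> is called flux below; this
  identity is the source of the positivity of \<open>Im m\<close> and of the Green
  functions.\<close>

lemma sys_on_energy:
  assumes s: "sys_on \<sigma> \<tau> z a b p q" and x: "x \<in> {a..b}"
  shows "Im (p x * cnj (q x)) = Im (p a * cnj (q a)) - Im z * integral {a..x} (\<lambda>t. (norm (q t))\<^sup>2)"
proof -
  have ab: "a \<le> b" using x by simp
  define g where "g t = p t * cnj (p t + of_real (\<sigma> t) * q t)
      + (- of_real (\<sigma> t) * p t + (of_real (\<tau> t - (\<sigma> t)\<^sup>2) - z) * q t) * cnj (q t)" for t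
  have A: "AC_with a b (\<lambda>x. p x * cnj (q x)) g"
    unfolding g_def using AC_with_mult[OF conjunct1[OF s[unfolded sys_on_def]] AC_with_cnj[OF conjunct2[OF s[unfolded sys_on_def]]] ab] .
  have Img: "Im (g t) = - Im z * (norm (q t))\<^sup>2" for t
    unfolding g_def cmod_power2 by (simp add: algebra_simps power2_eq_square)
  have i: "g integrable_on {a..x}"
    using A x unfolding AC_with_def absolutely_integrable_on_def by (auto intro: integrable_on_subinterval)
  have "p x * cnj (q x) = p a * cnj (q a) + integral {a..x} g" using A x unfolding AC_with_def by blast
  then have "Im (p x * cnj (q x)) = Im (p a * cnj (q a)) + Im (integral {a..x} g)" by (simp only: plus_complex.simps)
  also have "Im (integral {a..x} g) = integral {a..x} (\<lambda>t. Im (g t))"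
    using integral_linear[OF i bounded_linear_Im] by (simp add: o_def)
  finally show ?thesis unfolding Img by simp
qed

text \<open>Polynomials in \<open>z\<close> with coefficients continuous in \<open>x\<close>. Picard
  iterates have this shape, and it yields holomorphy in \<open>z\<close> without differentiation
  under an integral. Coefficients vanish beyond \<open>N\<close> so that two such sums can be
  brought to a common degree.\<close>

definition zpoly :: "real \<Rightarrow> (complex \<Rightarrow> real \<Rightarrow> complex) \<Rightarrow> bool" where
  "zpoly X f \<longleftrightarrow> (\<exists>N a. (\<forall>k. continuous_on {0..X} (a k)) \<and> (\<forall>k>N. a k = (\<lambda>_. 0)) \<and>
     (\<forall>z. \<forall>x\<in>{0..X}. f z x = (\<Sum>k\<le>N. a k x * z ^ k)))"

lemma zpolyE:
  assumes "zpoly X f"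
  obtains N a where "\<And>k. continuous_on {0..X} (a k)" "\<And>k. k > N \<Longrightarrow> a k = (\<lambda>_. 0)"
    "\<And>M z x. M \<ge> N \<Longrightarrow> x \<in> {0..X} \<Longrightarrow> f z x = (\<Sum>k\<le>M. a k x * z ^ k)"
proof -
  obtain N a where a: "\<And>k. continuous_on {0..X} (a k)" "\<And>k. k > N \<Longrightarrow> a k = (\<lambda>_. 0)"
    "\<And>z x. x \<in> {0..X} \<Longrightarrow> f z x = (\<Sum>k\<le>N. a k x * z ^ k)" using assms unfolding zpoly_def by blast
  show thesis
  proof (rule that[of a N])
    fix M :: nat and z x assume M: "M \<ge> N" and x: "x \<in> {0..X}"
    have "(\<Sum>k\<le>N. a k x * z ^ k) = (\<Sum>k\<le>M. a k x * z ^ k)"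
      using M a(2) by (intro sum.mono_neutral_left) auto
    then show "f z x = (\<Sum>k\<le>M. a k x * z ^ k)" using a(3)[OF x] by simp
  qed (use a in auto)
qed

lemma zpoly_cong:
  assumes "zpoly X f" "\<And>z x. x \<in> {0..X} \<Longrightarrow> g z x = f z x" shows "zpoly X g"
proof -
  obtain N a where a: "\<forall>k. continuous_on {0..X} (a k)" "\<forall>k>N. a k = (\<lambda>_. 0)"
    "\<forall>z. \<forall>x\<in>{0..X}. f z x = (\<Sum>k\<le>N. a k x * z ^ k)" using assms(1) unfolding zpoly_def by blast
  have "\<forall>z. \<forall>x\<in>{0..X}. g z x = (\<Sum>k\<le>N. a k x * z ^ k)"
  proof (intro allI ballI)
    fix z x assume x: "x \<in> {0..X}"
    show "g z x = (\<Sum>k\<le>N. a k x * z ^ k)" using a(3) assms(2)[OF x] x by metis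
  qed
  then show ?thesis unfolding zpoly_def using a(1,2) by blast
qed

lemma zpoly_const: "zpoly X (\<lambda>z x. c)"
  unfolding zpoly_def
  by (rule exI[of _ 0], rule exI[of _ "\<lambda>k x. if k = 0 then c else 0"]) auto

lemma zpoly_add: "zpoly X f \<Longrightarrow> zpoly X g \<Longrightarrow> zpoly X (\<lambda>z x. f z x + g z x)"
proof -
  assume "zpoly X f" "zpoly X g"
  obtain N a where a: "\<And>k. continuous_on {0..X} (a k)" "\<And>k. k > N \<Longrightarrow> a k = (\<lambda>_. 0)"
    "\<And>M z x. M \<ge> N \<Longrightarrow> x \<in> {0..X} \<Longrightarrow> f z x = (\<Sum>k\<le>M. a k x * z ^ k)" by (rule zpolyE[OF \<open>zpoly X f\<close>]) (rule that; assumption)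
  obtain L b where b: "\<And>k. continuous_on {0..X} (b k)" "\<And>k. k > L \<Longrightarrow> b k = (\<lambda>_. 0)"
    "\<And>M z x. M \<ge> L \<Longrightarrow> x \<in> {0..X} \<Longrightarrow> g z x = (\<Sum>k\<le>M. b k x * z ^ k)" by (rule zpolyE[OF \<open>zpoly X g\<close>]) (rule that; assumption)
  show ?thesis unfolding zpoly_def
  proof (rule exI[of _ "max N L"], rule exI[of _ "\<lambda>k x. a k x + b k x"], intro conjI allI ballI impI)
    show "continuous_on {0..X} (\<lambda>x. a k x + b k x)" for k by (intro continuous_intros a b)
    show "(\<lambda>x. a k x + b k x) = (\<lambda>_. 0)" if "k > max N L" for k using a(2)[of k] b(2)[of k] that by simp
    show "f z x + g z x = (\<Sum>k\<le>max N L. (a k x + b k x) * z ^ k)" if "x \<in> {0..X}" for z x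
      using a(3)[of "max N L" x z] b(3)[of "max N L" x z] that by (simp add: sum.distrib algebra_simps)
  qed
qed

lemma zpoly_mult_z: "zpoly X f \<Longrightarrow> zpoly X (\<lambda>z x. z * f z x)"
proof -
  assume "zpoly X f"
  obtain N a where a: "\<And>k. continuous_on {0..X} (a k)" "\<And>k. k > N \<Longrightarrow> a k = (\<lambda>_. 0)"
    "\<And>M z x. M \<ge> N \<Longrightarrow> x \<in> {0..X} \<Longrightarrow> f z x = (\<Sum>k\<le>M. a k x * z ^ k)" by (rule zpolyE[OF \<open>zpoly X f\<close>]) (rule that; assumption)
  define b where "b k = (case k of 0 \<Rightarrow> (\<lambda>_. 0) | Suc k \<Rightarrow> a k)" for k
  show ?thesis unfolding zpoly_def
  proof (rule exI[of _ "Suc N"], rule exI[of _ b], intro conjI allI ballI impI)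
    show "continuous_on {0..X} (b k)" for k using a(1) by (cases k) (auto simp: b_def)
    show "b k = (\<lambda>_. 0)" if "k > Suc N" for k using a(2) that by (cases k) (auto simp: b_def)
    show "z * f z x = (\<Sum>k\<le>Suc N. b k x * z ^ k)" if "x \<in> {0..X}" for z x
      unfolding sum.atMost_Suc_shift using a(3)[of N x z] that
      by (simp add: b_def sum_distrib_left algebra_simps)
  qed
qed

lemma zpoly_continuous: "zpoly X f \<Longrightarrow> continuous_on {0..X} (f z)"
proof -
  assume "zpoly X f"
  obtain N a where a: "\<And>k. continuous_on {0..X} (a k)" "\<And>k. k > N \<Longrightarrow> a k = (\<lambda>_. 0)"
    "\<And>M z x. M \<ge> N \<Longrightarrow> x \<in> {0..X} \<Longrightarrow> f z x = (\<Sum>k\<le>M. a k x * z ^ k)" by (rule zpolyE[OF \<open>zpoly X f\<close>]) (rule that; assumption)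
  have "continuous_on {0..X} (\<lambda>x. \<Sum>k\<le>N. a k x * z ^ k)" by (intro continuous_intros a)
  then show ?thesis by (rule continuous_on_eq) (use a(3)[of N _ z] in simp)
qed

lemma zpoly_holomorphic: "zpoly X f \<Longrightarrow> x \<in> {0..X} \<Longrightarrow> (\<lambda>z. f z x) holomorphic_on A"
proof -
  assume "zpoly X f" and x: "x \<in> {0..X}"
  obtain N a where a: "\<And>k. continuous_on {0..X} (a k)" "\<And>k. k > N \<Longrightarrow> a k = (\<lambda>_. 0)"
    "\<And>M z x. M \<ge> N \<Longrightarrow> x \<in> {0..X} \<Longrightarrow> f z x = (\<Sum>k\<le>M. a k x * z ^ k)" by (rule zpolyE[OF \<open>zpoly X f\<close>]) (rule that; assumption)
  have "(\<lambda>z. f z x) = (\<lambda>z. \<Sum>k\<le>N. a k x * z ^ k)" using a(3)[of N x] x by auto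
  then show ?thesis by (auto intro!: holomorphic_intros)
qed

lemma zpoly_integral:
  assumes f: "zpoly X f" and g: "g absolutely_integrable_on {0..X}"
  shows "zpoly X (\<lambda>z x. integral {0..x} (\<lambda>t. g t * f z t))"
proof -
  obtain N a where a: "\<And>k. continuous_on {0..X} (a k)" "\<And>k. k > N \<Longrightarrow> a k = (\<lambda>_. 0)"
    "\<And>M z x. M \<ge> N \<Longrightarrow> x \<in> {0..X} \<Longrightarrow> f z x = (\<Sum>k\<le>M. a k x * z ^ k)" by (rule zpolyE[OF f]) (rule that; assumption)
  have i: "(\<lambda>t. a k t * g t) integrable_on {0..x}" if "x \<in> {0..X}" for k x
    using absolutely_integrable_mult_continuous[OF a(1) g, of k] that
    unfolding absolutely_integrable_on_def by (auto intro: integrable_on_subinterval)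
  show ?thesis unfolding zpoly_def
  proof (rule exI[of _ N], rule exI[of _ "\<lambda>k x. integral {0..x} (\<lambda>t. a k t * g t)"], intro conjI allI ballI impI)
    show "continuous_on {0..X} (\<lambda>x. integral {0..x} (\<lambda>t. a k t * g t))" for k
      using i[of X k] by (cases "X \<ge> 0") (auto intro!: indefinite_integral_continuous_1)
    show "(\<lambda>x. integral {0..x} (\<lambda>t. a k t * g t)) = (\<lambda>_. 0)" if "k > N" for k using a(2)[OF that] by simp
    fix z x assume x: "x \<in> {0..X}"
    have "integral {0..x} (\<lambda>t. g t * f z t) = integral {0..x} (\<lambda>t. \<Sum>k\<le>N. (a k t * g t) * z ^ k)"
      using a(3)[of N _ z] x by (intro Henstock_Kurzweil_Integration.integral_cong) (auto simp: sum_distrib_left algebra_simps)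
    also have "\<dots> = (\<Sum>k\<le>N. integral {0..x} (\<lambda>t. (a k t * g t) * z ^ k))"
      using i[OF x] by (intro integral_sum integrable_on_mult_left) auto
    also have "\<dots> = (\<Sum>k\<le>N. integral {0..x} (\<lambda>t. a k t * g t) * z ^ k)" by simp
    finally show "integral {0..x} (\<lambda>t. g t * f z t) = (\<Sum>k\<le>N. integral {0..x} (\<lambda>t. a k t * g t) * z ^ k)" .
  qed
qed

lemma absolutely_integrable_dominated_half_line:
  fixes f g :: "real \<Rightarrow> real"
  assumes f: "f \<in> borel_measurable (lebesgue_on {0<..})" and g: "g absolutely_integrable_on {x..y}"
    and le: "\<And>t. \<bar>f t\<bar> \<le> g t" and x: "0 \<le> x"
  shows "f absolutely_integrable_on {x..y}"
proof -
  define f0 where "f0 t = (if t \<in> {0<..} then f t else 0)" for t :: real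
  have f0m: "f0 \<in> borel_measurable lebesgue" unfolding f0_def by (rule borel_measurable_if_I[OF f]) simp
  have "f0 absolutely_integrable_on {x..y}"
  proof (rule measurable_bounded_by_integrable_imp_absolutely_integrable)
    show "f0 \<in> borel_measurable (lebesgue_on {x..y})" using f0m by (rule measurable_restrict_space1)
    show "g integrable_on {x..y}" using g by (simp add: absolutely_integrable_on_def)
    show "norm (f0 t) \<le> g t" for t using le[of t] by (auto simp: f0_def)
  qed simp
  then show ?thesis
    by (rule absolutely_integrable_spike[where S = "{0}"]) (use x in \<open>auto simp: f0_def\<close>)
qed

section \<open>Coefficient bounds and Picard iteration\<close>

locale sl_coeffs =
  fixes \<sigma> \<tau> :: "real \<Rightarrow> real"
  assumes \<sigma>_meas: "\<sigma> \<in> borel_measurable (lebesgue_on {0<..})"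
    and \<tau>_meas: "\<tau> \<in> borel_measurable (lebesgue_on {0<..})"
    and \<sigma>_bdd: "(SUP s\<in>{0<..}. \<integral>\<^sup>+t\<in>{s..s+1}. ennreal ((\<sigma> t)\<^sup>2) \<partial>lebesgue) < \<infinity>"
    and \<tau>_bdd: "(SUP s\<in>{0<..}. \<integral>\<^sup>+t\<in>{s..s+1}. ennreal \<bar>\<tau> t\<bar> \<partial>lebesgue) < \<infinity>"
begin

text \<open>One majorant for all coefficients and, in the sum norm, for the coefficient matrix at
  \<open>z = 0\<close>; the constants leave room for
  \<open>2 * |\<sigma>| \<le> 1 + \<sigma>^2\<close>.\<close>

definition \<kappa> :: "real \<Rightarrow> real" where "\<kappa> t = 2 + 2 * (\<sigma> t)\<^sup>2 + \<bar>\<tau> t\<bar>"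

lemma \<kappa>_ge: "\<kappa> t \<ge> 2" by (simp add: \<kappa>_def)

lemma \<kappa>_bounds: "\<bar>\<sigma> t\<bar> \<le> \<kappa> t" "\<bar>\<tau> t - (\<sigma> t)\<^sup>2\<bar> \<le> \<kappa> t" "(\<sigma> t)\<^sup>2 \<le> \<kappa> t"
    "1 + \<bar>\<sigma> t\<bar> + \<bar>\<tau> t - (\<sigma> t)\<^sup>2\<bar> \<le> \<kappa> t"
proof -
  have "0 \<le> (\<bar>\<sigma> t\<bar> - 1)\<^sup>2" by simp
  then have s: "2 * \<bar>\<sigma> t\<bar> \<le> 1 + (\<sigma> t)\<^sup>2" by (simp add: power2_diff)
  have v: "\<bar>\<tau> t - (\<sigma> t)\<^sup>2\<bar> \<le> \<bar>\<tau> t\<bar> + (\<sigma> t)\<^sup>2" using abs_triangle_ineq4[of "\<tau> t" "(\<sigma> t)\<^sup>2"] by simp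
  have nn: "0 \<le> (\<sigma> t)\<^sup>2" "0 \<le> \<bar>\<sigma> t\<bar>" "0 \<le> \<bar>\<tau> t\<bar>" by auto
  show "\<bar>\<sigma> t\<bar> \<le> \<kappa> t" "\<bar>\<tau> t - (\<sigma> t)\<^sup>2\<bar> \<le> \<kappa> t" "(\<sigma> t)\<^sup>2 \<le> \<kappa> t" "1 + \<bar>\<sigma> t\<bar> + \<bar>\<tau> t - (\<sigma> t)\<^sup>2\<bar> \<le> \<kappa> t"
    unfolding \<kappa>_def using s v nn by linarith+
qed

lemma \<kappa>_unif:
  obtains K where "K \<ge> 0" "\<And>x. x \<ge> 0 \<Longrightarrow> \<kappa> absolutely_integrable_on {x..x+1} \<and> integral {x..x+1} \<kappa> \<le> K"
proof -
  have "(\<lambda>t. (\<sigma> t)\<^sup>2) \<in> borel_measurable (lebesgue_on {0<..})" using \<sigma>_meas by (rule borel_measurable_power)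
  from nonneg_uniformly_locally_integrable[OF this _ \<sigma>_bdd]
  obtain K1 where K1: "K1 \<ge> 0" "\<And>x. x \<ge> 0 \<Longrightarrow> (\<lambda>t. (\<sigma> t)\<^sup>2) absolutely_integrable_on {x..x+1} \<and> integral {x..x+1} (\<lambda>t. (\<sigma> t)\<^sup>2) \<le> K1"
    by (metis zero_le_power2)
  have "(\<lambda>t. \<bar>\<tau> t\<bar>) \<in> borel_measurable (lebesgue_on {0<..})" using \<tau>_meas by (rule borel_measurable_abs)
  from nonneg_uniformly_locally_integrable[OF this _ \<tau>_bdd]
  obtain K2 where K2: "K2 \<ge> 0" "\<And>x. x \<ge> 0 \<Longrightarrow> (\<lambda>t. \<bar>\<tau> t\<bar>) absolutely_integrable_on {x..x+1} \<and> integral {x..x+1} (\<lambda>t. \<bar>\<tau> t\<bar>) \<le> K2"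
    by (metis abs_ge_zero)
  show thesis
  proof (rule that[of "2 + 2 * K1 + K2"])
    fix x :: real assume x: "x \<ge> 0"
    have c: "(\<lambda>t. 2 :: real) absolutely_integrable_on {x..x+1}" by (intro absolutely_integrable_continuous_real continuous_intros)
    have s: "(\<lambda>t. 2 * (\<sigma> t)\<^sup>2) absolutely_integrable_on {x..x+1}" using K1(2)[OF x] by (intro set_integrable_mult_right) auto
    have t: "(\<lambda>t. \<bar>\<tau> t\<bar>) absolutely_integrable_on {x..x+1}" using K2(2)[OF x] by auto
    have "(\<lambda>t. (2 + 2 * (\<sigma> t)\<^sup>2) + \<bar>\<tau> t\<bar>) absolutely_integrable_on {x..x+1}"
      by (intro set_integral_add(1) c s t)
    then have "\<kappa> absolutely_integrable_on {x..x+1}" by (simp add: \<kappa>_def[abs_def])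
    moreover have "integral {x..x+1} \<kappa> = 2 + 2 * integral {x..x+1} (\<lambda>t. (\<sigma> t)\<^sup>2) + integral {x..x+1} (\<lambda>t. \<bar>\<tau> t\<bar>)"
      unfolding \<kappa>_def[abs_def] using c s t by (simp add: integral_add absolutely_integrable_on_def integrable_add)
    ultimately show "\<kappa> absolutely_integrable_on {x..x+1} \<and> integral {x..x+1} \<kappa> \<le> 2 + 2 * K1 + K2"
      using K1(2)[OF x] K2(2)[OF x] by auto
  qed (use K1(1) K2(1) in auto)
qed

lemma \<kappa>_int: "0 \<le> x \<Longrightarrow> \<kappa> absolutely_integrable_on {x..y}"
  using \<kappa>_unif by (metis absolutely_integrable_half_line)

lemma coeff_int:
  assumes x: "0 \<le> x"
  shows "(\<lambda>t. complex_of_real (\<sigma> t)) absolutely_integrable_on {x..y}"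
    "(\<lambda>t. complex_of_real (\<tau> t - (\<sigma> t)\<^sup>2)) absolutely_integrable_on {x..y}"
    "\<sigma> absolutely_integrable_on {x..y}"
proof -
  show 1: "\<sigma> absolutely_integrable_on {x..y}"
    by (rule absolutely_integrable_dominated_half_line[OF \<sigma>_meas \<kappa>_int[OF x] \<kappa>_bounds(1) x])
  have "(\<lambda>t. \<tau> t - (\<sigma> t)\<^sup>2) \<in> borel_measurable (lebesgue_on {0<..})"
    using \<sigma>_meas \<tau>_meas by (intro borel_measurable_diff borel_measurable_power)
  from absolutely_integrable_dominated_half_line[OF this \<kappa>_int[OF x] \<kappa>_bounds(2) x]
  have 2: "(\<lambda>t. \<tau> t - (\<sigma> t)\<^sup>2) absolutely_integrable_on {x..y}" .
  show "(\<lambda>t. complex_of_real (\<sigma> t)) absolutely_integrable_on {x..y}"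
    "(\<lambda>t. complex_of_real (\<tau> t - (\<sigma> t)\<^sup>2)) absolutely_integrable_on {x..y}"
    using absolutely_integrable_linear[OF 1 bounded_linear_of_real] absolutely_integrable_linear[OF 2 bounded_linear_of_real]
    by (simp_all add: o_def)
qed

definition rhs1 :: "complex \<Rightarrow> (real \<Rightarrow> complex) \<Rightarrow> (real \<Rightarrow> complex) \<Rightarrow> real \<Rightarrow> complex" where
  "rhs1 z p q t = - of_real (\<sigma> t) * p t + (of_real (\<tau> t - (\<sigma> t)\<^sup>2) - z) * q t"
definition rhs2 :: "(real \<Rightarrow> complex) \<Rightarrow> (real \<Rightarrow> complex) \<Rightarrow> real \<Rightarrow> complex" where
  "rhs2 p q t = p t + of_real (\<sigma> t) * q t"

lemma rhs_int:
  assumes x: "0 \<le> x" and c: "continuous_on {x..y} p" "continuous_on {x..y} q"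
  shows "rhs1 z p q absolutely_integrable_on {x..y}" "rhs2 p q absolutely_integrable_on {x..y}"
proof -
  have "(\<lambda>t. - p t * of_real (\<sigma> t) + (q t * of_real (\<tau> t - (\<sigma> t)\<^sup>2) - z * q t)) absolutely_integrable_on {x..y}"
    using c x by (intro set_integral_add set_integral_diff absolutely_integrable_mult_continuous coeff_int
      absolutely_integrable_continuous_real continuous_intros)
  then show "rhs1 z p q absolutely_integrable_on {x..y}"
    by (rule set_integrable_cong[THEN iffD1, rotated -1]) (auto simp: rhs1_def algebra_simps)
  have "(\<lambda>t. p t + q t * of_real (\<sigma> t)) absolutely_integrable_on {x..y}"
    using c x by (intro set_integral_add absolutely_integrable_mult_continuous coeff_int absolutely_integrable_continuous_real)
  then show "rhs2 p q absolutely_integrable_on {x..y}"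
    by (rule set_integrable_cong[THEN iffD1, rotated -1]) (auto simp: rhs2_def algebra_simps)
qed

lemma rhs_norm: "norm (rhs1 z p q t) + norm (rhs2 p q t) \<le> (\<kappa> t + norm z) * (norm (p t) + norm (q t))"
proof -
  have "norm (rhs1 z p q t) \<le> \<bar>\<sigma> t\<bar> * norm (p t) + (\<bar>\<tau> t - (\<sigma> t)\<^sup>2\<bar> + norm z) * norm (q t)"
  proof -
    have "norm (rhs1 z p q t) \<le> norm (- of_real (\<sigma> t) * p t) + norm ((of_real (\<tau> t - (\<sigma> t)\<^sup>2) - z) * q t)"
      unfolding rhs1_def by (rule norm_triangle_ineq)
    moreover have "norm (of_real (\<tau> t - (\<sigma> t)\<^sup>2) - z) \<le> \<bar>\<tau> t - (\<sigma> t)\<^sup>2\<bar> + norm z"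
      using norm_triangle_ineq4[of "of_real (\<tau> t - (\<sigma> t)\<^sup>2)" z] unfolding norm_of_real .
    then have "norm ((of_real (\<tau> t - (\<sigma> t)\<^sup>2) - z) * q t) \<le> (\<bar>\<tau> t - (\<sigma> t)\<^sup>2\<bar> + norm z) * norm (q t)"
      unfolding norm_mult by (rule mult_right_mono) simp
    ultimately show ?thesis by (simp add: norm_mult)
  qed
  moreover have "norm (rhs2 p q t) \<le> norm (p t) + \<bar>\<sigma> t\<bar> * norm (q t)"
    unfolding rhs2_def using norm_triangle_ineq[of "p t" "of_real (\<sigma> t) * q t"] by (simp add: norm_mult)
  moreover have "\<bar>\<sigma> t\<bar> * norm (p t) + (\<bar>\<tau> t - (\<sigma> t)\<^sup>2\<bar> + norm z) * norm (q t) + (norm (p t) + \<bar>\<sigma> t\<bar> * norm (q t))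
     \<le> (\<kappa> t + norm z) * (norm (p t) + norm (q t))"
  proof -
    have "(\<bar>\<sigma> t\<bar> + 1) * norm (p t) \<le> (\<kappa> t + norm z) * norm (p t)"
      using \<kappa>_bounds(4)[of t] abs_ge_zero[of "\<tau> t - (\<sigma> t)\<^sup>2"] norm_ge_zero[of z]
      by (intro mult_right_mono norm_ge_zero) linarith
    moreover have "(\<bar>\<tau> t - (\<sigma> t)\<^sup>2\<bar> + norm z + \<bar>\<sigma> t\<bar>) * norm (q t) \<le> (\<kappa> t + norm z) * norm (q t)"
      using \<kappa>_bounds(4)[of t] by (intro mult_right_mono norm_ge_zero) linarith
    ultimately show ?thesis by (simp add: algebra_simps)
  qed
  ultimately show ?thesis by linarith
qed

lemma rhs_integral_norm:
  assumes x: "0 \<le> x" and c: "continuous_on {0..x} p" "continuous_on {0..x} q"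
    and w: "\<And>t. t \<in> {0..x} \<Longrightarrow> norm (p t) + norm (q t) \<le> w t"
    and i: "(\<lambda>t. (\<kappa> t + norm z) * w t) integrable_on {0..x}"
  shows "norm (integral {0..x} (rhs1 z p q)) + norm (integral {0..x} (rhs2 p q)) \<le> integral {0..x} (\<lambda>t. (\<kappa> t + norm z) * w t)"
proof -
  note r = rhs_int(1)[OF order_refl c, of z] rhs_int(2)[OF order_refl c]
  have b: "rhs1 z p q integrable_on {0..x}" "rhs2 p q integrable_on {0..x}"
    and a: "(\<lambda>t. norm (rhs1 z p q t)) integrable_on {0..x}" "(\<lambda>t. norm (rhs2 p q t)) integrable_on {0..x}"
    using r unfolding absolutely_integrable_on_def by blast+
  have "norm (integral {0..x} (rhs1 z p q)) \<le> integral {0..x} (\<lambda>t. norm (rhs1 z p q t))"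
    by (rule integral_norm_bound_integral) (use a b in auto)
  moreover have "norm (integral {0..x} (rhs2 p q)) \<le> integral {0..x} (\<lambda>t. norm (rhs2 p q t))"
    by (rule integral_norm_bound_integral) (use a b in auto)
  moreover have "integral {0..x} (\<lambda>t. norm (rhs1 z p q t)) + integral {0..x} (\<lambda>t. norm (rhs2 p q t))
     = integral {0..x} (\<lambda>t. norm (rhs1 z p q t) + norm (rhs2 p q t))"
    by (rule integral_add[symmetric]) (use a in auto)
  moreover have "\<dots> \<le> integral {0..x} (\<lambda>t. (\<kappa> t + norm z) * w t)"
  proof (rule integral_le[OF integrable_add i])
    fix t assume t: "t \<in> {0..x}"
    have "(\<kappa> t + norm z) * (norm (p t) + norm (q t)) \<le> (\<kappa> t + norm z) * w t"
      using w[OF t] \<kappa>_ge[of t] norm_ge_zero[of z] by (intro mult_left_mono) linarith+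
    then show "norm (rhs1 z p q t) + norm (rhs2 p q t) \<le> (\<kappa> t + norm z) * w t" using rhs_norm[of z p q t] by linarith
  qed (use a in auto)
  ultimately show ?thesis by linarith
qed

text \<open>Picard iterates for the initial values \<open>c1\<close> of the quasi-derivative and
  \<open>c2\<close> of the function at 0.\<close>

primrec pic :: "complex \<Rightarrow> complex \<Rightarrow> complex \<Rightarrow> nat \<Rightarrow> (real \<Rightarrow> complex) \<times> (real \<Rightarrow> complex)" where
  "pic c1 c2 z 0 = ((\<lambda>x. c1), (\<lambda>x. c2))"
| "pic c1 c2 z (Suc n) = ((\<lambda>x. c1 + integral {0..x} (rhs1 z (fst (pic c1 c2 z n)) (snd (pic c1 c2 z n)))),
     (\<lambda>x. c2 + integral {0..x} (rhs2 (fst (pic c1 c2 z n)) (snd (pic c1 c2 z n)))))"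

text \<open>The system is affine in \<open>z\<close>, so one iteration multiplies by
  \<open>z\<close> at most once; the right-hand side is split accordingly.\<close>

lemma pic_zpoly: "zpoly X (\<lambda>z. fst (pic c1 c2 z n)) \<and> zpoly X (\<lambda>z. snd (pic c1 c2 z n))"
proof (induction n)
  case 0 show ?case by (simp add: zpoly_const)
next
  case (Suc n)
  define p where "p z = fst (pic c1 c2 z n)" for z
  define q where "q z = snd (pic c1 c2 z n)" for z
  have pq: "zpoly X p" "zpoly X q" using Suc by (simp_all add: p_def[abs_def] q_def[abs_def])
  have one: "(\<lambda>t. 1 :: complex) absolutely_integrable_on {0..X}"
    by (intro absolutely_integrable_continuous_real continuous_intros)
  have ns: "(\<lambda>t. - complex_of_real (\<sigma> t)) absolutely_integrable_on {0..X}"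
    using set_integrable_mult_right[OF coeff_int(1)[OF order_refl, of X], of "-1"] by simp
  note cint = coeff_int[OF order_refl, of X]
  have I: "(\<lambda>t. g t * r t) integrable_on {0..x}"
    if "g absolutely_integrable_on {0..X}" "continuous_on {0..X} r" "x \<in> {0..X}" for g r :: "real \<Rightarrow> complex" and x
    using absolutely_integrable_mult_continuous[OF that(2,1)] that(3) unfolding absolutely_integrable_on_def
    by (auto simp: mult.commute intro: integrable_on_subinterval)
  have "zpoly X (\<lambda>z x. c1 + ((integral {0..x} (\<lambda>t. - complex_of_real (\<sigma> t) * p z t)
      + integral {0..x} (\<lambda>t. complex_of_real (\<tau> t - (\<sigma> t)\<^sup>2) * q z t)) + z * integral {0..x} (\<lambda>t. - 1 * q z t)))"
    using set_integrable_mult_right[OF one, of "-1"]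
    by (intro zpoly_add zpoly_const zpoly_mult_z zpoly_integral pq cint ns) simp_all
  note pz1 = this
  have eq1: "c1 + integral {0..x} (rhs1 z (p z) (q z)) = c1 + ((integral {0..x} (\<lambda>t. - complex_of_real (\<sigma> t) * p z t)
      + integral {0..x} (\<lambda>t. complex_of_real (\<tau> t - (\<sigma> t)\<^sup>2) * q z t)) + z * integral {0..x} (\<lambda>t. - 1 * q z t))"
    if x: "x \<in> {0..X}" for z x
  proof -
    note c = zpoly_continuous[OF pq(1), of z] zpoly_continuous[OF pq(2), of z]
    have H: "((\<lambda>t. (- complex_of_real (\<sigma> t) * p z t + complex_of_real (\<tau> t - (\<sigma> t)\<^sup>2) * q z t) + z * (- 1 * q z t)) has_integral
      (integral {0..x} (\<lambda>t. - complex_of_real (\<sigma> t) * p z t)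
      + integral {0..x} (\<lambda>t. complex_of_real (\<tau> t - (\<sigma> t)\<^sup>2) * q z t)) + z * integral {0..x} (\<lambda>t. - 1 * q z t)) {0..x}"
      using I[OF ns c(1) x] I[OF cint(2) c(2) x] I[OF one c(2) x]
      by (intro has_integral_add has_integral_mult_right integrable_integral) (simp_all add: integrable_neg)
    have E: "rhs1 z (p z) (q z) = (\<lambda>t. (- complex_of_real (\<sigma> t) * p z t + complex_of_real (\<tau> t - (\<sigma> t)\<^sup>2) * q z t) + z * (- 1 * q z t))"
      by (auto simp: rhs1_def fun_eq_iff algebra_simps)
    show ?thesis unfolding E integral_unique[OF H] ..
  qed
  have 1: "zpoly X (\<lambda>z x. c1 + integral {0..x} (rhs1 z (p z) (q z)))"
    by (rule zpoly_cong[OF pz1 eq1])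
  have "zpoly X (\<lambda>z x. c2 + (integral {0..x} (\<lambda>t. 1 * p z t) + integral {0..x} (\<lambda>t. complex_of_real (\<sigma> t) * q z t)))"
    by (intro zpoly_add zpoly_const zpoly_integral pq cint one)
  note pz2 = this
  have eq2: "c2 + integral {0..x} (rhs2 (p z) (q z)) = c2 + (integral {0..x} (\<lambda>t. 1 * p z t) + integral {0..x} (\<lambda>t. complex_of_real (\<sigma> t) * q z t))"
    if x: "x \<in> {0..X}" for z x
  proof -
    note c = zpoly_continuous[OF pq(1), of z] zpoly_continuous[OF pq(2), of z]
    have H: "((\<lambda>t. 1 * p z t + complex_of_real (\<sigma> t) * q z t) has_integral
      (integral {0..x} (\<lambda>t. 1 * p z t) + integral {0..x} (\<lambda>t. complex_of_real (\<sigma> t) * q z t))) {0..x}"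
      using I[OF one c(1) x] I[OF cint(1) c(2) x] by (intro has_integral_add integrable_integral)
    have E: "rhs2 (p z) (q z) = (\<lambda>t. 1 * p z t + complex_of_real (\<sigma> t) * q z t)"
      by (auto simp: rhs2_def fun_eq_iff)
    show ?thesis unfolding E integral_unique[OF H] ..
  qed
  have 2: "zpoly X (\<lambda>z x. c2 + integral {0..x} (rhs2 (p z) (q z)))"
    by (rule zpoly_cong[OF pz2 eq2])
  show ?case using 1 2 by (simp add: p_def q_def)
qed

lemma rhs_diff: "rhs1 z p q t - rhs1 z p' q' t = rhs1 z (\<lambda>t. p t - p' t) (\<lambda>t. q t - q' t) t"
   "rhs2 p q t - rhs2 p' q' t = rhs2 (\<lambda>t. p t - p' t) (\<lambda>t. q t - q' t) t"
  by (simp_all add: rhs1_def rhs2_def algebra_simps)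

text \<open>Each step integrates the previous bound against \<open>\<kappa> + |z|\<close>, and
  \<open>integral_indefinite_power\<close> turns the iterated integrals into powers over factorials.
  Only the integral of \<open>\<kappa>\<close> is under control, so it takes the place of the usual
  Lipschitz constant times length.\<close>

lemma pic_bound:
  fixes n :: nat
  assumes x: "0 \<le> x"
  shows "norm (fst (pic c1 c2 z (Suc n)) x - fst (pic c1 c2 z n) x) + norm (snd (pic c1 c2 z (Suc n)) x - snd (pic c1 c2 z n) x)
    \<le> (norm c1 + norm c2) * integral {0..x} (\<lambda>t. \<kappa> t + norm z) ^ Suc n / fact (Suc n)"
  using x
proof (induction n arbitrary: x)
  case 0
  have k: "(\<lambda>t. \<kappa> t + norm z) absolutely_integrable_on {0..x}"
    by (intro set_integral_add \<kappa>_int absolutely_integrable_continuous_real continuous_intros) simp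
  have "norm (integral {0..x} (rhs1 z (\<lambda>x. c1) (\<lambda>x. c2))) + norm (integral {0..x} (rhs2 (\<lambda>x. c1) (\<lambda>x. c2)))
     \<le> integral {0..x} (\<lambda>t. (\<kappa> t + norm z) * (norm c1 + norm c2))"
    using 0 set_lebesgue_integral_eq_integral(1)[OF k]
    by (intro rhs_integral_norm integrable_on_mult_left continuous_intros) auto
  then show ?case by (simp add: mult.commute)
next
  case (Suc n)
  let ?S = "\<lambda>x. integral {0..x} (\<lambda>t. \<kappa> t + norm z)"
  let ?p = "\<lambda>n. fst (pic c1 c2 z n)" and ?q = "\<lambda>n. snd (pic c1 c2 z n)"
  have k: "(\<lambda>t. \<kappa> t + norm z) absolutely_integrable_on {0..x}"
    by (intro set_integral_add \<kappa>_int absolutely_integrable_continuous_real continuous_intros) simp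
  have cont: "continuous_on {0..x} (?p n)" "continuous_on {0..x} (?q n)" for n
    using pic_zpoly[of x c1 c2 n] zpoly_continuous[of x "\<lambda>z. fst (pic c1 c2 z n)" z] zpoly_continuous[of x "\<lambda>z. snd (pic c1 c2 z n)" z] by auto
  have ii: "rhs1 z (?p n) (?q n) integrable_on {0..x}" "rhs2 (?p n) (?q n) integrable_on {0..x}" for n
    using rhs_int(1)[OF order_refl cont, of z n n] rhs_int(2)[OF order_refl cont, of n n]
    unfolding absolutely_integrable_on_def by blast+
  have P: "((\<lambda>t. (\<kappa> t + norm z) * ((norm c1 + norm c2) * ?S t ^ Suc n / fact (Suc n))) has_integral
      ((norm c1 + norm c2) / fact (Suc n)) * (?S x ^ Suc (Suc n) / real (Suc (Suc n)))) {0..x}"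
    using has_integral_mult_right[OF integral_indefinite_power[OF k Suc.prems, of x "Suc n"], of "(norm c1 + norm c2) / fact (Suc n)"] Suc.prems
    by (simp add: mult_ac)
  have "?p (Suc (Suc n)) x - ?p (Suc n) x = integral {0..x} (rhs1 z (\<lambda>t. ?p (Suc n) t - ?p n t) (\<lambda>t. ?q (Suc n) t - ?q n t))"
    using integral_diff[OF ii(1)[of "Suc n"] ii(1)[of n]] unfolding rhs_diff by simp
  moreover have "?q (Suc (Suc n)) x - ?q (Suc n) x = integral {0..x} (rhs2 (\<lambda>t. ?p (Suc n) t - ?p n t) (\<lambda>t. ?q (Suc n) t - ?q n t))"
    using integral_diff[OF ii(2)[of "Suc n"] ii(2)[of n]] unfolding rhs_diff by simp
  moreover have "norm (integral {0..x} (rhs1 z (\<lambda>t. ?p (Suc n) t - ?p n t) (\<lambda>t. ?q (Suc n) t - ?q n t)))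
      + norm (integral {0..x} (rhs2 (\<lambda>t. ?p (Suc n) t - ?p n t) (\<lambda>t. ?q (Suc n) t - ?q n t)))
      \<le> integral {0..x} (\<lambda>t. (\<kappa> t + norm z) * ((norm c1 + norm c2) * ?S t ^ Suc n / fact (Suc n)))"
  proof (rule rhs_integral_norm[OF Suc.prems])
    show "continuous_on {0..x} (\<lambda>t. ?p (Suc n) t - ?p n t)" "continuous_on {0..x} (\<lambda>t. ?q (Suc n) t - ?q n t)"
      by (intro continuous_on_diff cont)+
    show "norm (?p (Suc n) t - ?p n t) + norm (?q (Suc n) t - ?q n t) \<le> (norm c1 + norm c2) * ?S t ^ Suc n / fact (Suc n)"
      if "t \<in> {0..x}" for t using Suc.IH[of t] that by simp
    show "(\<lambda>t. (\<kappa> t + norm z) * ((norm c1 + norm c2) * ?S t ^ Suc n / fact (Suc n))) integrable_on {0..x}"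
      using P by blast
  qed
  moreover have "integral {0..x} (\<lambda>t. (\<kappa> t + norm z) * ((norm c1 + norm c2) * ?S t ^ Suc n / fact (Suc n)))
      = (norm c1 + norm c2) * ?S x ^ Suc (Suc n) / fact (Suc (Suc n))"
    using integral_unique[OF P] by (simp add: fact_Suc[of "Suc n"] mult_ac del: fact_Suc power_Suc of_nat_Suc)
  ultimately show ?case by (simp only:)
qed

end

text \<open>Nonempty open sets are not null. This pins down the representative chosen by
  \<open>quasi_deriv\<close> at every point of the half-line.\<close>

lemma AE_eq_continuous_imp_eq:
  fixes f g :: "real \<Rightarrow> complex"
  assumes c: "continuous_on {0<..} f" "continuous_on {0<..} g"
    and ae: "AE x in lebesgue. 0 < x \<longrightarrow> f x = g x" and x: "0 < x"
  shows "f x = g x"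
proof (rule ccontr)
  assume ne: "f x \<noteq> g x"
  define S where "S = {0<..} \<inter> (\<lambda>x. f x - g x) -` (- {0})"
  have "open S" unfolding S_def
    by (intro continuous_open_preimage continuous_intros c)
  moreover have "S \<noteq> {}" using ne x by (auto simp: S_def)
  ultimately have "\<not> negligible S" by (rule open_not_negligible)
  moreover have "negligible S"
    unfolding negligible_iff_null_sets completion.null_sets_iff_AE
    using ae by (auto simp: S_def elim: eventually_mono)
  ultimately show False by blast
qed

lemma AC_with_refl: "AC_with a a u g"
proof -
  have "g absolutely_integrable_on cbox a a" by (rule absolutely_integrable_on_null) simp
  then show ?thesis by (simp add: AC_with_def)
qed

lemma AC_loc_continuous:
  assumes "u \<in> AC_loc" shows "continuous_on {0<..} u"
  unfolding continuous_on_eq_continuous_at[OF open_greaterThan]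
proof
  fix x :: real assume x: "x \<in> {0<..}"
  have "continuous_on {x / 2..2 * x} u"
    using assms x unfolding AC_loc_def by (intro abs_cont_on_continuous) auto
  then have "continuous_on {x / 2<..<2 * x} u" by (rule continuous_on_subset) auto
  then show "isCont u x" using x by (simp add: continuous_on_eq_continuous_at)
qed

lemma AE_half_lineI:
  fixes P :: "real \<Rightarrow> bool"
  assumes "\<And>a b. 0 < a \<Longrightarrow> a \<le> b \<Longrightarrow> AE x in lebesgue. x \<in> {a<..<b} \<longrightarrow> P x"
  shows "AE x in lebesgue. 0 < x \<longrightarrow> P x"
proof -
  have "AE x in lebesgue. \<forall>n::nat. x \<in> {1 / (real n + 1)<..<real n + 1} \<longrightarrow> P x"
    unfolding AE_all_countable
  proof
    fix n :: nat
    have "1 / (real n + 1) \<le> real n + 1" by (simp add: field_simps)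
    then show "AE x in lebesgue. x \<in> {1 / (real n + 1)<..<real n + 1} \<longrightarrow> P x" by (intro assms) auto
  qed
  then show ?thesis
  proof eventually_elim
    case (elim x)
    show ?case
    proof
      assume x: "0 < x"
      obtain n :: nat where n: "max x (1 / x) < real n" using reals_Archimedean2 by blast
      then have "1 / x < real n + 1" "x < real n + 1" by auto
      moreover from this(1) have "1 / (real n + 1) < x" using x by (simp add: field_simps)
      ultimately show "P x" using elim by auto
    qed
  qed
qed

section \<open>Solutions entire in \<open>z\<close> and their identification with
  \<open>is_solution\<close>\<close>

context sl_coeffs
begin

lemma sys_on_rhs: "sys_on \<sigma> \<tau> z a b p q \<longleftrightarrow> AC_with a b p (rhs1 z p q) \<and> AC_with a b q (rhs2 p q)"
  unfolding sys_on_def rhs1_def[abs_def] rhs2_def[abs_def] ..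

text \<open>The limit of the Picard iterates, written as a telescoping series so that the
  Weierstrass M-test applies.\<close>

definition sol1 :: "complex \<Rightarrow> complex \<Rightarrow> complex \<Rightarrow> real \<Rightarrow> complex" where
  "sol1 c1 c2 z x = c1 + (\<Sum>n. fst (pic c1 c2 z (Suc n)) x - fst (pic c1 c2 z n) x)"
definition sol2 :: "complex \<Rightarrow> complex \<Rightarrow> complex \<Rightarrow> real \<Rightarrow> complex" where
  "sol2 c1 c2 z x = c2 + (\<Sum>n. snd (pic c1 c2 z (Suc n)) x - snd (pic c1 c2 z n) x)"

text \<open>Convergence is uniform in \<open>z\<close> and \<open>x\<close> jointly: fixing
  \<open>z\<close> gives continuity in \<open>x\<close>, fixing \<open>x\<close> gives holomorphy in
  \<open>z\<close>, and the uniform bound on the iterates provides the majorant for dominated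
  convergence in \<open>sol_sys\<close>.\<close>

lemma pic_uniform:
  assumes X: "0 \<le> X" and R: "0 \<le> R"
  defines "A \<equiv> {z. norm z \<le> R} \<times> {0..X}"
  shows "uniform_limit A (\<lambda>n x. fst (pic c1 c2 (fst x) n) (snd x)) (\<lambda>x. sol1 c1 c2 (fst x) (snd x)) sequentially"
    and "uniform_limit A (\<lambda>n x. snd (pic c1 c2 (fst x) n) (snd x)) (\<lambda>x. sol2 c1 c2 (fst x) (snd x)) sequentially"
    and "\<exists>B. \<forall>n. \<forall>x\<in>A. norm (fst (pic c1 c2 (fst x) n) (snd x)) \<le> B \<and> norm (snd (pic c1 c2 (fst x) n) (snd x)) \<le> B"
proof -
  define S where "S = integral {0..X} (\<lambda>t. \<kappa> t + R)"
  define M where "M n = (norm c1 + norm c2) * (S ^ Suc n / fact (Suc n))" for n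
  have ki: "(\<lambda>t. \<kappa> t + r) integrable_on {0..x}" for r x
    using set_lebesgue_integral_eq_integral(1)[OF \<kappa>_int[OF order_refl, of x]] by (intro integrable_add) auto
  have kn: "0 \<le> \<kappa> t + r" if "r \<ge> 0" for r t using \<kappa>_ge[of t] that by simp
  have S0: "integral {0..x} (\<lambda>t. \<kappa> t + norm z) \<le> S" "0 \<le> integral {0..x} (\<lambda>t. \<kappa> t + norm z)"
    if "norm z \<le> R" "x \<in> {0..X}" for z :: complex and x
  proof -
    have "integral {0..x} (\<lambda>t. \<kappa> t + norm z) \<le> integral {0..x} (\<lambda>t. \<kappa> t + R)"
      using that by (intro integral_le ki) auto
    also have "\<dots> \<le> S" unfolding S_def using that kn[OF R] by (intro integral_subset_le ki) auto
    finally show "integral {0..x} (\<lambda>t. \<kappa> t + norm z) \<le> S" .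
    show "0 \<le> integral {0..x} (\<lambda>t. \<kappa> t + norm z)" by (intro integral_nonneg ki kn) simp
  qed
  have d: "norm (fst (pic c1 c2 (fst x) (Suc n)) (snd x) - fst (pic c1 c2 (fst x) n) (snd x)) \<le> M n"
    "norm (snd (pic c1 c2 (fst x) (Suc n)) (snd x) - snd (pic c1 c2 (fst x) n) (snd x)) \<le> M n" if "x \<in> A" for n x
  proof -
    have x: "norm (fst x) \<le> R" "snd x \<in> {0..X}" using that by (auto simp: A_def)
    have "(norm c1 + norm c2) * integral {0..snd x} (\<lambda>t. \<kappa> t + norm (fst x)) ^ Suc n / fact (Suc n) \<le> M n"
      unfolding M_def times_divide_eq_right using S0[OF x] by (intro divide_right_mono mult_left_mono power_mono) auto
    moreover have "norm (fst (pic c1 c2 (fst x) (Suc n)) (snd x) - fst (pic c1 c2 (fst x) n) (snd x)) +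
      norm (snd (pic c1 c2 (fst x) (Suc n)) (snd x) - snd (pic c1 c2 (fst x) n) (snd x))
      \<le> (norm c1 + norm c2) * integral {0..snd x} (\<lambda>t. \<kappa> t + norm (fst x)) ^ Suc n / fact (Suc n)"
      by (rule pic_bound) (use x in auto)
    ultimately show "norm (fst (pic c1 c2 (fst x) (Suc n)) (snd x) - fst (pic c1 c2 (fst x) n) (snd x)) \<le> M n"
      "norm (snd (pic c1 c2 (fst x) (Suc n)) (snd x) - snd (pic c1 c2 (fst x) n) (snd x)) \<le> M n"
      by (meson norm_ge_zero order_trans add_increasing add_increasing2 order_refl le_add_same_cancel1 le_add_same_cancel2)+
  qed
  have "summable (\<lambda>n. S ^ n / fact n)" using summable_exp[of S] by (simp add: divide_inverse mult.commute)
  then have "summable (\<lambda>n. S ^ Suc n / fact (Suc n))" by (subst summable_Suc_iff)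
  then have Ms: "summable M" unfolding M_def by (rule summable_mult)
  have M0: "M n \<ge> 0" for n
  proof -
    have "S \<ge> 0" unfolding S_def by (intro integral_nonneg ki kn R)
    then show ?thesis unfolding M_def by simp
  qed
  have tele1: "(\<Sum>i<n. fst (pic c1 c2 z (Suc i)) x - fst (pic c1 c2 z i) x) = fst (pic c1 c2 z n) x - c1" for n z x
    by (subst sum_lessThan_telescope) simp
  have tele2: "(\<Sum>i<n. snd (pic c1 c2 z (Suc i)) x - snd (pic c1 c2 z i) x) = snd (pic c1 c2 z n) x - c2" for n z x
    by (subst sum_lessThan_telescope) simp
  have sh: "dist (a - c) b = dist a (c + b)" for a b c :: complex by (simp add: dist_norm algebra_simps)
  show "uniform_limit A (\<lambda>n x. fst (pic c1 c2 (fst x) n) (snd x)) (\<lambda>x. sol1 c1 c2 (fst x) (snd x)) sequentially"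
    using Weierstrass_m_test[of A "\<lambda>n x. fst (pic c1 c2 (fst x) (Suc n)) (snd x) - fst (pic c1 c2 (fst x) n) (snd x)" M, OF d(1) Ms]
    unfolding tele1 uniform_limit_iff sh sol1_def by blast
  show "uniform_limit A (\<lambda>n x. snd (pic c1 c2 (fst x) n) (snd x)) (\<lambda>x. sol2 c1 c2 (fst x) (snd x)) sequentially"
    using Weierstrass_m_test[of A "\<lambda>n x. snd (pic c1 c2 (fst x) (Suc n)) (snd x) - snd (pic c1 c2 (fst x) n) (snd x)" M, OF d(2) Ms]
    unfolding tele2 uniform_limit_iff sh sol2_def by blast
  have b1: "norm (fst (pic c1 c2 (fst x) n) (snd x)) \<le> norm c1 + suminf M" if "x \<in> A" for n x
  proof -
    have "norm (\<Sum>i<n. fst (pic c1 c2 (fst x) (Suc i)) (snd x) - fst (pic c1 c2 (fst x) i) (snd x)) \<le> (\<Sum>i<n. M i)"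
      by (intro order_trans[OF norm_sum] sum_mono d that)
    also have "\<dots> \<le> suminf M" by (intro sum_le_suminf Ms M0) auto
    finally show ?thesis unfolding tele1 using norm_triangle_ineq2[of "fst (pic c1 c2 (fst x) n) (snd x)" c1] by linarith
  qed
  have b2: "norm (snd (pic c1 c2 (fst x) n) (snd x)) \<le> norm c2 + suminf M" if "x \<in> A" for n x
  proof -
    have "norm (\<Sum>i<n. snd (pic c1 c2 (fst x) (Suc i)) (snd x) - snd (pic c1 c2 (fst x) i) (snd x)) \<le> (\<Sum>i<n. M i)"
      by (intro order_trans[OF norm_sum] sum_mono d that)
    also have "\<dots> \<le> suminf M" by (intro sum_le_suminf Ms M0) auto
    finally show ?thesis unfolding tele2 using norm_triangle_ineq2[of "snd (pic c1 c2 (fst x) n) (snd x)" c2] by linarith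
  qed
  show "\<exists>B. \<forall>n. \<forall>x\<in>A. norm (fst (pic c1 c2 (fst x) n) (snd x)) \<le> B \<and> norm (snd (pic c1 c2 (fst x) n) (snd x)) \<le> B"
  proof (intro exI[of _ "norm c1 + norm c2 + suminf M"] allI ballI conjI)
    fix n x assume "x \<in> A"
    from b1[OF this, of n] show "norm (fst (pic c1 c2 (fst x) n) (snd x)) \<le> norm c1 + norm c2 + suminf M"
      using norm_ge_zero[of c2] by linarith
    from b2[OF \<open>x \<in> A\<close>, of n] show "norm (snd (pic c1 c2 (fst x) n) (snd x)) \<le> norm c1 + norm c2 + suminf M"
      using norm_ge_zero[of c1] by linarith
  qed
qed

lemma pic_uniform_x:
  assumes X: "0 \<le> X"
  shows "uniform_limit {0..X} (\<lambda>n. fst (pic c1 c2 z n)) (sol1 c1 c2 z) sequentially"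
    and "uniform_limit {0..X} (\<lambda>n. snd (pic c1 c2 z n)) (sol2 c1 c2 z) sequentially"
  using pic_uniform(1,2)[OF X norm_ge_zero[of z], of c1 c2] unfolding uniform_limit_iff
  by (auto elim!: eventually_mono)

lemma pic_uniform_z:
  assumes x: "0 \<le> x"
  shows "uniform_limit (cball w 1) (\<lambda>n z. fst (pic c1 c2 z n) x) (\<lambda>z. sol1 c1 c2 z x) sequentially"
    and "uniform_limit (cball w 1) (\<lambda>n z. snd (pic c1 c2 z n) x) (\<lambda>z. sol2 c1 c2 z x) sequentially"
proof -
  have "0 \<le> norm w + 1" by simp
  have sub: "norm z \<le> norm w + 1" if "z \<in> cball w 1" for z
    using that norm_triangle_ineq2[of z w] by (simp add: dist_norm norm_minus_commute)
  show "uniform_limit (cball w 1) (\<lambda>n z. fst (pic c1 c2 z n) x) (\<lambda>z. sol1 c1 c2 z x) sequentially"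
    unfolding uniform_limit_iff
  proof (intro allI impI)
    fix e :: real assume "e > 0"
    from uniform_limitD[OF pic_uniform(1)[OF x \<open>0 \<le> norm w + 1\<close>, of c1 c2] this]
    show "\<forall>\<^sub>F n in sequentially. \<forall>z\<in>cball w 1. dist (fst (pic c1 c2 z n) x) (sol1 c1 c2 z x) < e"
      by eventually_elim (use sub x in auto)
  qed
  show "uniform_limit (cball w 1) (\<lambda>n z. snd (pic c1 c2 z n) x) (\<lambda>z. sol2 c1 c2 z x) sequentially"
    unfolding uniform_limit_iff
  proof (intro allI impI)
    fix e :: real assume "e > 0"
    from uniform_limitD[OF pic_uniform(2)[OF x \<open>0 \<le> norm w + 1\<close>, of c1 c2] this]
    show "\<forall>\<^sub>F n in sequentially. \<forall>z\<in>cball w 1. dist (snd (pic c1 c2 z n) x) (sol2 c1 c2 z x) < e"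
      by eventually_elim (use sub x in auto)
  qed
qed

lemma pic_continuous: "continuous_on {0..X} (fst (pic c1 c2 z n))" "continuous_on {0..X} (snd (pic c1 c2 z n))"
  using pic_zpoly[of X c1 c2 n] zpoly_continuous[of X "\<lambda>z. fst (pic c1 c2 z n)" z] zpoly_continuous[of X "\<lambda>z. snd (pic c1 c2 z n)" z] by auto

lemma sol_holomorphic:
  assumes x: "0 \<le> x"
  shows "(\<lambda>z. sol1 c1 c2 z x) holomorphic_on UNIV" "(\<lambda>z. sol2 c1 c2 z x) holomorphic_on UNIV"
proof -
  have "x \<in> {0..x}" using x by simp
  show "(\<lambda>z. sol1 c1 c2 z x) holomorphic_on UNIV"
  proof (rule holomorphic_uniform_sequence[OF open_UNIV])
    show "(\<lambda>z. fst (pic c1 c2 z n) x) holomorphic_on UNIV" for n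
      by (rule zpoly_holomorphic[OF conjunct1[OF pic_zpoly] \<open>x \<in> {0..x}\<close>])
    show "\<exists>d>0. cball w d \<subseteq> UNIV \<and> uniform_limit (cball w d) (\<lambda>n z. fst (pic c1 c2 z n) x) (\<lambda>z. sol1 c1 c2 z x) sequentially" for w
      using pic_uniform_z(1)[OF x] by (intro exI[of _ 1]) simp
  qed
  show "(\<lambda>z. sol2 c1 c2 z x) holomorphic_on UNIV"
  proof (rule holomorphic_uniform_sequence[OF open_UNIV])
    show "(\<lambda>z. snd (pic c1 c2 z n) x) holomorphic_on UNIV" for n
      by (rule zpoly_holomorphic[OF conjunct2[OF pic_zpoly] \<open>x \<in> {0..x}\<close>])
    show "\<exists>d>0. cball w d \<subseteq> UNIV \<and> uniform_limit (cball w d) (\<lambda>n z. snd (pic c1 c2 z n) x) (\<lambda>z. sol2 c1 c2 z x) sequentially" for w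
      using pic_uniform_z(2)[OF x] by (intro exI[of _ 1]) simp
  qed
qed

lemma sol_continuous:
  "0 \<le> X \<Longrightarrow> continuous_on {0..X} (sol1 c1 c2 z)" "0 \<le> X \<Longrightarrow> continuous_on {0..X} (sol2 c1 c2 z)"
  by (rule uniform_limit_theorem[OF _ pic_uniform_x(1)]; simp add: pic_continuous)
     (rule uniform_limit_theorem[OF _ pic_uniform_x(2)]; simp add: pic_continuous)

text \<open>The limit is taken inside the Picard recursion by dominated convergence, with majorant
  \<open>\<kappa> + |z|\<close> times the uniform bound on the iterates.\<close>

lemma sol_sys:
  assumes X: "0 \<le> X"
  shows "sys_on \<sigma> \<tau> z 0 X (sol1 c1 c2 z) (sol2 c1 c2 z)" "sol1 c1 c2 z 0 = c1" "sol2 c1 c2 z 0 = c2"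
proof -
  let ?p = "\<lambda>n. fst (pic c1 c2 z n)" and ?q = "\<lambda>n. snd (pic c1 c2 z n)"
  have lim: "(\<lambda>n. ?p n t) \<longlonglongrightarrow> sol1 c1 c2 z t" "(\<lambda>n. ?q n t) \<longlonglongrightarrow> sol2 c1 c2 z t" if "t \<in> {0..X}" for t
    using tendsto_uniform_limitI[OF pic_uniform_x(1)[OF X] that] tendsto_uniform_limitI[OF pic_uniform_x(2)[OF X] that] by auto
  obtain B where B: "\<And>n t. t \<in> {0..X} \<Longrightarrow> norm (?p n t) \<le> B \<and> norm (?q n t) \<le> B"
    using pic_uniform(3)[OF X norm_ge_zero[of z], of c1 c2] by force
  define h where "h t = (\<kappa> t + norm z) * (2 * B)" for t
  have hi: "h integrable_on {0..x}" for x unfolding h_def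
    using set_lebesgue_integral_eq_integral(1)[OF \<kappa>_int[OF order_refl, of x]] by (intro integrable_on_mult_left integrable_add) auto
  have hb: "norm (rhs1 z (?p n) (?q n) t) \<le> h t" "norm (rhs2 (?p n) (?q n) t) \<le> h t" if "t \<in> {0..X}" for n t
  proof -
    have "(\<kappa> t + norm z) * (norm (?p n t) + norm (?q n t)) \<le> h t"
      unfolding h_def using B[OF that, of n] \<kappa>_ge[of t] by (intro mult_left_mono add_nonneg_nonneg) auto
    then show "norm (rhs1 z (?p n) (?q n) t) \<le> h t" "norm (rhs2 (?p n) (?q n) t) \<le> h t"
      using rhs_norm[of z "?p n" "?q n" t] norm_ge_zero[of "rhs1 z (?p n) (?q n) t"] norm_ge_zero[of "rhs2 (?p n) (?q n) t"] by linarith+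
  qed
  have eq: "sol1 c1 c2 z x = c1 + integral {0..x} (rhs1 z (sol1 c1 c2 z) (sol2 c1 c2 z))"
    "sol2 c1 c2 z x = c2 + integral {0..x} (rhs2 (sol1 c1 c2 z) (sol2 c1 c2 z))" if x: "x \<in> {0..X}" for x
  proof -
    have i: "rhs1 z (?p n) (?q n) integrable_on {0..x}" "rhs2 (?p n) (?q n) integrable_on {0..x}" for n
      using rhs_int(1)[OF order_refl pic_continuous(1)[of x c1 c2 z n] pic_continuous(2)[of x c1 c2 z n], of z]
        rhs_int(2)[OF order_refl pic_continuous(1)[of x c1 c2 z n] pic_continuous(2)[of x c1 c2 z n]]
      unfolding absolutely_integrable_on_def by blast+
    have "(\<lambda>n. integral {0..x} (rhs1 z (?p n) (?q n))) \<longlonglongrightarrow> integral {0..x} (rhs1 z (sol1 c1 c2 z) (sol2 c1 c2 z))"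
    proof (rule dominated_convergence(2)[OF i(1) hi])
      show "norm (rhs1 z (?p n) (?q n) t) \<le> h t" if "t \<in> {0..x}" for n t using hb that x by auto
      show "(\<lambda>n. rhs1 z (?p n) (?q n) t) \<longlonglongrightarrow> rhs1 z (sol1 c1 c2 z) (sol2 c1 c2 z) t" if "t \<in> {0..x}" for t
        unfolding rhs1_def using that x by (intro tendsto_intros lim) auto
    qed
    then have "(\<lambda>n. ?p (Suc n) x) \<longlonglongrightarrow> c1 + integral {0..x} (rhs1 z (sol1 c1 c2 z) (sol2 c1 c2 z))"
      by (simp add: tendsto_intros)
    then show "sol1 c1 c2 z x = c1 + integral {0..x} (rhs1 z (sol1 c1 c2 z) (sol2 c1 c2 z))"
      using LIMSEQ_unique[OF LIMSEQ_Suc[OF lim(1)[OF x]]] by blast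
    have "(\<lambda>n. integral {0..x} (rhs2 (?p n) (?q n))) \<longlonglongrightarrow> integral {0..x} (rhs2 (sol1 c1 c2 z) (sol2 c1 c2 z))"
    proof (rule dominated_convergence(2)[OF i(2) hi])
      show "norm (rhs2 (?p n) (?q n) t) \<le> h t" if "t \<in> {0..x}" for n t using hb that x by auto
      show "(\<lambda>n. rhs2 (?p n) (?q n) t) \<longlonglongrightarrow> rhs2 (sol1 c1 c2 z) (sol2 c1 c2 z) t" if "t \<in> {0..x}" for t
        unfolding rhs2_def using that x by (intro tendsto_intros lim) auto
    qed
    then have "(\<lambda>n. ?q (Suc n) x) \<longlonglongrightarrow> c2 + integral {0..x} (rhs2 (sol1 c1 c2 z) (sol2 c1 c2 z))"
      by (simp add: tendsto_intros)
    then show "sol2 c1 c2 z x = c2 + integral {0..x} (rhs2 (sol1 c1 c2 z) (sol2 c1 c2 z))"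
      using LIMSEQ_unique[OF LIMSEQ_Suc[OF lim(2)[OF x]]] by blast
  qed
  show 0: "sol1 c1 c2 z 0 = c1" "sol2 c1 c2 z 0 = c2"
    using trans[OF eq(1)[of 0]] trans[OF eq(2)[of 0]] X by simp_all
  note ri = rhs_int(1)[OF order_refl sol_continuous[OF X], of z c1 c2 z c1 c2 z] rhs_int(2)[OF order_refl sol_continuous[OF X], of c1 c2 z c1 c2 z]
  show "sys_on \<sigma> \<tau> z 0 X (sol1 c1 c2 z) (sol2 c1 c2 z)"
    unfolding sys_on_rhs AC_with_def 0 using eq ri by blast
qed

abbreviation "p1 \<equiv> sol1 1 0"
abbreviation "q1 \<equiv> sol2 1 0"
abbreviation "p2 \<equiv> sol1 0 1"
abbreviation "q2 \<equiv> sol2 0 1"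

lemma sol_wronskian: "0 \<le> x \<Longrightarrow> p1 z x * q2 z x - q1 z x * p2 z x = 1"
  using sys_on_wronskian[OF sol_sys(1)[of x z 1 0] sol_sys(1)[of x z 0 1], of x] by (simp add: sol_sys(2,3))

text \<open>Cramer's rule: the coefficients are Wronskians with the fundamental solutions, hence
  constant. Uniqueness for the initial value problem follows without a Gronwall argument.\<close>

lemma sys_on_repr:
  assumes s: "sys_on \<sigma> \<tau> z a b p q" and a: "0 \<le> a" and x: "x \<in> {a..b}"
  shows "p x = (p a * q2 z a - q a * p2 z a) * p1 z x + (p1 z a * q a - q1 z a * p a) * p2 z x"
    "q x = (p a * q2 z a - q a * p2 z a) * q1 z x + (p1 z a * q a - q1 z a * p a) * q2 z x"
proof -
  have b: "0 \<le> b" using a x by simp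
  have S: "sys_on \<sigma> \<tau> z a b (sol1 c1 c2 z) (sol2 c1 c2 z)" for c1 c2
    using sys_on_subset[OF sol_sys(1)[OF b] a order_refl] .
  have A: "p x * q2 z x - q x * p2 z x = p a * q2 z a - q a * p2 z a"
    by (rule sys_on_wronskian[OF s S x])
  have B: "p1 z x * q x - q1 z x * p x = p1 z a * q a - q1 z a * p a"
    by (rule sys_on_wronskian[OF S s x])
  have W: "p1 z x * q2 z x - q1 z x * p2 z x = 1" using sol_wronskian a x by auto
  have "p x = p x * (p1 z x * q2 z x - q1 z x * p2 z x)" by (simp add: W)
  also have "\<dots> = (p x * q2 z x - q x * p2 z x) * p1 z x + (p1 z x * q x - q1 z x * p x) * p2 z x" by (simp add: algebra_simps)
  finally show "p x = (p a * q2 z a - q a * p2 z a) * p1 z x + (p1 z a * q a - q1 z a * p a) * p2 z x" unfolding A B .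
  have "q x = q x * (p1 z x * q2 z x - q1 z x * p2 z x)" by (simp add: W)
  also have "\<dots> = (p x * q2 z x - q x * p2 z x) * q1 z x + (p1 z x * q x - q1 z x * p x) * q2 z x" by (simp add: algebra_simps)
  finally show "q x = (p a * q2 z a - q a * p2 z a) * q1 z x + (p1 z a * q a - q1 z a * p a) * q2 z x" unfolding A B .
qed

lemma sol_eq:
  assumes x: "0 \<le> x"
  shows "sol1 c1 c2 z x = c1 * p1 z x + c2 * p2 z x" "sol2 c1 c2 z x = c1 * q1 z x + c2 * q2 z x"
  using sys_on_repr[OF sol_sys(1)[OF x, of z c1 c2], of x] x by (simp_all add: sol_sys(2,3))

lemma sys_on_cnj:
  assumes "sys_on \<sigma> \<tau> z a b p q" shows "sys_on \<sigma> \<tau> (cnj z) a b (\<lambda>x. cnj (p x)) (\<lambda>x. cnj (q x))"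
proof -
  have "AC_with a b (\<lambda>x. cnj (p x)) (\<lambda>t. - of_real (\<sigma> t) * cnj (p t) + (of_real (\<tau> t - (\<sigma> t)\<^sup>2) - cnj z) * cnj (q t))"
    by (rule AC_with_cong[OF AC_with_cnj[OF conjunct1[OF assms[unfolded sys_on_def]]]]) simp_all
  moreover have "AC_with a b (\<lambda>x. cnj (q x)) (\<lambda>t. cnj (p t) + of_real (\<sigma> t) * cnj (q t))"
    by (rule AC_with_cong[OF AC_with_cnj[OF conjunct2[OF assms[unfolded sys_on_def]]]]) simp_all
  ultimately show ?thesis unfolding sys_on_def by blast
qed

text \<open>Since the coefficients are real, conjugation maps solutions for \<open>z\<close> to
  solutions for \<open>cnj z\<close>; the initial values then identify them.\<close>

lemma sol_cnj:
  assumes x: "0 \<le> x"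
  shows "cnj (sol1 c1 c2 z x) = sol1 (cnj c1) (cnj c2) (cnj z) x" "cnj (sol2 c1 c2 z x) = sol2 (cnj c1) (cnj c2) (cnj z) x"
  using sys_on_repr[OF sys_on_cnj[OF sol_sys(1)[OF x, of z c1 c2]], of x] x
  by (simp_all add: sol_sys(2,3) sol_eq[of x "cnj c1" "cnj c2"])

lemma sol_real:
  assumes x: "0 \<le> x"
  shows "Im (sol1 (of_real c1) (of_real c2) (of_real E) x) = 0" "Im (sol2 (of_real c1) (of_real c2) (of_real E) x) = 0"
  using sol_cnj[OF x, of "of_real c1" "of_real c2" "of_real E"] by (auto simp: complex_eq_iff)

text \<open>\<open>AC_withI\<close> turns the almost everywhere identities behind
  \<open>quasi_deriv\<close> and \<open>ell\<close> into the integral form, on which all estimates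
  are built.\<close>

lemma is_solution_sys_on:
  assumes u: "is_solution \<sigma> \<tau> z u" and ab: "0 < a" "a \<le> b"
  shows "sys_on \<sigma> \<tau> z a b (quasi_deriv \<sigma> u) u"
proof (cases "a = b")
  case False
  then have ab': "a < b" using ab by simp
  define v where "v = quasi_deriv \<sigma> u"
  have uD: "u \<in> AC_loc" "\<exists>v. is_quasi_deriv \<sigma> u v" using u unfolding is_solution_def DD_def by auto
  have "is_quasi_deriv \<sigma> u v" unfolding v_def quasi_deriv_def by (rule someI_ex[OF uD(2)])
  then have v: "v \<in> AC_loc" "AE x in lebesgue. 0 < x \<longrightarrow> v x = vector_derivative u (at x) - of_real (\<sigma> x) * u x"
    unfolding is_quasi_deriv_def by auto
  have uAC: "abs_cont_on a b u" and vAC: "abs_cont_on a b v" using uD(1) v(1) ab unfolding AC_loc_def by auto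
  obtain g where g: "AC_with a b u g" using abs_cont_on_AC_with[OF ab' uAC] by blast
  obtain h where h: "AC_with a b v h" using abs_cont_on_AC_with[OF ab' vAC] by blast
  have "AC_with a b u (\<lambda>t. v t + of_real (\<sigma> t) * u t)"
  proof (rule AC_withI[OF uAC _ ab(2)])
    show "AE x in lebesgue. x \<in> {a<..<b} \<longrightarrow> (u has_vector_derivative v x + of_real (\<sigma> x) * u x) (at x)"
      using AC_with_derivative_AE[OF g] v(2)
    proof eventually_elim
      case (elim x)
      show ?case
      proof
        assume x: "x \<in> {a<..<b}"
        then have d: "(u has_vector_derivative g x) (at x)" using elim by simp
        then have "v x = g x - of_real (\<sigma> x) * u x" using elim x ab vector_derivative_at[OF d] by simp
        then have "g x = v x + of_real (\<sigma> x) * u x" by simp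
        then show "(u has_vector_derivative v x + of_real (\<sigma> x) * u x) (at x)" using d by (simp only:)
      qed
    qed
  qed
  moreover have "AE x in lebesgue. 0 < x \<longrightarrow> ell \<sigma> \<tau> u x = z * u x" using u unfolding is_solution_def by simp
  then have "AC_with a b v (\<lambda>t. - of_real (\<sigma> t) * v t + (of_real (\<tau> t - (\<sigma> t)\<^sup>2) - z) * u t)"
  proof (intro AC_withI[OF vAC _ ab(2)])
    assume "AE x in lebesgue. 0 < x \<longrightarrow> ell \<sigma> \<tau> u x = z * u x"
    with AC_with_derivative_AE[OF h]
    show "AE x in lebesgue. x \<in> {a<..<b} \<longrightarrow>
      (v has_vector_derivative - of_real (\<sigma> x) * v x + (of_real (\<tau> x - (\<sigma> x)\<^sup>2) - z) * u x) (at x)"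
    proof eventually_elim
      case (elim x)
      show ?case
      proof
        assume x: "x \<in> {a<..<b}"
        then have d: "(v has_vector_derivative h x) (at x)" using elim by simp
        then have "vector_derivative v (at x) = h x" by (rule vector_derivative_at)
        moreover have "ell \<sigma> \<tau> u x = z * u x" using elim x ab by auto
        ultimately have "- h x - of_real (\<sigma> x) * v x + of_real (\<tau> x - (\<sigma> x)\<^sup>2) * u x = z * u x"
          unfolding ell_def v_def[symmetric] by simp
        then have "h x = - of_real (\<sigma> x) * v x + (of_real (\<tau> x - (\<sigma> x)\<^sup>2) - z) * u x"
          by (simp add: algebra_simps)
        then show "(v has_vector_derivative - of_real (\<sigma> x) * v x + (of_real (\<tau> x - (\<sigma> x)\<^sup>2) - z) * u x) (at x)"
          using d by simp
      qed
    qed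
  qed
  ultimately show ?thesis unfolding sys_on_def v_def[symmetric] by blast
qed (simp add: sys_on_def AC_with_refl)

text \<open>\<open>quasi_deriv\<close> picks some representative, which agrees with \<open>p\<close>
  almost everywhere and hence, by continuity, at every \<open>x > 0\<close>. Only then can
  \<open>ell\<close>, which differentiates that representative, be computed.\<close>

lemma sys_on_is_solution:
  assumes s: "\<And>a b. 0 < a \<Longrightarrow> a \<le> b \<Longrightarrow> sys_on \<sigma> \<tau> z a b p q"
  shows "is_solution \<sigma> \<tau> z q" and "0 < x \<Longrightarrow> quasi_deriv \<sigma> q x = p x"
proof -
  have AC: "p \<in> AC_loc" "q \<in> AC_loc"
    using s unfolding AC_loc_def sys_on_def by (auto intro: AC_with_abs_cont)
  have dp: "AE x in lebesgue. 0 < x \<longrightarrow> (p has_vector_derivative - of_real (\<sigma> x) * p x + (of_real (\<tau> x - (\<sigma> x)\<^sup>2) - z) * q x) (at x)"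
    by (rule AE_half_lineI, rule AC_with_derivative_AE) (use s in \<open>simp add: sys_on_def\<close>)
  have dq: "AE x in lebesgue. 0 < x \<longrightarrow> (q has_vector_derivative p x + of_real (\<sigma> x) * q x) (at x)"
    by (rule AE_half_lineI, rule AC_with_derivative_AE) (use s in \<open>simp add: sys_on_def\<close>)
  have qd: "is_quasi_deriv \<sigma> q p" unfolding is_quasi_deriv_def
    using AC(1) dq by (auto elim!: eventually_mono dest: vector_derivative_at)
  define v where "v = quasi_deriv \<sigma> q"
  have "is_quasi_deriv \<sigma> q v" unfolding v_def quasi_deriv_def by (rule someI[of "is_quasi_deriv \<sigma> q", OF qd])
  then have v: "v \<in> AC_loc" "AE x in lebesgue. 0 < x \<longrightarrow> v x = vector_derivative q (at x) - of_real (\<sigma> x) * q x"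
    unfolding is_quasi_deriv_def by auto
  have "AE x in lebesgue. 0 < x \<longrightarrow> v x = p x"
    using v(2) qd[unfolded is_quasi_deriv_def, THEN conjunct2] by eventually_elim auto
  then have vp: "v x = p x" if "0 < x" for x
    by (rule AE_eq_continuous_imp_eq[OF AC_loc_continuous[OF v(1)] AC_loc_continuous[OF AC(1)] _ that])
  then show "0 < x \<Longrightarrow> quasi_deriv \<sigma> q x = p x" by (simp add: v_def)
  have "AE x in lebesgue. 0 < x \<longrightarrow> ell \<sigma> \<tau> q x = z * q x" using dp
  proof eventually_elim
    case (elim x)
    show ?case
    proof
      assume x: "0 < x"
      have "(v has_vector_derivative - of_real (\<sigma> x) * p x + (of_real (\<tau> x - (\<sigma> x)\<^sup>2) - z) * q x) (at x)"
        by (rule has_vector_derivative_transform_within_open[OF elim[rule_format, OF x] open_greaterThan[of 0]]) (use x vp in auto)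
      then have "vector_derivative v (at x) = - of_real (\<sigma> x) * p x + (of_real (\<tau> x - (\<sigma> x)\<^sup>2) - z) * q x"
        by (rule vector_derivative_at)
      then show "ell \<sigma> \<tau> q x = z * q x" unfolding ell_def v_def[symmetric] using vp[OF x] by (simp add: algebra_simps)
    qed
  qed
  then show "is_solution \<sigma> \<tau> z q" using AC qd unfolding is_solution_def DD_def by auto
qed

lemma sol_is_solution:
  "is_solution \<sigma> \<tau> z (sol2 c1 c2 z)" "0 < x \<Longrightarrow> quasi_deriv \<sigma> (sol2 c1 c2 z) x = sol1 c1 c2 z x"
proof -
  have "sys_on \<sigma> \<tau> z a b (sol1 c1 c2 z) (sol2 c1 c2 z)" if "0 < a" "a \<le> b" for a b
    using sys_on_subset[OF sol_sys(1)[of b z c1 c2], of a b] that by simp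
  from sys_on_is_solution[OF this] show "is_solution \<sigma> \<tau> z (sol2 c1 c2 z)" "0 < x \<Longrightarrow> quasi_deriv \<sigma> (sol2 c1 c2 z) x = sol1 c1 c2 z x"
    by blast+
qed

text \<open>A solution is controlled for \<open>x > 0\<close> only, so its coefficients are read off
  at \<open>x = 1\<close>. Since Wronskians are constant, the same coefficients represent it to the
  left of 1, and this extends it continuously to 0.\<close>

lemma is_solution_repr:
  assumes u: "is_solution \<sigma> \<tau> z u"
  obtains c1 c2 where "\<And>x. 0 < x \<Longrightarrow> u x = sol2 c1 c2 z x" "\<And>x. 0 < x \<Longrightarrow> quasi_deriv \<sigma> u x = sol1 c1 c2 z x"
proof -
  let ?v = "quasi_deriv \<sigma> u"
  define c1 where "c1 = ?v 1 * q2 z 1 - u 1 * p2 z 1"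
  define c2 where "c2 = p1 z 1 * u 1 - q1 z 1 * ?v 1"
  have up: "u x = sol2 c1 c2 z x \<and> ?v x = sol1 c1 c2 z x" if "1 \<le> x" for x
    using sys_on_repr[OF is_solution_sys_on[OF u zero_less_one that], of x] that sol_eq[of x c1 c2 z]
    by (simp add: c1_def c2_def)
  have dn: "u x = sol2 c1 c2 z x \<and> ?v x = sol1 c1 c2 z x" if x: "0 < x" "x \<le> 1" for x
  proof -
    have s: "sys_on \<sigma> \<tau> z x 1 ?v u" by (rule is_solution_sys_on[OF u x])
    have S: "sys_on \<sigma> \<tau> z x 1 (sol1 d1 d2 z) (sol2 d1 d2 z)" for d1 d2
      using sys_on_subset[OF sol_sys(1)[of 1 z d1 d2], of x 1] x by simp
    have A: "c1 = ?v x * q2 z x - u x * p2 z x" unfolding c1_def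
      using sys_on_wronskian[OF s S, of 1 0 1] x by simp
    have B: "c2 = p1 z x * u x - q1 z x * ?v x" unfolding c2_def
      using sys_on_wronskian[OF S s, of 1 1 0] x by simp
    show ?thesis using sys_on_repr[OF s, of x] x sol_eq[of x c1 c2 z] unfolding A B by simp
  qed
  show thesis
  proof (rule that[of c1 c2])
    show "u x = sol2 c1 c2 z x" "quasi_deriv \<sigma> u x = sol1 c1 c2 z x" if "0 < x" for x
      using up[of x] dn[of x] that by linarith+
  qed
qed

end

section \<open>The Weyl solution\<close>

text \<open>
  In the coordinates \<open>e p\<close>, \<open>q / e\<close> with \<open>e = exp (\<integral> \<sigma>)\<close> the system has no diagonal part, so if \<open>q\<close>
  is small on a unit interval then \<open>e p\<close> is nearly constant there and \<open>q / e\<close> grows linearly.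
\<close>

lemma (in sl_coeffs) solution_lower_bound:
  assumes R: "0 \<le> R"
  obtains c where "c > 0" "\<And>z x p q. \<lbrakk>norm z \<le> R; 0 \<le> x; sys_on \<sigma> \<tau> z x (x + 1) p q\<rbrakk> \<Longrightarrow>
     c * ((norm (p x))\<^sup>2 + (norm (q x))\<^sup>2) \<le> integral {x..x+1} (\<lambda>t. (norm (q t))\<^sup>2)"
proof -
  obtain K where K: "K \<ge> 0" "\<And>x. x \<ge> 0 \<Longrightarrow> \<kappa> absolutely_integrable_on {x..x+1} \<and> integral {x..x+1} \<kappa> \<le> K"
    using \<kappa>_unif by blast
  \<comment> \<open>The chain of constants, with \<open>\<eta>\<close> the maximum of
    \<open>|q|\<close> on the interval: \<open>M\<close> bounds \<open>e\<close> and
    \<open>f = 1 / e\<close>, \<open>A * \<eta>\<close> the deviation of \<open>P = e p\<close> from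
    \<open>p x\<close>, \<open>C1 * \<eta>\<close> the value \<open>|p x|\<close>,
    \<open>C2 * \<eta>\<close> the whole of \<open>|p|\<close>, and \<open>D\<close> limits how fast
    \<open>|q|\<close> can leave its maximum. The width \<open>d\<close> is chosen so that
    \<open>d * D = 1 / 4\<close>.\<close>
  define M where "M = exp K"
  have M: "M \<ge> 1" using K(1) by (simp add: M_def)
  define A where "A = M * (K + R)"
  have A: "A \<ge> 0" using M K R by (simp add: A_def)
  define C1 where "C1 = M\<^sup>2 * (M + 1 + M\<^sup>2 * A)"
  define C2 where "C2 = M * (C1 + A)"
  have C1: "C1 \<ge> 0" and C2: "C2 \<ge> 0" using M A by (simp_all add: C1_def C2_def)
  define D where "D = C2 + K + 1"
  have D: "D \<ge> 1" using C2 K by (simp add: D_def)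
  define d where "d = 1 / (4 * D)"
  have d: "0 < d" "d \<le> 1 / 4" "d * D = 1 / 4" using D by (auto simp: d_def field_simps)
  define c where "c = d / (4 * (C1\<^sup>2 + 1))"
  have c: "c > 0" using d by (auto simp: c_def intro!: divide_pos_pos add_nonneg_pos)
  show thesis
  proof (rule that[OF c])
    fix z p q and x :: real
    assume z: "norm z \<le> R" and x: "0 \<le> x" and s: "sys_on \<sigma> \<tau> z x (x + 1) p q"
    let ?I = "{x..x + 1}"
    have xx: "x \<le> x + 1" by simp
    have pc: "continuous_on ?I p" and qc: "continuous_on ?I q"
      using s unfolding sys_on_def by (auto intro: AC_with_continuous)
    have ki: "\<kappa> integrable_on {s..t}" if "x \<le> s" "t \<le> x + 1" for s t
      using set_lebesgue_integral_eq_integral(1)[OF \<kappa>_int[of s t]] that x by simp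
    have kle: "integral {s..t} \<kappa> \<le> K" if "x \<le> s" "t \<le> x + 1" for s t
    proof -
      have "integral {s..t} \<kappa> \<le> integral ?I \<kappa>"
        using that \<kappa>_ge by (intro integral_subset_le ki) (auto intro: order_trans[of 0 2])
      then show ?thesis using K(2)[OF x] by linarith
    qed
    define \<Sigma> where "\<Sigma> t = integral {x..t} (\<lambda>t. complex_of_real (\<sigma> t))" for t
    define S where "S t = integral {x..t} \<sigma>" for t
    have si: "\<sigma> integrable_on {x..t}" for t using set_lebesgue_integral_eq_integral(1)[OF coeff_int(3)[OF x]] .
    have \<Sigma>S: "\<Sigma> t = of_real (S t)" for t
      unfolding \<Sigma>_def S_def using integral_linear[OF si bounded_linear_of_real] by (simp add: o_def)
    have Sb: "\<bar>S t\<bar> \<le> K" if "t \<in> ?I" for t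
    proof -
      have "norm (integral {x..t} \<sigma>) \<le> integral {x..t} \<kappa>"
        using \<kappa>_bounds(1) that by (intro integral_norm_bound_integral si ki) auto
      also have "\<dots> \<le> K" using that by (intro kle) auto
      finally show ?thesis by (simp add: S_def)
    qed
    have \<Sigma>A: "AC_with x (x + 1) \<Sigma> (\<lambda>t. complex_of_real (\<sigma> t))"
      using AC_with_indefinite[OF coeff_int(1)[OF x, of "x + 1"], of 0] by (simp add: \<Sigma>_def[abs_def])
    have \<Sigma>A': "AC_with x (x + 1) (\<lambda>t. - \<Sigma> t) (\<lambda>t. - complex_of_real (\<sigma> t))"
      using AC_with_cmult[OF \<Sigma>A, of "-1"] by simp
    define e where "e t = exp (\<Sigma> t)" for t
    define f where "f t = exp (- \<Sigma> t)" for t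
    have ef: "e t * f t = 1" for t by (simp add: e_def f_def exp_minus)
    have eA: "AC_with x (x + 1) e (\<lambda>t. of_real (\<sigma> t) * e t)"
      unfolding e_def[abs_def] by (rule AC_with_exp[OF \<Sigma>A xx])
    have fA: "AC_with x (x + 1) f (\<lambda>t. - of_real (\<sigma> t) * f t)"
      unfolding f_def[abs_def] by (rule AC_with_exp[OF \<Sigma>A' xx])
    have en: "norm (e t) \<le> M" and fn: "norm (f t) \<le> M" if "t \<in> ?I" for t
      using Sb[OF that] by (auto simp: e_def f_def \<Sigma>S M_def)
    have f2: "f t * f t = of_real (exp (- 2 * S t))" for t
      by (simp add: f_def \<Sigma>S exp_add[symmetric] exp_of_real[symmetric])
    have f2l: "1 / M\<^sup>2 \<le> exp (- 2 * S t)" if "t \<in> ?I" for t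
    proof -
      have "1 / M\<^sup>2 = exp (- 2 * K)" by (simp add: M_def exp_minus exp_double[symmetric] inverse_eq_divide)
      then show ?thesis using Sb[OF that] by simp
    qed
    have x0: "x \<in> ?I" by simp
    have e0: "e x = 1" "f x = 1" by (simp_all add: e_def f_def \<Sigma>_def)
    define P where "P t = e t * p t" for t
    define H where "H t = f t * q t" for t
    have PA: "AC_with x (x + 1) P (\<lambda>t. e t * ((of_real (\<tau> t - (\<sigma> t)\<^sup>2) - z) * q t))"
      unfolding P_def[abs_def]
      by (rule AC_with_cong[OF AC_with_mult[OF eA conjunct1[OF s[unfolded sys_on_def]] xx]]) (simp_all add: algebra_simps)
    have HA: "AC_with x (x + 1) H (\<lambda>t. f t * f t * P t)"
    proof (unfold H_def[abs_def], rule AC_with_cong[OF AC_with_mult[OF fA conjunct2[OF s[unfolded sys_on_def]] xx]])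
      fix t
      have "f t * f t * P t = f t * (e t * f t) * p t" unfolding P_def by (simp only: mult_ac)
      then have ffP: "f t * f t * P t = f t * p t" unfolding ef by simp
      show "f t * (p t + of_real (\<sigma> t) * q t) + - of_real (\<sigma> t) * f t * q t = f t * f t * P t"
        unfolding ffP by (simp add: algebra_simps)
    qed simp
    obtain t0 where t0: "t0 \<in> ?I" "\<And>t. t \<in> ?I \<Longrightarrow> norm (q t) \<le> norm (q t0)"
    proof -
      have "continuous_on ?I (\<lambda>t. norm (q t))" by (intro continuous_intros qc)
      moreover have "?I \<noteq> {}" by simp
      ultimately show ?thesis using continuous_attains_sup[OF compact_Icc, of x "x + 1" "\<lambda>t. norm (q t)"] that by blast
    qed
    define \<eta> where "\<eta> = norm (q t0)"
    have \<eta>: "\<eta> \<ge> 0" by (simp add: \<eta>_def)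
    have Pd: "norm (P t - p x) \<le> A * \<eta>" if t: "t \<in> ?I" for t
    proof -
      have Peq: "P t - P x = integral {x..t} (\<lambda>t. e t * ((of_real (\<tau> t - (\<sigma> t)\<^sup>2) - z) * q t))"
        by (rule AC_with_diff(1)[OF PA]) (use t in auto)
      have i: "(\<lambda>t. e t * ((of_real (\<tau> t - (\<sigma> t)\<^sup>2) - z) * q t)) integrable_on {x..t}"
        using set_lebesgue_integral_eq_integral(1)[OF AC_with_diff(2)[OF PA]] t by auto
      have "norm (integral {x..t} (\<lambda>t. e t * ((of_real (\<tau> t - (\<sigma> t)\<^sup>2) - z) * q t))) \<le> integral {x..t} (\<lambda>s. (M * \<eta>) * (\<kappa> s + R))"
      proof (rule integral_norm_bound_integral[OF i])
        show "(\<lambda>s. (M * \<eta>) * (\<kappa> s + R)) integrable_on {x..t}"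
          using t by (intro integrable_on_mult_right integrable_add ki) auto
        fix s assume "s \<in> {x..t}"
        then have s: "s \<in> ?I" using t by auto
        have "norm (of_real (\<tau> s - (\<sigma> s)\<^sup>2) - z) \<le> \<bar>\<tau> s - (\<sigma> s)\<^sup>2\<bar> + norm z"
          using norm_triangle_ineq4[of "of_real (\<tau> s - (\<sigma> s)\<^sup>2)" z] unfolding norm_of_real .
        then have "norm (of_real (\<tau> s - (\<sigma> s)\<^sup>2) - z) \<le> \<kappa> s + R" using \<kappa>_bounds(2)[of s] z by linarith
        then have "norm (e s) * (norm (of_real (\<tau> s - (\<sigma> s)\<^sup>2) - z) * norm (q s)) \<le> M * ((\<kappa> s + R) * \<eta>)"
          using en[OF s] t0(2)[OF s] M \<kappa>_ge[of s] R unfolding \<eta>_def by (intro mult_mono) auto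
        then show "norm (e s * ((of_real (\<tau> s - (\<sigma> s)\<^sup>2) - z) * q s)) \<le> (M * \<eta>) * (\<kappa> s + R)"
          by (simp only: norm_mult) (simp only: mult_ac)
      qed
      also have "integral {x..t} (\<lambda>s. (M * \<eta>) * (\<kappa> s + R)) = (M * \<eta>) * (integral {x..t} \<kappa> + R * (t - x))"
        using ki[of x t] t by (subst integral_mult_right, subst integral_add) auto
      also have "\<dots> \<le> (M * \<eta>) * (K + R * 1)"
        using kle[of x t] t M \<eta> R by (intro mult_left_mono add_mono) auto
      also have "\<dots> = A * \<eta>" by (simp add: A_def algebra_simps)
      finally show ?thesis unfolding Peq[symmetric] by (simp add: P_def e0)
    qed
    \<comment> \<open>Replacing \<open>P\<close> by its initial value in the density
      \<open>f^2 P\<close> of \<open>H\<close> costs a multiple of \<open>\<eta>\<close>. Since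
      \<open>H\<close> itself is of order \<open>\<eta>\<close> and the integral of
      \<open>f^2\<close> is at least \<open>1 / M^2\<close>, the value \<open>p x\<close> must be of
      order \<open>\<eta>\<close> too.\<close>
    have px: "norm (p x) \<le> C1 * \<eta>"
    proof -
      have ff: "continuous_on ?I f" "continuous_on ?I P" using AC_with_continuous[OF fA] AC_with_continuous[OF PA] .
      have "H (x + 1) - H x = integral ?I (\<lambda>t. f t * f t * P t)" by (rule AC_with_diff(1)[OF HA]) auto
      also have "\<dots> = integral ?I (\<lambda>t. f t * f t * p x + f t * f t * (P t - p x))"
        by (rule arg_cong[where f = "integral ?I"]) (auto simp: algebra_simps)
      also have "\<dots> = integral ?I (\<lambda>t. f t * f t * p x) + integral ?I (\<lambda>t. f t * f t * (P t - p x))"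
        by (intro integral_add integrable_continuous_real continuous_intros ff)
      also have "integral ?I (\<lambda>t. f t * f t * p x) = of_real (integral ?I (\<lambda>t. exp (- 2 * S t))) * p x"
      proof -
        have "continuous_on ?I (\<lambda>t. Re (f t * f t))" by (intro continuous_intros ff)
        then have c: "continuous_on ?I (\<lambda>t. exp (- 2 * S t))" by (simp only: f2 Re_complex_of_real)
        have "integral ?I (\<lambda>t. complex_of_real (exp (- 2 * S t))) = of_real (integral ?I (\<lambda>t. exp (- 2 * S t)))"
          using integral_linear[OF integrable_continuous_real[OF c] bounded_linear_of_real] unfolding o_def .
        then show ?thesis unfolding f2 integral_mult_left by (simp only:)
      qed
      finally have Heq: "of_real (integral ?I (\<lambda>t. exp (- 2 * S t))) * p x = f (x + 1) * q (x + 1) - q x - integral ?I (\<lambda>t. f t * f t * (P t - p x))"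
        by (simp add: H_def e0 algebra_simps)
      have "norm (integral ?I (\<lambda>t. f t * f t * (P t - p x))) \<le> integral ?I (\<lambda>t. M\<^sup>2 * (A * \<eta>))"
      proof (rule integral_norm_bound_integral)
        show "(\<lambda>t. f t * f t * (P t - p x)) integrable_on ?I" by (intro integrable_continuous_real continuous_intros ff)
        fix t assume t: "t \<in> ?I"
        show "norm (f t * f t * (P t - p x)) \<le> M\<^sup>2 * (A * \<eta>)"
          unfolding norm_mult power2_eq_square using fn[OF t] Pd[OF t] M by (intro mult_mono) auto
      qed (rule integrable_const_ivl)
      then have b1: "norm (integral ?I (\<lambda>t. f t * f t * (P t - p x))) \<le> M\<^sup>2 * (A * \<eta>)" by simp
      have "norm (f (x + 1) * q (x + 1)) \<le> M * \<eta>"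
        unfolding norm_mult \<eta>_def using fn[of "x + 1"] t0(2)[of "x + 1"] M by (intro mult_mono) auto
      moreover have "norm (q x) \<le> \<eta>" unfolding \<eta>_def using t0(2)[OF x0] .
      ultimately have up: "norm (of_real (integral ?I (\<lambda>t. exp (- 2 * S t))) * p x) \<le> M * \<eta> + \<eta> + M\<^sup>2 * (A * \<eta>)"
        unfolding Heq using b1 norm_triangle_ineq4[of "f (x + 1) * q (x + 1) - q x" "integral ?I (\<lambda>t. f t * f t * (P t - p x))"]
          norm_triangle_ineq4[of "f (x + 1) * q (x + 1)" "q x"] by linarith
      have "integral ?I (\<lambda>t. 1 / M\<^sup>2) \<le> integral ?I (\<lambda>t. exp (- 2 * S t))"
      proof (rule integral_le[OF integrable_const_ivl])
        have "continuous_on ?I (\<lambda>t. Re (f t * f t))" by (intro continuous_intros ff)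
        then have "continuous_on ?I (\<lambda>t. exp (- 2 * S t))" by (simp only: f2 Re_complex_of_real)
        then show "(\<lambda>t. exp (- 2 * S t)) integrable_on ?I" by (rule integrable_continuous_real)
      qed (rule f2l)
      then have "1 / M\<^sup>2 \<le> integral ?I (\<lambda>t. exp (- 2 * S t))" by simp
      then have "1 / M\<^sup>2 * norm (p x) \<le> \<bar>integral ?I (\<lambda>t. exp (- 2 * S t))\<bar> * norm (p x)"
        by (intro mult_right_mono) auto
      also have "\<dots> \<le> M * \<eta> + \<eta> + M\<^sup>2 * (A * \<eta>)" using up by (simp only: norm_mult norm_of_real)
      finally have "norm (p x) \<le> M\<^sup>2 * (M * \<eta> + \<eta> + M\<^sup>2 * (A * \<eta>))" using M by (simp add: divide_le_eq mult.commute)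
      then show ?thesis by (simp add: C1_def algebra_simps)
    qed
    have pt: "norm (p t) \<le> C2 * \<eta>" if t: "t \<in> ?I" for t
    proof -
      have "p t = f t * P t" unfolding P_def using ef[of t] by (metis mult.assoc mult.commute mult_1)
      then have "norm (p t) = norm (f t) * norm (P t)" by (simp only: norm_mult)
      also have "\<dots> \<le> M * (C1 * \<eta> + A * \<eta>)"
      proof (rule mult_mono)
        show "norm (P t) \<le> C1 * \<eta> + A * \<eta>" using Pd[OF t] px norm_triangle_ineq2[of "P t" "p x"] by linarith
      qed (use fn[OF t] M in auto)
      finally show ?thesis by (simp add: C2_def algebra_simps)
    qed
    have qd: "norm (q t - q s) \<le> \<eta> * (D * (t - s) + 1 / 4)" if st: "x \<le> s" "s \<le> t" "t \<le> x + 1" for s t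
    proof -
      have qeq: "q t - q s = integral {s..t} (\<lambda>t. p t + of_real (\<sigma> t) * q t)"
        by (rule AC_with_diff(1)[OF conjunct2[OF s[unfolded sys_on_def]] st])
      have i: "(\<lambda>t. p t + of_real (\<sigma> t) * q t) integrable_on {s..t}"
        using set_lebesgue_integral_eq_integral(1)[OF AC_with_diff(2)[OF conjunct2[OF s[unfolded sys_on_def]] st]] .
      have "norm (integral {s..t} (\<lambda>t. p t + of_real (\<sigma> t) * q t)) \<le> integral {s..t} (\<lambda>v. \<eta> * ((C2 + (K + 1)) + \<kappa> v / (4 * (K + 1))))"
      proof (rule integral_norm_bound_integral[OF i])
        show "(\<lambda>v. \<eta> * ((C2 + (K + 1)) + \<kappa> v / (4 * (K + 1)))) integrable_on {s..t}"
          using st by (intro integrable_on_mult_right integrable_add integrable_on_divide ki) auto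
        fix v assume "v \<in> {s..t}"
        then have v: "v \<in> ?I" using st by auto
        \<comment> \<open>Young's inequality: \<open>|\<sigma>|\<close> has no pointwise bound, so
          it is split into the constant \<open>K + 1\<close> and
          \<open>\<kappa> / (4 * (K + 1))\<close>, whose integral is at most 1/4.\<close>
        have "0 \<le> (\<bar>\<sigma> v\<bar> - 2 * (K + 1))\<^sup>2" by simp
        then have "4 * (K + 1) * \<bar>\<sigma> v\<bar> \<le> (\<sigma> v)\<^sup>2 + 4 * (K + 1)\<^sup>2" by (simp add: power2_eq_square algebra_simps)
        then have "4 * (K + 1) * \<bar>\<sigma> v\<bar> \<le> \<kappa> v + 4 * (K + 1) * (K + 1)" using \<kappa>_bounds(3)[of v]
          unfolding power2_eq_square[of "K + 1"] mult.assoc by linarith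
        then have sv: "\<bar>\<sigma> v\<bar> \<le> (K + 1) + \<kappa> v / (4 * (K + 1))" using K(1) by (simp add: field_simps)
        have "norm (p v + of_real (\<sigma> v) * q v) \<le> norm (p v) + \<bar>\<sigma> v\<bar> * norm (q v)"
          using norm_triangle_ineq[of "p v" "of_real (\<sigma> v) * q v"] by (simp add: norm_mult)
        also have "\<dots> \<le> C2 * \<eta> + ((K + 1) + \<kappa> v / (4 * (K + 1))) * \<eta>"
          using sv t0(2)[OF v] unfolding \<eta>_def[symmetric] by (intro add_mono pt[OF v] mult_mono) (use \<eta> in auto)
        finally show "norm (p v + of_real (\<sigma> v) * q v) \<le> \<eta> * ((C2 + (K + 1)) + \<kappa> v / (4 * (K + 1)))" by (simp add: algebra_simps)
      qed
      also have "integral {s..t} (\<lambda>v. \<eta> * ((C2 + (K + 1)) + \<kappa> v / (4 * (K + 1)))) = \<eta> * ((C2 + (K + 1)) * (t - s) + integral {s..t} \<kappa> / (4 * (K + 1)))"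
        using ki[of s t] st by (subst integral_mult_right, subst integral_add) (auto intro: integrable_on_divide)
      also have "\<dots> \<le> \<eta> * (D * (t - s) + 1 / 4)"
      proof (intro mult_left_mono[OF _ \<eta>] add_mono)
        show "(C2 + (K + 1)) * (t - s) \<le> D * (t - s)" by (simp add: D_def algebra_simps)
        show "integral {s..t} \<kappa> / (4 * (K + 1)) \<le> 1 / 4" using kle[of s t] st K(1) by (simp add: field_simps)
      qed
      finally show ?thesis unfolding qeq .
    qed
    have half: "\<eta> / 2 \<le> norm (q t)" if t: "t \<in> ?I" "\<bar>t - t0\<bar> \<le> d" for t
    proof -
      have "norm (q t - q t0) \<le> \<eta> * (D * \<bar>t - t0\<bar> + 1 / 4)"
        using qd[of t t0] qd[of t0 t] t t0(1) by (cases "t \<le> t0") (auto simp: norm_minus_commute)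
      also have "\<dots> \<le> \<eta> * (D * d + 1 / 4)" using t D \<eta> by (intro mult_left_mono add_mono) auto
      also have "\<dots> = \<eta> / 2" using d(3) by (simp add: mult.commute)
      finally have "norm (q t - q t0) \<le> \<eta> / 2" .
      then show ?thesis using norm_triangle_ineq2[of "q t0" "q t"] unfolding \<eta>_def[symmetric] by (simp add: norm_minus_commute)
    qed
    \<comment> \<open>A window of length \<open>d\<close> on whichever side of \<open>t0\<close>
      fits into the unit interval; there \<open>|q|\<close> stays above
      \<open>\<eta> / 2\<close>.\<close>
    define l where "l = (if t0 + d \<le> x + 1 then t0 else t0 - d)"
    have l: "x \<le> l" "l + d \<le> x + 1" "\<And>t. t \<in> {l..l + d} \<Longrightarrow> \<bar>t - t0\<bar> \<le> d"
    proof -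
      show "x \<le> l" "l + d \<le> x + 1" using t0(1) d by (auto simp: l_def)
      show "\<bar>t - t0\<bar> \<le> d" if "t \<in> {l..l + d}" for t
        using that d by (cases "t0 + d \<le> x + 1") (auto simp: l_def)
    qed
    have qi: "(\<lambda>t. (norm (q t))\<^sup>2) integrable_on {s..t}" if "x \<le> s" "t \<le> x + 1" for s t
      using continuous_on_subset[OF qc, of "{s..t}"] that by (intro integrable_continuous_real continuous_intros) auto
    have "d * (\<eta> / 2)\<^sup>2 = integral {l..l + d} (\<lambda>t. (\<eta> / 2)\<^sup>2)" using d by simp
    also have "\<dots> \<le> integral {l..l + d} (\<lambda>t. (norm (q t))\<^sup>2)"
      using l half \<eta> by (intro integral_le qi integrable_const_ivl power_mono) auto
    also have "\<dots> \<le> integral ?I (\<lambda>t. (norm (q t))\<^sup>2)" using l by (intro integral_subset_le qi) auto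
    finally have low: "d * (\<eta> / 2)\<^sup>2 \<le> integral ?I (\<lambda>t. (norm (q t))\<^sup>2)" .
    have "(norm (p x))\<^sup>2 + (norm (q x))\<^sup>2 \<le> (C1 * \<eta>)\<^sup>2 + \<eta>\<^sup>2"
      using px t0(2)[OF x0] unfolding \<eta>_def[symmetric] by (intro add_mono power_mono) auto
    then have "c * ((norm (p x))\<^sup>2 + (norm (q x))\<^sup>2) \<le> c * ((C1 * \<eta>)\<^sup>2 + \<eta>\<^sup>2)" using c by (intro mult_left_mono) auto
    also have "\<dots> = (c * (4 * (C1\<^sup>2 + 1))) * (\<eta> / 2)\<^sup>2" by (simp add: power_mult_distrib power_divide algebra_simps)
    also have "c * (4 * (C1\<^sup>2 + 1)) = d"
    proof -
      have "4 * (C1\<^sup>2 + 1) \<noteq> 0" by (simp add: add_nonneg_eq_0_iff)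
      then show ?thesis unfolding c_def by (rule nonzero_eq_divide_eq[THEN iffD1]) simp
    qed
    finally show "c * ((norm (p x))\<^sup>2 + (norm (q x))\<^sup>2) \<le> integral ?I (\<lambda>t. (norm (q t))\<^sup>2)" using low by linarith
  qed
qed

text \<open>Multiplying \<open>q Q\<close> by the conjugate of \<open>Q p - P q = 1\<close> turns it
  into \<open>|Q|^2 q cnj p - |q|^2 Q cnj P\<close>, whose imaginary part is a sum of two
  nonnegative terms; the second alone gives the quadratic lower bound. It is this bound that later
  limits the Green functions at \<open>z = \<i>\<close>.\<close>

lemma green_identity:
  fixes p q P Q :: complex
  assumes W: "P * q - Q * p = -1" and Y: "Im (p * cnj q) \<le> 0" and \<Psi>: "k * ((norm P)\<^sup>2 + (norm Q)\<^sup>2) \<le> Im (P * cnj Q)" and k: "k \<ge> 0"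
  shows "k * (norm (q * Q))\<^sup>2 \<le> Im (q * Q)" "k * (norm (p * P))\<^sup>2 \<le> Im (p * P)"
proof -
  have W1: "cnj (Q * p - P * q) = 1" using arg_cong[OF W, of "\<lambda>z. cnj (- z)"] by simp
  have n: "z * cnj z = of_real ((norm z)\<^sup>2)" for z by (simp only: complex_norm_square)
  have Imr: "Im (of_real r * w) = r * Im w" for r w by simp
  have "q * Q = q * Q * cnj (Q * p - P * q)" unfolding W1 by simp
  also have "\<dots> = (Q * cnj Q) * (q * cnj p) - (q * cnj q) * (Q * cnj P)" by (simp add: algebra_simps)
  finally have e1: "Im (q * Q) = (norm Q)\<^sup>2 * Im (q * cnj p) - (norm q)\<^sup>2 * Im (Q * cnj P)"
    unfolding n by (metis (no_types) Imr minus_complex.simps(2))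
  have fl: "Im (q * cnj p) = - Im (p * cnj q)" "Im (Q * cnj P) = - Im (P * cnj Q)" by simp_all
  have 1: "Im (q * Q) = (norm Q)\<^sup>2 * (- Im (p * cnj q)) + (norm q)\<^sup>2 * Im (P * cnj Q)" unfolding e1 fl by linarith
  have "k * (norm Q)\<^sup>2 \<le> Im (P * cnj Q)" using \<Psi> k by (simp add: distrib_left) (smt (verit) mult_nonneg_nonneg zero_le_power2)
  then have "(norm q)\<^sup>2 * (k * (norm Q)\<^sup>2) \<le> (norm q)\<^sup>2 * Im (P * cnj Q)" by (intro mult_left_mono) auto
  moreover have "0 \<le> (norm Q)\<^sup>2 * (- Im (p * cnj q))" using Y by (intro mult_nonneg_nonneg) auto
  ultimately show "k * (norm (q * Q))\<^sup>2 \<le> Im (q * Q)" unfolding 1 by (simp add: norm_mult power_mult_distrib mult_ac)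
  have "p * P = p * P * cnj (Q * p - P * q)" unfolding W1 by simp
  also have "\<dots> = (p * cnj p) * (P * cnj Q) - (P * cnj P) * (p * cnj q)" by (simp add: algebra_simps)
  finally have e2: "Im (p * P) = (norm p)\<^sup>2 * Im (P * cnj Q) - (norm P)\<^sup>2 * Im (p * cnj q)"
    unfolding n by (metis (no_types) Imr minus_complex.simps(2))
  have 2: "Im (p * P) = (norm p)\<^sup>2 * Im (P * cnj Q) + (norm P)\<^sup>2 * (- Im (p * cnj q))" unfolding e2 by linarith
  have "k * (norm P)\<^sup>2 \<le> Im (P * cnj Q)" using \<Psi> k by (simp add: distrib_left) (smt (verit) mult_nonneg_nonneg zero_le_power2)
  then have "(norm p)\<^sup>2 * (k * (norm P)\<^sup>2) \<le> (norm p)\<^sup>2 * Im (P * cnj Q)" by (intro mult_left_mono) auto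
  moreover have "0 \<le> (norm P)\<^sup>2 * (- Im (p * cnj q))" using Y by (intro mult_nonneg_nonneg) auto
  ultimately show "k * (norm (p * P))\<^sup>2 \<le> Im (p * P)" unfolding 2 by (simp add: norm_mult power_mult_distrib mult_ac)
qed

section \<open>Weyl's construction of \<open>m\<close> by truncation\<close>

locale sl_boundary = sl_coeffs +
  fixes \<alpha> :: real
begin

definition "ca = complex_of_real (cos \<alpha>)"
definition "sa = complex_of_real (sin \<alpha>)"

lemma casa: "ca * ca + sa * sa = 1"
  unfolding ca_def sa_def by (simp only: of_real_mult[symmetric] of_real_add[symmetric])
    (simp add: power2_eq_square[symmetric])

definition "pa z x = sol1 ca (- sa) z x"
definition "qa z x = sol2 ca (- sa) z x"
definition "pb z x = sol1 sa ca z x"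
definition "qb z x = sol2 sa ca z x"

lemma ab_sys: "0 \<le> X \<Longrightarrow> sys_on \<sigma> \<tau> z 0 X (pa z) (qa z)" "0 \<le> X \<Longrightarrow> sys_on \<sigma> \<tau> z 0 X (pb z) (qb z)"
  unfolding pa_def[abs_def] qa_def[abs_def] pb_def[abs_def] qb_def[abs_def] by (rule sol_sys(1); assumption)+

lemma ab_init: "pa z 0 = ca" "qa z 0 = - sa" "pb z 0 = sa" "qb z 0 = ca"
  unfolding pa_def qa_def pb_def qb_def by (simp_all add: sol_sys(2,3)[OF order_refl])

lemma ab_holo:
  assumes "0 \<le> x"
  shows "(\<lambda>z. pa z x) holomorphic_on A" "(\<lambda>z. qa z x) holomorphic_on A" "(\<lambda>z. pb z x) holomorphic_on A" "(\<lambda>z. qb z x) holomorphic_on A"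
  unfolding pa_def qa_def pb_def qb_def
  by (rule holomorphic_on_subset[OF sol_holomorphic(1)[OF assms]] holomorphic_on_subset[OF sol_holomorphic(2)[OF assms]]; simp)+

lemma ab_wronskian: "0 \<le> x \<Longrightarrow> pb z x * qa z x - qb z x * pa z x = -1"
proof -
  assume "0 \<le> x"
  then have "pb z x * qa z x - qb z x * pa z x = sa * (- sa) - ca * ca"
    using sys_on_wronskian[OF ab_sys(2)[of x z] ab_sys(1)[of x z], of x] by (simp add: ab_init)
  also have "\<dots> = - (ca * ca + sa * sa)" by simp
  finally show ?thesis unfolding casa .
qed

lemma ab_energy:
  assumes "0 \<le> x"
  shows "Im (pa z x * cnj (qa z x)) = - Im z * integral {0..x} (\<lambda>t. (norm (qa z t))\<^sup>2)"
    "Im (pb z x * cnj (qb z x)) = - Im z * integral {0..x} (\<lambda>t. (norm (qb z t))\<^sup>2)"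
  using sys_on_energy[OF ab_sys(1)[OF assms, of z], of x] sys_on_energy[OF ab_sys(2)[OF assms, of z], of x] assms
  by (simp_all add: ab_init ca_def sa_def)

text \<open>The parameter \<open>w\<close> is kept free so that the same identities serve the
  truncated values \<open>mn n z\<close> and the limit \<open>m z\<close>.\<close>

definition "psi1 w z x = pb z x + w * pa z x"
definition "psi2 w z x = qb z x + w * qa z x"

lemma psi_sys: "0 \<le> X \<Longrightarrow> sys_on \<sigma> \<tau> z 0 X (psi1 w z) (psi2 w z)"
  using sys_on_combination[OF ab_sys(2)[of X z] ab_sys(1)[of X z], of 1 w] by (simp add: psi1_def[abs_def] psi2_def[abs_def])

lemma psi_init: "psi1 w z 0 = sa + w * ca" "psi2 w z 0 = ca - w * sa"
  by (simp_all add: psi1_def psi2_def ab_init)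

lemma psi_energy:
  assumes "0 \<le> x"
  shows "Im (psi1 w z x * cnj (psi2 w z x)) = Im w - Im z * integral {0..x} (\<lambda>t. (norm (psi2 w z t))\<^sup>2)"
proof -
  have "Im (psi1 w z 0 * cnj (psi2 w z 0)) = Im w * (cos \<alpha> * cos \<alpha>) + Im w * (sin \<alpha> * sin \<alpha>)"
    unfolding psi_init ca_def sa_def by (simp add: algebra_simps)
  also have "\<dots> = Im w * ((cos \<alpha>)\<^sup>2 + (sin \<alpha>)\<^sup>2)" by (simp only: distrib_left power2_eq_square)
  also have "\<dots> = Im w" by simp
  finally show ?thesis using sys_on_energy[OF psi_sys[OF assms, of z w], of x] assms by simp
qed

lemma psi_wronskian: "0 \<le> x \<Longrightarrow> psi1 w z x * qa z x - psi2 w z x * pa z x = -1"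
  using ab_wronskian[of x z] by (simp add: psi1_def psi2_def algebra_simps)

lemma psi_wronskian_b: "0 \<le> x \<Longrightarrow> psi1 w z x * qb z x - psi2 w z x * pb z x = w"
proof -
  assume "0 \<le> x"
  have "psi1 w z x * qb z x - psi2 w z x * pb z x = - w * (pb z x * qa z x - qb z x * pa z x)"
    by (simp add: psi1_def psi2_def algebra_simps)
  then show ?thesis unfolding ab_wronskian[OF \<open>0 \<le> x\<close>] by simp
qed

lemma sys_continuous: "sys_on \<sigma> \<tau> z a b p q \<Longrightarrow> continuous_on {a..b} p" "sys_on \<sigma> \<tau> z a b p q \<Longrightarrow> continuous_on {a..b} q"
  unfolding sys_on_def by (blast intro: AC_with_continuous)+

lemma sq_int:
  assumes "\<And>X. 0 \<le> X \<Longrightarrow> sys_on \<sigma> \<tau> z 0 X p q" "0 \<le> s"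
  shows "(\<lambda>t. (norm (q t))\<^sup>2) integrable_on {s..t}"
proof (cases "0 \<le> t")
  case True
  then show ?thesis
    using continuous_on_subset[OF sys_continuous(2)[OF assms(1)[OF True]], of "{s..t}"] assms(2)
    by (intro integrable_continuous_real continuous_intros) auto
next
  case False
  then have "{s..t} = {}" using assms(2) by simp
  then show ?thesis by (simp only: integrable_on_empty)
qed

lemmas qa_int = sq_int[OF ab_sys(1)] and psi_int = sq_int[OF psi_sys]

text \<open>The constant of \<open>solution_lower_bound\<close>, fixed once for each radius, so that
  bounds uniform in \<open>x\<close> can be stated across lemmas.\<close>

definition "coer R = (SOME c. c > 0 \<and> (\<forall>z x p q. norm z \<le> R \<longrightarrow> 0 \<le> x \<longrightarrow> sys_on \<sigma> \<tau> z x (x + 1) p q \<longrightarrow>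
     c * ((norm (p x))\<^sup>2 + (norm (q x))\<^sup>2) \<le> integral {x..x+1} (\<lambda>t. (norm (q t))\<^sup>2)))"

lemma coer:
  assumes "0 \<le> R"
  shows "coer R > 0" "\<lbrakk>norm z \<le> R; 0 \<le> x; sys_on \<sigma> \<tau> z x (x + 1) p q\<rbrakk> \<Longrightarrow>
     coer R * ((norm (p x))\<^sup>2 + (norm (q x))\<^sup>2) \<le> integral {x..x+1} (\<lambda>t. (norm (q t))\<^sup>2)"
proof -
  have "\<exists>c. c > 0 \<and> (\<forall>z x p q. norm z \<le> R \<longrightarrow> 0 \<le> x \<longrightarrow> sys_on \<sigma> \<tau> z x (x + 1) p q \<longrightarrow>
     c * ((norm (p x))\<^sup>2 + (norm (q x))\<^sup>2) \<le> integral {x..x+1} (\<lambda>t. (norm (q t))\<^sup>2))"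
    by (rule solution_lower_bound[OF assms]) blast
  from someI_ex[OF this] show "coer R > 0" "\<lbrakk>norm z \<le> R; 0 \<le> x; sys_on \<sigma> \<tau> z x (x + 1) p q\<rbrakk> \<Longrightarrow>
     coer R * ((norm (p x))\<^sup>2 + (norm (q x))\<^sup>2) \<le> integral {x..x+1} (\<lambda>t. (norm (q t))\<^sup>2)"
    unfolding coer_def by blast+
qed

text \<open>A quantitative form of the limit point property. By \<open>ab_energy\<close> the flux of
  \<open>a\<close> beyond \<open>x = 1\<close> is at least \<open>Im z * coer R\<close> in modulus,
  so \<open>|p|^2 + |q|^2\<close> stays away from 0 there, and \<open>coer\<close> makes every
  further unit interval contribute a fixed amount.\<close>

lemma qa_growth:
  assumes R: "0 \<le> R" "norm z \<le> R" and z: "Im z > 0"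
  shows "2 * (coer R)\<^sup>2 * Im z * real n \<le> integral {0..real n + 1} (\<lambda>t. (norm (qa z t))\<^sup>2)"
proof (induction n)
  case 0 show ?case by (simp add: integral_nonneg qa_int)
next
  case (Suc n)
  let ?c = "coer R" and ?f = "\<lambda>t. (norm (qa z t))\<^sup>2"
  define x where "x = real n + 1"
  have x: "1 \<le> x" by (simp add: x_def)
  have c: "?c > 0" by (rule coer[OF R(1)])
  have init: "(norm ca)\<^sup>2 + (norm (- sa))\<^sup>2 = 1" by (simp add: ca_def sa_def)
  have "?c * ((norm (pa z 0))\<^sup>2 + (norm (qa z 0))\<^sup>2) \<le> integral {0..0+1} ?f"
    by (rule coer(2)[OF R(1) R(2)]) (use ab_sys(1)[of 1 z] in auto)
  then have "?c \<le> integral {0..1} ?f" unfolding ab_init init by simp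
  also have "\<dots> \<le> integral {0..x} ?f" using x by (intro integral_subset_le qa_int) auto
  finally have "Im z * ?c \<le> Im z * integral {0..x} ?f" using z by (intro mult_left_mono) auto
  also have "\<dots> = - Im (pa z x * cnj (qa z x))" using ab_energy(1)[of x z] x by simp
  also have "\<dots> \<le> norm (pa z x * cnj (qa z x))" using abs_Im_le_cmod[of "pa z x * cnj (qa z x)"] by linarith
  also have "\<dots> = norm (pa z x) * norm (qa z x)" by (simp add: norm_mult)
  finally have "Im z * ?c \<le> norm (pa z x) * norm (qa z x)" .
  moreover have "2 * (norm (pa z x) * norm (qa z x)) \<le> (norm (pa z x))\<^sup>2 + (norm (qa z x))\<^sup>2"
    using sum_squares_bound[of "norm (pa z x)" "norm (qa z x)"] by (simp add: mult.assoc)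
  ultimately have "2 * (Im z * ?c) \<le> (norm (pa z x))\<^sup>2 + (norm (qa z x))\<^sup>2" by linarith
  then have "?c * (2 * (Im z * ?c)) \<le> ?c * ((norm (pa z x))\<^sup>2 + (norm (qa z x))\<^sup>2)" using c by (intro mult_left_mono) auto
  also have "\<dots> \<le> integral {x..x+1} ?f"
    by (rule coer(2)[OF R(1) R(2)]) (use sys_on_subset[OF ab_sys(1)[of "x + 1" z], of x "x + 1"] x in auto)
  finally have "2 * ?c\<^sup>2 * Im z \<le> integral {x..x+1} ?f" by (simp add: power2_eq_square mult_ac)
  moreover have "integral {0..x} ?f + integral {x..x+1} ?f = integral {0..x+1} ?f"
    using x by (intro Henstock_Kurzweil_Integration.integral_combine qa_int) auto
  ultimately show ?case using Suc by (simp add: x_def algebra_simps)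
qed

text \<open>The Weyl coefficient of the problem truncated at \<open>n\<close> with a Dirichlet
  condition there.\<close>

definition "mn n z = - qb z (real n) / qa z (real n)"

text \<open>At a zero the flux vanishes, so \<open>a\<close> would have no mass on
  \<open>[0, x]\<close>, against \<open>coer\<close>. In other terms, the truncated problem has no
  eigenvalue in the upper half-plane.\<close>

lemma qa_nonzero:
  assumes z: "Im z > 0" and x: "1 \<le> x" shows "qa z x \<noteq> 0"
proof
  assume "qa z x = 0"
  then have "Im z * integral {0..x} (\<lambda>t. (norm (qa z t))\<^sup>2) = 0" using ab_energy(1)[of x z] x by simp
  then have I: "integral {0..x} (\<lambda>t. (norm (qa z t))\<^sup>2) = 0" using z by simp
  have "coer (norm z) * ((norm (pa z 0))\<^sup>2 + (norm (qa z 0))\<^sup>2) \<le> integral {0..0+1} (\<lambda>t. (norm (qa z t))\<^sup>2)"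
    by (rule coer(2)) (use ab_sys(1)[of 1 z] in auto)
  moreover have "(norm (pa z 0))\<^sup>2 + (norm (qa z 0))\<^sup>2 = 1" by (simp add: ab_init ca_def sa_def)
  moreover have "integral {0..0+1} (\<lambda>t. (norm (qa z t))\<^sup>2) \<le> integral {0..x} (\<lambda>t. (norm (qa z t))\<^sup>2)"
    using x by (intro integral_subset_le qa_int) auto
  ultimately show False using I coer(1)[of "norm z"] by simp
qed

lemma mn_zero: "Im z > 0 \<Longrightarrow> 1 \<le> n \<Longrightarrow> psi2 (mn n z) z (real n) = 0"
  using qa_nonzero[of z "real n"] by (simp add: psi2_def mn_def)

lemma mn_energy:
  assumes z: "Im z > 0" and n: "1 \<le> n" and x: "0 \<le> x" "x \<le> real n"
  shows "Im (psi1 (mn n z) z x * cnj (psi2 (mn n z) z x)) = Im z * integral {x..real n} (\<lambda>t. (norm (psi2 (mn n z) z t))\<^sup>2)"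
proof -
  let ?f = "\<lambda>t. (norm (psi2 (mn n z) z t))\<^sup>2"
  have "Im (mn n z) = Im z * integral {0..real n} ?f"
    using psi_energy[of "real n" "mn n z" z] mn_zero[OF z n] by simp
  moreover have "integral {0..x} ?f + integral {x..real n} ?f = integral {0..real n} ?f"
    using x by (intro Henstock_Kurzweil_Integration.integral_combine psi_int) auto
  ultimately have "Im (mn n z) = Im z * integral {0..x} ?f + Im z * integral {x..real n} ?f"
    by (simp only: distrib_left[symmetric])
  then show ?thesis using psi_energy[OF x(1), of "mn n z" z] by linarith
qed

text \<open>The nesting of Weyl discs. At \<open>x = n\<close> the solution truncated there
  vanishes, so \<open>psi2 (mn k z)\<close> equals \<open>D * qa\<close>. Nonnegativity of its flux
  bounds \<open>|D|^2\<close> times the modulus of the flux of \<open>a\<close> by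
  \<open>|D|\<close>, with factor 1 because of the Wronskian.\<close>

lemma mn_cauchy:
  assumes z: "Im z > 0" and n: "1 \<le> n" "n \<le> k"
  shows "norm (mn k z - mn n z) * (Im z * integral {0..real n} (\<lambda>t. (norm (qa z t))\<^sup>2)) \<le> 1"
proof -
  define D where "D = mn k z - mn n z"
  define x where "x = real n"
  have x: "0 \<le> x" by (simp add: x_def)
  have "0 \<le> Im (psi1 (mn k z) z x * cnj (psi2 (mn k z) z x))"
    using mn_energy[OF z _ x, of k] n z by (simp add: x_def integral_nonneg psi_int)
  moreover have "psi2 (mn k z) z x = D * qa z x"
    using mn_zero[OF z n(1)] by (simp add: D_def psi2_def x_def algebra_simps)
  moreover have "psi1 (mn k z) z x = psi1 (mn n z) z x + D * pa z x" by (simp add: D_def psi1_def algebra_simps)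
  ultimately have "0 \<le> Im ((psi1 (mn n z) z x + D * pa z x) * cnj (D * qa z x))" by simp
  also have "(psi1 (mn n z) z x + D * pa z x) * cnj (D * qa z x) =
      psi1 (mn n z) z x * cnj (qa z x) * cnj D + (D * cnj D) * (pa z x * cnj (qa z x))" by (simp add: algebra_simps)
  also have "D * cnj D = of_real ((norm D)\<^sup>2)" by (simp only: complex_norm_square)
  finally have 1: "(norm D)\<^sup>2 * (- Im (pa z x * cnj (qa z x))) \<le> Im (psi1 (mn n z) z x * cnj (qa z x) * cnj D)"
  proof -
    have Imr: "Im (A + of_real r * B) = Im A + r * Im B" for A B r by simp
    assume "0 \<le> Im (psi1 (mn n z) z x * cnj (qa z x) * cnj D + complex_of_real ((norm D)\<^sup>2) * (pa z x * cnj (qa z x)))"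
    then show ?thesis unfolding Imr by linarith
  qed
  have "psi1 (mn n z) z x * qa z x = -1" using psi_wronskian[OF x, of "mn n z" z] mn_zero[OF z n(1)] by (simp add: x_def)
  then have "norm (psi1 (mn n z) z x) * norm (qa z x) = 1" by (metis norm_mult norm_minus_cancel norm_one)
  then have "norm (psi1 (mn n z) z x * cnj (qa z x) * cnj D) = norm D" by (simp add: norm_mult)
  then have "Im (psi1 (mn n z) z x * cnj (qa z x) * cnj D) \<le> norm D"
    using abs_Im_le_cmod[of "psi1 (mn n z) z x * cnj (qa z x) * cnj D"] by linarith
  then have "(norm D)\<^sup>2 * (Im z * integral {0..x} (\<lambda>t. (norm (qa z t))\<^sup>2)) \<le> norm D"
  proof -
    have "- Im (pa z x * cnj (qa z x)) = Im z * integral {0..x} (\<lambda>t. (norm (qa z t))\<^sup>2)"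
      unfolding ab_energy(1)[OF x] by simp
    from 1[unfolded this] \<open>Im (psi1 (mn n z) z x * cnj (qa z x) * cnj D) \<le> norm D\<close> show ?thesis by (rule order_trans)
  qed
  then have "norm D * (norm D * (Im z * integral {0..x} (\<lambda>t. (norm (qa z t))\<^sup>2))) \<le> norm D * 1"
    by (simp add: power2_eq_square mult.assoc)
  then show ?thesis unfolding D_def[symmetric] x_def[symmetric] by (cases "norm D = 0") (auto simp: mult_le_cancel_left)
qed

lemma mn_cauchy_bound:
  assumes R: "0 \<le> R" "norm z \<le> R" and z: "Im z \<ge> y" and y: "y > 0" and n: "n \<le> k"
  shows "norm (mn (k + 2) z - mn (n + 2) z) \<le> 1 / (2 * (coer R)\<^sup>2 * y\<^sup>2) * (1 / (real n + 1))"
proof -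
  have c: "coer R > 0" by (rule coer[OF R(1)])
  have zp: "Im z > 0" using z y by linarith
  define G where "G = 2 * (coer R)\<^sup>2 * y\<^sup>2 * (real n + 1)"
  have G: "G > 0" using c y by (simp add: G_def)
  have "2 * (coer R)\<^sup>2 * Im z * real (n + 1) \<le> integral {0..real (n + 2)} (\<lambda>t. (norm (qa z t))\<^sup>2)"
    using qa_growth[OF R zp, of "n + 1"] by (simp add: algebra_simps)
  then have "Im z * (2 * (coer R)\<^sup>2 * Im z * real (n + 1)) \<le> Im z * integral {0..real (n + 2)} (\<lambda>t. (norm (qa z t))\<^sup>2)"
    using zp by (intro mult_left_mono) auto
  moreover have "G \<le> Im z * (2 * (coer R)\<^sup>2 * Im z * real (n + 1))"
  proof -
    have "y\<^sup>2 \<le> (Im z)\<^sup>2" using z y by (intro power_mono) auto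
    then have "2 * (coer R)\<^sup>2 * (real n + 1) * y\<^sup>2 \<le> 2 * (coer R)\<^sup>2 * (real n + 1) * (Im z)\<^sup>2" by (intro mult_left_mono) auto
    then show ?thesis by (simp add: G_def power2_eq_square mult_ac add.commute)
  qed
  ultimately have "norm (mn (k + 2) z - mn (n + 2) z) * G \<le> norm (mn (k + 2) z - mn (n + 2) z) *
      (Im z * integral {0..real (n + 2)} (\<lambda>t. (norm (qa z t))\<^sup>2))" by (intro mult_left_mono) auto
  also have "\<dots> \<le> 1" by (rule mn_cauchy[OF zp]) (use n in auto)
  finally have "norm (mn (k + 2) z - mn (n + 2) z) \<le> 1 / G" using G by (simp add: pos_le_divide_eq)
  then show ?thesis by (simp add: G_def)
qed

text \<open>The shift by 2 makes the count in \<open>qa_growth\<close> equal to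
  \<open>n + 1\<close>, positive already for \<open>n = 0\<close>, so that the rate in
  \<open>mn_cauchy_bound\<close> holds for all \<open>n\<close>.\<close>

definition "m z = lim (\<lambda>n. mn (n + 2) z)"

lemma inverse_Suc_to_zero: "(\<lambda>n. C * (1 / (real n + 1))) \<longlonglongrightarrow> (0::real)"
  using tendsto_mult_right_zero[OF LIMSEQ_inverse_real_of_nat, of C] by (simp add: inverse_eq_divide add.commute)

lemma mn_lim:
  assumes z: "Im z > 0" shows "(\<lambda>n. mn (n + 2) z) \<longlonglongrightarrow> m z"
proof -
  define C where "C = 1 / (2 * (coer (norm z))\<^sup>2 * (Im z)\<^sup>2)"
  have "Cauchy (\<lambda>n. mn (n + 2) z)"
  proof (rule CauchyI')
    fix e :: real assume "e > 0"
    then obtain N where N: "\<And>n. n \<ge> N \<Longrightarrow> C * (1 / (real n + 1)) < e"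
      using order_tendstoD(2)[OF inverse_Suc_to_zero] unfolding eventually_sequentially by blast
    show "\<exists>M. \<forall>n\<ge>M. \<forall>k>n. dist (mn (n + 2) z) (mn (k + 2) z) < e"
    proof (intro exI[of _ N] allI impI)
      fix n k assume "N \<le> n" "n < k"
      have "dist (mn (n + 2) z) (mn (k + 2) z) \<le> C * (1 / (real n + 1))"
        unfolding C_def dist_norm norm_minus_commute[of "mn (n + 2) z"]
        by (rule mn_cauchy_bound) (use z \<open>n < k\<close> in auto)
      then show "dist (mn (n + 2) z) (mn (k + 2) z) < e" using N[OF \<open>N \<le> n\<close>] by linarith
    qed
  qed
  then show ?thesis unfolding m_def by (simp add: Cauchy_convergent_iff convergent_LIMSEQ_iff)
qed

lemma m_bound:
  assumes R: "0 \<le> R" "norm z \<le> R" and z: "Im z \<ge> y" and y: "y > 0"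
  shows "norm (m z - mn (n + 2) z) \<le> 1 / (2 * (coer R)\<^sup>2 * y\<^sup>2) * (1 / (real n + 1))"
proof (rule LIMSEQ_le_const2)
  have "Im z > 0" using z y by linarith
  then show "(\<lambda>k. norm (mn (k + 2) z - mn (n + 2) z)) \<longlonglongrightarrow> norm (m z - mn (n + 2) z)"
    by (intro tendsto_intros mn_lim)
  show "\<exists>N. \<forall>k\<ge>N. norm (mn (k + 2) z - mn (n + 2) z) \<le> 1 / (2 * (coer R)\<^sup>2 * y\<^sup>2) * (1 / (real n + 1))"
    using mn_cauchy_bound[OF R z y] by blast
qed

lemma m_holomorphic: "m holomorphic_on {z. Im z > 0}"
proof (rule holomorphic_uniform_sequence)
  show "open {z. Im z > 0}" by (rule open_halfspace_Im_gt)
  show "mn (n + 2) holomorphic_on {z. Im z > 0}" for n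
    unfolding mn_def[abs_def] using qa_nonzero[of _ "real (n + 2)"]
    by (intro holomorphic_intros ab_holo) auto
  fix w :: complex assume "w \<in> {z. Im z > 0}"
  then have w: "Im w > 0" by simp
  define y where "y = Im w / 2"
  have y: "y > 0" using w by (simp add: y_def)
  have inc: "Im z \<ge> y" "norm z \<le> norm w + y" if "z \<in> cball w y" for z
  proof -
    have d: "norm (w - z) \<le> y" using that by (simp add: dist_norm)
    have "\<bar>Im (w - z)\<bar> \<le> norm (w - z)" by (rule abs_Im_le_cmod)
    then show "Im z \<ge> y" using d unfolding y_def by (simp add: abs_le_iff)
    show "norm z \<le> norm w + y" using d norm_triangle_ineq2[of z w] by (simp add: norm_minus_commute)
  qed
  define C where "C = 1 / (2 * (coer (norm w + y))\<^sup>2 * y\<^sup>2)"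
  show "\<exists>d>0. cball w d \<subseteq> {z. Im z > 0} \<and> uniform_limit (cball w d) (\<lambda>n. mn (n + 2)) m sequentially"
  proof (intro exI[of _ y] conjI y)
    show "cball w y \<subseteq> {z. Im z > 0}" using inc y by fastforce
    show "uniform_limit (cball w y) (\<lambda>n. mn (n + 2)) m sequentially"
    proof (rule uniform_limitI)
      fix e :: real assume "e > 0"
      from order_tendstoD(2)[OF inverse_Suc_to_zero[of C] this]
      show "\<forall>\<^sub>F n in sequentially. \<forall>z\<in>cball w y. dist (mn (n + 2) z) (m z) < e"
      proof eventually_elim
        case (elim n)
        show ?case
        proof
          fix z assume z: "z \<in> cball w y"
          have "norm (m z - mn (n + 2) z) \<le> C * (1 / (real n + 1))"
            unfolding C_def by (rule m_bound[OF _ inc(2)[OF z] inc(1)[OF z] y]) (use y in simp)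
          then show "dist (mn (n + 2) z) (m z) < e" using elim by (simp add: dist_norm norm_minus_commute)
        qed
      qed
    qed
  qed
qed

lemma psi_limit:
  assumes z: "Im z > 0"
  shows "(\<lambda>n. psi1 (mn (n + 2) z) z x) \<longlonglongrightarrow> psi1 (m z) z x" "(\<lambda>n. psi2 (mn (n + 2) z) z x) \<longlonglongrightarrow> psi2 (m z) z x"
  unfolding psi1_def psi2_def by (intro tendsto_intros mn_lim z)+

lemma weyl_nonneg:
  assumes z: "Im z > 0" and x: "0 \<le> x"
  shows "0 \<le> Im (psi1 (m z) z x * cnj (psi2 (m z) z x))"
proof (rule LIMSEQ_le_const)
  show "(\<lambda>n. Im (psi1 (mn (n + 2) z) z x * cnj (psi2 (mn (n + 2) z) z x))) \<longlonglongrightarrow> Im (psi1 (m z) z x * cnj (psi2 (m z) z x))"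
    by (intro tendsto_intros psi_limit z)
  obtain N :: nat where N: "x \<le> real N" using real_arch_simple by blast
  show "\<exists>N. \<forall>n\<ge>N. 0 \<le> Im (psi1 (mn (n + 2) z) z x * cnj (psi2 (mn (n + 2) z) z x))"
  proof (intro exI[of _ N] allI impI)
    fix n assume "N \<le> n"
    then have "x \<le> real (n + 2)" using N by simp
    then show "0 \<le> Im (psi1 (mn (n + 2) z) z x * cnj (psi2 (mn (n + 2) z) z x))"
      using mn_energy[OF z _ x, of "n + 2"] z x by (simp add: integral_nonneg psi_int)
  qed
qed

lemma weyl_integral_bound:
  assumes z: "Im z > 0" and x: "0 \<le> x"
  shows "Im z * integral {0..x} (\<lambda>t. (norm (psi2 (m z) z t))\<^sup>2) \<le> Im (m z)"
  using weyl_nonneg[OF z x] psi_energy[OF x, of "m z" z] by simp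

text \<open>The flux at \<open>x\<close> dominates \<open>Im z\<close> times the integral of
  \<open>|psi2|^2\<close> beyond \<open>x\<close>, of which the first unit interval is kept. The
  constant does not depend on \<open>x\<close>; through it the uniform local bounds on the
  coefficients reach the Green functions.\<close>

lemma weyl_coercive:
  assumes R: "0 \<le> R" "norm z \<le> R" and z: "Im z > 0" and x: "0 \<le> x"
  shows "Im z * coer R * ((norm (psi1 (m z) z x))\<^sup>2 + (norm (psi2 (m z) z x))\<^sup>2) \<le> Im (psi1 (m z) z x * cnj (psi2 (m z) z x))"
proof -
  let ?f = "\<lambda>t. (norm (psi2 (m z) z t))\<^sup>2"
  have "coer R * ((norm (psi1 (m z) z x))\<^sup>2 + (norm (psi2 (m z) z x))\<^sup>2) \<le> integral {x..x+1} ?f"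
    by (rule coer(2)[OF R x]) (use sys_on_subset[OF psi_sys[of "x + 1" z "m z"], of x "x + 1"] x in auto)
  then have "Im z * (coer R * ((norm (psi1 (m z) z x))\<^sup>2 + (norm (psi2 (m z) z x))\<^sup>2)) \<le> Im z * integral {x..x+1} ?f"
    using z by (intro mult_left_mono) auto
  moreover have "integral {0..x} ?f + integral {x..x+1} ?f = integral {0..x+1} ?f"
    using x by (intro Henstock_Kurzweil_Integration.integral_combine psi_int) auto
  then have "Im z * integral {x..x+1} ?f = Im z * integral {0..x+1} ?f - Im z * integral {0..x} ?f"
    by (metis add_diff_cancel_left' right_diff_distrib)
  moreover have "Im z * integral {0..x+1} ?f \<le> Im (m z)" using weyl_integral_bound[OF z, of "x + 1"] x by simp
  ultimately show ?thesis using psi_energy[OF x, of "m z" z] by (simp add: mult.assoc)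
qed

text \<open>This is \<open>weyl_coercive\<close> at \<open>x = 0\<close>, where the flux is
  \<open>Im (m z)\<close> and the initial vector cannot vanish, because its component along
  \<open>(sa, ca)\<close> is 1.\<close>

lemma m_Im_pos:
  assumes z: "Im z > 0" shows "Im (m z) > 0"
proof -
  have "psi1 (m z) z 0 * ca - psi2 (m z) z 0 * sa = m z * (ca * ca + sa * sa)"
    "psi1 (m z) z 0 * sa + psi2 (m z) z 0 * ca = ca * ca + sa * sa"
    unfolding psi_init by (simp_all add: algebra_simps)
  then have "psi1 (m z) z 0 * sa + psi2 (m z) z 0 * ca = 1" using casa by simp
  then have "psi1 (m z) z 0 \<noteq> 0 \<or> psi2 (m z) z 0 \<noteq> 0" by auto
  then have "0 < (norm (psi1 (m z) z 0))\<^sup>2 + (norm (psi2 (m z) z 0))\<^sup>2"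
    by (auto intro: add_pos_nonneg add_nonneg_pos)
  then have "0 < Im z * coer (norm z) * ((norm (psi1 (m z) z 0))\<^sup>2 + (norm (psi2 (m z) z 0))\<^sup>2)"
    using z coer(1)[of "norm z"] by simp
  also have "\<dots> \<le> Im (psi1 (m z) z 0 * cnj (psi2 (m z) z 0))" by (rule weyl_coercive) (use z in auto)
  also have "\<dots> = Im (m z)" using psi_energy[of 0 "m z" z] by simp
  finally show ?thesis .
qed

text \<open>The diagonal Green functions for the boundary parameters \<open>\<alpha>\<close> and \<open>\<alpha> + \<pi>/2\<close>, and their quasi-derivatives.\<close>

lemma green_a:
  assumes z: "Im z > 0" and x: "0 \<le> x"
  shows "0 \<le> Im (qa z x * psi2 (m z) z x)" "0 \<le> Im (pa z x * psi1 (m z) z x)"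
    "Im z * coer (norm z) * (norm (qa z x * psi2 (m z) z x))\<^sup>2 \<le> Im (qa z x * psi2 (m z) z x)"
    "Im z * coer (norm z) * (norm (pa z x * psi1 (m z) z x))\<^sup>2 \<le> Im (pa z x * psi1 (m z) z x)"
proof -
  have Y: "Im (pa z x * cnj (qa z x)) \<le> 0"
    using ab_energy(1)[OF x, of z] z by (simp add: integral_nonneg qa_int)
  have k: "0 \<le> Im z * coer (norm z)" using z coer(1)[of "norm z"] by simp
  note g = green_identity[OF psi_wronskian[OF x] Y weyl_coercive[OF norm_ge_zero order_refl z x] k]
  show "Im z * coer (norm z) * (norm (qa z x * psi2 (m z) z x))\<^sup>2 \<le> Im (qa z x * psi2 (m z) z x)"
    "Im z * coer (norm z) * (norm (pa z x * psi1 (m z) z x))\<^sup>2 \<le> Im (pa z x * psi1 (m z) z x)" by (rule g)+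
  then show "0 \<le> Im (qa z x * psi2 (m z) z x)" "0 \<le> Im (pa z x * psi1 (m z) z x)"
    using k by (meson mult_nonneg_nonneg order_trans zero_le_power2)+
qed

text \<open>The Weyl solution is rescaled to \<open>- psi / m\<close> to have Wronskian -1 with
  \<open>b\<close>; both sides of the coercive bound scale by \<open>1 / |m|^2\<close>, so
  \<open>green_identity\<close> applies as before.\<close>

lemma green_b:
  assumes z: "Im z > 0" and x: "0 \<le> x"
  shows "0 \<le> Im (qb z x * (- psi2 (m z) z x / m z))" "0 \<le> Im (pb z x * (- psi1 (m z) z x / m z))"
    "Im z * coer (norm z) * (norm (qb z x * (- psi2 (m z) z x / m z)))\<^sup>2 \<le> Im (qb z x * (- psi2 (m z) z x / m z))"
    "Im z * coer (norm z) * (norm (pb z x * (- psi1 (m z) z x / m z)))\<^sup>2 \<le> Im (pb z x * (- psi1 (m z) z x / m z))"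
proof -
  have m: "m z \<noteq> 0" using m_Im_pos[OF z] by auto
  have Y: "Im (pb z x * cnj (qb z x)) \<le> 0"
    using ab_energy(2)[OF x, of z] z by (simp add: integral_nonneg sq_int[OF ab_sys(2)])
  have k: "0 \<le> Im z * coer (norm z)" using z coer(1)[of "norm z"] by simp
  have W: "(- psi1 (m z) z x / m z) * qb z x - (- psi2 (m z) z x / m z) * pb z x = -1"
    using psi_wronskian_b[OF x, of "m z" z] m by (simp add: field_simps)
  have eq: "Im ((- psi1 (m z) z x / m z) * cnj (- psi2 (m z) z x / m z)) = Im (psi1 (m z) z x * cnj (psi2 (m z) z x)) / (norm (m z))\<^sup>2"
  proof -
    have "(- psi1 (m z) z x / m z) * cnj (- psi2 (m z) z x / m z) = psi1 (m z) z x * cnj (psi2 (m z) z x) / (m z * cnj (m z))" by simp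
    also have "m z * cnj (m z) = of_real ((norm (m z))\<^sup>2)" by (simp only: complex_norm_square)
    finally show ?thesis by (simp only: Im_divide_of_real)
  qed
  have \<Psi>: "Im z * coer (norm z) * ((norm (- psi1 (m z) z x / m z))\<^sup>2 + (norm (- psi2 (m z) z x / m z))\<^sup>2)
      \<le> Im ((- psi1 (m z) z x / m z) * cnj (- psi2 (m z) z x / m z))"
    unfolding eq using divide_right_mono[OF weyl_coercive[OF norm_ge_zero order_refl z x], of "(norm (m z))\<^sup>2"]
    by (simp add: norm_divide power_divide add_divide_distrib[symmetric])
  note g = green_identity[OF W Y \<Psi> k]
  show "Im z * coer (norm z) * (norm (qb z x * (- psi2 (m z) z x / m z)))\<^sup>2 \<le> Im (qb z x * (- psi2 (m z) z x / m z))"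
    "Im z * coer (norm z) * (norm (pb z x * (- psi1 (m z) z x / m z)))\<^sup>2 \<le> Im (pb z x * (- psi1 (m z) z x / m z))" by (rule g)+
  then show "0 \<le> Im (qb z x * (- psi2 (m z) z x / m z))" "0 \<le> Im (pb z x * (- psi1 (m z) z x / m z))"
    using k by (meson mult_nonneg_nonneg order_trans zero_le_power2)+
qed

end

section \<open>Identification with \<open>m_fun\<close> and with the transfer matrix\<close>

lemma bdry_val_zero:
  assumes "\<And>x. 0 < x \<Longrightarrow> f x = g x" "continuous_on {0..1} g"
  shows "bdry_val f 0 = g 0"
proof -
  have "(g \<longlongrightarrow> g 0) (at_right 0)" by (rule continuous_on_Icc_at_rightD[OF assms(2)]) simp
  then have "(f \<longlongrightarrow> g 0) (at_right 0)"
    by (rule Lim_transform_eventually) (use eventually_at_right_less[of 0] assms(1) in \<open>auto elim: eventually_mono\<close>)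
  then show ?thesis unfolding bdry_val_def by (simp add: tendsto_Lim)
qed

lemma integrable_lebesgue_on_iff:
  fixes f :: "real \<Rightarrow> real"
  assumes "S \<in> sets lebesgue"
  shows "integrable (lebesgue_on S) f \<longleftrightarrow> f absolutely_integrable_on S"
  using assms by (simp add: integrable_restrict_space set_integrable_def)

lemma L2_half_lineI:
  assumes c: "continuous_on {0<..} q" and i: "\<And>X. (\<lambda>t. (norm (q t))\<^sup>2) integrable_on {0..X}"
    and B: "\<And>X. 0 \<le> X \<Longrightarrow> integral {0..X} (\<lambda>t. (norm (q t))\<^sup>2) \<le> B"
  shows "L2_half_line q"
proof -
  define f where "f t = (norm (q t))\<^sup>2" for t
  have ff: "(\<lambda>t. if t \<in> {0..real k} then f t else 0) integrable_on {0..}"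
    "integral {0..} (\<lambda>t. if t \<in> {0..real k} then f t else 0) = integral {0..real k} f" for k
  proof -
    have "(f has_integral integral {0..real k} f) {0..real k}"
      using i[of "real k"] by (simp add: f_def[abs_def] integrable_integral)
    then have "((\<lambda>t. if t \<in> {0..real k} then f t else 0) has_integral integral {0..real k} f) {0..}"
      by (subst has_integral_restrict) auto
    then show "(\<lambda>t. if t \<in> {0..real k} then f t else 0) integrable_on {0..}"
      "integral {0..} (\<lambda>t. if t \<in> {0..real k} then f t else 0) = integral {0..real k} f" by blast+
  qed
  have "f integrable_on {0..} \<and> ((\<lambda>k. integral {0..} (\<lambda>t. if t \<in> {0..real k} then f t else 0)) \<longlonglongrightarrow> integral {0..} f)"
  proof (rule monotone_convergence_increasing)
    show "(\<lambda>t. if t \<in> {0..real k} then f t else 0) integrable_on {0..}" for k by (rule ff)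
    show "(if x \<in> {0..real k} then f x else 0) \<le> (if x \<in> {0..real (Suc k)} then f x else 0)" for k x
      by (auto simp: f_def)
    show "(\<lambda>k. if x \<in> {0..real k} then f x else 0) \<longlonglongrightarrow> f x" if "x \<in> {0..}" for x
    proof (rule tendsto_eventually)
      obtain N :: nat where N: "x \<le> real N" using real_arch_simple by blast
      show "\<forall>\<^sub>F k in sequentially. (if x \<in> {0..real k} then f x else 0) = f x"
        using eventually_ge_at_top[of N] by eventually_elim (use N that in auto)
    qed
    have "0 \<le> integral {0..real k} f" for k unfolding f_def[abs_def] by (intro integral_nonneg i) simp
    moreover have "integral {0..real k} f \<le> B" for k using B[of "real k"] by (simp add: f_def[abs_def])
    ultimately show "bounded (range (\<lambda>k. integral {0..} (\<lambda>t. if t \<in> {0..real k} then f t else 0)))"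
      unfolding ff(2) by (auto simp: bounded_iff intro!: exI[of _ B])
  qed
  then have "f absolutely_integrable_on {0..}" by (intro nonnegative_absolutely_integrable_1) (auto simp: f_def)
  then have "f absolutely_integrable_on {0<..}" by (rule set_integrable_subset) auto
  then have "integrable (lebesgue_on {0<..}) f" by (subst integrable_lebesgue_on_iff) auto
  moreover have "q \<in> borel_measurable (lebesgue_on {0<..})"
    by (rule continuous_imp_measurable_on_sets_lebesgue[OF c]) simp
  ultimately show ?thesis unfolding L2_half_line_def f_def[abs_def] by simp
qed

lemma L2_half_line_unit_intervals:
  assumes L2: "L2_half_line u"
  shows "(\<lambda>n. integral {real n + 1..real n + 1 + 1} (\<lambda>t. (norm (u t))\<^sup>2)) \<longlonglongrightarrow> 0"
proof -
  define f where "f t = (norm (u t))\<^sup>2" for t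
  have "f absolutely_integrable_on {0<..}"
    using L2 unfolding L2_half_line_def f_def[abs_def] by (subst (asm) integrable_lebesgue_on_iff) auto
  then have fi: "f integrable_on {0<..}" by (rule set_lebesgue_integral_eq_integral(1))
  have fi': "f integrable_on {1..x}" for x
  proof -
    have "f absolutely_integrable_on {1..x}"
      by (rule set_integrable_subset[OF \<open>f absolutely_integrable_on {0<..}\<close>]) auto
    then show ?thesis by (rule set_lebesgue_integral_eq_integral(1))
  qed
  have fi2: "f integrable_on {real n + 1..x}" for n x
    using fi'[of x] by (rule integrable_on_subinterval) auto
  have sums: "(\<Sum>i<n. integral {real i + 1..real i + 1 + 1} f) = integral {1..real n + 1} f" for n
  proof (induction n)
    case (Suc n)
    have "integral {1..real n + 1} f + integral {real n + 1..real n + 1 + 1} f = integral {1..real n + 1 + 1} f"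
      by (intro Henstock_Kurzweil_Integration.integral_combine fi') auto
    then show ?case using Suc by (simp add: add.commute)
  qed simp
  have "summable (\<lambda>n. integral {real n + 1..real n + 1 + 1} f)"
  proof (rule summableI_nonneg_bounded)
    show "0 \<le> integral {real n + 1..real n + 1 + 1} f" for n by (intro integral_nonneg fi2) (simp add: f_def)
    show "(\<Sum>i<n. integral {real i + 1..real i + 1 + 1} f) \<le> integral {0<..} f" for n
      unfolding sums by (intro integral_subset_le fi' fi) (auto simp: f_def)
  qed
  then show ?thesis unfolding f_def[abs_def] by (rule summable_LIMSEQ_zero)
qed

context sl_boundary
begin

lemma psi_is_solution:
  "is_solution \<sigma> \<tau> z (psi2 w z)" "0 < x \<Longrightarrow> quasi_deriv \<sigma> (psi2 w z) x = psi1 w z x"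
proof -
  have "sys_on \<sigma> \<tau> z a b (psi1 w z) (psi2 w z)" if "0 < a" "a \<le> b" for a b
    using sys_on_subset[OF psi_sys[of b z w], of a b] that by simp
  from sys_on_is_solution[OF this] show "is_solution \<sigma> \<tau> z (psi2 w z)" "0 < x \<Longrightarrow> quasi_deriv \<sigma> (psi2 w z) x = psi1 w z x"
    by blast+
qed

lemma psi_L2:
  assumes z: "Im z > 0" shows "L2_half_line (psi2 (m z) z)"
proof (rule L2_half_lineI)
  show "continuous_on {0<..} (psi2 (m z) z)"
    using psi_is_solution(1)[of z "m z"] unfolding is_solution_def DD_def by (auto intro: AC_loc_continuous)
  show "(\<lambda>t. (norm (psi2 (m z) z t))\<^sup>2) integrable_on {0..X}" for X by (rule psi_int) simp_all
  show "integral {0..X} (\<lambda>t. (norm (psi2 (m z) z t))\<^sup>2) \<le> Im (m z) / Im z" if "0 \<le> X" for X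
    using weyl_integral_bound[OF z that] z by (simp add: pos_le_divide_eq mult.commute)
qed

lemma psi_nontrivial:
  assumes z: "Im z > 0" shows "\<exists>x>0. psi2 (m z) z x \<noteq> 0"
proof (rule ccontr)
  assume "\<not> ?thesis"
  then have 0: "psi2 (m z) z x = 0" if "0 < x" for x using that by blast
  have "integral {0..1} (\<lambda>t. (norm (psi2 (m z) z t))\<^sup>2) = integral {0..1} (\<lambda>t::real. 0)"
    by (rule integral_spike[where S = "{0}"]) (use 0 in auto)
  then have "Im (psi1 (m z) z 1 * cnj (psi2 (m z) z 1)) = Im (m z)"
    using psi_energy[of 1 "m z" z] by simp
  then show False using 0[of 1] m_Im_pos[OF z] by simp
qed

text \<open>The Wronskian with \<open>psi\<close> is constant, and by \<open>coer\<close> it is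
  bounded at \<open>n + 1\<close> by a multiple of the \<open>L^2\<close> masses over the following
  unit interval, which tend to 0. The conclusion expresses its vanishing in terms of initial
  values.\<close>

lemma L2_solution_unique:
  assumes z: "Im z > 0" and u: "is_solution \<sigma> \<tau> z u" "L2_half_line u"
    and c: "\<And>x. 0 < x \<Longrightarrow> u x = sol2 c1 c2 z x"
  shows "c1 * (ca - m z * sa) = c2 * (sa + m z * ca)"
proof -
  define W where "W = c1 * (ca - m z * sa) - c2 * (sa + m z * ca)"
  define k where "k = coer (norm z)"
  have k: "k > 0" by (simp add: k_def coer(1))
  have Weq: "sol1 c1 c2 z x * psi2 (m z) z x - sol2 c1 c2 z x * psi1 (m z) z x = W" if "0 \<le> x" for x
    using sys_on_wronskian[OF sol_sys(1)[OF that, of z c1 c2] psi_sys[OF that, of z "m z"], of x] that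
    by (simp add: W_def psi_init sol_sys(2,3))
  let ?J = "\<lambda>n. integral {real n + 1..real n + 1 + 1} (\<lambda>t. (norm (u t))\<^sup>2) + integral {real n + 1..real n + 1 + 1} (\<lambda>t. (norm (psi2 (m z) z t))\<^sup>2)"
  have "?J \<longlonglongrightarrow> 0 + 0" by (intro tendsto_add L2_half_line_unit_intervals u psi_L2 z)
  then have J: "(\<lambda>n. ?J n / k) \<longlonglongrightarrow> 0" using tendsto_divide[of ?J 0 sequentially "\<lambda>_. k" k] k by simp
  have "norm W \<le> ?J n / k" for n
  proof -
    define x where "x = real n + 1"
    have x: "0 < x" by (simp add: x_def)
    let ?P = "sol1 c1 c2 z x" and ?Q = "sol2 c1 c2 z x" and ?R = "psi1 (m z) z x" and ?T = "psi2 (m z) z x"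
    have "norm W \<le> norm ?P * norm ?T + norm ?Q * norm ?R"
      unfolding Weq[symmetric, OF less_imp_le[OF x]] norm_mult[symmetric] by (rule norm_triangle_ineq4)
    also have "\<dots> \<le> ((norm ?P)\<^sup>2 + (norm ?Q)\<^sup>2) + ((norm ?R)\<^sup>2 + (norm ?T)\<^sup>2)"
      using sum_squares_bound[of "norm ?P" "norm ?T"] sum_squares_bound[of "norm ?Q" "norm ?R"]
        mult_nonneg_nonneg[OF norm_ge_zero[of ?P] norm_ge_zero[of ?T]] mult_nonneg_nonneg[OF norm_ge_zero[of ?Q] norm_ge_zero[of ?R]]
      by linarith
    finally have "k * norm W \<le> k * ((norm ?P)\<^sup>2 + (norm ?Q)\<^sup>2) + k * ((norm ?R)\<^sup>2 + (norm ?T)\<^sup>2)"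
      using k by (simp add: distrib_left[symmetric])
    moreover have "k * ((norm ?P)\<^sup>2 + (norm ?Q)\<^sup>2) \<le> integral {x..x+1} (\<lambda>t. (norm (sol2 c1 c2 z t))\<^sup>2)"
      unfolding k_def by (rule coer(2)) (use sys_on_subset[OF sol_sys(1)[of "x + 1" z c1 c2], of x "x + 1"] x in auto)
    moreover have "integral {x..x+1} (\<lambda>t. (norm (sol2 c1 c2 z t))\<^sup>2) = integral {x..x+1} (\<lambda>t. (norm (u t))\<^sup>2)"
      using c x by (intro Henstock_Kurzweil_Integration.integral_cong) auto
    moreover have "k * ((norm ?R)\<^sup>2 + (norm ?T)\<^sup>2) \<le> integral {x..x+1} (\<lambda>t. (norm (psi2 (m z) z t))\<^sup>2)"
      unfolding k_def by (rule coer(2)) (use sys_on_subset[OF psi_sys[of "x + 1" z "m z"], of x "x + 1"] x in auto)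
    ultimately have "k * norm W \<le> ?J n" unfolding x_def by linarith
    then show ?thesis using k by (simp add: pos_le_divide_eq mult.commute)
  qed
  then have "norm W \<le> 0" using J by (intro LIMSEQ_le_const[OF J]) blast
  then show ?thesis by (simp add: W_def)
qed

lemma m_fun_eq:
  assumes z: "Im z > 0" shows "m_fun \<sigma> \<tau> \<alpha> z = m z"
proof -
  define u where "u = weyl_solution \<sigma> \<tau> z"
  have "is_solution \<sigma> \<tau> z u \<and> L2_half_line u \<and> (\<exists>x>0. u x \<noteq> 0)"
    unfolding u_def weyl_solution_def by (rule someI[of _ "psi2 (m z) z"]) (use psi_is_solution(1) psi_L2[OF z] psi_nontrivial[OF z] in blast)
  then have u: "is_solution \<sigma> \<tau> z u" "L2_half_line u" "\<exists>x>0. u x \<noteq> 0" by blast+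
  obtain c1 c2 where c: "\<And>x. 0 < x \<Longrightarrow> u x = sol2 c1 c2 z x" "\<And>x. 0 < x \<Longrightarrow> quasi_deriv \<sigma> u x = sol1 c1 c2 z x"
    by (rule is_solution_repr[OF u(1)]) (rule that; assumption)
  have b: "bdry_val u 0 = c2" "bdry_val (quasi_deriv \<sigma> u) 0 = c1"
    using bdry_val_zero[OF c(1) sol_continuous(2)] bdry_val_zero[OF c(2) sol_continuous(1)]
    by (simp_all add: sol_sys(2,3)[OF order_refl])
  have eq: "c1 * (ca - m z * sa) = c2 * (sa + m z * ca)" by (rule L2_solution_unique[OF z u(1,2) c(1)])
  \<comment> \<open>The factor of proportionality between the chosen solution and
    \<open>psi\<close>: for \<open>psi\<close> itself this combination of initial values is
    1.\<close>
  define k where "k = sa * c1 + ca * c2"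
  have "c1 = c1 * (ca * ca + sa * sa)" by (simp add: casa)
  also have "\<dots> = ca * (c1 * (ca - m z * sa)) + sa * c1 * (sa + m z * ca)" by (simp add: algebra_simps)
  also have "\<dots> = k * (sa + m z * ca)" unfolding eq by (simp add: k_def algebra_simps)
  finally have c1: "c1 = k * (sa + m z * ca)" .
  have "c2 = c2 * (ca * ca + sa * sa)" by (simp add: casa)
  also have "\<dots> = sa * (c2 * (sa + m z * ca)) + ca * c2 * (ca - m z * sa)" by (simp add: algebra_simps)
  also have "\<dots> = k * (ca - m z * sa)" unfolding eq[symmetric] by (simp add: k_def algebra_simps)
  finally have c2: "c2 = k * (ca - m z * sa)" .
  have k: "k \<noteq> 0"
  proof
    assume "k = 0"
    then have "c1 = 0" "c2 = 0" using c1 c2 by simp_all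
    then have "u x = 0" if "0 < x" for x using c(1)[OF that] sol_eq(2)[of x c1 c2 z] that by simp
    then show False using u(3) by blast
  qed
  have "ca * c1 - sa * c2 = k * (m z * (ca * ca + sa * sa))"
    unfolding c1 c2 by (simp add: algebra_simps)
  then have "ca * c1 - sa * c2 = k * m z" unfolding casa by simp
  then have "(ca * c1 - sa * c2) / k = m z" using k by simp
  then show ?thesis unfolding m_fun_def Let_def u_def[symmetric] b ca_def[symmetric] sa_def[symmetric] k_def by simp
qed

definition "nrm z x = norm (pa z x) + norm (qa z x) + norm (pb z x) + norm (qb z x)"

text \<open>The Wronskian normalisation makes the inverse of the fundamental matrix its adjugate,
  which gives the explicit \<open>T\<close>. The definition uses \<open>THE\<close>, so uniqueness
  has to be shown too; it holds because solutions attain every vector of values at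
  \<open>y\<close>.\<close>

lemma transfer_matrix_norm:
  assumes x: "0 < x" and y: "0 < y"
  shows "onorm ((*v) (transfer_matrix \<sigma> \<tau> z x y)) \<le> 4 * (nrm z x * nrm z y)"
proof -
  define T :: "complex^2^2" where "T = vector [vector [pa z x * qb z y - pb z x * qa z y, pb z x * pa z y - pa z x * pb z y],
     vector [qa z x * qb z y - qb z x * qa z y, qb z x * pa z y - qa z x * pb z y]]"
  have Tv: "(T *v v) $ 1 = (pa z x * qb z y - pb z x * qa z y) * v $ 1 + (pb z x * pa z y - pa z x * pb z y) * v $ 2"
    "(T *v v) $ 2 = (qa z x * qb z y - qb z x * qa z y) * v $ 1 + (qb z x * pa z y - qa z x * pb z y) * v $ 2" for v
    by (simp_all add: T_def matrix_vector_mult_def sum_2)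
  have W: "pa z y * qb z y - qa z y * pb z y = 1"
    using arg_cong[OF ab_wronskian[of y z], of uminus] y by (simp add: mult.commute)
  have comb: "sol1 c1 c2 z t = (c1 * ca - c2 * sa) * pa z t + (c1 * sa + c2 * ca) * pb z t"
    "sol2 c1 c2 z t = (c1 * ca - c2 * sa) * qa z t + (c1 * sa + c2 * ca) * qb z t" if t: "0 < t" for c1 c2 t
  proof -
    note e = sol_eq[OF less_imp_le[OF t], of c1 c2 z] sol_eq[OF less_imp_le[OF t], of ca "- sa" z, folded pa_def qa_def]
      sol_eq[OF less_imp_le[OF t], of sa ca z, folded pb_def qb_def]
    have "(c1 * ca - c2 * sa) * pa z t + (c1 * sa + c2 * ca) * pb z t
       = (ca * ca + sa * sa) * (c1 * p1 z t + c2 * p2 z t)" unfolding e by (simp add: algebra_simps)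
    then show "sol1 c1 c2 z t = (c1 * ca - c2 * sa) * pa z t + (c1 * sa + c2 * ca) * pb z t" unfolding casa e(1) by simp
    have "(c1 * ca - c2 * sa) * qa z t + (c1 * sa + c2 * ca) * qb z t
       = (ca * ca + sa * sa) * (c1 * q1 z t + c2 * q2 z t)" unfolding e by (simp add: algebra_simps)
    then show "sol2 c1 c2 z t = (c1 * ca - c2 * sa) * qa z t + (c1 * sa + c2 * ca) * qb z t" unfolding casa e(2) by simp
  qed
  define Pr where "Pr T \<longleftrightarrow> (\<forall>u. is_solution \<sigma> \<tau> z u \<longrightarrow>
        T *v vector [bdry_val (quasi_deriv \<sigma> u) y, bdry_val u y] = vector [bdry_val (quasi_deriv \<sigma> u) x, bdry_val u x])" for T :: "complex^2^2"
  have bv: "bdry_val f x = f x" "bdry_val f y = f y" for f using x y by (simp_all add: bdry_val_def)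
  have act: "T *v vector [A * pa z y + B * pb z y, A * qa z y + B * qb z y] = vector [A * pa z x + B * pb z x, A * qa z x + B * qb z x]" for A B
  proof -
    have "(T *v vector [A * pa z y + B * pb z y, A * qa z y + B * qb z y]) $ 1 = (A * pa z x + B * pb z x) * (pa z y * qb z y - qa z y * pb z y)"
      "(T *v vector [A * pa z y + B * pb z y, A * qa z y + B * qb z y]) $ 2 = (A * qa z x + B * qb z x) * (pa z y * qb z y - qa z y * pb z y)"
      unfolding Tv by (simp_all add: algebra_simps)
    then show ?thesis unfolding W by (simp add: vec_eq_iff forall_2)
  qed
  have PT: "Pr T" unfolding Pr_def bv
  proof (intro allI impI)
    fix u assume "is_solution \<sigma> \<tau> z u"
    then obtain c1 c2 where c: "\<And>x. 0 < x \<Longrightarrow> u x = sol2 c1 c2 z x" "\<And>x. 0 < x \<Longrightarrow> quasi_deriv \<sigma> u x = sol1 c1 c2 z x"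
      by (rule is_solution_repr) (rule that; assumption)
    show "T *v vector [quasi_deriv \<sigma> u y, u y] = vector [quasi_deriv \<sigma> u x, u x]"
      unfolding c(1)[OF x] c(1)[OF y] c(2)[OF x] c(2)[OF y] comb[OF x] comb[OF y] by (rule act)
  qed
  have uniq: "T' = T" if "Pr T'" for T'
    unfolding matrix_eq
  proof
    fix v :: "complex^2"
    define A where "A = v $ 1 * qb z y - v $ 2 * pb z y"
    define B where "B = v $ 2 * pa z y - v $ 1 * qa z y"
    define c1 where "c1 = A * ca + B * sa"
    define c2 where "c2 = B * ca - A * sa"
    have "c1 * ca - c2 * sa = A * (ca * ca + sa * sa)" "c1 * sa + c2 * ca = B * (ca * ca + sa * sa)"
      by (simp_all add: c1_def c2_def algebra_simps)
    then have AB: "c1 * ca - c2 * sa = A" "c1 * sa + c2 * ca = B" by (simp_all add: casa)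
    have v: "v = vector [A * pa z y + B * pb z y, A * qa z y + B * qb z y]"
    proof -
      have "A * pa z y + B * pb z y = v $ 1 * (pa z y * qb z y - qa z y * pb z y)"
        "A * qa z y + B * qb z y = v $ 2 * (pa z y * qb z y - qa z y * pb z y)"
        by (simp_all add: A_def B_def algebra_simps)
      then show ?thesis unfolding W by (simp add: vec_eq_iff forall_2)
    qed
    have "T' *v vector [sol1 c1 c2 z y, sol2 c1 c2 z y] = vector [sol1 c1 c2 z x, sol2 c1 c2 z x]"
      using that[unfolded Pr_def bv, rule_format, OF sol_is_solution(1)[of z c1 c2]]
      by (simp add: sol_is_solution(2) x y)
    then show "T' *v v = T *v v" unfolding comb[OF x] comb[OF y] AB v[symmetric] unfolding v act .
  qed
  have "transfer_matrix \<sigma> \<tau> z x y = (THE T. Pr T)" unfolding transfer_matrix_def Pr_def ..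
  also have "\<dots> = T" 
  proof (rule the_equality)
    show "Pr T" by (rule PT)
    show "T' = T" if "Pr T'" for T' using that by (rule uniq)
  qed
  finally have TT: "transfer_matrix \<sigma> \<tau> z x y = T" .
  have nn: "norm (pa z t) \<le> nrm z t" "norm (qa z t) \<le> nrm z t" "norm (pb z t) \<le> nrm z t" "norm (qb z t) \<le> nrm z t" "0 \<le> nrm z t" for t
    by (simp_all add: nrm_def)
  show ?thesis unfolding TT
  proof (rule onorm_le)
    fix v :: "complex^2"
    define N where "N = norm (pa z x) * norm (qb z y) + norm (pb z x) * norm (qa z y) + norm (pb z x) * norm (pa z y) + norm (pa z x) * norm (pb z y)"
    have pr: "norm (a * b - c * d) \<le> norm a * norm b + norm c * norm d" for a b c d :: complex
      unfolding norm_mult[symmetric] by (rule norm_triangle_ineq4)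
    have v1: "norm (v $ 1) \<le> norm v" "norm (v $ 2) \<le> norm v" by (rule Finite_Cartesian_Product.norm_nth_le)+
    have tr: "norm (a * v $ 1 + b * v $ 2) \<le> (norm a + norm b) * norm v" for a b :: complex
    proof -
      have "norm (a * v $ 1 + b * v $ 2) \<le> norm a * norm (v $ 1) + norm b * norm (v $ 2)"
        unfolding norm_mult[symmetric] by (rule norm_triangle_ineq)
      also have "\<dots> \<le> norm a * norm v + norm b * norm v" using v1 by (intro add_mono mult_left_mono) auto
      finally show ?thesis by (simp add: distrib_right)
    qed
    have "norm (T *v v) \<le> norm ((T *v v) $ 1) + norm ((T *v v) $ 2)"
      unfolding norm_vec_def using L2_set_le_sum[of UNIV "\<lambda>i. norm ((T *v v) $ i)"] by (simp add: sum_2)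
    also have "\<dots> \<le> ((norm (pa z x) * norm (qb z y) + norm (pb z x) * norm (qa z y)) + (norm (pb z x) * norm (pa z y) + norm (pa z x) * norm (pb z y))) * norm v
       + ((norm (qa z x) * norm (qb z y) + norm (qb z x) * norm (qa z y)) + (norm (qb z x) * norm (pa z y) + norm (qa z x) * norm (pb z y))) * norm v"
      unfolding Tv by (intro add_mono order_trans[OF tr] mult_right_mono pr norm_ge_zero)
    also have "\<dots> \<le> (nrm z x * nrm z y) * norm v + (nrm z x * nrm z y) * norm v"
      unfolding nrm_def by (intro add_mono mult_right_mono norm_ge_zero) (simp_all add: algebra_simps add_nonneg_nonneg)
    also have "\<dots> \<le> 4 * (nrm z x * nrm z y) * norm v" using nn[of x] nn[of y] by (simp add: mult_nonneg_nonneg)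
    finally show "norm (T *v v) \<le> 4 * (nrm z x * nrm z y) * norm v" .
  qed
qed

end

section \<open>Herglotz functions\<close>

definition uhp :: "complex set" where "uhp = {z. Im z > 0}"

lemma open_uhp [simp]: "open uhp"
  unfolding uhp_def using open_halfspace_Im_gt[of 0] by simp

lemma convex_uhp [simp]: "convex uhp"
  unfolding uhp_def using convex_halfspace_Im_gt[of 0] by simp

text \<open>Sends the unit disc to the upper half-plane, \<open>0\<close> to \<open>\<i>\<close> and
  the boundary point \<open>1\<close> to infinity. At \<open>1\<close> division by zero yields 0, so
  this point has to be excluded in what follows.\<close>

definition cayley :: "complex \<Rightarrow> complex" where "cayley w = \<i> * (1 + w) / (1 - w)"

lemma Im_cayley: "w \<noteq> 1 \<Longrightarrow> Im (cayley w) = (1 - (norm w)\<^sup>2) / (norm (1 - w))\<^sup>2"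
proof -
  have "Im (cayley w) = Re ((1 + w) / (1 - w))" unfolding cayley_def
    by (metis Im_i_times times_divide_eq_right)
  also have "\<dots> = (1 - (norm w)\<^sup>2) / (norm (1 - w))\<^sup>2"
    unfolding Re_divide cmod_power2 by (simp add: algebra_simps power2_eq_square)
  finally show "Im (cayley w) = (1 - (norm w)\<^sup>2) / (norm (1 - w))\<^sup>2" .
qed

lemma Im_cayley_nonneg: "w \<noteq> 1 \<Longrightarrow> norm w \<le> 1 \<Longrightarrow> Im (cayley w) \<ge> 0"
  by (simp add: Im_cayley power_le_one)

lemma Im_cayley_pos: "norm w < 1 \<Longrightarrow> Im (cayley w) > 0"
proof -
  assume w: "norm w < 1"
  then have "w \<noteq> 1" by auto
  moreover have "(norm w)\<^sup>2 < 1" using w by (simp add: power_less_one_iff abs_square_less_1)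
  ultimately show ?thesis by (auto simp: Im_cayley)
qed

text \<open>In the parameter \<open>s\<close> the normalised arc length
  \<open>1 / 2 + arctan s / pi\<close> on the circle has derivative
  \<open>1 / (pi * (1 + s^2))\<close>, the Poisson kernel at height 1.\<close>

lemma cayley_arctan: "cayley (- exp (2 * \<i> * of_real (arctan s))) = of_real s"
proof -
  define c where "c = cos (arctan s)"
  have c: "c > 0" unfolding c_def using arctan_lbound[of s] arctan_ubound[of s] by (intro cos_gt_zero_pi) auto
  have sin: "sin (arctan s) = s * c"
    using c tan_arctan[of s] by (simp add: tan_def c_def field_simps)
  have c2: "c\<^sup>2 * (1 + s\<^sup>2) = 1"
    using sin_cos_squared_add[of "arctan s"] unfolding sin c_def[symmetric] by (simp add: algebra_simps power2_eq_square)
  define E where "E = complex_of_real c * (1 + \<i> * of_real s)"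
  have "exp (\<i> * of_real (arctan s)) = E"
    by (simp add: exp_eq_polar[symmetric] cis_conv_exp[symmetric] E_def complex_eq_iff sin c_def)
  then have "exp (2 * \<i> * of_real (arctan s)) = E\<^sup>2"
    by (metis exp_double mult.assoc)
  moreover have C2: "(complex_of_real c)\<^sup>2 * (1 + (of_real s)\<^sup>2) = 1"
    using arg_cong[OF c2, of complex_of_real] by simp
  have "\<i> * (1 - E\<^sup>2) = of_real s * (1 + E\<^sup>2)"
  proof -
    have "E\<^sup>2 = (of_real c)\<^sup>2 * (1 + 2 * \<i> * of_real s - (of_real s)\<^sup>2)"
      by (simp add: E_def power2_eq_square algebra_simps)
    then have "(of_real c)\<^sup>2 * (1 + (of_real s)\<^sup>2) - E\<^sup>2 = (of_real c)\<^sup>2 * (2 * (of_real s)\<^sup>2 - 2 * \<i> * of_real s)"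
      "(of_real c)\<^sup>2 * (1 + (of_real s)\<^sup>2) + E\<^sup>2 = (of_real c)\<^sup>2 * (2 + 2 * \<i> * of_real s)"
      by (simp_all only:) (simp_all add: algebra_simps)
    then have "1 - E\<^sup>2 = (of_real c)\<^sup>2 * (2 * (of_real s)\<^sup>2 - 2 * \<i> * of_real s)"
      "1 + E\<^sup>2 = (of_real c)\<^sup>2 * (2 + 2 * \<i> * of_real s)" unfolding C2 by simp_all
    then show ?thesis by (simp only:) (simp add: algebra_simps power2_eq_square)
  qed
  moreover have "1 + E\<^sup>2 \<noteq> 0"
  proof
    assume "1 + E\<^sup>2 = 0"
    then have "E\<^sup>2 = -1" by (simp add: add_eq_0_iff)
    then have "\<i> * (1 - E\<^sup>2) \<noteq> 0" by simp
    then show False using \<open>1 + E\<^sup>2 = 0\<close> \<open>\<i> * (1 - E\<^sup>2) = of_real s * (1 + E\<^sup>2)\<close> by simp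
  qed
  ultimately show ?thesis by (simp add: cayley_def field_simps)
qed

lemma holomorphic_cayley: "1 \<notin> S \<Longrightarrow> cayley holomorphic_on S"
  unfolding cayley_def by (intro holomorphic_intros) auto

lemma cayley_inverse: "Im z > 0 \<Longrightarrow> cayley ((z - \<i>) / (z + \<i>)) = z"
proof -
  assume z: "Im z > 0"
  then have nz: "z + \<i> \<noteq> 0" by (auto simp: complex_eq_iff)
  have "1 + (z - \<i>) / (z + \<i>) = 2 * z / (z + \<i>)" "1 - (z - \<i>) / (z + \<i>) = 2 * \<i> / (z + \<i>)"
    using nz by (simp_all add: field_simps)
  then show ?thesis using nz by (simp add: cayley_def)
qed

section \<open>Integral bounds on horizontal segments\<close>

lemma mean_value_disc:
  assumes h: "h holomorphic_on ball 0 1" and \<rho>: "0 < \<rho>" "\<rho> < 1"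
  shows "((\<lambda>t. h (of_real \<rho> * exp (2 * of_real pi * \<i> * of_real t))) has_integral h 0) {0..1}"
proof -
  have "((\<lambda>u. h u / (u - 0)) has_contour_integral (2 * of_real pi * \<i> * h 0)) (circlepath 0 \<rho>)"
  proof (rule Cauchy_integral_circlepath)
    show "continuous_on (cball 0 \<rho>) h"
      using \<rho> by (intro holomorphic_on_imp_continuous_on holomorphic_on_subset[OF h]) auto
    show "h holomorphic_on ball 0 \<rho>" using \<rho> by (intro holomorphic_on_subset[OF h]) auto
  qed (use \<rho> in auto)
  then have "((\<lambda>t. h (circlepath 0 \<rho> t) / circlepath 0 \<rho> t * vector_derivative (circlepath 0 \<rho>) (at t within {0..1}))
      has_integral (2 * of_real pi * \<i> * h 0)) {0..1}"
    unfolding has_contour_integral_def by simp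
  then have "((\<lambda>t. (2 * of_real pi * \<i>) * h (of_real \<rho> * exp (2 * of_real pi * \<i> * of_real t)))
      has_integral ((2 * of_real pi * \<i>) * h 0)) {0..1}"
  proof (rule has_integral_eq[rotated])
    fix t :: real assume "t \<in> {0..1}"
    then show "h (circlepath 0 \<rho> t) / circlepath 0 \<rho> t * vector_derivative (circlepath 0 \<rho>) (at t within {0..1})
      = (2 * of_real pi * \<i>) * h (of_real \<rho> * exp (2 * of_real pi * \<i> * of_real t))"
      using \<rho> by (subst vector_derivative_circlepath01) (auto simp: circlepath field_simps)
  qed
  then have "((\<lambda>t. (1 / (2 * of_real pi * \<i>)) * ((2 * of_real pi * \<i>) * h (of_real \<rho> * exp (2 * of_real pi * \<i> * of_real t))))
      has_integral (1 / (2 * of_real pi * \<i>)) * ((2 * of_real pi * \<i>) * h 0)) {0..1}"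
    by (rule has_integral_mult_right)
  then show ?thesis by simp
qed

text \<open>Only an inequality can be claimed: \<open>h\<close> may be singular at \<open>1\<close>,
  the preimage of infinity, and mass can be lost there. On smaller circles the mean value property
  and positivity give it, and on an arc that avoids \<open>1\<close> the radius may tend to
  1.\<close>

lemma mean_value_arc_le:
  assumes h: "h holomorphic_on ball 0 1" and c: "continuous_on (cball 0 1 - {1}) h"
    and nn: "\<And>w. norm w < 1 \<Longrightarrow> Im (h w) \<ge> 0" and ab: "0 < a" "b < 1"
  shows "integral {a..b} (\<lambda>t. Im (h (exp (2 * of_real pi * \<i> * of_real t)))) \<le> Im (h 0)"
proof -
  let ?e = "\<lambda>\<rho> t. complex_of_real \<rho> * exp (2 * of_real pi * \<i> * of_real t)"
  define F where "F \<rho> = integral (cbox a b) (\<lambda>t. Im (h (?e \<rho> t)))" for \<rho>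
  have norm_e: "norm (?e \<rho> t) = \<bar>\<rho>\<bar>" for \<rho> t :: real by (simp add: norm_mult)
  have ne1: "?e \<rho> t \<noteq> 1" if "\<rho> \<in> {0..1}" "t \<in> {a..b}" for \<rho> t
  proof
    assume eq: "?e \<rho> t = 1"
    then have "\<rho> = 1" using norm_e[of \<rho> t] that by simp
    then have "exp (2 * of_real pi * \<i> * of_real t) = exp (0 :: complex)" using eq by simp
    then obtain n :: int where "2 * of_real pi * \<i> * complex_of_real t = 0 + (of_int (2 * n) * pi) * \<i>"
      unfolding exp_eq by auto
    then have "of_real t = (of_int n :: complex)" by simp
    then have "t = of_int n" by (metis of_real_eq_iff of_real_of_int_eq)
    moreover have "0 < t" "t < 1" using that ab by auto
    ultimately show False by simp
  qed
  have "continuous_on {0..1} F" unfolding F_def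
  proof (rule integral_continuous_on_param)
    have "continuous_on ({0..1} \<times> cbox a b) (\<lambda>x. h (?e (fst x) (snd x)))"
    proof (rule continuous_on_compose2[OF c])
      show "continuous_on ({0..1} \<times> cbox a b) (\<lambda>x. ?e (fst x) (snd x))" by (intro continuous_intros)
      show "(\<lambda>x. ?e (fst x) (snd x)) ` ({0..1} \<times> cbox a b) \<subseteq> cball 0 1 - {1}"
        using ne1 by (auto simp: norm_mult)
    qed
    then show "continuous_on ({0..1} \<times> cbox a b) (\<lambda>(\<rho>, t). Im (h (?e \<rho> t)))"
      by (auto simp: case_prod_unfold intro!: continuous_intros)
  qed
  then have "F 1 \<le> Im (h 0)"
  proof (intro continuous_le_on_closure[of "{0<..<1}" F 1])
    fix \<rho> :: real assume "\<rho> \<in> {0<..<1}"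
    then have \<rho>: "0 < \<rho>" "\<rho> < 1" by auto
    have I: "((\<lambda>t. Im (h (?e \<rho> t))) has_integral Im (h 0)) {0..1}"
      using has_integral_Im[OF mean_value_disc[OF h \<rho>]] .
    show "F \<rho> \<le> Im (h 0)"
    proof (cases "a \<le> b")
      case True
      have "(\<lambda>t. Im (h (?e \<rho> t))) integrable_on {0..1}" using I by blast
      then have "(\<lambda>t. Im (h (?e \<rho> t))) integrable_on {a..b}"
        using ab by (rule_tac integrable_on_subinterval) auto
      then have "F \<rho> \<le> integral {0..1} (\<lambda>t. Im (h (?e \<rho> t)))" unfolding F_def cbox_interval
        using ab I nn \<rho> by (intro integral_subset_le) (auto simp: norm_mult has_integral_integrable)
      then show ?thesis using integral_unique[OF I] by simp
    next
      case False then show ?thesis using nn[of 0] by (simp add: F_def)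
    qed
  qed auto
  then show ?thesis by (simp add: F_def)
qed

text \<open>After the shift by \<open>\<delta>\<close>, \<open>g\<close> is continuous up to the
  line, and the mean value inequality pulled back by the Cayley map is Poisson's formula as an
  inequality. The factor \<open>pi * (1 + K^2)\<close> is the reciprocal of the smallest value of
  the kernel on \<open>[-K, K]\<close>.\<close>

lemma poisson_interval_bound:
  assumes g: "g holomorphic_on uhp" and nn: "\<And>z. Im z > 0 \<Longrightarrow> Im (g z) \<ge> 0"
    and pos: "\<delta> > 0" "r > 0" "K > 0"
  shows "integral {b - K * r..b + K * r} (\<lambda>t. Im (g (Complex t \<delta>))) \<le> pi * (1 + K\<^sup>2) * r * Im (g (Complex b (r + \<delta>)))"
proof -
  define h where "h w = g (Complex b \<delta> + of_real r * cayley w)" for w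
  have dom: "Complex b \<delta> + of_real r * cayley w \<in> uhp" if "w \<noteq> 1" "norm w \<le> 1" for w
    using Im_cayley_nonneg[OF that] pos unfolding uhp_def by (auto intro: add_pos_nonneg)
  have c: "continuous_on (cball 0 1 - {1}) h" unfolding h_def
    by (rule continuous_on_compose2[OF holomorphic_on_imp_continuous_on[OF g]])
       (use dom in \<open>force intro!: continuous_intros holomorphic_on_imp_continuous_on[OF holomorphic_cayley]\<close>)+
  have hol: "h holomorphic_on ball 0 1"
  proof -
    have "(g \<circ> (\<lambda>w. Complex b \<delta> + of_real r * cayley w)) holomorphic_on ball 0 1"
    proof (rule holomorphic_on_compose_gen[OF _ g])
      show "(\<lambda>w. Complex b \<delta> + of_real r * cayley w) holomorphic_on ball 0 1"
        by (intro holomorphic_intros holomorphic_cayley) simp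
      show "(\<lambda>w. Complex b \<delta> + of_real r * cayley w) ` ball 0 1 \<subseteq> uhp"
      proof safe
        fix w :: complex assume "w \<in> ball 0 1"
        then have "w \<noteq> 1" "norm w \<le> 1" by auto
        then show "Complex b \<delta> + of_real r * cayley w \<in> uhp" by (rule dom)
      qed
    qed
    then show ?thesis by (simp add: h_def[abs_def] o_def)
  qed
  have hnn: "Im (h w) \<ge> 0" if "norm w < 1" for w
    using nn dom[of w] that unfolding h_def uhp_def by fastforce
  define \<phi> where "\<phi> s = 1 / 2 + arctan s / pi" for s
  have \<phi>: "0 < \<phi> s" "\<phi> s < 1" for s
    using arctan_lbound[of s] arctan_ubound[of s] by (auto simp: \<phi>_def field_simps)
  let ?f = "\<lambda>t. Im (h (exp (2 * of_real pi * \<i> * of_real t)))"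
  have fphi: "?f (\<phi> s) = Im (g (Complex (b + r * s) \<delta>))" for s
  proof -
    have "exp (2 * of_real pi * \<i> * of_real (\<phi> s)) = exp (\<i> * of_real pi + 2 * \<i> * of_real (arctan s))"
      by (rule arg_cong[where f = exp]) (simp add: \<phi>_def field_simps)
    also have "\<dots> = - exp (2 * \<i> * of_real (arctan s))" by (simp add: exp_add)
    finally have e: "exp (2 * of_real pi * \<i> * of_real (\<phi> s)) = - exp (2 * \<i> * of_real (arctan s))" .
    have "Complex b \<delta> + of_real r * of_real s = Complex (b + r * s) \<delta>" by (simp add: complex_eq_iff)
    then show ?thesis unfolding h_def e cayley_arctan by simp
  qed
  have "continuous_on {\<phi> (-K)..\<phi> K} ?f"
  proof -
    have "continuous_on {\<phi> (-K)..\<phi> K} (\<lambda>t. h (exp (2 * of_real pi * \<i> * of_real t)))"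
    proof (rule continuous_on_compose2[OF c])
      show "(\<lambda>t. exp (2 * of_real pi * \<i> * complex_of_real t)) ` {\<phi> (-K)..\<phi> K} \<subseteq> cball 0 1 - {1}"
      proof safe
        fix t assume t: "t \<in> {\<phi> (-K)..\<phi> K}" and e: "exp (2 * of_real pi * \<i> * complex_of_real t) = 1"
        then have "exp (2 * of_real pi * \<i> * of_real t) = exp (0 :: complex)" by simp
        then obtain n :: int where "2 * of_real pi * \<i> * complex_of_real t = 0 + (of_int (2 * n) * pi) * \<i>"
          unfolding exp_eq by auto
        then have "of_real t = (of_int n :: complex)" by simp
        then have "t = of_int n" by (metis of_real_eq_iff of_real_of_int_eq)
        moreover have "0 < t" "t < 1" using t \<phi>[of K] \<phi>[of "-K"] by auto
        ultimately show False by simp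
      qed auto
    qed (intro continuous_intros)
    then show ?thesis by (intro continuous_intros)
  qed
  note cont = this
  have mono: "\<phi> s \<le> \<phi> t" if "s \<le> t" for s t
    unfolding \<phi>_def using that by (intro add_left_mono divide_right_mono) (auto simp: arctan_le_iff)
  have sub: "((\<lambda>s. (1 / (pi * (1 + s\<^sup>2))) *\<^sub>R ?f (\<phi> s)) has_integral integral {\<phi> (-K)..\<phi> K} ?f) {-K..K}"
  proof (rule has_integral_substitution[where c = "\<phi> (-K)" and d = "\<phi> K" and g = \<phi> and f = ?f, OF _ _ _ cont])
    fix s
    have "(\<phi> has_field_derivative inverse (1 + s\<^sup>2) / pi) (at s within {-K..K})"
      using DERIV_add[OF DERIV_const[of "1 / 2"] DERIV_cdivide[OF DERIV_arctan[of s], of pi]]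
      unfolding \<phi>_def[abs_def] by (simp only: add_0 has_field_derivative_at_within)
    moreover have "inverse (1 + s\<^sup>2) / pi = 1 / (pi * (1 + s\<^sup>2))" by (simp add: inverse_eq_divide mult.commute)
    ultimately show "(\<phi> has_field_derivative 1 / (pi * (1 + s\<^sup>2))) (at s within {-K..K})" by (simp only:)
  next
    show "\<phi> ` {-K..K} \<subseteq> {\<phi> (-K)..\<phi> K}" using mono by auto
    show "\<phi> (-K) \<le> \<phi> K" using mono pos by simp
  qed (use pos in simp)
  have "continuous_on UNIV (\<lambda>t. g (Complex t \<delta>))"
    by (rule continuous_on_compose2[OF holomorphic_on_imp_continuous_on[OF g]])
       (use pos in \<open>auto simp: uhp_def Complex_eq intro!: continuous_intros\<close>)
  then have cg: "continuous_on A (\<lambda>t. Im (g (Complex t \<delta>)))" for A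
    by (intro continuous_intros) (auto intro: continuous_on_subset)
  have cgs: "continuous_on A (\<lambda>s. Im (g (Complex (b + r * s) \<delta>)))" for A
    by (rule continuous_on_compose2[OF cg[of UNIV]]) (auto intro!: continuous_intros)
  have "(1 / (pi * (1 + K\<^sup>2))) * integral {-K..K} (\<lambda>s. Im (g (Complex (b + r * s) \<delta>)))
      = integral {-K..K} (\<lambda>s. (1 / (pi * (1 + K\<^sup>2))) * Im (g (Complex (b + r * s) \<delta>)))" by simp
  also have "\<dots> \<le> integral {-K..K} (\<lambda>s. (1 / (pi * (1 + s\<^sup>2))) *\<^sub>R ?f (\<phi> s))"
  proof (rule integral_le)
    show "(\<lambda>s. (1 / (pi * (1 + K\<^sup>2))) * Im (g (Complex (b + r * s) \<delta>))) integrable_on {-K..K}"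
      by (intro integrable_continuous_real continuous_intros cgs)
    show "(\<lambda>s. (1 / (pi * (1 + s\<^sup>2))) *\<^sub>R ?f (\<phi> s)) integrable_on {-K..K}" using sub by blast
    fix s assume s: "s \<in> {-K..K}"
    have "\<bar>s\<bar> \<le> \<bar>K\<bar>" using s by auto
    then have "s\<^sup>2 \<le> K\<^sup>2" by (simp only: abs_le_square_iff)
    then have "1 / (pi * (1 + K\<^sup>2)) \<le> 1 / (pi * (1 + s\<^sup>2))"
      by (intro divide_left_mono mult_left_mono mult_pos_pos) (auto intro: add_pos_nonneg)
    moreover have "Im (g (Complex (b + r * s) \<delta>)) \<ge> 0" using nn pos by simp
    ultimately show "(1 / (pi * (1 + K\<^sup>2))) * Im (g (Complex (b + r * s) \<delta>)) \<le> (1 / (pi * (1 + s\<^sup>2))) *\<^sub>R ?f (\<phi> s)"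
      unfolding fphi real_scaleR_def by (rule mult_right_mono)
  qed
  also have "\<dots> = integral {\<phi> (-K)..\<phi> K} ?f" using sub by (rule integral_unique)
  also have "\<dots> \<le> Im (h 0)" by (rule mean_value_arc_le[OF hol c hnn]) (use \<phi> in auto)
  also have "h 0 = g (Complex b (r + \<delta>))"
    unfolding h_def cayley_def by (rule arg_cong[of _ _ g]) (simp add: complex_eq_iff)
  finally have le: "integral {-K..K} (\<lambda>s. Im (g (Complex (b + r * s) \<delta>))) \<le> pi * (1 + K\<^sup>2) * Im (g (Complex b (r + \<delta>)))"
    by (simp add: field_simps add_pos_nonneg)
  have "((\<lambda>s. r *\<^sub>R Im (g (Complex (b + r * s) \<delta>))) has_integral
      integral {b + r * (-K)..b + r * K} (\<lambda>t. Im (g (Complex t \<delta>)))) {-K..K}"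
  proof (rule has_integral_substitution[where c = "b - r * K" and d = "b + r * K" and g = "\<lambda>s. b + r * s"
        and f = "\<lambda>t. Im (g (Complex t \<delta>))", OF _ _ _ cg])
    show "(\<lambda>s. b + r * s) ` {- K..K} \<subseteq> {b - r * K..b + r * K}"
    proof safe
      fix s assume s: "s \<in> {-K..K}"
      have "r * (-K) \<le> r * s" "r * s \<le> r * K" by (rule mult_left_mono; use s pos in simp)+
      then show "b + r * s \<in> {b - r * K..b + r * K}" by simp
    qed
  qed (use pos in \<open>auto intro!: derivative_eq_intros\<close>)
  then have "integral {-K..K} (\<lambda>s. r *\<^sub>R Im (g (Complex (b + r * s) \<delta>))) =
      integral {b + r * (-K)..b + r * K} (\<lambda>t. Im (g (Complex t \<delta>)))" by (rule integral_unique)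
  then have "integral {b + r * (-K)..b + r * K} (\<lambda>t. Im (g (Complex t \<delta>))) = r * integral {-K..K} (\<lambda>s. Im (g (Complex (b + r * s) \<delta>)))"
    by simp
  also have "\<dots> \<le> r * (pi * (1 + K\<^sup>2) * Im (g (Complex b (r + \<delta>))))"
    using le pos by (intro mult_left_mono) auto
  finally show ?thesis by (simp add: mult.commute mult.left_commute)
qed

lemma continuous_on_horizontal:
  assumes "g holomorphic_on uhp" "\<delta> > 0" shows "continuous_on A (\<lambda>t. g (Complex t \<delta>))"
  by (rule continuous_on_compose2[OF holomorphic_on_imp_continuous_on[OF assms(1)]])
     (use assms(2) in \<open>auto simp: uhp_def Complex_eq intro!: continuous_intros\<close>)

text \<open>With \<open>K = 2 * R\<close> and \<open>r = 1 - \<epsilon>\<close> the total height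
  \<open>r + \<epsilon>\<close> is 1, so the bound sits at \<open>\<i>\<close> for every
  \<open>\<epsilon>\<close>, and \<open>r \<ge> 1 / 2\<close> keeps \<open>[-R, R]\<close> inside
  the interval.\<close>

lemma poisson_fixed_interval_bound:
  assumes g: "g holomorphic_on uhp" and nn: "\<And>z. Im z > 0 \<Longrightarrow> Im (g z) \<ge> 0"
    and pos: "0 < \<epsilon>" "\<epsilon> \<le> 1 / 2" "R > 0"
  shows "integral {-R..R} (\<lambda>t. Im (g (Complex t \<epsilon>))) \<le> pi * (1 + 4 * R\<^sup>2) * Im (g \<i>)"
proof -
  have c: "continuous_on A (\<lambda>t. Im (g (Complex t \<epsilon>)))" for A
    by (intro continuous_intros continuous_on_horizontal g pos)
  have "R * \<epsilon> \<le> R * (1 / 2)" using pos by (intro mult_left_mono) auto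
  then have "integral {-R..R} (\<lambda>t. Im (g (Complex t \<epsilon>))) \<le>
     integral {0 - (2 * R) * (1 - \<epsilon>)..0 + (2 * R) * (1 - \<epsilon>)} (\<lambda>t. Im (g (Complex t \<epsilon>)))"
    using pos nn by (intro integral_subset_le integrable_continuous_real c) (auto simp: algebra_simps)
  also have "\<dots> \<le> pi * (1 + (2 * R)\<^sup>2) * (1 - \<epsilon>) * Im (g (Complex 0 ((1 - \<epsilon>) + \<epsilon>)))"
    using pos by (intro poisson_interval_bound[OF g nn]) auto
  also have "Complex 0 ((1 - \<epsilon>) + \<epsilon>) = \<i>" by (simp add: complex_eq_iff)
  also have "pi * (1 + (2 * R)\<^sup>2) * (1 - \<epsilon>) * Im (g \<i>) \<le> pi * (1 + (2 * R)\<^sup>2) * 1 * Im (g \<i>)"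
    using pos nn[of \<i>] by (intro mult_right_mono mult_left_mono) auto
  finally show ?thesis by (simp add: power2_eq_square)
qed

text \<open>Positivity controls only the imaginary part in the mean, but the square root
  \<open>g\<close> of \<open>f\<close> has values in the first quadrant, so \<open>g\<close> and
  \<open>\<i> * g\<close> both qualify and \<open>|g| \<le> Re g + Im g\<close>. The resulting bound
  on \<open>|f|\<close> off small sets takes the place of boundary value theorems.\<close>

lemma sqrt_norm_interval_bound:
  assumes f: "f holomorphic_on uhp" and im: "\<And>z. Im z > 0 \<Longrightarrow> Im (f z) > 0"
    and pos: "0 < \<epsilon>" "\<epsilon> \<le> 1 / 2" "R > 0"
  shows "integral {-R..R} (\<lambda>t. sqrt (norm (f (Complex t \<epsilon>)))) \<le> 2 * pi * (1 + 4 * R\<^sup>2) * sqrt (norm (f \<i>))"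
proof -
  define g where "g z = csqrt (f z)" for z
  have nr: "f z \<notin> \<real>\<^sub>\<le>\<^sub>0" if "z \<in> uhp" for z
    using im[of z] that by (auto simp: uhp_def complex_nonpos_Reals_iff)
  have g: "g holomorphic_on uhp" unfolding g_def by (intro holomorphic_on_csqrt' f nr) auto
  have ig: "(\<lambda>z. \<i> * g z) holomorphic_on uhp" by (intro holomorphic_intros g)
  have pr: "Im (g z) \<ge> 0" "Re (g z) \<ge> 0" if "Im z > 0" for z
  proof -
    show "Re (g z) \<ge> 0" unfolding g_def by (rule Re_csqrt)
    have "Im (g z ^ 2) > 0" using im[OF that] by (simp add: g_def)
    then have "Re (g z) * Im (g z) > 0" by (simp add: power2_eq_square mult.commute)
    then show "Im (g z) \<ge> 0" using \<open>Re (g z) \<ge> 0\<close> by (simp add: zero_less_mult_iff)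
  qed
  have ng: "sqrt (norm (f z)) = norm (g z)" for z
  proof -
    have "norm (f z) = (norm (g z))\<^sup>2" by (simp add: g_def norm_power[symmetric])
    then show ?thesis by simp
  qed
  have i1: "(\<lambda>t. Im (g (Complex t \<epsilon>))) integrable_on {-R..R}" "(\<lambda>t. Im (\<i> * g (Complex t \<epsilon>))) integrable_on {-R..R}"
    by (intro integrable_continuous_real continuous_intros continuous_on_horizontal g pos)+
  have "integral {-R..R} (\<lambda>t. sqrt (norm (f (Complex t \<epsilon>)))) \<le>
     integral {-R..R} (\<lambda>t. Im (g (Complex t \<epsilon>)) + Im (\<i> * g (Complex t \<epsilon>)))"
  proof (rule integral_le)
    show "(\<lambda>t. sqrt (norm (f (Complex t \<epsilon>)))) integrable_on {-R..R}"
      unfolding ng by (intro integrable_continuous_real continuous_intros continuous_on_horizontal g pos)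
    show "sqrt (norm (f (Complex t \<epsilon>))) \<le> Im (g (Complex t \<epsilon>)) + Im (\<i> * g (Complex t \<epsilon>))" for t
      unfolding ng using cmod_le[of "g (Complex t \<epsilon>)"] pr[of "Complex t \<epsilon>"] pos by simp
  qed (intro integrable_add i1)
  also have "\<dots> = integral {-R..R} (\<lambda>t. Im (g (Complex t \<epsilon>))) + integral {-R..R} (\<lambda>t. Im (\<i> * g (Complex t \<epsilon>)))"
    by (intro integral_add i1)
  also have "\<dots> \<le> pi * (1 + 4 * R\<^sup>2) * Im (g \<i>) + pi * (1 + 4 * R\<^sup>2) * Im (\<i> * g \<i>)"
    using pr by (intro add_mono poisson_fixed_interval_bound g ig pos) auto
  also have "\<dots> \<le> pi * (1 + 4 * R\<^sup>2) * norm (g \<i>) + pi * (1 + 4 * R\<^sup>2) * norm (g \<i>)"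
    using complex_Re_le_cmod[of "g \<i>"] order_trans[OF abs_ge_self abs_Im_le_cmod[of "g \<i>"]]
    by (intro add_mono mult_left_mono) auto
  finally show ?thesis unfolding ng by (simp add: algebra_simps)
qed

text \<open>The Schwarz lemma, after moving source and target to the disc. The factor 4 in
  \<open>1 - |w|^2 = 4 * Im z / |z + \<i>|^2\<close> cancels against the crude
  \<open>(1 + |w|)^2 \<le> 4\<close>.\<close>

lemma herglotz_growth:
  assumes f: "f holomorphic_on uhp" and im: "\<And>z. Im z > 0 \<Longrightarrow> Im (f z) > 0" and z: "Im z > 0"
  shows "norm (f z) \<le> norm (f \<i>) * (norm (z + \<i>))\<^sup>2 / Im z"
proof -
  define a where "a = f \<i>"
  have a: "Im a > 0" using im[of \<i>] by (simp add: a_def)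
  define h where "h w = f (cayley w)" for w
  have h: "h holomorphic_on ball 0 1"
  proof -
    have "(f \<circ> cayley) holomorphic_on ball 0 1"
      by (rule holomorphic_on_compose_gen[OF _ f]) (auto intro!: holomorphic_cayley simp: uhp_def Im_cayley_pos)
    then show ?thesis by (simp add: h_def[abs_def] o_def)
  qed
  have hp: "Im (h w) > 0" if "norm w < 1" for w using im Im_cayley_pos[OF that] by (simp add: h_def)
  define k where "k w = (h w - a) / (h w - cnj a)" for w
  have kd: "h w - cnj a \<noteq> 0" if "norm w < 1" for w
    using hp[OF that] a by (auto simp: complex_eq_iff)
  have lt: "norm (u - a) < norm (u - cnj a)" if "Im u > 0" for u
  proof -
    have "(norm (u - a))\<^sup>2 < (norm (u - cnj a))\<^sup>2"
      unfolding cmod_power2 using mult_pos_pos[OF that a] by (simp add: power2_eq_square algebra_simps)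
    then show ?thesis by (rule power_less_imp_less_base) simp
  qed
  define w where "w = (z - \<i>) / (z + \<i>)"
  have zi: "norm (z + \<i>) > 0" using z by (auto simp: complex_eq_iff)
  have w2: "1 - (norm w)\<^sup>2 = 4 * Im z / (norm (z + \<i>))\<^sup>2"
  proof -
    have "(norm (z + \<i>))\<^sup>2 - (norm (z - \<i>))\<^sup>2 = 4 * Im z"
      unfolding cmod_power2 by (simp add: power2_eq_square algebra_simps)
    then have "4 * Im z / (norm (z + \<i>))\<^sup>2 = ((norm (z + \<i>))\<^sup>2 - (norm (z - \<i>))\<^sup>2) / (norm (z + \<i>))\<^sup>2" by simp
    also have "\<dots> = 1 - (norm w)\<^sup>2" using zi unfolding w_def norm_divide power_divide by (subst diff_divide_distrib) simp
    finally show ?thesis by simp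
  qed
  have "(norm w)\<^sup>2 < 1" using w2 z zi by (smt (verit) divide_pos_pos zero_less_power)
  then have w1: "norm w < 1" by (simp add: abs_square_less_1)
  have "norm (k w) \<le> norm w"
  proof (rule Schwarz_Lemma(1))
    show "k holomorphic_on ball 0 1" unfolding k_def using kd by (intro holomorphic_intros h) auto
    show "k 0 = 0" by (simp add: k_def h_def cayley_def a_def)
    show "norm (k v) < 1" if "norm v < 1" for v
      using lt[OF hp[OF that]] by (simp add: k_def norm_divide divide_less_eq)
  qed (rule w1)
  moreover have hw: "h w = f z" using cayley_inverse[OF z] by (simp add: h_def w_def)
  ultimately have "norm (f z - a) \<le> norm w * norm (f z - cnj a)"
    using kd[OF w1] by (simp add: k_def norm_divide divide_le_eq)
  also have "\<dots> \<le> norm w * (norm (f z) + norm a)"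
    using norm_triangle_ineq4[of "f z" "cnj a"] by (intro mult_left_mono) auto
  finally have "norm (f z) - norm a \<le> norm w * (norm (f z) + norm a)"
    using norm_triangle_ineq2[of "f z" a] by linarith
  then have "norm (f z) * (1 - norm w) \<le> norm a * (1 + norm w)" by (simp add: algebra_simps)
  then have "norm (f z) * (1 - norm w) * (1 + norm w) \<le> norm a * (1 + norm w) * (1 + norm w)"
    by (intro mult_right_mono) auto
  also have "\<dots> \<le> norm a * 2 * 2" using w1 by (intro mult_mono) auto
  finally have "norm (f z) * (1 - (norm w)\<^sup>2) \<le> norm a * 4" by (simp add: algebra_simps power2_eq_square)
  then show ?thesis unfolding w2 a_def using z zi by (simp add: field_simps)
qed

section \<open>Stieltjes inversion through iterated primitives\<close>

lemma has_vector_derivative_vertical: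
  assumes "(P has_field_derivative p) (at (Complex x y))"
  shows "((\<lambda>y. P (Complex x y)) has_vector_derivative (\<i> * p)) (at y)"
proof -
  have "((\<lambda>y. of_real x + \<i> * complex_of_real y) has_vector_derivative \<i>) (at y)"
    by (auto intro!: derivative_eq_intros)
  then have "((\<lambda>y. Complex x y) has_vector_derivative \<i>) (at y)" by (simp add: Complex_eq)
  from field_vector_diff_chain_at[OF this assms] show ?thesis by (simp add: o_def)
qed

lemma has_vector_derivative_horizontal:
  assumes "(P has_field_derivative p) (at (Complex x y))"
  shows "((\<lambda>x. P (Complex x y)) has_vector_derivative p) (at x)"
proof -
  have "((\<lambda>x. complex_of_real x + \<i> * of_real y) has_vector_derivative 1) (at x)"
    by (auto intro!: derivative_eq_intros)
  then have "((\<lambda>x. Complex x y) has_vector_derivative 1) (at x)" by (simp add: Complex_eq)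
  from field_vector_diff_chain_at[OF this assms] show ?thesis by (simp add: o_def)
qed

lemma has_real_derivative_Im:
  "(f has_vector_derivative d) (at x) \<Longrightarrow> ((\<lambda>x. Im (f x)) has_real_derivative Im d) (at x)"
  using bounded_linear.has_vector_derivative[OF bounded_linear_Im]
  by (simp add: has_real_derivative_iff_has_vector_derivative)

lemma convex_right_slope_limit:
  fixes \<phi> :: "real \<Rightarrow> real"
  assumes "convex_on UNIV \<phi>"
  obtains l where "((\<lambda>x. (\<phi> (b + x) - \<phi> b) / x) \<longlongrightarrow> l) (at_right 0)"
proof -
  define S where "S x = (\<phi> (b + x) - \<phi> b) / x" for x
  have flip: "(p - q) / r = - ((q - p) / r)" for p q r :: real
    by (simp add: minus_divide_left)
  have mono: "S x \<le> S x'" if "0 < x" "x \<le> x'" for x x'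
  proof (cases "x = x'")
    case False
    then have "(\<phi> b - \<phi> (b + x')) / x' \<le> (\<phi> b - \<phi> (b + x)) / x"
      using convex_on_slope_le(1)[OF assms, of b "b + x'" "b + x"] that by simp
    then show ?thesis unfolding S_def flip[of _ "\<phi> b"] by simp
  qed simp
  have lower: "\<phi> b - \<phi> (b - 1) \<le> S x" if "0 < x" for x
  proof -
    have "(\<phi> (b - 1) - \<phi> b) / - 1 \<le> (\<phi> b - \<phi> (b + x)) / (b - (b + x))"
      using order_trans[OF convex_on_slope_le[OF assms, of "b - 1" "b + x" b]] that by simp
    then show ?thesis unfolding S_def flip[of _ "\<phi> b"] by simp
  qed
  have bdd: "bdd_below (S ` {0<..})" using lower by (auto intro!: bdd_belowI2)
  have "(S \<longlongrightarrow> (INF x\<in>{0<..}. S x)) (at_right 0)"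
  proof (rule order_tendstoI)
    fix a assume a: "a < (INF x\<in>{0<..}. S x)"
    have "a < S x" if "x > 0" for x using cINF_lower[OF bdd, of x] a that by simp
    then show "\<forall>\<^sub>F x in at_right 0. a < S x" by (auto simp: eventually_at_right_less intro: eventually_mono[OF eventually_at_right_less])
  next
    fix a assume a: "(INF x\<in>{0<..}. S x) < a"
    then obtain x0 where x0: "x0 > 0" "S x0 < a" using cINF_less_iff[OF _ bdd, of a] by auto
    have "S x < a" if "x \<in> {0<..<x0}" for x using mono[of x x0] that x0 by auto
    then show "\<forall>\<^sub>F x in at_right 0. S x < a" using x0(1) unfolding eventually_at_right_field by (auto intro!: exI[of _ x0])
  qed
  then show thesis using that unfolding S_def by blast
qed

locale herglotz =
  fixes f :: "complex \<Rightarrow> complex"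
  assumes holo: "f holomorphic_on uhp" and im_pos: "\<And>z. Im z > 0 \<Longrightarrow> Im (f z) > 0"
begin

text \<open>First and second primitive of \<open>f\<close>. The growth \<open>1 / y\<close> at the
  real line becomes logarithmic for \<open>P\<close> and disappears for \<open>Q\<close>, which
  extends continuously; the behaviour of \<open>P\<close> at the line is then recovered from the
  boundary values of \<open>Q\<close>. This takes the place of the Herglotz representation
  theorem.\<close>

definition "P = (SOME P. \<forall>z. Im z > 0 \<longrightarrow> (P has_field_derivative f z) (at z))"
definition "Q = (SOME Q. \<forall>z. Im z > 0 \<longrightarrow> (Q has_field_derivative P z) (at z))"

lemma primitive_exists:
  assumes "g holomorphic_on uhp" shows "\<exists>G. \<forall>z. Im z > 0 \<longrightarrow> (G has_field_derivative g z) (at z)"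
proof -
  obtain G where G: "\<And>z. z \<in> uhp \<Longrightarrow> (G has_field_derivative g z) (at z within uhp)"
    by (rule holomorphic_convex_primitive'[OF convex_uhp open_uhp assms]) blast
  have "(G has_field_derivative g z) (at z)" if "Im z > 0" for z
    using G[of z] that at_within_open[OF _ open_uhp, of z] by (simp add: uhp_def)
  then show ?thesis by blast
qed

lemma P: "Im z > 0 \<Longrightarrow> (P has_field_derivative f z) (at z)"
  using someI_ex[OF primitive_exists[OF holo]] unfolding P_def by blast

lemma holo_P: "P holomorphic_on uhp"
  unfolding holomorphic_on_open[OF open_uhp] using P by (auto simp: uhp_def)

lemma Q: "Im z > 0 \<Longrightarrow> (Q has_field_derivative P z) (at z)"
  using someI_ex[OF primitive_exists[OF holo_P]] unfolding Q_def by blast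

lemma holo_Q: "Q holomorphic_on uhp"
  unfolding holomorphic_on_open[OF open_uhp] using Q by (auto simp: uhp_def)

text \<open>Integrating \<open>C / y\<close> down from height 1 gives a logarithm; it is weakened to
  \<open>1 / sqrt y\<close> by \<open>ln s \<le> s - 1\<close> at \<open>s = 1 / sqrt y\<close>, so
  that one more integration is elementary.\<close>

lemma P_bound:
  assumes R: "R > 0"
  obtains D where "D \<ge> 0" "\<And>x y. \<lbrakk>\<bar>x\<bar> \<le> R; 0 < y; y \<le> 1\<rbrakk> \<Longrightarrow> norm (P (Complex x y)) \<le> D / sqrt y"
proof -
  define C where "C = norm (f \<i>) * (R + 2)\<^sup>2"
  have C: "C \<ge> 0" by (simp add: C_def)
  have fb: "norm (f (Complex x y)) \<le> C / y" if "\<bar>x\<bar> \<le> R" "0 < y" "y \<le> 1" for x y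
  proof -
    have "norm (Complex x y + \<i>) \<le> \<bar>x\<bar> + \<bar>y + 1\<bar>" using cmod_le[of "Complex x y + \<i>"] by simp
    also have "\<dots> \<le> R + 2" using that by simp
    finally have "(norm (Complex x y + \<i>))\<^sup>2 \<le> (R + 2)\<^sup>2" by (intro power_mono) auto
    then have "norm (f \<i>) * (norm (Complex x y + \<i>))\<^sup>2 / y \<le> C / y"
      unfolding C_def using that by (intro divide_right_mono mult_left_mono) auto
    then show ?thesis using herglotz_growth[OF holo im_pos, of "Complex x y"] that by simp
  qed
  have "bounded ((\<lambda>x. P (Complex x 1)) ` {-R..R})"
    by (intro compact_imp_bounded compact_continuous_image continuous_on_horizontal holo_P) auto
  then obtain B where B: "\<And>x. x \<in> {-R..R} \<Longrightarrow> norm (P (Complex x 1)) \<le> B" unfolding bounded_iff by blast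
  have B0: "B \<ge> 0" using order_trans[OF norm_ge_zero B[of 0]] R by simp
  show thesis
  proof (rule that[of "B + 2 * C"])
    fix x y assume xy: "\<bar>x\<bar> \<le> R" "0 < y" "y \<le> (1::real)"
    have s1: "1 \<le> 1 / sqrt y" using xy by simp
    have "norm (P (Complex x 1) - P (Complex x y)) \<le> 2 * C / sqrt y"
    proof (cases "y = 1")
      case False
      then have y1: "y < 1" using xy by simp
      have "norm (P (Complex x 1) - P (Complex x y)) \<le> C * ln 1 - C * ln y"
      proof (rule differentiable_bound_general[OF y1, where \<phi> = "\<lambda>y. C * ln y" and \<phi>' = "\<lambda>y. C / y"
             and f = "\<lambda>y. P (Complex x y)" and f' = "\<lambda>y. \<i> * f (Complex x y)"])
        show "continuous_on {y..1} (\<lambda>y. P (Complex x y))"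
          by (rule continuous_at_imp_continuous_on)
             (use xy in \<open>auto intro!: has_vector_derivative_continuous[OF has_vector_derivative_vertical[OF P]]\<close>)
        show "continuous_on {y..1} (\<lambda>y. C * ln y)" using xy by (intro continuous_intros) auto
        fix v assume v: "y < v" "v < 1"
        show "((\<lambda>y. P (Complex x y)) has_vector_derivative \<i> * f (Complex x v)) (at v)"
          using v xy by (intro has_vector_derivative_vertical P) auto
        show "((\<lambda>y. C * ln y) has_vector_derivative C / v) (at v)"
          unfolding has_real_derivative_iff_has_vector_derivative[symmetric]
          using v xy by (auto intro!: derivative_eq_intros)
        show "norm (\<i> * f (Complex x v)) \<le> C / v" using fb[of x v] v xy by (simp add: norm_mult)
      qed
      also have "\<dots> = C * (2 * ln (1 / sqrt y))" using xy by (simp add: ln_div ln_sqrt)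
      also have "\<dots> \<le> C * (2 * (1 / sqrt y))"
        using xy C ln_le_minus_one[of "1 / sqrt y"] by (intro mult_left_mono) auto
      finally show ?thesis by (simp add: mult.commute)
    qed (use C in auto)
    moreover have "norm (P (Complex x 1)) \<le> B * (1 / sqrt y)"
    proof -
      have "x \<in> {-R..R}" using xy by auto
      from B[OF this] show ?thesis using mult_left_mono[OF s1 B0] by simp
    qed
    ultimately show "norm (P (Complex x y)) \<le> (B + 2 * C) / sqrt y"
      using norm_triangle_ineq2[of "P (Complex x y)" "P (Complex x 1)"] norm_minus_commute[of "P (Complex x y)" "P (Complex x 1)"]
      by (simp add: add_divide_distrib)
  qed (use B0 C in simp)
qed

lemma Q_holder:
  assumes R: "R > 0"
  obtains D where "D \<ge> 0" "\<And>x y y'. \<lbrakk>\<bar>x\<bar> \<le> R; 0 < y'; y' \<le> y; y \<le> 1\<rbrakk> \<Longrightarrow>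
     norm (Q (Complex x y) - Q (Complex x y')) \<le> D * (sqrt y - sqrt y')"
proof -
  obtain D where D: "D \<ge> 0" "\<And>x y. \<lbrakk>\<bar>x\<bar> \<le> R; 0 < y; y \<le> 1\<rbrakk> \<Longrightarrow> norm (P (Complex x y)) \<le> D / sqrt y"
    using P_bound[OF R] by blast
  show thesis
  proof (rule that[of "2 * D"])
    fix x y y' assume xy: "\<bar>x\<bar> \<le> R" "0 < y'" "y' \<le> y" "y \<le> (1::real)"
    show "norm (Q (Complex x y) - Q (Complex x y')) \<le> 2 * D * (sqrt y - sqrt y')"
    proof (cases "y' = y")
      case False
      then have "y' < y" using xy by simp
      have "norm (Q (Complex x y) - Q (Complex x y')) \<le> 2 * D * sqrt y - 2 * D * sqrt y'"
      proof (rule differentiable_bound_general[OF \<open>y' < y\<close>, where \<phi> = "\<lambda>y. 2 * D * sqrt y" and \<phi>' = "\<lambda>y. D / sqrt y"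
             and f = "\<lambda>y. Q (Complex x y)" and f' = "\<lambda>y. \<i> * P (Complex x y)"])
        show "continuous_on {y'..y} (\<lambda>y. Q (Complex x y))"
          by (rule continuous_at_imp_continuous_on)
             (use xy in \<open>auto intro!: has_vector_derivative_continuous[OF has_vector_derivative_vertical[OF Q]]\<close>)
        show "continuous_on {y'..y} (\<lambda>y. 2 * D * sqrt y)" by (intro continuous_intros)
        fix v assume v: "y' < v" "v < y"
        show "((\<lambda>y. Q (Complex x y)) has_vector_derivative \<i> * P (Complex x v)) (at v)"
          using v xy by (intro has_vector_derivative_vertical Q) auto
        have "((\<lambda>y. 2 * D * sqrt y) has_real_derivative 2 * D * (inverse (sqrt v) / 2)) (at v)"
          using v xy by (intro DERIV_cmult DERIV_real_sqrt) auto
        then show "((\<lambda>y. 2 * D * sqrt y) has_vector_derivative D / sqrt v) (at v)"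
          unfolding has_real_derivative_iff_has_vector_derivative[symmetric] by (simp add: inverse_eq_divide)
        show "norm (\<i> * P (Complex x v)) \<le> D / sqrt v" using D(2)[of x v] v xy by (simp add: norm_mult)
      qed
      then show ?thesis by (simp add: algebra_simps)
    qed simp
  qed (use D in simp)
qed

definition "q x = lim (\<lambda>n. Q (Complex x (1 / (real n + 1))))"
definition "Qe z = (if Im z > 0 then Q z else q (Re z))"

lemma inv_Suc_tendsto: "(\<lambda>n. 1 / (real n + 1)) \<longlonglongrightarrow> 0"
  using LIMSEQ_inverse_real_of_nat by (simp add: inverse_eq_divide add.commute)

lemma q_limit: "(\<lambda>n. Q (Complex x (1 / (real n + 1)))) \<longlonglongrightarrow> q x"
proof -
  obtain D where D: "D \<ge> 0" "\<And>x' y y'. \<lbrakk>\<bar>x'\<bar> \<le> \<bar>x\<bar> + 1; 0 < y'; y' \<le> y; y \<le> 1\<rbrakk> \<Longrightarrow>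
     norm (Q (Complex x' y) - Q (Complex x' y')) \<le> D * (sqrt y - sqrt y')"
    by (rule Q_holder[of "\<bar>x\<bar> + 1"]) (simp, blast)
  have "(\<lambda>n. D * sqrt (1 / (real n + 1))) \<longlonglongrightarrow> D * sqrt 0"
    by (intro tendsto_intros inv_Suc_tendsto)
  then have lim: "(\<lambda>n. D * sqrt (1 / (real n + 1))) \<longlonglongrightarrow> 0" by simp
  have "Cauchy (\<lambda>n. Q (Complex x (1 / (real n + 1))))"
  proof (rule CauchyI')
    fix e :: real assume "e > 0"
    then obtain N where N: "\<And>n. n \<ge> N \<Longrightarrow> D * sqrt (1 / (real n + 1)) < e"
      using order_tendstoD(2)[OF lim] unfolding eventually_sequentially by blast
    show "\<exists>M. \<forall>m\<ge>M. \<forall>n>m. dist (Q (Complex x (1 / (real m + 1)))) (Q (Complex x (1 / (real n + 1)))) < e"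
      unfolding dist_norm
    proof (intro exI[of _ N] allI impI)
      fix m n assume mn: "m \<ge> N" "n > m"
      have "norm (Q (Complex x (1 / (real m + 1))) - Q (Complex x (1 / (real n + 1)))) \<le>
         D * (sqrt (1 / (real m + 1)) - sqrt (1 / (real n + 1)))"
        using mn by (intro D(2)) (auto simp: frac_le)
      also have "\<dots> \<le> D * sqrt (1 / (real m + 1))" using D(1) by (intro mult_left_mono) auto
      also have "\<dots> < e" using N mn by blast
      finally show "norm (Q (Complex x (1 / (real m + 1))) - Q (Complex x (1 / (real n + 1)))) < e" .
    qed
  qed
  then show ?thesis unfolding q_def by (simp add: Cauchy_convergent_iff convergent_LIMSEQ_iff)
qed

text \<open>The shifts of \<open>Q\<close> by \<open>1 / (n + 2)\<close> are continuous up to the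
  line and converge uniformly by \<open>Q_holder\<close>; a shift of at most 1/2 keeps the height
  within the range \<open>y \<le> 1\<close> of that estimate.\<close>

lemma Qe_continuous:
  assumes R: "R > 0" shows "continuous_on {z. \<bar>Re z\<bar> \<le> R \<and> 0 \<le> Im z \<and> Im z \<le> 1 / 2} Qe"
proof -
  obtain D where D: "D \<ge> 0" "\<And>x' y y'. \<lbrakk>\<bar>x'\<bar> \<le> R; 0 < y'; y' \<le> y; y \<le> 1\<rbrakk> \<Longrightarrow>
     norm (Q (Complex x' y) - Q (Complex x' y')) \<le> D * (sqrt y - sqrt y')"
    using Q_holder[OF R] by blast
  have lim: "(\<lambda>n. D * sqrt (1 / (real n + 2))) \<longlonglongrightarrow> 0"
  proof -
    have "(\<lambda>n. D * sqrt (1 / (real (Suc n) + 1))) \<longlonglongrightarrow> D * sqrt 0"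
      by (intro tendsto_intros LIMSEQ_Suc[OF inv_Suc_tendsto])
    then show ?thesis by (simp add: add.commute)
  qed
  define A where "A = {z. \<bar>Re z\<bar> \<le> R \<and> 0 \<le> Im z \<and> Im z \<le> 1 / 2}"
  have bd: "norm (Q (z + \<i> * of_real (1 / (real n + 2))) - Qe z) \<le> D * sqrt (1 / (real n + 2))" if z: "z \<in> A" for z n
  proof -
    define h where "h = 1 / (real n + 2)"
    have h: "0 < h" "h \<le> 1 / 2" by (auto simp: h_def field_simps)
    have zh: "z + \<i> * of_real h = Complex (Re z) (Im z + h)" by (simp add: complex_eq_iff)
    show ?thesis unfolding h_def[symmetric]
    proof (cases "Im z > 0")
      case True
      have "norm (Q (Complex (Re z) (Im z + h)) - Q (Complex (Re z) (Im z))) \<le> D * (sqrt (Im z + h) - sqrt (Im z))"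
        using z h True by (intro D(2)) (auto simp: A_def)
      also have "\<dots> \<le> D * sqrt h"
        using D(1) h sqrt_add_le_add_sqrt[of "Im z" h] True by (intro mult_left_mono) auto
      finally show "norm (Q (z + \<i> * of_real h) - Qe z) \<le> D * sqrt h" using True by (simp add: Qe_def zh)
    next
      case False
      then have z0: "Im z = 0" using z by (simp add: A_def)
      have "norm (Q (Complex (Re z) h) - q (Re z)) \<le> D * sqrt h"
      proof (rule LIMSEQ_le_const2)
        show "(\<lambda>n. norm (Q (Complex (Re z) h) - Q (Complex (Re z) (1 / (real n + 1))))) \<longlonglongrightarrow> norm (Q (Complex (Re z) h) - q (Re z))"
          by (intro tendsto_intros q_limit)
        obtain N where N: "\<And>n. n \<ge> N \<Longrightarrow> 1 / (real n + 1) < h"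
          using order_tendstoD(2)[OF inv_Suc_tendsto h(1)] unfolding eventually_sequentially by blast
        have "norm (Q (Complex (Re z) h) - Q (Complex (Re z) (1 / (real n + 1)))) \<le> D * sqrt h" if "n \<ge> N" for n
        proof -
          have "norm (Q (Complex (Re z) h) - Q (Complex (Re z) (1 / (real n + 1)))) \<le> D * (sqrt h - sqrt (1 / (real n + 1)))"
            using N[OF that] z h by (intro D(2)) (auto simp: A_def)
          also have "\<dots> \<le> D * sqrt h" using D(1) by (intro mult_left_mono) auto
          finally show ?thesis .
        qed
        then show "\<exists>N. \<forall>n\<ge>N. norm (Q (Complex (Re z) h) - Q (Complex (Re z) (1 / (real n + 1)))) \<le> D * sqrt h" by blast
      qed
      then show "norm (Q (z + \<i> * of_real h) - Qe z) \<le> D * sqrt h" using False z0 by (simp add: Qe_def zh)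
    qed
  qed
  have "continuous_on A Qe"
  proof (rule uniform_limit_theorem[where f = "\<lambda>n z. Q (z + \<i> * of_real (1 / (real n + 2)))" and F = sequentially])
    show "\<forall>\<^sub>F n in sequentially. continuous_on A (\<lambda>z. Q (z + \<i> * of_real (1 / (real n + 2))))"
    proof (intro always_eventually allI)
      fix n
      show "continuous_on A (\<lambda>z. Q (z + \<i> * of_real (1 / (real n + 2))))"
      proof (rule continuous_on_compose2[OF holomorphic_on_imp_continuous_on[OF holo_Q]])
        show "(\<lambda>z. z + \<i> * of_real (1 / (real n + 2))) ` A \<subseteq> uhp"
        proof safe
          fix z assume "z \<in> A"
          then have "0 \<le> Im z" by (simp add: A_def)
          moreover have "1 / (real n + 2) > 0" by simp
          ultimately have "Im z + 1 / (real n + 2) > 0" by linarith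
          then show "z + \<i> * of_real (1 / (real n + 2)) \<in> uhp" by (simp add: uhp_def)
        qed
      qed (intro continuous_intros)
    qed
    show "uniform_limit A (\<lambda>n z. Q (z + \<i> * of_real (1 / (real n + 2)))) Qe sequentially"
    proof (rule uniform_limitI)
      fix e :: real assume "e > 0"
      from order_tendstoD(2)[OF lim this]
      show "\<forall>\<^sub>F n in sequentially. \<forall>z\<in>A. dist (Q (z + \<i> * of_real (1 / (real n + 2)))) (Qe z) < e"
        by eventually_elim (use bd in \<open>auto simp: dist_norm intro: le_less_trans\<close>)
    qed
  qed simp
  then show ?thesis by (simp add: A_def)
qed

text \<open>The second derivative in \<open>x\<close> is \<open>Im f > 0\<close>. Convexity passes
  to the boundary function \<open>Im q\<close> and gives it one-sided derivatives at every
  point.\<close>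

lemma Im_Q_convex: "y > 0 \<Longrightarrow> convex_on UNIV (\<lambda>x. Im (Q (Complex x y)))"
proof (rule convex_on_realI[where f' = "\<lambda>x. Im (P (Complex x y))"])
  assume y: "y > 0"
  show "((\<lambda>x. Im (Q (Complex x y))) has_real_derivative Im (P (Complex x y))) (at x)" for x
    using y by (intro has_real_derivative_Im has_vector_derivative_horizontal Q) simp
  show "Im (P (Complex x y)) \<le> Im (P (Complex x' y))" if "x \<le> x'" for x x'
  proof (rule DERIV_nonneg_imp_nondecreasing[OF that])
    fix v
    have "((\<lambda>x. Im (P (Complex x y))) has_real_derivative Im (f (Complex v y))) (at v)"
      using y by (intro has_real_derivative_Im has_vector_derivative_horizontal P) simp
    moreover have "0 \<le> Im (f (Complex v y))" using im_pos[of "Complex v y"] y by simp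
    ultimately show "\<exists>d. ((\<lambda>x. Im (P (Complex x y))) has_real_derivative d) (at v) \<and> 0 \<le> d" by blast
  qed
qed simp

lemma Im_q_convex: "convex_on UNIV (\<lambda>x. Im (q x))"
proof (rule convex_onI)
  fix t x y :: real assume t: "0 < t" "t < 1"
  show "Im (q ((1 - t) *\<^sub>R x + t *\<^sub>R y)) \<le> (1 - t) * Im (q x) + t * Im (q y)"
  proof (rule LIMSEQ_le)
    show "(\<lambda>n. Im (Q (Complex ((1 - t) *\<^sub>R x + t *\<^sub>R y) (1 / (real n + 1))))) \<longlonglongrightarrow> Im (q ((1 - t) *\<^sub>R x + t *\<^sub>R y))"
      by (intro tendsto_intros q_limit)
    show "(\<lambda>n. (1 - t) * Im (Q (Complex x (1 / (real n + 1)))) + t * Im (Q (Complex y (1 / (real n + 1)))))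
        \<longlonglongrightarrow> (1 - t) * Im (q x) + t * Im (q y)"
      by (intro tendsto_intros q_limit)
    show "\<exists>N. \<forall>n\<ge>N. Im (Q (Complex ((1 - t) *\<^sub>R x + t *\<^sub>R y) (1 / (real n + 1))))
        \<le> (1 - t) * Im (Q (Complex x (1 / (real n + 1)))) + t * Im (Q (Complex y (1 / (real n + 1))))"
    proof (intro exI[of _ 0] allI impI)
      fix n
      have "(1 / (real n + 1)) > 0" by simp
      from convex_onD[OF Im_Q_convex[OF this], of t x y] t
      show "Im (Q (Complex ((1 - t) *\<^sub>R x + t *\<^sub>R y) (1 / (real n + 1))))
        \<le> (1 - t) * Im (Q (Complex x (1 / (real n + 1)))) + t * Im (Q (Complex y (1 / (real n + 1))))" by simp
    qed
  qed
qed simp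

text \<open>
  The harmonic function \<open>\<plusminus>(Im V - \<kappa> x) - \<eta> x - M x y\<close> is nonpositive on the frontier of a small
  rectangle \<open>[0, s] \<times> [0, 1/2]\<close>, hence inside; its normal derivative on \<open>x = 0\<close> then confines
  \<open>2 Im P\<close> to \<open>[\<kappa> - \<eta> - M y, \<kappa> + \<eta> + M y]\<close>. This is what makes the limit exist also at atoms.
\<close>

lemma Im_P_limit:
  assumes lim: "((\<lambda>x. (Im (q (b + x)) - Im (q (b - x))) / x) \<longlongrightarrow> \<kappa>) (at_right 0)"
  shows "((\<lambda>y. 2 * Im (P (Complex b y))) \<longlongrightarrow> \<kappa>) (at_right 0)"
proof -
  \<comment> \<open>The reflection \<open>z \<mapsto> - cnj z\<close> makes \<open>Im V\<close> the
    difference of \<open>Im Q\<close> at \<open>b + x\<close> and \<open>b - x\<close>: a harmonic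
    function that vanishes on \<open>x = 0\<close> and has slope \<open>2 * Im P\<close>
    there.\<close>
  define V where "V z = Qe (of_real b + z) + cnj (Qe (of_real b - cnj z))" for z
  have ImV: "Im (V (Complex x y)) = Im (Q (Complex (b + x) y)) - Im (Q (Complex (b - x) y))" if "y > 0" for x y
  proof -
    have "of_real b + Complex x y = Complex (b + x) y" "of_real b - cnj (Complex x y) = Complex (b - x) y"
      by (simp_all add: complex_eq_iff)
    then show ?thesis using that by (simp add: V_def Qe_def)
  qed
  have ImV0: "Im (V (Complex x 0)) = Im (q (b + x)) - Im (q (b - x))" for x
    by (simp add: V_def Qe_def)
  have contV: "continuous_on {z. \<bar>Re z\<bar> \<le> 1 \<and> 0 \<le> Im z \<and> Im z \<le> 1 / 2} V"
    unfolding V_def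
    by (intro continuous_intros continuous_on_compose2[OF Qe_continuous[of "\<bar>b\<bar> + 1"]]) auto
  have holV: "V holomorphic_on uhp"
  proof -
    have "(\<lambda>z. Q (of_real b + z) + (cnj \<circ> (\<lambda>w. Q (of_real b - w)) \<circ> cnj) z) holomorphic_on uhp"
    proof (intro holomorphic_on_add holomorphic_on_compose_cnj_cnj)
      have "(Q \<circ> (\<lambda>z. of_real b + z)) holomorphic_on uhp"
        by (rule holomorphic_on_compose_gen[OF _ holo_Q]) (auto intro!: holomorphic_intros simp: uhp_def)
      then show "(\<lambda>z. Q (of_real b + z)) holomorphic_on uhp" by (simp add: o_def)
      have "(Q \<circ> (\<lambda>w. of_real b - w)) holomorphic_on (cnj ` uhp)"
        by (rule holomorphic_on_compose_gen[OF _ holo_Q]) (auto intro!: holomorphic_intros simp: uhp_def)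
      then show "(\<lambda>w. Q (of_real b - w)) holomorphic_on (cnj ` uhp)" by (simp add: o_def)
      show "open uhp" by simp
    qed
    then show ?thesis
      by (rule holomorphic_transform) (auto simp: V_def Qe_def uhp_def)
  qed
  have main: "\<exists>M\<ge>0. \<forall>y. 0 < y \<and> y < 1 / 2 \<longrightarrow> \<bar>2 * Im (P (Complex b y)) - \<kappa>\<bar> \<le> \<eta> + M * y" if \<eta>: "\<eta> > 0" for \<eta>
  proof -
    have "\<forall>\<^sub>F x in at_right 0. dist ((Im (q (b + x)) - Im (q (b - x))) / x) \<kappa> < \<eta> / 2"
      using tendstoD[OF lim, of "\<eta> / 2"] \<eta> by simp
    then obtain s0 where s0: "s0 > 0" "\<And>x. \<lbrakk>0 < x; x < s0\<rbrakk> \<Longrightarrow> \<bar>(Im (q (b + x)) - Im (q (b - x))) / x - \<kappa>\<bar> < \<eta> / 2"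
      unfolding eventually_at_right_field dist_real_def by auto
    define s where "s = min (s0 / 2) 1"
    have s: "0 < s" "s \<le> 1" "s < s0" using s0(1) by (auto simp: s_def)
    have base: "\<bar>Im (V (Complex x 0)) - \<kappa> * x\<bar> \<le> \<eta> / 2 * x" if "0 \<le> x" "x \<le> s" for x
    proof (cases "x = 0")
      case False
      then have x: "0 < x" "x < s0" using that s by auto
      have "Im (V (Complex x 0)) - \<kappa> * x = x * ((Im (q (b + x)) - Im (q (b - x))) / x - \<kappa>)"
      proof -
        have "x * ((Im (q (b + x)) - Im (q (b - x))) / x) = Im (q (b + x)) - Im (q (b - x))" using x by simp
        then show ?thesis unfolding ImV0 right_diff_distrib[of x "_ / x"] by (simp only: mult.commute)
      qed
      then have "\<bar>Im (V (Complex x 0)) - \<kappa> * x\<bar> = x * \<bar>(Im (q (b + x)) - Im (q (b - x))) / x - \<kappa>\<bar>"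
        using x by (simp add: abs_mult)
      also have "\<dots> \<le> x * (\<eta> / 2)" using s0(2)[OF x] x by (intro mult_left_mono) auto
      finally show ?thesis by (simp add: mult.commute)
    qed (simp add: ImV0)
    define k where "k y = Im (V (Complex s y)) - \<kappa> * s" for y
    have kcont: "continuous_on {0..1/2} k" unfolding k_def
      by (intro continuous_intros continuous_on_compose2[OF contV]) (use s in \<open>auto simp: Complex_eq intro!: continuous_intros\<close>)
    then have "bounded (k ` {0..1/2})" by (intro compact_imp_bounded compact_continuous_image) auto
    then obtain M1 where "\<forall>v\<in>k ` {0..1/2}. norm v \<le> M1" unfolding bounded_iff by blast
    then have M1: "\<bar>k y\<bar> \<le> M1" if "y \<in> {0..1/2}" for y using that by (metis imageI real_norm_def)
    have M10: "M1 \<ge> 0" using M1[of 0] by simp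
    have "\<exists>d>0. \<forall>y\<in>{0..1/2}. dist y 0 < d \<longrightarrow> dist (k y) (k 0) < \<eta> / 2 * s"
    proof -
      have "\<eta> / 2 * s > 0" using \<eta> s(1) by simp
      moreover have "(0::real) \<in> {0..1/2}" by simp
      ultimately show ?thesis using kcont unfolding continuous_on_iff by blast
    qed
    then obtain y0 where y0: "y0 > 0" "\<And>y. y \<in> {0..1/2} \<Longrightarrow> y < y0 \<Longrightarrow> \<bar>k y - k 0\<bar> < \<eta> / 2 * s"
      by (auto simp: dist_real_def)
    have side_small: "\<bar>k y\<bar> \<le> \<eta> * s" if "y \<in> {0..1/2}" "y < y0" for y
      using y0(2)[OF that] base[of s] s by (auto simp: k_def abs_if split: if_splits)
    have "bounded ((\<lambda>x. P (Complex x (1/2))) ` {b - 1..b + 1})"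
      by (intro compact_imp_bounded compact_continuous_image continuous_on_horizontal holo_P) auto
    then obtain D' where D': "\<And>x. x \<in> {b - 1..b + 1} \<Longrightarrow> norm (P (Complex x (1/2))) \<le> D'" unfolding bounded_iff by blast
    have D'0: "D' \<ge> 0" using order_trans[OF norm_ge_zero D'[of b]] by simp
    have top: "\<bar>Im (V (Complex x (1/2))) - \<kappa> * x\<bar> \<le> x * (2 * D' + \<bar>\<kappa>\<bar>)" if x: "0 \<le> x" "x \<le> s" for x
    proof -
      have "norm (Q (Complex (b + x) (1/2)) - Q (Complex (b - x) (1/2))) \<le> D' * (2 * x)"
      proof (cases "x = 0")
        case False
        then have lt: "b - x < b + x" using x by simp
        have "norm (Q (Complex (b + x) (1/2)) - Q (Complex (b - x) (1/2))) \<le> D' * (b + x) - D' * (b - x)"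
        proof (rule differentiable_bound_general[OF lt, where \<phi> = "\<lambda>v. D' * v" and \<phi>' = "\<lambda>v. D'"
             and f = "\<lambda>v. Q (Complex v (1/2))" and f' = "\<lambda>v. P (Complex v (1/2))"])
          show "continuous_on {b - x..b + x} (\<lambda>v. Q (Complex v (1/2)))"
            by (rule continuous_on_horizontal[OF holo_Q]) simp
          fix v assume v: "b - x < v" "v < b + x"
          show "((\<lambda>v. Q (Complex v (1/2))) has_vector_derivative P (Complex v (1/2))) (at v)"
            by (intro has_vector_derivative_horizontal Q) simp
          show "((\<lambda>v. D' * v) has_vector_derivative D') (at v)"
            unfolding has_real_derivative_iff_has_vector_derivative[symmetric] by (auto intro!: derivative_eq_intros)
          show "norm (P (Complex v (1/2))) \<le> D'" using v x s by (intro D') auto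
        qed (intro continuous_intros)
        then show ?thesis by (simp add: algebra_simps)
      qed simp
      moreover have "\<bar>Im (V (Complex x (1/2)))\<bar> \<le> norm (Q (Complex (b + x) (1/2)) - Q (Complex (b - x) (1/2)))"
        using abs_Im_le_cmod[of "Q (Complex (b + x) (1/2)) - Q (Complex (b - x) (1/2))"] by (simp add: ImV)
      moreover have "\<bar>\<kappa> * x\<bar> = \<bar>\<kappa>\<bar> * x" using x by (simp add: abs_mult)
      moreover have "\<bar>Im (V (Complex x (1/2))) - \<kappa> * x\<bar> \<le> \<bar>Im (V (Complex x (1/2)))\<bar> + \<bar>\<kappa> * x\<bar>"
        by (rule abs_triangle_ineq4)
      ultimately show ?thesis by (simp add: algebra_simps)
    qed
    \<comment> \<open>The term \<open>M x y\<close> has to cover what \<open>\<eta> x\<close>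
      cannot: the side \<open>x = s\<close> above height \<open>y0\<close>, where only the bound
      \<open>M1\<close> is known, and the top edge \<open>y = 1 / 2\<close>. On the side below
      \<open>y0\<close> continuity of \<open>k\<close> suffices.\<close>
    define M where "M = max (M1 / (s * y0)) (2 * (2 * D' + \<bar>\<kappa>\<bar>))"
    have M: "M \<ge> 0" "M1 \<le> M * (s * y0)" "2 * D' + \<bar>\<kappa>\<bar> \<le> M * (1/2)"
    proof -
      have "M1 / (s * y0) \<le> M" by (simp add: M_def)
      then show "M1 \<le> M * (s * y0)" using s y0(1) by (simp add: pos_divide_le_eq)
      have "2 * (2 * D' + \<bar>\<kappa>\<bar>) \<le> M" by (simp add: M_def)
      then show "2 * D' + \<bar>\<kappa>\<bar> \<le> M * (1/2)" "M \<ge> 0" using D'0 by simp_all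
    qed
    have box: "\<bar>Im (V (Complex x y)) - \<kappa> * x\<bar> \<le> \<eta> * x + M * x * y" if x: "0 \<le> x" "x \<le> s" and y: "0 \<le> y" "y \<le> 1/2" for x y
    proof -
      define B where "B = cbox 0 (Complex s (1/2))"
      have *: "\<omega> * (Im (V (Complex x y)) - \<kappa> * x) \<le> \<eta> * x + M * x * y" if \<omega>: "\<omega> = 1 \<or> \<omega> = -1" for \<omega> :: real
      proof -
        \<comment> \<open>The functions \<open>\<i> z\<close> and \<open>z^2 / 2\<close> have
          imaginary parts \<open>x\<close> and \<open>x y\<close>, and \<open>\<omega>\<close> is
          the sign. The maximum principle is applied to \<open>Re (- \<i> * G)\<close>, which is
          \<open>Im G\<close>.\<close>
        define G where "G z = of_real \<omega> * (V z - of_real \<kappa> * (\<i> * z)) - of_real \<eta> * (\<i> * z) - of_real (M / 2) * (z * z)" for z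
        have ImG: "Im (G (Complex x y)) = \<omega> * (Im (V (Complex x y)) - \<kappa> * x) - \<eta> * x - M * x * y" for x y
          by (simp add: G_def algebra_simps)
        have "Re (- \<i> * G (Complex x y)) \<le> 0"
        proof (rule maximum_real_frontier[of "\<lambda>z. - \<i> * G z" B])
          have "interior B \<subseteq> uhp" by (auto simp: B_def in_box_complex_iff uhp_def)
          then show "(\<lambda>z. - \<i> * G z) holomorphic_on interior B" unfolding G_def
            by (intro holomorphic_intros holomorphic_on_subset[OF holV])
          have "B \<subseteq> {z. \<bar>Re z\<bar> \<le> 1 \<and> 0 \<le> Im z \<and> Im z \<le> 1 / 2}" using s by (auto simp: B_def in_cbox_complex_iff)
          then show "continuous_on (closure B) (\<lambda>z. - \<i> * G z)" unfolding G_def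
            by (intro continuous_intros continuous_on_subset[OF contV]) (simp add: B_def)
          show "bounded B" by (simp add: B_def)
          show "Complex x y \<in> B" using x y by (simp add: B_def in_cbox_complex_iff)
          fix z assume "z \<in> frontier B"
          then have z: "0 \<le> Re z" "Re z \<le> s" "0 \<le> Im z" "Im z \<le> 1/2"
            and fr: "Re z = 0 \<or> Re z = s \<or> Im z = 0 \<or> Im z = 1/2"
            by (auto simp: B_def frontier_cbox in_cbox_complex_iff in_box_complex_iff)
          have "\<omega> * (Im (V z) - \<kappa> * Re z) \<le> \<bar>Im (V z) - \<kappa> * Re z\<bar>" using \<omega> by auto
          also have "\<dots> \<le> \<eta> * Re z + M * Re z * Im z"
          proof -
            have nn: "0 \<le> \<eta> * Re z" "0 \<le> M * Re z * Im z" using \<eta> M(1) z by auto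
            consider "Re z = 0" | "Im z = 0" | "Re z = s" "Im z < y0" | "Re z = s" "Im z \<ge> y0" | "Im z = 1/2" using fr by linarith
            then show ?thesis
            proof cases
              case 1
              have "Im (V (Complex 0 (Im z))) = 0"
                using ImV[of "Im z" 0] ImV0[of 0] z by (cases "Im z = 0") auto
              moreover have "Complex 0 (Im z) = z" using 1 by (simp add: complex_eq_iff)
              ultimately have "Im (V z) = 0" by simp
              then show ?thesis using 1 by simp
            next
              case 2
              then have "Complex (Re z) 0 = z" by (simp add: complex_eq_iff)
              then have "\<bar>Im (V z) - \<kappa> * Re z\<bar> \<le> \<eta> / 2 * Re z" using base[of "Re z"] z by simp
              then show ?thesis using nn by simp
            next
              case 3
              then have "z = Complex s (Im z)" by (simp add: complex_eq_iff)
              then show ?thesis using side_small[of "Im z"] 3 z nn unfolding k_def by auto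
            next
              case 4
              then have "z = Complex s (Im z)" by (simp add: complex_eq_iff)
              then have "\<bar>Im (V z) - \<kappa> * Re z\<bar> \<le> M1" using M1[of "Im z"] 4 z unfolding k_def by auto
              also have "\<dots> \<le> M * (s * y0)" by (rule M)
              also have "\<dots> \<le> M * (s * Im z)" using M(1) s 4 by (intro mult_left_mono) auto
              finally show ?thesis using nn 4 by (simp add: mult.assoc)
            next
              case 5
              then have "z = Complex (Re z) (1/2)" by (simp add: complex_eq_iff)
              then have "\<bar>Im (V z) - \<kappa> * Re z\<bar> \<le> Re z * (2 * D' + \<bar>\<kappa>\<bar>)" using top[of "Re z"] z by simp
              also have "\<dots> \<le> Re z * (M * (1/2))" using M(3) z by (intro mult_left_mono) auto
              also have "\<dots> = M * Re z * Im z" using 5 by simp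
              finally show ?thesis using nn by linarith
            qed
          qed
          finally have "Im (G (Complex (Re z) (Im z))) \<le> 0" unfolding ImG by simp
          then show "Re (- \<i> * G z) \<le> 0" by simp
        qed
        then show ?thesis using ImG[of x y] by simp
      qed
      show ?thesis using *[of 1] *[of "-1"] by (simp add: abs_le_iff)
    qed
    have "\<bar>2 * Im (P (Complex b y)) - \<kappa>\<bar> \<le> \<eta> + M * y" if y: "0 < y" "y < 1/2" for y
    proof -
      define g where "g x = Im (V (Complex x y))" for x
      have D1: "((\<lambda>x. Im (Q (Complex x y))) has_real_derivative Im (P (Complex b y))) (at b)"
        using y by (intro has_real_derivative_Im has_vector_derivative_horizontal Q) simp
      have "((\<lambda>x. Im (Q (Complex (b + x) y))) has_real_derivative Im (P (Complex b y)) * 1) (at 0)"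
        by (rule DERIV_chain2[where g = "\<lambda>x. b + x"]) (use D1 in \<open>auto intro!: derivative_eq_intros\<close>)
      moreover have "((\<lambda>x. Im (Q (Complex (b - x) y))) has_real_derivative Im (P (Complex b y)) * (-1)) (at 0)"
        by (rule DERIV_chain2[where g = "\<lambda>x. b - x"]) (use D1 in \<open>auto intro!: derivative_eq_intros\<close>)
      ultimately have "(g has_real_derivative (Im (P (Complex b y)) * 1 - Im (P (Complex b y)) * (-1))) (at 0)"
        unfolding g_def[abs_def] ImV[OF y(1)] by (rule DERIV_diff)
      then have "((\<lambda>x. g x / x) \<longlongrightarrow> 2 * Im (P (Complex b y))) (at 0)"
        unfolding has_field_derivative_iff using ImV[OF y(1), of 0] by (simp add: g_def)
      then have "((\<lambda>x. \<bar>g x / x - \<kappa>\<bar>) \<longlongrightarrow> \<bar>2 * Im (P (Complex b y)) - \<kappa>\<bar>) (at_right 0)"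
        by (intro tendsto_intros) (rule filterlim_at_within_not_equal | rule tendsto_mono[OF at_le]; simp)+
      moreover have "\<forall>\<^sub>F x in at_right 0. \<bar>g x / x - \<kappa>\<bar> \<le> \<eta> + M * y"
        unfolding eventually_at_right_field
      proof (intro exI[of _ s] conjI allI impI)
        fix x assume x: "0 < x" "x < s"
        have "g x / x - \<kappa> = (g x - \<kappa> * x) / x" using x by (simp add: field_simps)
        then have "\<bar>g x / x - \<kappa>\<bar> = \<bar>g x - \<kappa> * x\<bar> / x" using x by (simp add: abs_divide)
        also have "\<dots> \<le> (\<eta> * x + M * x * y) / x"
          using box[of x y] x y unfolding g_def by (intro divide_right_mono) auto
        also have "\<dots> = \<eta> + M * y" using x by (simp add: field_simps)
        finally show "\<bar>g x / x - \<kappa>\<bar> \<le> \<eta> + M * y" .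
      qed (use s in simp)
      ultimately show ?thesis by (rule tendsto_upperbound) simp
    qed
    then show ?thesis using M(1) by blast
  qed
  show ?thesis
  proof (rule tendstoI)
    fix e :: real assume e: "e > 0"
    obtain M where M: "M \<ge> 0" "\<And>y. \<lbrakk>0 < y; y < 1 / 2\<rbrakk> \<Longrightarrow> \<bar>2 * Im (P (Complex b y)) - \<kappa>\<bar> \<le> e / 2 + M * y"
      using main[of "e / 2"] e by auto
    show "\<forall>\<^sub>F y in at_right 0. dist (2 * Im (P (Complex b y))) \<kappa> < e"
      unfolding eventually_at_right_field dist_real_def
    proof (intro exI[of _ "min (1/2) (e / (2 * (M + 1)))"] conjI allI impI)
      show "0 < min (1/2) (e / (2 * (M + 1)))" using e M by simp
      fix y assume y: "0 < y" "y < min (1/2) (e / (2 * (M + 1)))"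
      then have "(M + 1) * y < e / 2" using M(1) by (simp add: field_simps)
      then have "M * y < e / 2" using y by (simp add: algebra_simps)
      then show "\<bar>2 * Im (P (Complex b y)) - \<kappa>\<bar> < e" using M(2)[of y] y by linarith
    qed
  qed
qed

text \<open>Integrals of \<open>Im f\<close> along a horizontal segment are differences of
  \<open>Im P\<close>, and \<open>Im_P_limit\<close> gives their limits at every endpoint because
  both one-sided slopes of the convex function \<open>Im q\<close> exist. \<open>L\<close> is half
  the sum of these slopes.\<close>

theorem stieltjes_limit:
  obtains L where "mono L"
    "\<And>a b. a \<le> b \<Longrightarrow> ((\<lambda>\<epsilon>. integral {a..b} (\<lambda>t. Im (f (Complex t \<epsilon>)))) \<longlongrightarrow> L b - L a) (at_right 0)"
proof -
  have ex: "\<exists>l. ((\<lambda>y. Im (P (Complex b y))) \<longlongrightarrow> l) (at_right 0)" for b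
  proof -
    obtain l where l: "((\<lambda>x. (Im (q (b + x)) - Im (q b)) / x) \<longlongrightarrow> l) (at_right 0)"
      using convex_right_slope_limit[OF Im_q_convex] by blast
    have "convex_on UNIV (\<lambda>x. Im (q (- x)))"
    proof (rule convex_onI)
      fix t x y :: real assume "0 < t" "t < 1"
      then show "Im (q (- ((1 - t) *\<^sub>R x + t *\<^sub>R y))) \<le> (1 - t) * Im (q (- x)) + t * Im (q (- y))"
        using convex_onD[OF Im_q_convex, of t "-x" "-y"] by simp
    qed simp
    then obtain l' where l': "((\<lambda>x. (Im (q (- (- b + x))) - Im (q (- (- b)))) / x) \<longlongrightarrow> l') (at_right 0)"
      using convex_right_slope_limit[of "\<lambda>x. Im (q (- x))" "- b"] by blast
    have "((\<lambda>x. (Im (q (b + x)) - Im (q (b - x))) / x) \<longlongrightarrow> l - l') (at_right 0)"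
      using tendsto_diff[OF l l'] by (simp add: diff_divide_distrib[symmetric] algebra_simps)
    from tendsto_mult_left[OF Im_P_limit[OF this], of "1/2"] show ?thesis by auto
  qed
  define L where "L b = (SOME l. ((\<lambda>y. Im (P (Complex b y))) \<longlongrightarrow> l) (at_right 0))" for b
  have L: "((\<lambda>y. Im (P (Complex b y))) \<longlongrightarrow> L b) (at_right 0)" for b
    unfolding L_def by (rule someI_ex[OF ex])
  have ftc: "integral {a..b} (\<lambda>t. Im (f (Complex t y))) = Im (P (Complex b y)) - Im (P (Complex a y))" if "a \<le> b" "y > 0" for a b y
  proof (rule integral_unique, rule fundamental_theorem_of_calculus[OF that(1)])
    fix x
    have "((\<lambda>x. Im (P (Complex x y))) has_real_derivative Im (f (Complex x y))) (at x)"
      using that by (intro has_real_derivative_Im has_vector_derivative_horizontal P) simp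
    then show "((\<lambda>x. Im (P (Complex x y))) has_vector_derivative Im (f (Complex x y))) (at x within {a..b})"
      unfolding has_real_derivative_iff_has_vector_derivative by (rule has_vector_derivative_at_within)
  qed
  have conv: "((\<lambda>\<epsilon>. integral {a..b} (\<lambda>t. Im (f (Complex t \<epsilon>)))) \<longlongrightarrow> L b - L a) (at_right 0)" if "a \<le> b" for a b
  proof (rule Lim_transform_eventually[OF tendsto_diff[OF L L]])
    show "\<forall>\<^sub>F y in at_right 0. Im (P (Complex b y)) - Im (P (Complex a y)) = integral {a..b} (\<lambda>t. Im (f (Complex t y)))"
      using eventually_at_right_less[of 0] by eventually_elim (use ftc[OF that] in simp)
  qed
  have "mono L"
  proof (rule monoI)
    fix a b :: real assume ab: "a \<le> b"
    have "\<forall>\<^sub>F y in at_right 0. 0 \<le> integral {a..b} (\<lambda>t. Im (f (Complex t y)))"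
      using eventually_at_right_less[of 0]
    proof eventually_elim
      case (elim y)
      then have "0 \<le> Im (f (Complex t y))" for t using im_pos[of "Complex t y"] by simp
      then show ?case by (intro integral_nonneg integrable_continuous_real continuous_intros continuous_on_horizontal holo elim)
    qed
    from tendsto_lowerbound[OF conv[OF ab] this] show "L a \<le> L b" by simp
  qed
  then show thesis using conv that by blast
qed

end

section \<open>The spectral measure and its absolutely continuous part\<close>

lemma UN_Ioc_eq_UNIV: "(\<Union>i. {- real i<..real i}) = UNIV"
proof -
  have "\<exists>i. x \<in> {- real i<..real i}" for x
    by (rule exI[of _ "nat \<lceil>\<bar>x\<bar>\<rceil> + 1"]) (simp; linarith)
  then show ?thesis by blast
qed

lemma measure_eqI_Ioc:
  fixes \<mu> \<nu> :: "real measure"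
  assumes s: "sets \<mu> = sets borel" "sets \<nu> = sets borel"
    and fin: "\<And>a b. a < b \<Longrightarrow> emeasure \<mu> {a<..b} < \<infinity>"
    and eq: "\<And>a b. a < b \<Longrightarrow> emeasure \<mu> {a<..b} = emeasure \<nu> {a<..b}"
  shows "\<mu> = \<nu>"
proof (rule measure_eqI_generator_eq[where E = "range (\<lambda>(a, b). {a<..b::real})" and \<Omega> = UNIV and A = "\<lambda>i. {- real i<..real i}"])
  show "Int_stable (range (\<lambda>(a, b). {a<..b::real}))"
    unfolding Int_stable_def by (auto simp: image_iff intro!: exI)
  show "\<mu> A = \<nu> A" if "A \<in> range (\<lambda>(a, b). {a<..b})" for A
  proof -
    from that obtain a b where A: "A = {a<..b}" by auto
    show ?thesis unfolding A by (cases "a < b") (simp_all add: eq)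
  qed
  show "sets \<mu> = sigma_sets UNIV (range (\<lambda>(a, b). {a<..b}))" "sets \<nu> = sigma_sets UNIV (range (\<lambda>(a, b). {a<..b}))"
    unfolding s borel_sigma_sets_Ioc by simp_all
  show "(\<Union>i. {- real i<..real i}) = UNIV" by (rule UN_Ioc_eq_UNIV)
  show "emeasure \<mu> {- real i<..real i} \<noteq> \<infinity>" for i
    by (cases "i = 0") (use fin[of "- real i" "real i"] in auto)
qed auto

text \<open>The limit function of the inversion formula takes the middle value at an atom, whereas
  the distribution function of a measure is right continuous. Passing to right limits corresponds to
  the outer limit in \<open>\<delta>\<close>.\<close>

lemma mono_right_limit:
  fixes L :: "real \<Rightarrow> real"
  assumes "mono L"
  obtains G where "mono G" "\<And>a. (L \<longlongrightarrow> G a) (at_right a)" "\<And>a. continuous (at_right a) G"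
    "\<And>a b. a < b \<Longrightarrow> G a \<le> L b" "\<And>a. L a \<le> G a"
proof
  define G where "G a = (INF t\<in>{a<..}. L t)" for a
  have bdd: "bdd_below (L ` {a<..})" for a
    using monoD[OF assms] by (intro bdd_belowI2[of _ "L a"]) auto
  show le: "G a \<le> L b" if "a < b" for a b
    unfolding G_def using that by (intro cINF_lower bdd) auto
  show ge: "L a \<le> G a" for a
    unfolding G_def using monoD[OF assms] by (intro cINF_greatest) auto
  show mono: "mono G"
    unfolding G_def by (intro monoI cINF_superset_mono bdd) auto
  have near: "\<exists>t>a. L t < c" if "G a < c" for a c
    using cInf_lessD[of "L ` {a<..}" c] that unfolding G_def by auto
  show "(L \<longlongrightarrow> G a) (at_right a)" for a
  proof (rule order_tendstoI)
    fix c assume c: "c < G a"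
    show "\<forall>\<^sub>F x in at_right a. c < L x"
      using eventually_at_right_less[of a] by eventually_elim (use c le[of a] in force)
  next
    fix c assume "G a < c"
    then obtain t where t: "t > a" "L t < c" using near by blast
    show "\<forall>\<^sub>F x in at_right a. L x < c"
      using eventually_at_right_real[OF t(1)]
    proof eventually_elim
      case (elim x)
      have "L x \<le> L t" using elim by (intro monoD[OF assms]) simp
      then show ?case using t(2) by linarith
    qed
  qed
  show "continuous (at_right a) G" for a
    unfolding continuous_within
  proof (rule order_tendstoI)
    fix c assume c: "c < G a"
    show "\<forall>\<^sub>F x in at_right a. c < G x"
      by (rule eventually_mono[OF eventually_at_right_less[of a]]) (rule less_le_trans[OF c monoD[OF mono]], simp)
  next
    fix c assume "G a < c"
    then obtain t where t: "t > a" "L t < c" using near by blast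
    show "\<forall>\<^sub>F x in at_right a. G x < c"
      using eventually_at_right_real[OF t(1)]
    proof eventually_elim
      case (elim x)
      have "G x \<le> L t" using elim by (intro le) simp
      then show ?case using t(2) by linarith
    qed
  qed
qed

section \<open>Lebesgue decomposition and density points\<close>

definition measure_sum :: "'a measure \<Rightarrow> 'a measure \<Rightarrow> 'a measure" where
  "measure_sum \<mu> \<nu> = measure_of (space \<mu>) (sets \<mu>) (\<lambda>A. emeasure \<mu> A + emeasure \<nu> A)"

lemma measure_sum:
  assumes s: "sets \<nu> = sets \<mu>"
  shows "sets (measure_sum \<mu> \<nu>) = sets \<mu>" "space (measure_sum \<mu> \<nu>) = space \<mu>"
    "A \<in> sets \<mu> \<Longrightarrow> emeasure (measure_sum \<mu> \<nu>) A = emeasure \<mu> A + emeasure \<nu> A"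
proof -
  show "sets (measure_sum \<mu> \<nu>) = sets \<mu>" "space (measure_sum \<mu> \<nu>) = space \<mu>"
    unfolding measure_sum_def by simp_all
  show "emeasure (measure_sum \<mu> \<nu>) A = emeasure \<mu> A + emeasure \<nu> A" if "A \<in> sets \<mu>"
    unfolding measure_sum_def
  proof (rule emeasure_measure_of_sigma)
    show "sigma_algebra (space \<mu>) (sets \<mu>)" ..
    show "positive (sets \<mu>) (\<lambda>A. emeasure \<mu> A + emeasure \<nu> A)" by (simp add: positive_def)
    show "countably_additive (sets \<mu>) (\<lambda>A. emeasure \<mu> A + emeasure \<nu> A)"
    proof (rule countably_additiveI)
      fix B :: "nat \<Rightarrow> _" assume B: "range B \<subseteq> sets \<mu>" "disjoint_family B"
      then show "(\<Sum>i. emeasure \<mu> (B i) + emeasure \<nu> (B i)) = emeasure \<mu> (\<Union>i. B i) + emeasure \<nu> (\<Union>i. B i)"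
        by (subst suminf_add[symmetric]) (simp_all add: suminf_emeasure s)
    qed
  qed (use that in simp)
qed

text \<open>With \<open>\<eta> = \<mu> + lborel\<close> and \<open>lborel = f \<cdot> \<eta>\<close>, the singular part of \<open>\<mu>\<close> lives on \<open>{f = 0}\<close>.\<close>

lemma lebesgue_decomposition:
  fixes \<mu> :: "real measure"
  assumes s: "sets \<mu> = sets borel" and fin: "\<And>a b. emeasure \<mu> {a<..b} < \<infinity>"
  obtains N where "N \<in> null_sets lborel" "\<And>A. A \<in> null_sets lborel \<Longrightarrow> emeasure \<mu> (A - N) = 0"
proof -
  define \<eta> where "\<eta> = measure_sum \<mu> lborel"
  have sl: "sets lborel = sets \<mu>" using s by simp
  note \<eta> = measure_sum[OF sl, folded \<eta>_def]
  have sp: "space \<mu> = UNIV" using sets_eq_imp_space_eq[OF s] by simp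
  interpret \<eta>: sigma_finite_measure \<eta>
  proof
    let ?A = "range (\<lambda>i. {- real i<..real i})"
    note UN_Ioc_eq_UNIV
    moreover have "emeasure \<eta> {- real i<..real i} \<noteq> \<infinity>" for i
      using fin[of "- real i" "real i"] by (simp add: \<eta> s less_top)
    ultimately show "\<exists>A. countable A \<and> A \<subseteq> sets \<eta> \<and> \<Union> A = space \<eta> \<and> (\<forall>a\<in>A. emeasure \<eta> a \<noteq> \<infinity>)"
      by (intro exI[of _ ?A]) (auto simp: \<eta> s sp)
  qed
  have "absolutely_continuous \<eta> lborel"
    unfolding absolutely_continuous_def by (auto simp: null_sets_def \<eta> s)
  then obtain f where f: "f \<in> borel_measurable \<eta>" "density \<eta> f = lborel"
    using \<eta>.Radon_Nikodym[of lborel] \<eta>(1) sl by auto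
  define N where "N = {x. f x = 0}"
  have Nm: "N \<in> sets \<eta>" using f(1) measurable_sets[OF f(1), of "{0}"] by (simp add: N_def vimage_def \<eta>(2) sp)
  have sub: "f \<in> borel_measurable borel" using f(1) measurable_cong_sets[OF \<eta>(1)[unfolded s] refl] by blast
  show thesis
  proof
    have "emeasure lborel N = (\<integral>\<^sup>+x. f x * indicator N x \<partial>\<eta>)"
      unfolding f(2)[symmetric] by (rule emeasure_density[OF f(1) Nm])
    also have "\<dots> = (\<integral>\<^sup>+x. 0 \<partial>\<eta>)" by (intro nn_integral_cong) (auto simp: N_def indicator_def)
    finally show "N \<in> null_sets lborel" using Nm by (auto simp: null_sets_def \<eta> s)
  next
    fix A :: "real set" assume A: "A \<in> null_sets lborel"
    then have A': "A \<in> sets \<eta>" "emeasure lborel A = 0" by (auto simp: \<eta> s)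
    have "(\<integral>\<^sup>+x. f x * indicator A x \<partial>\<eta>) = 0"
      using emeasure_density[OF f(1) A'(1)] A'(2) unfolding f(2) by simp
    then have "AE x in \<eta>. f x * indicator A x = 0"
      using f(1) A'(1) by (subst (asm) nn_integral_0_iff_AE) auto
    then have "AE x in \<eta>. x \<notin> A - N" by eventually_elim (auto simp: N_def indicator_def split: if_splits)
    then have "A - N \<in> null_sets \<eta>"
      using A'(1) Nm by (subst AE_iff_null_sets) auto
    then show "emeasure \<mu> (A - N) = 0" using A'(1) Nm by (auto simp: null_sets_def \<eta>)
  qed
qed

text \<open>Deleting \<open>N\<close> leaves an absolutely continuous measure, and what is deleted
  lives on a null set, so this is a decomposition. Given another one with null set
  \<open>N'\<close>, both singular parts vanish off \<open>N \<union> N'\<close>, and absolutely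
  continuous measures do not see that set; hence the uniqueness behind \<open>THE\<close>.\<close>

lemma ac_part_eq:
  fixes \<mu> :: "real measure"
  assumes s: "sets \<mu> = sets borel" and fin: "\<And>a b. emeasure \<mu> {a<..b} < \<infinity>"
  obtains N where "N \<in> null_sets lborel" "sets (ac_part \<mu>) = sets borel" "absolutely_continuous lborel (ac_part \<mu>)"
    "\<And>A. A \<in> sets borel \<Longrightarrow> emeasure (ac_part \<mu>) A = emeasure \<mu> (A - N)"
proof -
  obtain N where N: "N \<in> null_sets lborel" "\<And>A. A \<in> null_sets lborel \<Longrightarrow> emeasure \<mu> (A - N) = 0"
    by (rule lebesgue_decomposition[OF assms]) blast
  have Nb: "N \<in> sets borel" using N(1) by auto
  have sp: "space \<mu> = UNIV" using sets_eq_imp_space_eq[OF s] by simp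
  define \<nu> where "\<nu> = density \<mu> (indicator (- N))"
  define \<rho> where "\<rho> = density \<mu> (indicator N)"
  have \<nu>s: "sets \<nu> = sets borel" "sets \<rho> = sets borel" by (simp_all add: \<nu>_def \<rho>_def s)
  have \<nu>: "emeasure \<nu> A = emeasure \<mu> (A - N)" "emeasure \<rho> A = emeasure \<mu> (A \<inter> N)" if "A \<in> sets borel" for A
  proof -
    have i: "indicator (- N) x * indicator A x = (indicator (A - N) x :: ennreal)"
      "indicator N x * indicator A x = (indicator (A \<inter> N) x :: ennreal)" for x by (auto simp: indicator_def)
    show "emeasure \<nu> A = emeasure \<mu> (A - N)" "emeasure \<rho> A = emeasure \<mu> (A \<inter> N)"
      unfolding \<nu>_def \<rho>_def using that Nb s
      by (simp_all add: emeasure_density i borel_measurable_indicator borel_comp)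
  qed
  have ac: "absolutely_continuous lborel \<nu>"
    unfolding absolutely_continuous_def using N(2) by (auto simp: null_sets_def \<nu>s \<nu>)
  define Pr where "Pr \<nu> \<longleftrightarrow> sets \<nu> = sets borel \<and> absolutely_continuous lborel \<nu> \<and>
        (\<exists>\<rho>. sets \<rho> = sets borel \<and> (\<exists>N\<in>null_sets lborel. emeasure \<rho> (- N) = 0) \<and>
           (\<forall>A\<in>sets borel. emeasure \<mu> A = emeasure \<nu> A + emeasure \<rho> A))" for \<nu> :: "real measure"
  have "Pr \<nu>" unfolding Pr_def
  proof (intro conjI exI[of _ \<rho>] bexI[of _ N] ballI \<nu>s ac N(1))
    have "- N \<in> sets borel" using Nb by (simp add: borel_comp)
    then show "emeasure \<rho> (- N) = 0" by (simp add: \<nu>)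
    fix A :: "real set" assume A: "A \<in> sets borel"
    have "emeasure \<mu> (A - N) + emeasure \<mu> (A \<inter> N) = emeasure \<mu> ((A - N) \<union> (A \<inter> N))"
      by (rule plus_emeasure) (use A Nb in \<open>auto simp: s\<close>)
    also have "(A - N) \<union> (A \<inter> N) = A" by auto
    finally show "emeasure \<mu> A = emeasure \<nu> A + emeasure \<rho> A" by (simp add: \<nu> A)
  qed
  moreover have "\<nu>' = \<nu>" if P: "Pr \<nu>'" for \<nu>'
  proof (rule measure_eqI)
    from P obtain \<rho>' N' where \<nu>': "sets \<nu>' = sets borel" "absolutely_continuous lborel \<nu>'" "sets \<rho>' = sets borel"
      "N' \<in> null_sets lborel" "emeasure \<rho>' (- N') = 0"
      "\<And>A. A \<in> sets borel \<Longrightarrow> emeasure \<mu> A = emeasure \<nu>' A + emeasure \<rho>' A" unfolding Pr_def by blast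
    show "sets \<nu>' = sets \<nu>" by (simp add: \<nu>' \<nu>s)
    fix A assume "A \<in> sets \<nu>'"
    then have A: "A \<in> sets borel" by (simp add: \<nu>')
    define Z where "Z = N \<union> N'"
    have Z: "Z \<in> null_sets lborel" unfolding Z_def using N(1) \<nu>'(4) by blast
    then have Zb: "Z \<in> sets borel" by auto
    have N'b: "- N' \<in> sets borel" using \<nu>'(4) by (simp add: borel_comp null_sets_def)
    have drop: "emeasure \<xi> (A - Z) = emeasure \<xi> A" if "sets \<xi> = sets borel" "absolutely_continuous lborel \<xi>" for \<xi> :: "real measure"
      by (rule emeasure_Diff_null_set) (use that Z A in \<open>auto simp: absolutely_continuous_def\<close>)
    have "emeasure \<rho>' (A - Z) \<le> emeasure \<rho>' (- N')" by (rule emeasure_mono) (use N'b \<nu>'(3) in \<open>auto simp: Z_def\<close>)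
    then have "emeasure \<mu> (A - Z) = emeasure \<nu>' (A - Z)" using \<nu>'(5) \<nu>'(6)[of "A - Z"] A Zb by simp
    moreover have "emeasure \<nu> (A - Z) = emeasure \<mu> (A - Z)"
    proof -
      have "A - Z - N = A - Z" by (auto simp: Z_def)
      then show ?thesis using \<nu>(1)[of "A - Z"] A Zb by simp
    qed
    ultimately show "emeasure \<nu>' A = emeasure \<nu> A" using drop[OF \<nu>'(1,2)] drop[OF \<nu>s(1) ac] by simp
  qed
  ultimately have "(THE \<nu>. Pr \<nu>) = \<nu>" by (rule the_equality)
  then have "ac_part \<mu> = \<nu>" unfolding ac_part_def Pr_def .
  then show thesis using that[of N] N(1) \<nu>s(1) ac \<nu>(1) by simp
qed

text \<open>Prepares the argument by contradiction. Null sets are removed so that \<open>F\<close>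
  becomes Borel and the almost everywhere property holds everywhere on it; then a level set of the
  density \<open>f\<close>, cut to a bounded interval, must have positive length.\<close>

lemma not_null_ac_part:
  fixes \<mu> :: "real measure"
  assumes s: "sets \<mu> = sets borel" and fin: "\<And>a b. emeasure \<mu> {a<..b} < \<infinity>"
    and F: "F \<in> sets lebesgue" "F \<notin> null_sets (completion (ac_part \<mu>))"
    and Q: "AE E in lebesgue. E \<in> F \<longrightarrow> Q E"
  obtains A R w where "A \<in> sets borel" "A \<subseteq> {-R..R}" "1 \<le> R" "0 < measure lborel A" "0 < w"
    "\<And>E. E \<in> A \<Longrightarrow> Q E"
    "\<And>C. C \<in> sets borel \<Longrightarrow> C \<subseteq> A \<Longrightarrow> ennreal w * emeasure lborel C \<le> emeasure \<mu> C"
proof -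
  define \<nu> where "\<nu> = ac_part \<mu>"
  obtain N where N: "sets \<nu> = sets borel" "absolutely_continuous lborel \<nu>"
    "\<And>A. A \<in> sets borel \<Longrightarrow> emeasure \<nu> A = emeasure \<mu> (A - N)" "N \<in> null_sets lborel"
    unfolding \<nu>_def by (rule ac_part_eq[OF s fin]) blast
  have \<nu>_le: "emeasure \<nu> A \<le> emeasure \<mu> A" if "A \<in> sets borel" for A
    unfolding N(3)[OF that] using that s by (intro emeasure_mono) auto
  obtain f where f: "f \<in> borel_measurable lborel" "density lborel f = \<nu>"
    using sigma_finite_measure.Radon_Nikodym[OF sigma_finite_lborel N(2)] N(1) by auto
  obtain N0 where N0: "\<And>E. E \<notin> N0 \<Longrightarrow> E \<in> F \<longrightarrow> Q E" "N0 \<in> null_sets lebesgue"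
    by (rule AE_E3[OF Q]) (rule that, auto)
  obtain N1 where N1: "N1 \<in> null_sets lborel" "N0 \<subseteq> N1"
    using N0(2) unfolding null_sets_completion_iff2 by auto
  obtain S T N2 where FF: "F = S \<union> T" "T \<subseteq> N2" "N2 \<in> null_sets lborel" "S \<in> sets lborel"
    using F(1) by (rule sets_completionE)
  define B where "B = S - N1"
  have B: "B \<in> sets borel" "B \<subseteq> F" "\<And>E. E \<in> B \<Longrightarrow> Q E" "F \<subseteq> B \<union> (N1 \<union> N2)"
    using FF N0(1) N1 by (auto simp: B_def)
  have "\<not> (AE x in lborel. x \<in> B \<longrightarrow> f x = 0)"
  proof
    assume "AE x in lborel. x \<in> B \<longrightarrow> f x = 0"
    then have "AE x in lborel. f x * indicator B x = 0" by eventually_elim (auto simp: indicator_def)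
    then have "(\<integral>\<^sup>+x. f x * indicator B x \<partial>lborel) = 0" using f(1) B(1) by (subst nn_integral_0_iff_AE) auto
    then have "B \<in> null_sets \<nu>" using f B(1) emeasure_density[OF f(1), of B] N(1) by (auto simp: null_sets_def)
    moreover have "N1 \<union> N2 \<in> null_sets \<nu>" using N(2) N1(1) FF(3) by (auto simp: absolutely_continuous_def)
    ultimately have "B \<union> (N1 \<union> N2) \<in> null_sets \<nu>" by blast
    then have "F \<in> null_sets (completion \<nu>)" using B(4) null_sets_completion_subset null_sets_completionI by blast
    then show False using F(2) unfolding \<nu>_def by simp
  qed
  \<comment> \<open>One index serves both as the level \<open>1 / (n + 1)\<close> and as the cut-off
    \<open>n + 1\<close>; \<open>max n k\<close> below meets the two requirements together.\<close>
  define D where "D n = {x\<in>B. f x \<ge> ennreal (1 / real (Suc n))} \<inter> {- real (Suc n)..real (Suc n)}" for n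
  have Db: "D n \<in> sets borel" for n
  proof -
    have "{x\<in>space borel. f x \<ge> ennreal (1 / real (Suc n))} \<in> sets borel" using f(1) by measurable
    then show ?thesis unfolding D_def using B(1) by (auto simp: Collect_conj_eq Int_def[symmetric])
  qed
  have "\<exists>n. emeasure lborel (D n) \<noteq> 0"
  proof (rule ccontr)
    assume "\<not> ?thesis"
    then have "(\<Union>n. D n) \<in> null_sets lborel" using Db by (intro null_sets_UN) (auto simp: null_sets_def)
    then have "AE x in lborel. x \<notin> (\<Union>n. D n)" by (rule AE_not_in)
    then have "AE x in lborel. x \<in> B \<longrightarrow> f x = 0"
    proof eventually_elim
      case (elim x)
      show ?case
      proof (intro impI, rule ccontr)
        assume x: "x \<in> B" "f x \<noteq> 0"
        obtain e :: real where e: "e > 0" "ennreal e \<le> f x"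
          
        proof (cases "f x")
          case (real r)
          then show thesis using x(2) by (intro that[of r]) (auto simp: less_le)
        next
          case top
          then show thesis by (intro that[of 1]) auto
        qed
        obtain n where n: "1 / real (Suc n) < e" using e(1) reals_Archimedean[of e] by (auto simp: inverse_eq_divide)
        obtain k where k: "\<bar>x\<bar> < real k" using reals_Archimedean2 by blast
        have "1 / real (Suc (max n k)) \<le> 1 / real (Suc n)" by (simp add: frac_le)
        then have "ennreal (1 / real (Suc (max n k))) \<le> f x" using n by (intro order_trans[OF ennreal_leI e(2)]) linarith
        then have "x \<in> D (max n k)" using x(1) k by (auto simp: D_def abs_less_iff)
        then show False using elim by blast
      qed
    qed
    then show False using \<open>\<not> (AE x in lborel. x \<in> B \<longrightarrow> f x = 0)\<close> by blast
  qed
  then obtain n where n: "emeasure lborel (D n) \<noteq> 0" by blast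
  show thesis
  proof (rule that[of "D n" "real (Suc n)" "1 / real (Suc n)"])
    show "D n \<in> sets borel" by (rule Db)
    show "D n \<subseteq> {- real (Suc n)..real (Suc n)}" by (auto simp: D_def)
    have "emeasure lborel (D n) \<le> emeasure lborel {- real (Suc n)..real (Suc n)}" using Db by (intro emeasure_mono) (auto simp: D_def)
    then have "emeasure lborel (D n) < \<infinity>" by (rule le_less_trans) simp
    then show "0 < measure lborel (D n)" using n unfolding measure_def enn2real_positive_iff by (auto simp: zero_less_iff_neq_zero)
    show "Q E" if "E \<in> D n" for E using that B(3) unfolding D_def by blast
    fix C assume C: "C \<in> sets borel" "C \<subseteq> D n"
    have "ennreal (1 / real (Suc n)) * emeasure lborel C = (\<integral>\<^sup>+x. ennreal (1 / real (Suc n)) * indicator C x \<partial>lborel)"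
      using C(1) by (simp add: nn_integral_cmult_indicator)
    also have "\<dots> \<le> (\<integral>\<^sup>+x. f x * indicator C x \<partial>lborel)"
      using C(2) by (intro nn_integral_mono) (auto simp: D_def indicator_def)
    also have "\<dots> = emeasure \<nu> C" using emeasure_density[OF f(1), of C] C(1) f(2) by simp
    also have "\<dots> \<le> emeasure \<mu> C" by (rule \<nu>_le[OF C(1)])
    finally show "ennreal (1 / real (Suc n)) * emeasure lborel C \<le> emeasure \<mu> C" .
  qed simp_all
qed

lemma measure_tendsto_0:
  assumes A: "A \<in> fmeasurable M" and B: "\<And>n::nat. B n \<in> sets M" "\<And>n. B n \<subseteq> A"
    and ev: "AE t in M. t \<in> A \<longrightarrow> (\<forall>\<^sub>F n in sequentially. t \<notin> B n)"
  shows "(\<lambda>n. measure M (B n)) \<longlonglongrightarrow> 0"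
proof -
  have "(\<lambda>n. integral\<^sup>L M (\<lambda>t. indicator (B n) t :: real)) \<longlonglongrightarrow> integral\<^sup>L M (\<lambda>t. 0::real)"
  proof (rule integral_dominated_convergence[where w = "indicator A"])
    show "integrable M (indicator A :: _ \<Rightarrow> real)"
      using A by (intro integrable_real_indicator) (auto simp: fmeasurable_def less_top)
    show "AE t in M. (\<lambda>n. indicator (B n) t :: real) \<longlonglongrightarrow> 0"
      using ev
    proof eventually_elim
      case (elim t)
      have "\<forall>\<^sub>F n in sequentially. t \<notin> B n"
        using elim B(2) by (cases "t \<in> A") (auto intro: always_eventually)
      then show ?case by (intro tendsto_eventually) (auto elim: eventually_mono)
    qed
    show "AE t in M. norm (indicator (B n) t :: real) \<le> indicator A t" for n
      using B(2) by (intro AE_I2) (auto simp: indicator_def)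
  qed (simp_all add: B borel_measurable_indicator)
  then show ?thesis using B(1) sets.sets_into_space by (simp add: Int_absorb2)
qed

text \<open>A one-sided Lebesgue density theorem: \<open>J\<close> measures \<open>A\<close> from
  the left and has derivative 1 at almost every point of \<open>A\<close>, so its quotient over
  \<open>[t, t + 1 / n]\<close> finally exceeds 1/2. For \<open>n = 0\<close> division by zero makes
  \<open>B 0\<close> empty.\<close>

lemma low_density_set_tendsto_0:
  fixes A :: "real set"
  assumes A: "A \<in> sets borel" "A \<subseteq> {-R..R}"
  defines "B \<equiv> \<lambda>n. {t\<in>A. measure lborel (A \<inter> {t<..t + 1 / real n}) < 1 / (2 * real n)}"
  shows "B n \<in> sets borel" "(\<lambda>n. measure lborel (B n)) \<longlonglongrightarrow> 0"
proof -
  define J where "J t = measure lborel (A \<inter> {..t})" for t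
  have fm: "A \<inter> S \<in> fmeasurable lborel" if "S \<in> sets borel" for S
    by (rule fmeasurableI2[OF fmeasurable_cbox(1)[of "-R" R]]) (use A that in auto)
  have diff: "measure lborel (A \<inter> {s<..t}) = J t - J s" if "s \<le> t" for s t
  proof -
    have "A \<inter> {..t} = (A \<inter> {..s}) \<union> (A \<inter> {s<..t})" using that by auto
    moreover have "measure lborel ((A \<inter> {..s}) \<union> (A \<inter> {s<..t})) = measure lborel (A \<inter> {..s}) + measure lborel (A \<inter> {s<..t})"
    proof (rule measure_Union)
      show "emeasure lborel (A \<inter> {..s}) \<noteq> \<infinity>" "emeasure lborel (A \<inter> {s<..t}) \<noteq> \<infinity>"
        "A \<inter> {..s} \<in> sets lborel" "A \<inter> {s<..t} \<in> sets lborel"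
        using fmeasurableD2[OF fm] fmeasurableD[OF fm] by simp_all
    qed auto
    ultimately show ?thesis unfolding J_def by simp
  qed
  have mono: "mono J" unfolding J_def
    by (intro monoI measure_mono_fmeasurable) (use fm A in auto)
  then have Jm: "J \<in> borel_measurable borel" by (rule borel_measurable_mono)
  have B: "B n = {t\<in>A. J (t + 1 / real n) - J t < 1 / (2 * real n)}" for n
    unfolding B_def by (intro Collect_cong conj_cong refl) (simp add: diff)
  have Bm: "B n \<in> sets borel" for n
  proof -
    have "{t\<in>space borel. J (t + 1 / real n) - J t < 1 / (2 * real n)} \<in> sets borel"
      using Jm by measurable
    then show ?thesis unfolding B using A(1) by (auto simp: Collect_conj_eq)
  qed
  show "B n \<in> sets borel" by (rule Bm)
  \<comment> \<open>The margin of 1 puts \<open>A\<close> into the open interval on which the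
    differentiation theorem speaks.\<close>
  define a b where "a = -R - 1" and "b = R + 1"
  have Jint: "((\<lambda>t. indicator A t :: complex) has_integral of_real (J t - J a)) {a..t}" if "a \<le> t" for t
  proof -
    have "A \<inter> {a..t} = A \<inter> {a<..t}" using A(2) by (force simp: a_def)
    then have "measure lborel (A \<inter> {a..t}) = J t - J a" using diff[OF that] by simp
    moreover have "((\<lambda>x. 1::real) has_integral measure lborel (A \<inter> {a..t})) (A \<inter> {a..t})"
      by (rule has_integral_measure_lborel) (use A(1) fmeasurableD2[OF fm, of "{a..t}"] in \<open>auto simp: less_top\<close>)
    ultimately have "((\<lambda>x. if x \<in> A then 1 else 0 :: real) has_integral (J t - J a)) {a..t}"
      unfolding has_integral_restrict_Int by simp
    from has_integral_of_real[OF this] show ?thesis by (simp add: indicator_def of_bool_def if_distrib cong: if_cong)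
  qed
  have AE: "AE t in lborel. t \<in> A \<longrightarrow> (\<lambda>n. real n * (J (t + 1 / real n) - J t)) \<longlonglongrightarrow> 1"
  proof -
    have "AE t in lebesgue. t \<in> {a<..<b} \<longrightarrow> ((\<lambda>s. integral {a..s} (\<lambda>t. indicator A t :: complex)) has_vector_derivative indicator A t) (at t)"
      by (rule indefinite_integral_has_vector_derivative_AE) (cases "a \<le> b", use Jint[of b] in \<open>auto simp: has_integral_integrable\<close>)
    then have "AE t in lborel. t \<in> {a<..<b} \<longrightarrow> ((\<lambda>s. integral {a..s} (\<lambda>t. indicator A t :: complex)) has_vector_derivative indicator A t) (at t)"
      by (simp only: AE_completion_iff)
    then show ?thesis
    proof eventually_elim
      case (elim t)
      show ?case
      proof
        assume t: "t \<in> A"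
        then have tab: "a < t" "t < b" using A(2) by (force simp: a_def b_def)+
        then have d: "((\<lambda>s. integral {a..s} (\<lambda>t. indicator A t :: complex)) has_vector_derivative 1) (at t)"
          using elim t by simp
        have "((\<lambda>s. of_real (J s - J a) :: complex) has_vector_derivative 1) (at t)"
          by (rule has_vector_derivative_transform_within_open[OF d, of "{a<..}"]) (use tab in \<open>auto simp: integral_unique[OF Jint]\<close>)
        from bounded_linear.has_vector_derivative[OF bounded_linear_Re this]
        have "((\<lambda>s. J s - J a) has_real_derivative 1) (at t)" by (simp add: has_real_derivative_iff_has_vector_derivative)
        then have "((\<lambda>h. (J (t + h) - J a - (J t - J a)) / h) \<longlongrightarrow> 1) (at 0)" by (simp add: DERIV_def)
        moreover have "filterlim (\<lambda>n. 1 / real (Suc n)) (at 0) sequentially"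
          unfolding filterlim_at using LIMSEQ_inverse_real_of_nat by (auto simp: inverse_eq_divide)
        ultimately have "(\<lambda>n. (J (t + 1 / real (Suc n)) - J a - (J t - J a)) / (1 / real (Suc n))) \<longlonglongrightarrow> 1"
          by (rule filterlim_compose)
        then have "(\<lambda>n. real (Suc n) * (J (t + 1 / real (Suc n)) - J t)) \<longlonglongrightarrow> 1" by (simp add: mult.commute)
        then show "(\<lambda>n. real n * (J (t + 1 / real n) - J t)) \<longlonglongrightarrow> 1" by (subst (asm) filterlim_sequentially_Suc)
      qed
    qed
  qed
  show "(\<lambda>n. measure lborel (B n)) \<longlonglongrightarrow> 0"
  proof (rule measure_tendsto_0[of A])
    show "A \<in> fmeasurable lborel" using fm[of UNIV] by simp
    show "AE t in lborel. t \<in> A \<longrightarrow> (\<forall>\<^sub>F n in sequentially. t \<notin> B n)"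
      using AE
    proof eventually_elim
      case (elim t)
      show ?case
      proof
        assume "t \<in> A"
        with elim have "\<forall>\<^sub>F n in sequentially. 1 / 2 < real n * (J (t + 1 / real n) - J t)"
          by (intro order_tendstoD(1)[where y = 1]) auto
        then show "\<forall>\<^sub>F n in sequentially. t \<notin> B n"
          using eventually_gt_at_top[of 0] by eventually_elim (auto simp: B field_simps)
      qed
    qed
  qed (use Bm in \<open>auto simp: B_def\<close>)
qed

section \<open>The spectral measure as a Stieltjes measure\<close>

context sl_boundary
begin

lemma herglotz_m: "herglotz m"
  by (rule herglotz.intro) (use m_holomorphic m_Im_pos in \<open>simp_all add: uhp_def\<close>)

text \<open>The Stieltjes measure of \<open>G / pi\<close> meets the inversion formula, and values
  on half-open intervals determine a measure, so it is the one selected by \<open>THE\<close>. In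
  the third claim \<open>b'\<close> stays strictly below \<open>b\<close>, because the mass up to
  \<open>b'\<close> involves the right limit of \<open>L\<close> there, which is bounded by the
  value at a point further right.\<close>

lemma spectral_measure_properties:
  shows "sets (spectral_measure \<sigma> \<tau> \<alpha>) = sets borel"
    "emeasure (spectral_measure \<sigma> \<tau> \<alpha>) {a<..b} < \<infinity>"
    "\<lbrakk>a \<le> b'; b' < b; 0 < \<epsilon>0; \<And>\<epsilon>. 0 < \<epsilon> \<Longrightarrow> \<epsilon> < \<epsilon>0 \<Longrightarrow> integral {a..b} (\<lambda>t. Im (m (Complex t \<epsilon>))) \<le> C\<rbrakk>
       \<Longrightarrow> emeasure (spectral_measure \<sigma> \<tau> \<alpha>) {a<..b'} \<le> ennreal (C / pi)"
proof -
  interpret herglotz m by (rule herglotz_m)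
  obtain L where L: "mono L"
    "\<And>a b. a \<le> b \<Longrightarrow> ((\<lambda>\<epsilon>. integral {a..b} (\<lambda>t. Im (m (Complex t \<epsilon>)))) \<longlongrightarrow> L b - L a) (at_right 0)"
    by (rule stieltjes_limit) (rule that; assumption)
  obtain G where G: "mono G" "\<And>a. (L \<longlongrightarrow> G a) (at_right a)" "\<And>a. continuous (at_right a) G"
    "\<And>a b. a < b \<Longrightarrow> G a \<le> L b" "\<And>a. L a \<le> G a"
    by (rule mono_right_limit[OF L(1)]) (rule that; assumption)
  define \<mu> where "\<mu> = interval_measure (\<lambda>x. G x / pi)"
  have \<mu>s: "sets \<mu> = sets borel" by (simp add: \<mu>_def)
  have \<mu>: "emeasure \<mu> {a<..b} = ennreal ((G b - G a) / pi)" if "a \<le> b" for a b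
    unfolding \<mu>_def diff_divide_distrib
  proof (rule emeasure_interval_measure_Ioc[OF that])
    show "G x / pi \<le> G y / pi" if "x \<le> y" for x y using monoD[OF G(1) that] by (simp add: divide_right_mono)
    show "continuous (at_right a) (\<lambda>x. G x / pi)" for a by (intro continuous_intros G(3)) simp
  qed
  have lb: "(LBINT t:{a..b}. Im (m_fun \<sigma> \<tau> \<alpha> (Complex t \<epsilon>))) = integral {a..b} (\<lambda>t. Im (m (Complex t \<epsilon>)))" if "0 < \<epsilon>" for a b \<epsilon>
  proof -
    have eq: "m_fun \<sigma> \<tau> \<alpha> (Complex t \<epsilon>) = m (Complex t \<epsilon>)" for t by (rule m_fun_eq) (use that in simp)
    have "set_integrable lborel {a..b} (\<lambda>t. Im (m (Complex t \<epsilon>)))"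
      by (intro borel_integrable_atLeastAtMost' continuous_intros continuous_on_horizontal holo that)
    then show ?thesis unfolding eq by (rule set_borel_integral_eq_integral(2))
  qed
  define J where "J a b \<delta> = (L (b + \<delta>) - L (a + \<delta>)) / pi" for a b \<delta>
  have J: "((\<lambda>\<epsilon>. (1 / pi) * (LBINT t:{a + \<delta>..b + \<delta>}. Im (m_fun \<sigma> \<tau> \<alpha> (Complex t \<epsilon>)))) \<longlongrightarrow> J a b \<delta>) (at_right 0)"
    if "a < b" for a b \<delta>
  proof (rule Lim_transform_eventually)
    show "((\<lambda>\<epsilon>. (1 / pi) * integral {a + \<delta>..b + \<delta>} (\<lambda>t. Im (m (Complex t \<epsilon>)))) \<longlongrightarrow> J a b \<delta>) (at_right 0)"
      using tendsto_mult_left[OF L(2)[of "a + \<delta>" "b + \<delta>"], of "1 / pi"] that by (simp add: J_def)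
    show "\<forall>\<^sub>F \<epsilon> in at_right 0. (1 / pi) * integral {a + \<delta>..b + \<delta>} (\<lambda>t. Im (m (Complex t \<epsilon>))) =
        (1 / pi) * (LBINT t:{a + \<delta>..b + \<delta>}. Im (m_fun \<sigma> \<tau> \<alpha> (Complex t \<epsilon>)))"
      using eventually_at_right_less[of 0] by eventually_elim (simp add: lb)
  qed
  have Jlim: "(J a b \<longlongrightarrow> (G b - G a) / pi) (at_right 0)" for a b
  proof -
    have "((\<lambda>\<delta>. L (c + \<delta>)) \<longlongrightarrow> G c) (at_right 0)" for c
      using G(2)[of c] unfolding filterlim_at_right_to_0[of L _ c] by (simp add: add.commute)
    then show ?thesis unfolding J_def[abs_def] by (intro tendsto_intros) auto
  qed
  define Pr where "Pr \<mu> \<longleftrightarrow> sets \<mu> = sets borel \<and>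
        (\<forall>a b. a < b \<longrightarrow>
           emeasure \<mu> {a<..b} < \<infinity> \<and>
           (\<exists>J. (\<forall>\<delta>>0. ((\<lambda>\<epsilon>. (1 / pi) *
                     (LBINT t:{a + \<delta>..b + \<delta>}. Im (m_fun \<sigma> \<tau> \<alpha> (Complex t \<epsilon>))))
                   \<longlongrightarrow> J \<delta>) (at_right 0)) \<and>
                (J \<longlongrightarrow> measure \<mu> {a<..b}) (at_right 0)))" for \<mu> :: "real measure"
  have mes: "measure \<mu> {a<..b} = (G b - G a) / pi" if "a < b" for a b
    unfolding measure_def using \<mu>[of a b] monoD[OF G(1), of a b] that by simp
  have "Pr \<mu>" unfolding Pr_def
  proof (intro conjI allI impI)
    fix a b :: real assume ab: "a < b"
    show "emeasure \<mu> {a<..b} < \<infinity>" using \<mu>[of a b] ab by simp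
    show "\<exists>J. (\<forall>\<delta>>0. ((\<lambda>\<epsilon>. (1 / pi) * (LBINT t:{a + \<delta>..b + \<delta>}. Im (m_fun \<sigma> \<tau> \<alpha> (Complex t \<epsilon>)))) \<longlongrightarrow> J \<delta>) (at_right 0)) \<and>
        (J \<longlongrightarrow> measure \<mu> {a<..b}) (at_right 0)"
      using J[OF ab] Jlim[of a b] mes[OF ab] by (intro exI[of _ "J a b"]) simp
  qed (rule \<mu>s)
  moreover have "\<mu>' = \<mu>" if "Pr \<mu>'" for \<mu>'
  proof (rule measure_eqI_Ioc)
    show "sets \<mu>' = sets borel" using that unfolding Pr_def by blast
    show "emeasure \<mu>' {a<..b} < \<infinity>" if "a < b" for a b using \<open>Pr \<mu>'\<close> that unfolding Pr_def by blast
    have fin: "emeasure \<mu>' {a<..b} = ennreal (measure \<mu>' {a<..b})" if "a < b" for a b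
      by (rule emeasure_eq_ennreal_measure) (use \<open>Pr \<mu>'\<close> that in \<open>auto simp: Pr_def less_top\<close>)
    fix a b :: real assume ab: "a < b"
    obtain J' where J': "\<And>\<delta>. \<delta> > 0 \<Longrightarrow> ((\<lambda>\<epsilon>. (1 / pi) * (LBINT t:{a + \<delta>..b + \<delta>}. Im (m_fun \<sigma> \<tau> \<alpha> (Complex t \<epsilon>)))) \<longlongrightarrow> J' \<delta>) (at_right 0)"
        "(J' \<longlongrightarrow> measure \<mu>' {a<..b}) (at_right 0)"
      using \<open>Pr \<mu>'\<close>[unfolded Pr_def, THEN conjunct2, rule_format, OF ab, THEN conjunct2] by auto
    have "J a b \<delta> = J' \<delta>" if "\<delta> > 0" for \<delta>
      by (rule tendsto_unique[OF _ J[OF ab] J'(1)[OF that]]) simp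
    then have "\<forall>\<^sub>F \<delta> in at_right 0. J a b \<delta> = J' \<delta>"
      by (intro eventually_mono[OF eventually_at_right_less[of 0]]) simp
    then have "(J' \<longlongrightarrow> (G b - G a) / pi) (at_right 0)" using Jlim by (rule Lim_transform_eventually[rotated])
    then have "measure \<mu>' {a<..b} = (G b - G a) / pi" using J'(2) by (intro tendsto_unique[of "at_right 0" J']) simp_all
    then show "emeasure \<mu>' {a<..b} = emeasure \<mu> {a<..b}" using fin[OF ab] \<mu>[of a b] ab by simp
  qed (rule \<mu>s)
  ultimately have "(THE \<mu>. Pr \<mu>) = \<mu>" by (rule the_equality)
  then have eq: "spectral_measure \<sigma> \<tau> \<alpha> = \<mu>" unfolding spectral_measure_def Pr_def .
  show "sets (spectral_measure \<sigma> \<tau> \<alpha>) = sets borel" unfolding eq by (rule \<mu>s)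
  show "emeasure (spectral_measure \<sigma> \<tau> \<alpha>) {a<..b} < \<infinity>" for a b
    unfolding eq by (cases "a \<le> b") (simp_all add: \<mu>)
  fix a b b' \<epsilon>0 C :: real
  assume *: "a \<le> b'" "b' < b" "0 < \<epsilon>0" "\<And>\<epsilon>. 0 < \<epsilon> \<Longrightarrow> \<epsilon> < \<epsilon>0 \<Longrightarrow> integral {a..b} (\<lambda>t. Im (m (Complex t \<epsilon>))) \<le> C"
  have "\<forall>\<^sub>F \<epsilon> in at_right 0. integral {a..b} (\<lambda>t. Im (m (Complex t \<epsilon>))) \<le> C"
    by (rule eventually_mono[OF eventually_at_right_real[OF *(3)]]) (use *(4) in auto)
  then have "L b - L a \<le> C" by (intro tendsto_upperbound[OF L(2)]) (use * in auto)
  then have "G b' - G a \<le> C" using G(4)[OF *(2)] G(5)[of a] by linarith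
  then show "emeasure (spectral_measure \<sigma> \<tau> \<alpha>) {a<..b'} \<le> ennreal (C / pi)"
    unfolding eq \<mu>[OF *(1)] by (intro ennreal_leI divide_right_mono) auto
qed

end

section \<open>Bounds off small sets\<close>

lemma markov_interval:
  fixes h :: "real \<Rightarrow> real"
  assumes D: "D \<in> sets borel" "D \<subseteq> {a..b}" and h: "continuous_on {a..b} h" "\<And>t. t \<in> {a..b} \<Longrightarrow> 0 \<le> h t"
    and k: "\<And>t. t \<in> D \<Longrightarrow> k \<le> h t"
  shows "k * measure lborel D \<le> integral {a..b} h"
proof -
  have "D \<in> fmeasurable lborel"
    by (rule fmeasurableI2[OF fmeasurable_cbox(1)[of a b]]) (use D in auto)
  then have "emeasure lborel D < \<infinity>" by (simp add: fmeasurable_def)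
  from has_integral_mult_right[OF has_integral_measure_lborel[OF D(1) this], of k]
  have "((\<lambda>x. k) has_integral k * measure lborel D) (D \<inter> {a..b})" using D(2) by (simp add: Int_absorb2)
  then have "((\<lambda>x. if x \<in> D then k else 0) has_integral k * measure lborel D) {a..b}"
    unfolding has_integral_restrict_Int .
  then show ?thesis
    by (rule has_integral_le[OF _ integrable_integral[OF integrable_continuous_real[OF h(1)]]]) (use h(2) k in auto)
qed

text \<open>Just above a real point \<open>t\<close> the values of \<open>q\<close> and
  \<open>q'\<close> are nearly real, so \<open>Im (q (q' + w q))\<close> is nearly
  \<open>q^2 Im w\<close>, which is at least \<open>K / M\<close> where \<open>q^2 > K\<close>. The
  integral of this imaginary part is bounded through its value at \<open>\<i>\<close>, and Markov's
  inequality limits the length of the set. How large \<open>n\<close> must be depends on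
  \<open>q\<close> and \<open>q'\<close>, the bound does not.\<close>

lemma herglotz_product_large_set:
  fixes q q' w :: "complex \<Rightarrow> complex" and S :: "nat \<Rightarrow> real set"
  assumes q: "q holomorphic_on UNIV" "q' holomorphic_on UNIV"
    and real: "\<And>t. Im (q (of_real t)) = 0" "\<And>t. Im (q' (of_real t)) = 0"
    and w: "w holomorphic_on uhp"
    and nn: "\<And>z. 0 < Im z \<Longrightarrow> 0 \<le> Im (q z * (q' z + w z * q z))"
    and c: "Im (q \<i> * (q' \<i> + w \<i> * q \<i>)) \<le> c"
    and S: "\<And>n. S n \<in> sets borel" "\<And>n. S n \<subseteq> {-R..R}" and R: "0 < R"
    and wS: "\<And>n t. t \<in> S n \<Longrightarrow> norm (w (Complex t (1 / real (n + 2)))) \<le> M"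
      "\<And>n t. t \<in> S n \<Longrightarrow> 1 / M \<le> Im (w (Complex t (1 / real (n + 2))))"
    and M: "0 < M" "M < K"
  shows "\<forall>\<^sub>F n in sequentially. measure lborel {t\<in>S n. K < (norm (q (of_real t)))\<^sup>2} \<le> pi * (1 + 4 * R\<^sup>2) * c / (K / M - 1)"
proof -
  \<comment> \<open>Three errors occur, \<open>\<eta>\<close> from \<open>q q'\<close> and twice
    \<open>M * \<eta>\<close> from \<open>w q^2\<close>; they add up to 1, which is the 1 in
    \<open>K / M - 1\<close>.\<close>
  define \<eta> where "\<eta> = 1 / (2 * M + 1)"
  have \<eta>: "0 < \<eta>" using M by (simp add: \<eta>_def)
  define X where "X = cbox (Complex (-R) 0) (Complex R 1)"
  have cq: "continuous_on A q" "continuous_on A q'" for A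
    using q holomorphic_on_imp_continuous_on continuous_on_subset by blast+
  have "uniformly_continuous_on X (\<lambda>z. (q z)\<^sup>2)" and u2: "uniformly_continuous_on X (\<lambda>z. q z * q' z)"
    unfolding X_def by (intro compact_uniformly_continuous compact_cbox continuous_intros cq)+
  from uniformly_continuous_onE[OF this(1) \<eta>] obtain d1 where
    d1: "0 < d1" "\<And>z z'. z \<in> X \<Longrightarrow> z' \<in> X \<Longrightarrow> dist z' z < d1 \<Longrightarrow> dist ((q z')\<^sup>2) ((q z)\<^sup>2) < \<eta>" by blast
  from uniformly_continuous_onE[OF u2 \<eta>] obtain d2 where
    d2: "0 < d2" "\<And>z z'. z \<in> X \<Longrightarrow> z' \<in> X \<Longrightarrow> dist z' z < d2 \<Longrightarrow> dist (q z' * q' z') (q z * q' z) < \<eta>" by blast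
  note d = d1(1) d2(1) d1(2) d2(2)
  have "(\<lambda>n. 1 / real (n + 2)) \<longlonglongrightarrow> 0"
    using LIMSEQ_ignore_initial_segment[OF lim_1_over_n, of 2] by simp
  then have "\<forall>\<^sub>F n in sequentially. 1 / real (n + 2) < min d1 d2"
    by (rule order_tendstoD(2)) (use d in simp)
  then show ?thesis
  proof eventually_elim
    case (elim n)
    define \<epsilon> where "\<epsilon> = 1 / real (n + 2)"
    have \<epsilon>: "0 < \<epsilon>" "\<epsilon> \<le> 1 / 2" "\<epsilon> < d1" "\<epsilon> < d2" using elim by (simp_all add: \<epsilon>_def frac_le)
    define g where "g z = q z * (q' z + w z * q z)" for z
    have g: "g holomorphic_on uhp"
      unfolding g_def[abs_def] by (intro holomorphic_intros w holomorphic_on_subset[OF q(1)] holomorphic_on_subset[OF q(2)]) auto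
    define D where "D = {t\<in>S n. K < (norm (q (of_real t)))\<^sup>2}"
    have "{t::real. K < (norm (q (of_real t)))\<^sup>2} \<in> sets borel"
      by (intro borel_open open_Collect_less continuous_intros continuous_on_compose2[OF cq(1)[of UNIV]]) auto
    then have D: "D \<in> sets borel" "D \<subseteq> {-R..R}" using S unfolding D_def by (auto simp: Collect_conj_eq)
    have low: "K / M - 1 \<le> Im (g (Complex t \<epsilon>))" if t: "t \<in> D" for t
    proof -
      define z where "z = Complex t \<epsilon>"
      have X: "z \<in> X" "of_real t \<in> X" using t D(2) \<epsilon> by (auto simp: X_def z_def in_cbox_complex_iff)
      have "dist z (of_real t) = \<epsilon>" using \<epsilon>(1) by (simp add: z_def dist_norm norm_complex_def)
      then have 1: "norm ((q z)\<^sup>2 - (q (of_real t))\<^sup>2) < \<eta>" "norm (q z * q' z - q (of_real t) * q' (of_real t)) < \<eta>"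
        using d(3)[OF X(2,1)] d(4)[OF X(2,1)] \<epsilon> by (simp_all add: dist_norm)
      define a where "a = Re (q (of_real t))"
      define b where "b = Re (q' (of_real t))"
      have qt: "q (of_real t) = of_real a" "q' (of_real t) = of_real b"
        using real by (simp_all add: complex_eq_iff a_def b_def)
      have sq: "(norm (q (of_real t)))\<^sup>2 = a\<^sup>2" unfolding qt by simp
      have "(q (of_real t))\<^sup>2 = of_real (a\<^sup>2)" "q (of_real t) * q' (of_real t) = of_real (a * b)"
        unfolding qt by simp_all
      with 1 have 2: "norm ((q z)\<^sup>2 - of_real (a\<^sup>2)) < \<eta>" "norm (q z * q' z - of_real (a * b)) < \<eta>" by simp_all
      have 3: "\<bar>Im ((q z)\<^sup>2)\<bar> \<le> \<eta>" "a\<^sup>2 - \<eta> \<le> Re ((q z)\<^sup>2)" "- \<eta> \<le> Im (q z * q' z)"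
        using abs_Im_le_cmod[of "(q z)\<^sup>2 - of_real (a\<^sup>2)"] abs_Re_le_cmod[of "(q z)\<^sup>2 - of_real (a\<^sup>2)"]
          abs_Im_le_cmod[of "q z * q' z - of_real (a * b)"] 2
        unfolding minus_complex.sel Im_complex_of_real Re_complex_of_real by linarith+
      have tS: "t \<in> S n" and Ka: "K \<le> a\<^sup>2" using t sq by (auto simp: D_def)
      have W: "norm (w z) \<le> M" "1 / M \<le> Im (w z)" using wS[OF tS] by (simp_all add: z_def \<epsilon>_def)
      have W': "\<bar>Re (w z)\<bar> \<le> M" "Im (w z) \<le> M" "0 \<le> Im (w z)"
        using abs_Re_le_cmod[of "w z"] abs_Im_le_cmod[of "w z"] W M order_trans[of 0 "1 / M" "Im (w z)"] by auto
      have "g z = q z * q' z + w z * (q z)\<^sup>2" by (simp add: g_def algebra_simps power2_eq_square)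
      then have e: "Im (g z) = Im (q z * q' z) + (Re (w z) * Im ((q z)\<^sup>2) + Im (w z) * Re ((q z)\<^sup>2))"
        by (simp only: plus_complex.sel times_complex.sel)
      have "\<bar>Re (w z) * Im ((q z)\<^sup>2)\<bar> \<le> M * \<eta>" unfolding abs_mult using W'(1) 3(1) M by (intro mult_mono) auto
      then have f1: "- (M * \<eta>) \<le> Re (w z) * Im ((q z)\<^sup>2)" by linarith
      have "Im (w z) * (a\<^sup>2 - \<eta>) \<le> Im (w z) * Re ((q z)\<^sup>2)" using 3(2) W'(3) by (intro mult_left_mono)
      moreover have "Im (w z) * \<eta> \<le> M * \<eta>" using W'(2) \<eta> by (intro mult_right_mono) auto
      moreover have "1 / M * K \<le> Im (w z) * a\<^sup>2" using W(2) W'(3) Ka M by (intro mult_mono) auto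
      ultimately have f2: "K / M - M * \<eta> \<le> Im (w z) * Re ((q z)\<^sup>2)" by (simp add: algebra_simps)
      have "(2 * M + 1) * \<eta> = 1" using M by (simp add: \<eta>_def)
      then have "M * \<eta> + M * \<eta> + \<eta> = 1" by (simp add: algebra_simps)
      then show ?thesis using e f1 f2 3(3) unfolding z_def by linarith
    qed
    have "(K / M - 1) * measure lborel D \<le> integral {-R..R} (\<lambda>t. Im (g (Complex t \<epsilon>)))"
      by (rule markov_interval[OF D _ _ low])
        (use \<epsilon> nn in \<open>auto simp: g_def[symmetric] intro!: continuous_intros continuous_on_horizontal g\<close>)
    also have "\<dots> \<le> pi * (1 + 4 * R\<^sup>2) * Im (g \<i>)"
      by (rule poisson_fixed_interval_bound[OF g _ \<epsilon>(1,2) R]) (use nn in \<open>simp add: g_def\<close>)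
    also have "\<dots> \<le> pi * (1 + 4 * R\<^sup>2) * c" using c unfolding g_def by (intro mult_left_mono) auto
    finally show ?case unfolding D_def using M by (simp add: pos_le_divide_eq mult.commute)
  qed
qed

context sl_boundary
begin

text \<open>The lower bound on \<open>Im m\<close> comes from the measure: off a low-density set the
  mass of \<open>{t<..t + \<epsilon>}\<close> is at least a multiple of \<open>\<epsilon>\<close>,
  while Poisson's inequality bounds it by a multiple of \<open>\<epsilon>\<close> times
  \<open>Im m\<close> at height \<open>\<epsilon>\<close> above \<open>t\<close>. The upper bound on
  \<open>|m|\<close> comes from \<open>sqrt_norm_interval_bound\<close> by Markov's
  inequality.\<close>

lemma m_good_sets:
  assumes A: "A \<in> sets borel" "A \<subseteq> {-R..R}" "1 \<le> R" "0 < measure lborel A" and w: "0 < w"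
    and \<mu>: "\<And>C. C \<in> sets borel \<Longrightarrow> C \<subseteq> A \<Longrightarrow> ennreal w * emeasure lborel C \<le> emeasure (spectral_measure \<sigma> \<tau> \<alpha>) C"
  obtains M S where "1 \<le> M" "\<And>n. S n \<in> sets borel" "\<And>n. S n \<subseteq> A"
    "\<And>n t. t \<in> S n \<Longrightarrow> norm (m (Complex t (1 / real (n + 2)))) \<le> M"
    "\<And>n t. t \<in> S n \<Longrightarrow> 1 / M \<le> Im (m (Complex t (1 / real (n + 2))))"
    "\<forall>\<^sub>F n in sequentially. measure lborel (A - S n) \<le> measure lborel A / 8"
proof -
  interpret herglotz m by (rule herglotz_m)
  define a0 where "a0 = measure lborel A"
  define B where "B n = {t\<in>A. measure lborel (A \<inter> {t<..t + 1 / real n}) < 1 / (2 * real n)}" for n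
  note B = low_density_set_tendsto_0[OF A(1,2), folded B_def]
  define C where "C = 2 * pi * (1 + 4 * R\<^sup>2) * sqrt (norm (m \<i>))"
  \<comment> \<open>\<open>10 / w\<close> collects the Poisson factor 5 and the density 1/2;
    \<open>(16 * C / a0)^2\<close> makes the set with \<open>|m| > M\<close> at most
    \<open>a0 / 16\<close> long, and the low-density points account for the other
    \<open>a0 / 16\<close>.\<close>
  define M where "M = max 1 (max (10 / w) ((16 * C / a0)\<^sup>2))"
  have a0: "0 < a0" using A by (simp add: a0_def)
  have C0: "0 \<le> C" by (simp add: C_def)
  have M: "1 \<le> M" "10 / w \<le> M" "(16 * C / a0)\<^sup>2 \<le> M" by (simp_all add: M_def)
  have sM: "16 * C / a0 \<le> sqrt M" using M(3) by (rule real_le_rsqrt)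
  define h where "h n t = m (Complex t (1 / real (n + 2)))" for n :: nat and t
  have hc: "continuous_on X (h n)" for X n unfolding h_def[abs_def] by (rule continuous_on_horizontal[OF holo]) simp
  define S where "S n = {t\<in>A. norm (h n t) \<le> M \<and> 1 / M \<le> Im (h n t)}" for n
  have Sb: "S n \<in> sets borel" for n
  proof -
    have "{t. norm (h n t) \<le> M} \<in> sets borel" "{t. 1 / M \<le> Im (h n t)} \<in> sets borel"
      by (intro borel_closed closed_Collect_le continuous_intros hc)+
    then show ?thesis using A(1) unfolding S_def by (simp add: Collect_conj_eq sets.Int)
  qed
  have fm: "X \<in> fmeasurable lborel" if "X \<in> sets borel" "X \<subseteq> A" for X
    by (rule fmeasurableI2[OF fmeasurable_cbox(1)[of "-R" R]]) (use A that in auto)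
  have Im_low: "1 / M \<le> Im (h n t)" if t: "t \<in> A" "t \<notin> B (n + 2)" for n t
  proof -
    define \<epsilon> where "\<epsilon> = 1 / real (n + 2)"
    have \<epsilon>: "0 < \<epsilon>" by (simp add: \<epsilon>_def)
    define D where "D = A \<inter> {t<..t + \<epsilon>}"
    have D: "D \<in> sets borel" "D \<subseteq> A" using A(1) by (auto simp: D_def)
    have nn: "0 \<le> Im (m z)" if "0 < Im z" for z using im_pos[OF that] by simp
    have I0: "0 \<le> Im (m (Complex t \<epsilon>))" using \<epsilon> by (simp add: nn)
    have e2: "\<epsilon> / 2 = 1 / (2 * real (n + 2))" by (simp add: \<epsilon>_def)
    have "\<not> measure lborel D < 1 / (2 * real (n + 2))" using t unfolding B_def D_def \<epsilon>_def by blast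
    then have low: "\<epsilon> / 2 \<le> measure lborel D" unfolding e2 by (simp only: not_less)
    have "emeasure (spectral_measure \<sigma> \<tau> \<alpha>) {t<..t + \<epsilon>} \<le> ennreal (5 * pi * \<epsilon> * Im (m (Complex t \<epsilon>)) / pi)"
    \<comment> \<open>For \<open>\<delta> < \<epsilon> / 4\<close> the interval of half-width
      \<open>2 * (\<epsilon> - \<delta>)\<close> around \<open>t\<close> covers
      \<open>[t, t + 3 / 2 * \<epsilon>]\<close>, and the height
      \<open>\<epsilon> - \<delta> + \<delta>\<close> is exactly \<open>\<epsilon>\<close>;
      \<open>K = 2\<close> gives the factor \<open>1 + 2^2 = 5\<close>.\<close>
    proof (rule spectral_measure_properties(3)[of _ _ "t + 3 / 2 * \<epsilon>" "\<epsilon> / 4"])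
      fix \<delta> assume \<delta>: "0 < \<delta>" "\<delta> < \<epsilon> / 4"
      have cc: "(\<lambda>s. Im (m (Complex s \<delta>))) integrable_on {p..q}" for p q
        by (intro integrable_continuous_real continuous_intros continuous_on_horizontal holo \<delta>)
      have "integral {t..t + 3 / 2 * \<epsilon>} (\<lambda>s. Im (m (Complex s \<delta>))) \<le> integral {t - 2 * (\<epsilon> - \<delta>)..t + 2 * (\<epsilon> - \<delta>)} (\<lambda>s. Im (m (Complex s \<delta>)))"
        by (rule integral_subset_le) (use \<delta> cc nn in auto)
      also have "\<dots> \<le> pi * (1 + 2\<^sup>2) * (\<epsilon> - \<delta>) * Im (m (Complex t (\<epsilon> - \<delta> + \<delta>)))"
        by (rule poisson_interval_bound[OF holo nn]) (use \<delta> in auto)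
      also have "\<dots> \<le> pi * (1 + 2\<^sup>2) * \<epsilon> * Im (m (Complex t \<epsilon>))"
        using I0 \<delta> by (simp add: mult_right_mono)
      finally show "integral {t..t + 3 / 2 * \<epsilon>} (\<lambda>s. Im (m (Complex s \<delta>))) \<le> 5 * pi * \<epsilon> * Im (m (Complex t \<epsilon>))" by simp
    qed (use \<epsilon> in auto)
    then have sm: "emeasure (spectral_measure \<sigma> \<tau> \<alpha>) {t<..t + \<epsilon>} \<le> ennreal (5 * \<epsilon> * Im (m (Complex t \<epsilon>)))" by (simp add: mult.assoc)
    have "ennreal (w * measure lborel D) = ennreal w * emeasure lborel D"
      using fm[OF D] w by (simp add: emeasure_eq_measure2 ennreal_mult)
    also have "\<dots> \<le> emeasure (spectral_measure \<sigma> \<tau> \<alpha>) D" by (rule \<mu>[OF D])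
    also have "\<dots> \<le> emeasure (spectral_measure \<sigma> \<tau> \<alpha>) {t<..t + \<epsilon>}"
      by (rule emeasure_mono) (auto simp: D_def spectral_measure_properties(1))
    also note sm
    finally have "ennreal (w * measure lborel D) \<le> ennreal (5 * \<epsilon> * Im (m (Complex t \<epsilon>)))" .
    then have "w * measure lborel D \<le> 5 * \<epsilon> * Im (m (Complex t \<epsilon>))" using I0 \<epsilon> by (subst (asm) ennreal_le_iff) auto
    moreover have "w * (\<epsilon> / 2) \<le> w * measure lborel D" using low w by (intro mult_left_mono) auto
    ultimately have "\<epsilon> * (w / 2) \<le> \<epsilon> * (5 * Im (m (Complex t \<epsilon>)))" by (simp add: algebra_simps)
    then have "w / 10 \<le> Im (m (Complex t \<epsilon>))" using \<epsilon> by simp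
    moreover have "1 / M \<le> w / 10" using M w by (simp add: field_simps)
    ultimately show ?thesis by (simp add: h_def \<epsilon>_def)
  qed
  have "\<forall>\<^sub>F n in sequentially. measure lborel (A - S n) \<le> a0 / 8"
  proof -
    have "(\<lambda>n. measure lborel (B (n + 2))) \<longlonglongrightarrow> 0" by (rule LIMSEQ_ignore_initial_segment[OF B(2)])
    then have "\<forall>\<^sub>F n in sequentially. measure lborel (B (n + 2)) < a0 / 16"
      by (rule order_tendstoD(2)) (use a0 in simp)
    then show ?thesis
    proof eventually_elim
      case (elim n)
      define E where "E = {t\<in>A. M < norm (h n t)}"
      have "{t. M < norm (h n t)} \<in> sets borel" by (intro borel_open open_Collect_less continuous_intros hc)
      then have Eb: "E \<in> sets borel" using A(1) unfolding E_def by (simp add: Collect_conj_eq sets.Int)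
      have EA: "E \<subseteq> A" "B (n + 2) \<subseteq> A" by (auto simp: E_def B_def)
      have "sqrt M * measure lborel E \<le> integral {-R..R} (\<lambda>t. sqrt (norm (h n t)))"
        by (rule markov_interval[OF Eb]) (use EA A(2) in \<open>auto simp: E_def intro!: continuous_intros hc\<close>)
      also have "\<dots> \<le> C" unfolding C_def h_def
        by (rule sqrt_norm_interval_bound[OF holo im_pos]) (use A(3) in \<open>auto simp: frac_le\<close>)
      finally have "sqrt M * measure lborel E \<le> C" .
      moreover have "16 * C / a0 * measure lborel E \<le> sqrt M * measure lborel E" by (rule mult_right_mono[OF sM]) simp
      moreover have "measure lborel E \<le> sqrt M * measure lborel E" using mult_right_mono[of 1 "sqrt M" "measure lborel E"] M(1) by simp
      ultimately have "16 * C / a0 * measure lborel E \<le> C" "measure lborel E \<le> C" by linarith+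
      then have "C * (16 * measure lborel E) \<le> C * a0" "measure lborel E \<le> C" using a0 by (simp_all add: field_simps)
      then have "measure lborel E \<le> a0 / 16"
        using a0 C0 by (cases "C = 0") simp_all
      moreover have "measure lborel (A - S n) \<le> measure lborel (B (n + 2) \<union> E)"
      proof (rule measure_mono_fmeasurable)
        show "A - S n \<subseteq> B (n + 2) \<union> E" using Im_low[of _ n] by (auto simp: S_def E_def not_le)
        show "A - S n \<in> sets lborel" using A(1) Sb by simp
        show "B (n + 2) \<union> E \<in> fmeasurable lborel" using fm[OF B(1) EA(2)] fm[OF Eb EA(1)] by (rule fmeasurable.Un)
      qed
      moreover have "measure lborel (B (n + 2) \<union> E) \<le> measure lborel (B (n + 2)) + measure lborel E"
        by (rule measure_Un_le) (use B(1) Eb in auto)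
      ultimately show ?case using elim by linarith
    qed
  qed
  then show thesis
    by (intro that[of M S]) (use M Sb in \<open>auto simp: S_def h_def a0_def\<close>)
qed

text \<open>The chain \<open>coer 1 * |g|^2 \<le> Im g \<le> |g|\<close> bounds \<open>|g|\<close>
  itself. Since \<open>coer\<close> does not depend on \<open>x\<close>, this is the uniform bound
  at \<open>z = \<i>\<close>.\<close>

lemma Green_at_i_bound:
  assumes "Im \<i> * coer (norm \<i>) * (norm g)\<^sup>2 \<le> Im g"
  shows "Im g \<le> 1 / coer 1"
proof -
  have k: "0 < coer 1" by (rule coer(1)) simp
  have "coer 1 * (norm g)\<^sup>2 \<le> norm g" using assms abs_Im_le_cmod[of g] by simp
  then have "norm g * (coer 1 * norm g) \<le> norm g * 1" by (simp add: power2_eq_square mult_ac)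
  then have "norm g \<le> 1 / coer 1" using k by (cases "g = 0") (auto simp: field_simps)
  then show ?thesis using abs_Im_le_cmod[of g] by linarith
qed

text \<open>Each of the four entries goes through \<open>herglotz_product_large_set\<close>:
  \<open>pa\<close> and \<open>qa\<close> with \<open>w = m\<close>, \<open>pb\<close> and
  \<open>qb\<close> with \<open>w = - 1 / m\<close> and with \<open>q'\<close> the negative of the
  corresponding entry of \<open>a\<close>. The index \<open>n\<close> is chosen after
  \<open>x\<close> and does not occur in the conclusion, so the bound is uniform in
  \<open>x\<close>.\<close>

lemma fundamental_bound_off_small_set:
  assumes A: "A \<in> sets borel" "A \<subseteq> {-R..R}" "1 \<le> R" "0 < measure lborel A" and w: "0 < w"
    and \<mu>: "\<And>C. C \<in> sets borel \<Longrightarrow> C \<subseteq> A \<Longrightarrow> ennreal w * emeasure lborel C \<le> emeasure (spectral_measure \<sigma> \<tau> \<alpha>) C"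
  obtains K where "0 < K" "\<And>x. 0 < x \<Longrightarrow> {t\<in>A. K < nrm (of_real t) x} \<in> sets borel"
    "\<And>x. 0 < x \<Longrightarrow> measure lborel {t\<in>A. K < nrm (of_real t) x} \<le> measure lborel A / 4"
proof -
  obtain M S where M: "1 \<le> M" and S: "\<And>n. S n \<in> sets borel" "\<And>n. S n \<subseteq> A"
    "\<And>n t. t \<in> S n \<Longrightarrow> norm (m (Complex t (1 / real (n + 2)))) \<le> M"
    "\<And>n t. t \<in> S n \<Longrightarrow> 1 / M \<le> Im (m (Complex t (1 / real (n + 2))))"
    "\<forall>\<^sub>F n in sequentially. measure lborel (A - S n) \<le> measure lborel A / 8"
    by (rule m_good_sets[OF assms]) (assumption | rule that)+
  define a0 where "a0 = measure lborel A"
  have a0: "0 < a0" using A by (simp add: a0_def)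
  have k: "0 < coer 1" by (rule coer(1)) simp
  define c where "c = pi * (1 + 4 * R\<^sup>2) * (1 / coer 1)"
  have c0: "0 < c" unfolding c_def using k by (intro mult_pos_pos add_pos_nonneg) auto
  \<comment> \<open>The exponent 3 admits \<open>- 1 / m\<close> beside \<open>m\<close>, as
    \<open>Im (- 1 / m) = Im m / |m|^2 \<ge> 1 / M^3\<close>. The second factor makes each
    exceptional set at most \<open>a0 / 32\<close> long; four of them together with
    \<open>A - S n\<close> give \<open>a0 / 4\<close>.\<close>
  define K where "K = M ^ 3 * (1 + 32 * c / a0)"
  have M3: "M \<le> M ^ 3" "1 \<le> M ^ 3" using M self_le_power[of M 3] by auto
  have K: "M ^ 3 < K" 
  proof -
    have "M ^ 3 * 1 < M ^ 3 * (1 + 32 * c / a0)" using M c0 a0 by (intro mult_strict_left_mono) auto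
    then show ?thesis by (simp add: K_def)
  qed
  have Kc: "c / (K / M ^ 3 - 1) = a0 / 32" using M c0 a0 by (simp add: K_def)
  have SR: "S n \<subseteq> {-R..R}" for n using S(2) A(2) by blast
  have R: "0 < R" using A(3) by simp
  have bnd: "\<forall>\<^sub>F n in sequentially. measure lborel {t\<in>S n. K < (norm (q (of_real t)))\<^sup>2} \<le> a0 / 32"
    if q: "q holomorphic_on UNIV" "q' holomorphic_on UNIV" "\<And>t. Im (q (of_real t)) = 0" "\<And>t. Im (q' (of_real t)) = 0"
      and v: "v holomorphic_on uhp" "\<And>z. 0 < Im z \<Longrightarrow> 0 \<le> Im (q z * (q' z + v z * q z))"
      "Im \<i> * coer (norm \<i>) * (norm (q \<i> * (q' \<i> + v \<i> * q \<i>)))\<^sup>2 \<le> Im (q \<i> * (q' \<i> + v \<i> * q \<i>))"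
      "\<And>n t. t \<in> S n \<Longrightarrow> norm (v (Complex t (1 / real (n + 2)))) \<le> M ^ 3"
      "\<And>n t. t \<in> S n \<Longrightarrow> 1 / M ^ 3 \<le> Im (v (Complex t (1 / real (n + 2))))"
    for q q' v
    using herglotz_product_large_set[where S = S, OF q v(1,2) Green_at_i_bound[OF v(3)] S(1) SR R v(4,5) _ K] M
    unfolding c_def[symmetric] Kc by simp
  have m_uhp: "m holomorphic_on uhp" using m_holomorphic by (simp add: uhp_def)
  have m_S: "norm (m (Complex t (1 / real (n + 2)))) \<le> M ^ 3" "1 / M ^ 3 \<le> Im (m (Complex t (1 / real (n + 2))))" if "t \<in> S n" for n t
  proof -
    show "norm (m (Complex t (1 / real (n + 2)))) \<le> M ^ 3" using S(3)[OF that] M3(1) by linarith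
    have "1 / M ^ 3 \<le> 1 / M" using M M3 by (intro divide_left_mono) auto
    then show "1 / M ^ 3 \<le> Im (m (Complex t (1 / real (n + 2))))" using S(4)[OF that] by linarith
  qed
  have m'_uhp: "(\<lambda>z. - 1 / m z) holomorphic_on uhp"
    using m_Im_pos by (intro holomorphic_intros m_uhp) (force simp: uhp_def)
  have m'_S: "norm (- 1 / m (Complex t (1 / real (n + 2)))) \<le> M ^ 3" "1 / M ^ 3 \<le> Im (- 1 / m (Complex t (1 / real (n + 2))))" if "t \<in> S n" for n t
  proof -
    define v where "v = m (Complex t (1 / real (n + 2)))"
    have v: "norm v \<le> M" "1 / M \<le> Im v" using S(3,4)[OF that] by (simp_all add: v_def)
    then have n: "1 / M \<le> norm v" using abs_Im_le_cmod[of v] by linarith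
    have np: "0 < norm v" using n M by (smt (verit) divide_pos_pos)
    have "1 / norm v \<le> M" using n np M by (simp add: field_simps)
    then have "norm (- 1 / v) \<le> M ^ 3" using M3(1) by (simp add: norm_divide)
    then show "norm (- 1 / m (Complex t (1 / real (n + 2)))) \<le> M ^ 3" unfolding v_def .
    have "Im (- 1 / v) = Im v / (norm v)\<^sup>2" by (simp add: Im_divide cmod_power2)
    moreover have "(1 / M) / M\<^sup>2 \<le> Im v / (norm v)\<^sup>2" using v np M by (intro frac_le) (auto intro: power_mono order_trans[of 0 "1 / M"])
    ultimately have "1 / M ^ 3 \<le> Im (- 1 / v)" by (simp add: power3_eq_cube power2_eq_square mult.assoc)
    then show "1 / M ^ 3 \<le> Im (- 1 / m (Complex t (1 / real (n + 2))))" unfolding v_def .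
  qed
  have real: "Im (pa (of_real t) x) = 0" "Im (qa (of_real t) x) = 0" "Im (pb (of_real t) x) = 0" "Im (qb (of_real t) x) = 0" if "0 < x" for t x
    using sol_real[of x "cos \<alpha>" "- sin \<alpha>" t] sol_real[of x "sin \<alpha>" "cos \<alpha>" t] that
    by (simp_all add: pa_def qa_def pb_def qb_def ca_def sa_def)
  have ii: "0 < Im \<i>" by simp
  have ga: "pb z x + m z * pa z x = psi1 (m z) z x" "qb z x + m z * qa z x = psi2 (m z) z x" for z x
    by (simp_all add: psi1_def psi2_def)
  have gb: "- pa z x + - 1 / m z * pb z x = - psi1 (m z) z x / m z" "- qa z x + - 1 / m z * qb z x = - psi2 (m z) z x / m z" if "0 < Im z" for z x
  proof -
    have "m z \<noteq> 0" using m_Im_pos[OF that] by auto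
    then show "- pa z x + - 1 / m z * pb z x = - psi1 (m z) z x / m z" "- qa z x + - 1 / m z * qb z x = - psi2 (m z) z x / m z"
      by (simp_all add: psi1_def psi2_def field_simps)
  qed
  show thesis
  \<comment> \<open>\<open>nrm\<close> is a sum of four norms, so where it exceeds
    \<open>4 * sqrt K\<close> one of them exceeds \<open>sqrt K\<close>.\<close>
  proof (rule that[of "4 * sqrt K"])
    have K0: "0 < K" using K M3(2) by linarith
    show "0 < 4 * sqrt K" using K0 by simp
    fix x :: real assume x: "0 < x"
    then have x0: "0 \<le> x" by simp
    note holo = ab_holo[OF x0, of UNIV] and rl = real[OF x]
    have ev1: "\<forall>\<^sub>F n in sequentially. measure lborel {t\<in>S n. K < (norm (pa (of_real t) x))\<^sup>2} \<le> a0 / 32"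
      by (rule bnd[where q' = "\<lambda>z. pb z x" and v = m]) (use holo rl m_uhp m_S green_a[OF _ x0] in \<open>simp_all only: ga ii\<close>)
    have ev2: "\<forall>\<^sub>F n in sequentially. measure lborel {t\<in>S n. K < (norm (qa (of_real t) x))\<^sup>2} \<le> a0 / 32"
      by (rule bnd[where q' = "\<lambda>z. qb z x" and v = m]) (use holo rl m_uhp m_S green_a[OF _ x0] in \<open>simp_all only: ga ii\<close>)
    have ev3: "\<forall>\<^sub>F n in sequentially. measure lborel {t\<in>S n. K < (norm (pb (of_real t) x))\<^sup>2} \<le> a0 / 32"
    proof (rule bnd[where q' = "\<lambda>z. - pa z x" and v = "\<lambda>z. - 1 / m z"])
      show "(\<lambda>z. - pa z x) holomorphic_on UNIV" by (intro holomorphic_intros holo)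
    qed (use holo rl m'_uhp m'_S green_b[OF _ x0] in \<open>simp_all only: gb ii uminus_complex.sel minus_zero\<close>)
    have ev4: "\<forall>\<^sub>F n in sequentially. measure lborel {t\<in>S n. K < (norm (qb (of_real t) x))\<^sup>2} \<le> a0 / 32"
    proof (rule bnd[where q' = "\<lambda>z. - qa z x" and v = "\<lambda>z. - 1 / m z"])
      show "(\<lambda>z. - qa z x) holomorphic_on UNIV" by (intro holomorphic_intros holo)
    qed (use holo rl m'_uhp m'_S green_b[OF _ x0] in \<open>simp_all only: gb ii uminus_complex.sel minus_zero\<close>)
    obtain n where n: "measure lborel (A - S n) \<le> a0 / 8" "measure lborel {t\<in>S n. K < (norm (pa (of_real t) x))\<^sup>2} \<le> a0 / 32"
      "measure lborel {t\<in>S n. K < (norm (qa (of_real t) x))\<^sup>2} \<le> a0 / 32"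
      "measure lborel {t\<in>S n. K < (norm (pb (of_real t) x))\<^sup>2} \<le> a0 / 32"
      "measure lborel {t\<in>S n. K < (norm (qb (of_real t) x))\<^sup>2} \<le> a0 / 32"
      using eventually_happens[OF eventually_conj[OF S(5)[folded a0_def] eventually_conj[OF ev1 eventually_conj[OF ev2 eventually_conj[OF ev3 ev4]]]]] by auto
    define D where "D q = {t\<in>S n. K < (norm (q (of_real t)))\<^sup>2}" for q :: "complex \<Rightarrow> complex"
    have ct: "continuous_on UNIV (\<lambda>t. q (of_real t :: complex))" if "q holomorphic_on UNIV" for q :: "complex \<Rightarrow> complex"
      by (rule continuous_on_compose2[OF holomorphic_on_imp_continuous_on[OF that]]) (auto intro!: continuous_intros)
    have Db: "D q \<in> sets lborel" if "q holomorphic_on UNIV" for q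
    proof -
      have "{t::real. K < (norm (q (of_real t)))\<^sup>2} \<in> sets borel"
        by (intro borel_open open_Collect_less continuous_intros ct that)
      then show ?thesis using S(1)[of n] unfolding D_def by (simp add: Collect_conj_eq sets.Int)
    qed
    define U where "U = (A - S n) \<union> (D (\<lambda>z. pa z x) \<union> (D (\<lambda>z. qa z x) \<union> (D (\<lambda>z. pb z x) \<union> D (\<lambda>z. qb z x))))"
    have "{t::real. 4 * sqrt K < nrm (of_real t) x} \<in> sets borel"
      unfolding nrm_def by (intro borel_open open_Collect_less continuous_intros ct holo)
    then show bb: "{t\<in>A. 4 * sqrt K < nrm (of_real t) x} \<in> sets borel" using A(1) by (simp add: Collect_conj_eq sets.Int)
    have UA: "U \<subseteq> A" using S(2)[of n] by (auto simp: U_def D_def)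
    have Ub: "U \<in> sets lborel" unfolding U_def using A(1) S(1) by (intro sets.Un Db holo) auto
    have sub: "{t\<in>A. 4 * sqrt K < nrm (of_real t) x} \<subseteq> U"
    proof
      fix t assume "t \<in> {t\<in>A. 4 * sqrt K < nrm (of_real t) x}"
      then have t: "t \<in> A" "4 * sqrt K < nrm (of_real t) x" by auto
      have "K < y\<^sup>2" if "sqrt K < y" for y using that K0 by (metis real_sqrt_less_iff real_sqrt_unique real_le_lsqrt less_le_trans not_le order_less_imp_le real_sqrt_ge_zero le_less_trans)
      moreover have "sqrt K < norm (pa (of_real t) x) \<or> sqrt K < norm (qa (of_real t) x) \<or> sqrt K < norm (pb (of_real t) x) \<or> sqrt K < norm (qb (of_real t) x)"
        using t(2) unfolding nrm_def by linarith
      ultimately show "t \<in> U" using t(1) unfolding U_def D_def by blast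
    qed
    have "measure lborel {t\<in>A. 4 * sqrt K < nrm (of_real t) x} \<le> measure lborel U"
    proof (rule measure_mono_fmeasurable[OF sub])
      show "U \<in> fmeasurable lborel"
        by (rule fmeasurableI2[OF fmeasurable_cbox(1)[of "-R" R]]) (use A(2) UA Ub in auto)
    qed (use bb in simp)
    also have "\<dots> \<le> measure lborel (A - S n) + (measure lborel (D (\<lambda>z. pa z x)) + (measure lborel (D (\<lambda>z. qa z x)) + (measure lborel (D (\<lambda>z. pb z x)) + measure lborel (D (\<lambda>z. qb z x)))))"
      unfolding U_def using A(1) S(1)
      by (intro order_trans[OF measure_Un_le] add_left_mono sets.Un Db holo) auto
    also have "\<dots> \<le> a0 / 8 + (a0 / 32 + (a0 / 32 + (a0 / 32 + a0 / 32)))"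
      unfolding D_def by (intro add_mono n)
    finally show "measure lborel {t\<in>A. 4 * sqrt K < nrm (of_real t) x} \<le> measure lborel A / 4" by (simp add: a0_def)
  qed
qed

theorem ac_part_null_of_unbounded_transfer:
  assumes F: "F \<in> sets lebesgue" and xy: "\<And>j. 0 < x j" "\<And>j. 0 < y j"
    and lim: "AE E in lebesgue. E \<in> F \<longrightarrow>
       filterlim (\<lambda>j. onorm ((*v) (transfer_matrix \<sigma> \<tau> (complex_of_real E) (x j) (y j)))) at_top sequentially"
  shows "F \<in> null_sets (completion (ac_part (spectral_measure \<sigma> \<tau> \<alpha>)))"
proof (rule ccontr)
  assume "\<not> ?thesis"
  then obtain A R w where A: "A \<in> sets borel" "A \<subseteq> {-R..R}" "1 \<le> R" "0 < measure lborel A" and w: "0 < w"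
    and Q: "\<And>E. E \<in> A \<Longrightarrow> filterlim (\<lambda>j. onorm ((*v) (transfer_matrix \<sigma> \<tau> (complex_of_real E) (x j) (y j)))) at_top sequentially"
    and low: "\<And>C. C \<in> sets borel \<Longrightarrow> C \<subseteq> A \<Longrightarrow> ennreal w * emeasure lborel C \<le> emeasure (spectral_measure \<sigma> \<tau> \<alpha>) C"
    by (rule not_null_ac_part[OF spectral_measure_properties(1,2) F _ lim]) (assumption | rule that)+
  obtain K where K: "0 < K" "\<And>x. 0 < x \<Longrightarrow> {t\<in>A. K < nrm (of_real t) x} \<in> sets borel"
    "\<And>x. 0 < x \<Longrightarrow> measure lborel {t\<in>A. K < nrm (of_real t) x} \<le> measure lborel A / 4"
    by (rule fundamental_bound_off_small_set[OF A w low]) (assumption | rule that)+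
  define Bad where "Bad x = {t\<in>A. K < nrm (of_real t) x}" for x
  have Bad: "Bad x \<in> sets borel" "measure lborel (Bad x) \<le> measure lborel A / 4" "Bad x \<subseteq> A" if "0 < x" for x
    using K(2,3)[OF that] by (auto simp: Bad_def)
  \<comment> \<open>The two exceptional sets take at most half of \<open>A\<close>, so the length of
    \<open>G j\<close> stays bounded below; but divergence at a point of \<open>A\<close> puts it
    outside \<open>G j\<close> for large \<open>j\<close>, which sends the length to 0.\<close>
  define G where "G j = A - (Bad (x j) \<union> Bad (y j))" for j
  have G: "G j \<in> sets lborel" "G j \<subseteq> A" for j using A(1) Bad(1)[OF xy(1)] Bad(1)[OF xy(2)] by (auto simp: G_def)
  have fm: "X \<in> fmeasurable lborel" if "X \<in> sets lborel" "X \<subseteq> A" for X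
    by (rule fmeasurableI2[OF fmeasurable_cbox(1)[of "-R" R]]) (use A that in auto)
  have "measure lborel A / 2 \<le> measure lborel (G j)" for j
  proof -
    have "A = G j \<union> (Bad (x j) \<union> Bad (y j))"
      using Bad(3)[OF xy(1)[of j]] Bad(3)[OF xy(2)[of j]] unfolding G_def by blast
    then have "measure lborel A = measure lborel (G j \<union> (Bad (x j) \<union> Bad (y j)))" by (rule arg_cong)
    also have "\<dots> \<le> measure lborel (G j) + measure lborel (Bad (x j) \<union> Bad (y j))"
      by (rule measure_Un_le) (use G(1)[of j] Bad(1)[OF xy(1)[of j]] Bad(1)[OF xy(2)[of j]] in auto)
    also have "measure lborel (Bad (x j) \<union> Bad (y j)) \<le> measure lborel (Bad (x j)) + measure lborel (Bad (y j))"
      by (rule measure_Un_le) (use Bad(1)[OF xy(1)[of j]] Bad(1)[OF xy(2)[of j]] in auto)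
    finally have "measure lborel A \<le> measure lborel (G j) + (measure lborel (Bad (x j)) + measure lborel (Bad (y j)))" by simp
    then show ?thesis using Bad(2)[OF xy(1)[of j]] Bad(2)[OF xy(2)[of j]] by linarith
  qed
  moreover have "(\<lambda>j. measure lborel (G j)) \<longlonglongrightarrow> 0"
  proof (rule measure_tendsto_0[of A])
    show "A \<in> fmeasurable lborel" using A(1) by (intro fm) auto
    show "AE t in lborel. t \<in> A \<longrightarrow> (\<forall>\<^sub>F j in sequentially. t \<notin> G j)"
    proof (intro AE_I2 impI)
      fix t assume t: "t \<in> A"
      have "\<forall>\<^sub>F j in sequentially. 4 * (K * K) < onorm ((*v) (transfer_matrix \<sigma> \<tau> (complex_of_real t) (x j) (y j)))"
        using Q[OF t] unfolding filterlim_at_top_dense by blast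
      then show "\<forall>\<^sub>F j in sequentially. t \<notin> G j"
      proof eventually_elim
        case (elim j)
        show ?case
        proof
          assume "t \<in> G j"
          then have b: "nrm (of_real t) (x j) \<le> K" "nrm (of_real t) (y j) \<le> K" using t by (auto simp: G_def Bad_def)
          have "nrm (of_real t) (x j) * nrm (of_real t) (y j) \<le> K * K"
            using b K(1) by (intro mult_mono) (auto simp: nrm_def)
          then show False using elim transfer_matrix_norm[OF xy(1) xy(2), of "of_real t" j j] by linarith
        qed
      qed
    qed
  qed (rule G)+
  ultimately have "measure lborel A / 2 \<le> 0"
    by (intro tendsto_lowerbound[of "\<lambda>j. measure lborel (G j)" 0 sequentially]) auto
  then show False using A(4) by simp
qed

end

theorem theorem1p4:
  fixes \<sigma> \<tau> :: "real \<Rightarrow> real" and \<alpha> :: real and F :: "real set" and x y :: "nat \<Rightarrow> real"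
  assumes "\<sigma> \<in> borel_measurable (lebesgue_on {0<..})"
    and "\<tau> \<in> borel_measurable (lebesgue_on {0<..})"
    and "(SUP s\<in>{0<..}. \<integral>\<^sup>+t\<in>{s..s+1}. ennreal ((\<sigma> t)\<^sup>2) \<partial>lebesgue) < \<infinity>"
    and "(SUP s\<in>{0<..}. \<integral>\<^sup>+t\<in>{s..s+1}. ennreal \<bar>\<tau> t\<bar> \<partial>lebesgue) < \<infinity>"
    and "0 \<le> \<alpha>" and "\<alpha> < pi"
    and "F \<in> sets lebesgue"
    and "\<And>j. 0 < x j" and "\<And>j. 0 < y j"
    and "AE E in lebesgue. E \<in> F \<longrightarrow>
           filterlim (\<lambda>j. onorm ((*v) (transfer_matrix \<sigma> \<tau> (complex_of_real E) (x j) (y j))))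
             at_top sequentially"
  shows "F \<in> null_sets (completion (ac_part (spectral_measure \<sigma> \<tau> \<alpha>)))"
proof -
  interpret sl_boundary \<sigma> \<tau> \<alpha>
    by (intro sl_boundary.intro sl_coeffs.intro assms(1-4))
  show ?thesis by (rule ac_part_null_of_unbounded_transfer[OF assms(7-10)])
qed

end
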